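(* Let $H=\tfrac12(p_1^2+p_2^2)+V_1(q_1)+V_2(q_2)$ and suppose $H$ possesses an integral $X$ of order $n$ with $1\le n\le 4$ that is not a polynomial in $H_1,H_2$, such that for both $i=1$ and $i=2$ the potential summand $V_i$ is a solution of the linear compatibility equations of $X$ for non-trivial values of the parameters (all terms are defined in the context). Then, up to a translation of the coordinate $q_i$ and an additive constant, each of the summands $V_i$ ($i=1,2$) is of one of the following forms, where $\beta,\beta_1,\beta_2$ denote constants: $$(\mathrm{I})\quad \beta q_i,$$ $$(\mathrm{II})\quad \beta_1q_i^2+\frac{\beta_2}{q_i^2},$$ $$(\mathrm{III})\quad \beta_1\left(q_i^2+\frac{\beta_2^2}{q_i^2}\right)+\hbar^2\left[\frac{2(q_i^2+\beta_2)}{(q_i^2-\beta_2)^2}-\frac{1}{8q_i^2}\right],$$ $$(\mathrm{IV})\quad \frac{3\hbar^2q_i(q_i^3+2\beta)}{(q_i^3-\beta)^2}.$$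
   Context: Phase space has coordinates $q_1,q_2$ and momenta $p_1,p_2$, treated as commuting variables; $\hbar\ge 0$ is a constant ($\hbar=0$ is the classical case, with $0^0=1$). $V_1,V_2$ are smooth functions of one variable on open intervals, and $H_i=\tfrac12p_i^2+V_i(q_i)$. For functions $f,g$ polynomial in the momenta with coefficients smooth in the coordinates, put (multi-indices $\mathbf i=(i_1,i_2)$ of non-negative integers, $|\mathbf i|=i_1+i_2$, $\mathbf i!=i_1!i_2!$) $$(f,g)=\sum_{|\mathbf i|\ge1}\frac1{\mathbf i!}\Big(\frac{\hbar}{\sqrt{-1}}\Big)^{|\mathbf i|-1}\big(\partial_q^{\mathbf i}f\,\partial_p^{\mathbf i}g-\partial_p^{\mathbf i}f\,\partial_q^{\mathbf i}g\big).$$ For $\hbar=0$ this is the Poisson bracket; for $\hbar>0$ one has $f\circ g-g\circ f=\hbar\sqrt{-1}(f,g)$, where $\circ$ is the product of quantum observables (symbols in standard ordering, momenta on the right). An integral of order $n$ is a function $X$, polynomial of degree $n$ in the momenta with coefficients smooth in the coordinates, with $(X,H)=0$. "Polynomial in $H_1,H_2$" is with respect to the ordinary product if $\hbar=0$ and the product $\circ$ if $\hbar>0$. It is assumed throughout that $X=\tfrac12(Y+Y^* )$, where $Y$ has real coefficients and only components of degrees $n,n-2,n-4,\dots$ in the momenta, and $Y^*=\exp(2a_0)\bar Y$ with $a_0=\frac{\hbar}{2\sqrt{-1}}\sum_i\frac{\partial^2}{\partial q_i\partial p_i}$. The component $Z_0\ne0$ of $X$ of degree $n$ in the momenta can be written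 uniquely as $Z_0=\sum_{i+j+k=n}\alpha_{ijk}\,p_1^ip_2^jm_{12}^k$ with $m_{12}=q_1p_2-q_2p_1$ and constants $\alpha_{ijk}$. For further constants $\alpha_{ijl}$ with $i+j+l=n+2$, and for $k=0,1$, set $$\xi_{ki1}(q_1)=\sum_{j=0}^{n+2k-i}\alpha_{i,j,n+2k-i-j}\,q_1^{n+2k-i-j},\qquad \xi_{kj2}(q_2)=\sum_{i=0}^{n+2k-j}\alpha_{i,j,n+2k-i-j}(-1)^i q_2^{n+2k-i-j}.$$ Let $Q_{i,1}=\int V_i\,dq_i$ (any antiderivative). The linear compatibility equations for $V_i$ are $$\xi_{00i}'(q_i)\,Q_{i,1}+\xi_{10i}(q_i)=0,\qquad \big[\xi_{01i}(q_i)\,Q_{i,1}\big]'+\xi_{11i}(q_i)=0,$$ and $V_i$ is said to be a solution of them for non-trivial values of the parameters if they hold (for suitable constants $\alpha_{ijl}$, $i+j+l=n+2$) with $\xi_{00i}'$ and $\xi_{01i}$ not both identically zero, where $\xi_{00i},\xi_{01i}$ are the polynomials obtained from $Z_0$. *)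

theory Defs
  imports
    "HOL-Analysis.Analysis"
    "HOL-Library.Poly_Mapping"
    "HOL-Library.Function_Algebras"
begin

text \<open>
  On an open set, \<open>smooth_on\<close> is the class \<open>C\<close>-infinity: all iterated directional
  derivatives exist and are Frechet differentiable.
\<close>

primrec differentiable_times_on ::
    "nat \<Rightarrow> 'a::real_normed_vector set \<Rightarrow> ('a \<Rightarrow> 'b::real_normed_vector) \<Rightarrow> bool" where
  "differentiable_times_on 0 S f \<longleftrightarrow> continuous_on S f"
| "differentiable_times_on (Suc k) S f \<longleftrightarrow>
     (\<forall>x\<in>S. f differentiable (at x)) \<and>
     (\<forall>v. differentiable_times_on k S (\<lambda>x. frechet_derivative f (at x) v))"

definition smooth_on ::
    "'a::real_normed_vector set \<Rightarrow> ('a \<Rightarrow> 'b::real_normed_vector) \<Rightarrow> bool" where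
  "smooth_on S f \<longleftrightarrow> (\<forall>k. differentiable_times_on k S f)"

text \<open>
  A function on phase space that is polynomial in the momenta is an element of the polynomial
  ring in \<open>p\<^sub>1, p\<^sub>2\<close> over the ring of functions of \<open>(q\<^sub>1, q\<^sub>2)\<close> (with pointwise operations):
  \<open>Poly_Mapping.lookup f (a, b)\<close> is the coefficient of \<open>p\<^sub>1\<^sup>a p\<^sub>2\<^sup>b\<close>.
  Coefficients are total functions of the coordinates, so statements about them are always made relative to a domain \<open>S\<close>; as all
  operations on coefficients below are local, values outside an open \<open>S\<close> do not matter.
\<close>

type_synonym observable = "(nat \<times> nat) \<Rightarrow>\<^sub>0 (real \<times> real \<Rightarrow> complex)"

definition coord :: "(real \<times> real \<Rightarrow> complex) \<Rightarrow> observable" where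
  "coord c = Poly_Mapping.single (0, 0) c"

definition const :: "complex \<Rightarrow> observable" where
  "const c = coord (\<lambda>_. c)"

definition p1 :: observable where "p1 = Poly_Mapping.single (1, 0) 1"
definition p2 :: observable where "p2 = Poly_Mapping.single (0, 1) 1"

definition m12 :: observable where
  "m12 = coord (\<lambda>q. of_real (fst q)) * p2 - coord (\<lambda>q. of_real (snd q)) * p1"

definition eq_on :: "(real \<times> real) set \<Rightarrow> observable \<Rightarrow> observable \<Rightarrow> bool" where
  "eq_on S f g \<longleftrightarrow> (\<forall>k. \<forall>q\<in>S. Poly_Mapping.lookup f k q = Poly_Mapping.lookup g k q)"

definition smooth_coeffs :: "(real \<times> real) set \<Rightarrow> observable \<Rightarrow> bool" where
  "smooth_coeffs S f \<longleftrightarrow> (\<forall>k. smooth_on S (Poly_Mapping.lookup f k))"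

definition component :: "nat \<Rightarrow> observable \<Rightarrow> observable" where
  "component d f =
     (\<Sum>k\<in>{k \<in> Poly_Mapping.keys f. fst k + snd k = d}.
        Poly_Mapping.single k (Poly_Mapping.lookup f k))"

definition has_degree :: "(real \<times> real) set \<Rightarrow> nat \<Rightarrow> observable \<Rightarrow> bool" where
  "has_degree S n f \<longleftrightarrow>
     \<not> eq_on S (component n f) 0 \<and> (\<forall>d>n. eq_on S (component d f) 0)"

definition dq1 :: "observable \<Rightarrow> observable" where
  "dq1 f = Poly_Mapping.map (\<lambda>c q. frechet_derivative c (at q) (1, 0)) f"

definition dq2 :: "observable \<Rightarrow> observable" where
  "dq2 f = Poly_Mapping.map (\<lambda>c q. frechet_derivative c (at q) (0, 1)) f"

text \<open>The truncated subtractions below only occur with coefficient \<open>0\<close>.\<close>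

definition dp1 :: "observable \<Rightarrow> observable" where
  "dp1 f = (\<Sum>(a, b)\<in>Poly_Mapping.keys f.
     Poly_Mapping.single (a - 1, b) (\<lambda>q. of_nat a * Poly_Mapping.lookup f (a, b) q))"

definition dp2 :: "observable \<Rightarrow> observable" where
  "dp2 f = (\<Sum>(a, b)\<in>Poly_Mapping.keys f.
     Poly_Mapping.single (a, b - 1) (\<lambda>q. of_nat b * Poly_Mapping.lookup f (a, b) q))"

definition dq :: "nat \<times> nat \<Rightarrow> observable \<Rightarrow> observable" where
  "dq i f = (dq1 ^^ fst i) ((dq2 ^^ snd i) f)"

definition dp :: "nat \<times> nat \<Rightarrow> observable \<Rightarrow> observable" where
  "dp i f = (dp1 ^^ fst i) ((dp2 ^^ snd i) f)"

text \<open>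
  In the following sums over all multi-indices only finitely many terms are nonzero, since
  high momentum derivatives vanish; \<open>Sum_any\<close> is the sum of these terms.
\<close>

definition bracket :: "real \<Rightarrow> observable \<Rightarrow> observable \<Rightarrow> observable" where
  "bracket h f g =
     Sum_any (\<lambda>i. if fst i + snd i \<ge> 1
       then const (1 / (fact (fst i) * fact (snd i)) * (of_real h / \<i>) ^ (fst i + snd i - 1))
            * (dq i f * dp i g - dp i f * dq i g)
       else 0)"

text \<open>
  Composition of differential operators in terms of their symbols in standard ordering
  (momenta on the right, \<open>p\<close> acting as \<open>h/\<i>\<close> times \<open>d/dq\<close>).  For \<open>h = 0\<close> only the term of
  multi-index \<open>(0, 0)\<close> survives (as \<open>0 ^ 0 = 1\<close>), and \<open>star 0\<close> is the ordinary product.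
\<close>

definition star :: "real \<Rightarrow> observable \<Rightarrow> observable \<Rightarrow> observable" where
  "star h f g =
     Sum_any (\<lambda>i. const (1 / (fact (fst i) * fact (snd i)) * (of_real h / \<i>) ^ (fst i + snd i))
                  * (dp i f * dq i g))"

primrec star_power :: "real \<Rightarrow> observable \<Rightarrow> nat \<Rightarrow> observable" where
  "star_power h f 0 = 1"
| "star_power h f (Suc k) = star h f (star_power h f k)"

text \<open>Since the two observables \<open>H\<^sub>1, H\<^sub>2\<close> this is used for commute, ordered monomials suffice.\<close>

definition polynomial_in ::
    "real \<Rightarrow> (real \<times> real) set \<Rightarrow> observable \<Rightarrow> observable \<Rightarrow> observable \<Rightarrow> bool" where
  "polynomial_in h S A B X \<longleftrightarrow>
     (\<exists>(N::nat) (c :: nat \<Rightarrow> nat \<Rightarrow> complex). eq_on S X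
        (\<Sum>i\<le>N. \<Sum>j\<le>N. const (c i j) * star h (star_power h A i) (star_power h B j)))"

definition H1 :: "(real \<Rightarrow> real) \<Rightarrow> observable" where
  "H1 V = const (1/2) * p1 ^ 2 + coord (\<lambda>q. of_real (V (fst q)))"

definition H2 :: "(real \<Rightarrow> real) \<Rightarrow> observable" where
  "H2 V = const (1/2) * p2 ^ 2 + coord (\<lambda>q. of_real (V (snd q)))"

definition integral_of_order ::
    "real \<Rightarrow> (real \<times> real) set \<Rightarrow> nat \<Rightarrow> observable \<Rightarrow> observable \<Rightarrow> bool" where
  "integral_of_order h S n H X \<longleftrightarrow>
     smooth_coeffs S X \<and> has_degree S n X \<and> eq_on S (bracket h X H) 0"

text \<open>The formal adjoint \<open>Y\<^sup>* = exp (2 a\<^sub>0) (cnj Y)\<close>; the exponential series is finite on observables.\<close>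

definition conj_obs :: "observable \<Rightarrow> observable" where
  "conj_obs f = Poly_Mapping.map (\<lambda>c q. cnj (c q)) f"

definition a0 :: "real \<Rightarrow> observable \<Rightarrow> observable" where
  "a0 h f = const (of_real h / (2 * \<i>)) * (dq1 (dp1 f) + dq2 (dp2 f))"

definition adjoint_obs :: "real \<Rightarrow> observable \<Rightarrow> observable" where
  "adjoint_obs h Y =
     Sum_any (\<lambda>k. const (1 / fact k) * ((\<lambda>f. const 2 * a0 h f) ^^ k) (conj_obs Y))"

definition standard_form :: "real \<Rightarrow> (real \<times> real) set \<Rightarrow> nat \<Rightarrow> observable \<Rightarrow> bool" where
  "standard_form h S n X \<longleftrightarrow>
     (\<exists>Y. smooth_coeffs S Y \<and>
          (\<forall>k. \<forall>q\<in>S. Poly_Mapping.lookup Y k q \<in> \<real>) \<and>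
          (\<forall>d. d > n \<or> odd (n - d) \<longrightarrow> eq_on S (component d Y) 0) \<and>
          eq_on S X (const (1/2) * (Y + adjoint_obs h Y)))"

text \<open>
  A family \<open>\<alpha>\<close> carries both the constants with index sum \<open>n\<close>, which are determined by the
  leading component of \<open>X\<close>, and those with index sum \<open>n + 2\<close>, on which there is no condition here.
\<close>

definition leading_coeffs ::
    "(real \<times> real) set \<Rightarrow> nat \<Rightarrow> observable \<Rightarrow> (nat \<Rightarrow> nat \<Rightarrow> nat \<Rightarrow> real) \<Rightarrow> bool" where
  "leading_coeffs S n X \<alpha> \<longleftrightarrow>
     eq_on S (component n X)
       (\<Sum>(i, j, k)\<in>{(i, j, k). i + j + k = n}.
          const (of_real (\<alpha> i j k)) * p1 ^ i * p2 ^ j * m12 ^ k)"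

definition xi1 :: "nat \<Rightarrow> (nat \<Rightarrow> nat \<Rightarrow> nat \<Rightarrow> real) \<Rightarrow> nat \<Rightarrow> nat \<Rightarrow> real \<Rightarrow> real" where
  "xi1 n \<alpha> k i q =
     (\<Sum>j = 0..n + 2*k - i. \<alpha> i j (n + 2*k - i - j) * q ^ (n + 2*k - i - j))"

definition xi2 :: "nat \<Rightarrow> (nat \<Rightarrow> nat \<Rightarrow> nat \<Rightarrow> real) \<Rightarrow> nat \<Rightarrow> nat \<Rightarrow> real \<Rightarrow> real" where
  "xi2 n \<alpha> k j q =
     (\<Sum>i = 0..n + 2*k - j. \<alpha> i j (n + 2*k - i - j) * (- 1) ^ i * q ^ (n + 2*k - i - j))"

text \<open>
  Changing the antiderivative \<open>Q\<close> by a constant is absorbed by the free constants in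
  \<open>\<xi> 1 0\<close> and \<open>\<xi> 1 1\<close>, so it does not matter which antiderivative is used.
\<close>

definition linear_compatibility ::
    "real set \<Rightarrow> (real \<Rightarrow> real) \<Rightarrow> (nat \<Rightarrow> nat \<Rightarrow> real \<Rightarrow> real) \<Rightarrow> bool" where
  "linear_compatibility I V \<xi> \<longleftrightarrow>
     (\<exists>Q. (\<forall>q\<in>I. (Q has_real_derivative V q) (at q)) \<and>
          (\<forall>q\<in>I. deriv (\<xi> 0 0) q * Q q + \<xi> 1 0 q = 0) \<and>
          (\<forall>q\<in>I. deriv (\<lambda>t. \<xi> 0 1 t * Q t) q + \<xi> 1 1 q = 0))"

definition nontrivial_parameters :: "(nat \<Rightarrow> nat \<Rightarrow> real \<Rightarrow> real) \<Rightarrow> bool" where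
  "nontrivial_parameters \<xi> \<longleftrightarrow> \<not> ((\<forall>q. deriv (\<xi> 0 0) q = 0) \<and> (\<forall>q. \<xi> 0 1 q = 0))"

definition form_I :: "real \<Rightarrow> real \<Rightarrow> real" where
  "form_I \<beta> q = \<beta> * q"

definition form_II :: "real \<Rightarrow> real \<Rightarrow> real \<Rightarrow> real" where
  "form_II \<beta>1 \<beta>2 q = \<beta>1 * q^2 + \<beta>2 / q^2"

text \<open>
  If \<open>8 * \<beta>1 * \<beta>2\<^sup>2 = h\<^sup>2\<close> and \<open>\<beta>2 \<noteq> 0\<close>, the poles at \<open>0\<close> in \<open>form_III\<close> cancel; the convention
  \<open>x / 0 = 0\<close> then yields at \<open>0\<close> the value \<open>2 * h\<^sup>2 / \<beta>2\<close> of the continuous extension.  In all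
  other cases a smooth function cannot agree with one of the forms near a genuine pole.
\<close>

definition form_III :: "real \<Rightarrow> real \<Rightarrow> real \<Rightarrow> real \<Rightarrow> real" where
  "form_III h \<beta>1 \<beta>2 q =
     \<beta>1 * (q^2 + \<beta>2^2 / q^2) + h^2 * (2 * (q^2 + \<beta>2) / (q^2 - \<beta>2)^2 - 1 / (8 * q^2))"

definition form_IV :: "real \<Rightarrow> real \<Rightarrow> real \<Rightarrow> real" where
  "form_IV h \<beta> q = 3 * h^2 * q * (q^3 + 2*\<beta>) / (q^3 - \<beta>)^2"

definition up_to_translation :: "real set \<Rightarrow> (real \<Rightarrow> real) \<Rightarrow> (real \<Rightarrow> real) \<Rightarrow> bool" where
  "up_to_translation I V F \<longleftrightarrow> (\<exists>c d. \<forall>q\<in>I. V q = F (q - c) + d)"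

definition listed_potential :: "real \<Rightarrow> real set \<Rightarrow> (real \<Rightarrow> real) \<Rightarrow> bool" where
  "listed_potential h I V \<longleftrightarrow>
     (\<exists>\<beta>. up_to_translation I V (form_I \<beta>)) \<or>
     (\<exists>\<beta>1 \<beta>2. up_to_translation I V (form_II \<beta>1 \<beta>2)) \<or>
     (\<exists>\<beta>1 \<beta>2. up_to_translation I V (form_III h \<beta>1 \<beta>2)) \<or>
     (\<exists>\<beta>. up_to_translation I V (form_IV h \<beta>))"

end

theory Submission
  imports Defs "HOL-Computational_Algebra.Computational_Algebra"
begin

text \<open>
  Let \<open>W\<close> be the Weyl symbol of \<open>X\<close>; its leading component is a Killing tensor, with
  coefficients polynomial in \<open>q\<close>.  The components of degrees \<open>n - 1\<close> and \<open>n - 3\<close> of the Moyal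
  bracket of \<open>W\<close> and \<open>H\<close>, after elimination of the component of degree \<open>n - 4\<close> of \<open>W\<close> by
  cross-differentiation, give for each fixed \<open>q\<^sub>2\<close> a nonlinear ordinary differential equation for
  the antiderivative \<open>Q\<close> of \<open>V\<^sub>1\<close>, whose coefficients are polynomials in \<open>q\<^sub>1\<close>.  The linear
  compatibility equations make \<open>Q\<close> a rational function.  Expanding the equation at the poles of
  \<open>Q\<close> and at infinity, in fields of Laurent series, shows that the poles are simple with
  prescribed residues, bounds the degree of the denominator by three and leaves the listed
  potentials.  The situation is symmetric in \<open>q\<^sub>1\<close> and \<open>q\<^sub>2\<close>.
\<close>

unbundle fps_syntax

section \<open>Laurent expansions of solutions\<close>

text \<open>Poles of \<open>Q\<close> may be complex and need not lie near the interval where the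
  potential lives. No continuation is involved: for rational \<open>Q\<close> the differential
  equation is a polynomial identity, which can be read in any field of Laurent series over the
  complex numbers.

  At order four the leading coefficient of the equation is a polynomial of degree at most one in q1.
  Away from its zero the quadratic terms can only be balanced by the highest derivative, which
  forces a simple pole of residue -h^2. At its zero this balance degenerates and the residue stays
  free; this is the source of the arbitrary inverse-square terms in (II) and (III). Such a pole sits
  at the zero for every q2, hence is real, and the compatibility polynomial is then odd about it.

  The next coefficients say that (q - r)^2 is absent from the expansion of \<open>Q\<close> at each
  pole r. Together with the polynomial part of \<open>Q\<close>, of degree at most three, this gives
  one equation per pole, like an equilibrium of particles with inverse-cube forces. With at most
  three poles these equations can be solved explicitly.\<close>

definition lead :: "'a::field fls \<Rightarrow> int \<Rightarrow> 'a \<Rightarrow> bool" where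
  "lead f m c \<longleftrightarrow> (\<forall>j<m. f $$ j = 0) \<and> f $$ m = c"

lemma leadD: "lead f m c \<Longrightarrow> f $$ m = c" "lead f m c \<Longrightarrow> j < m \<Longrightarrow> f $$ j = 0"
  by (auto simp: lead_def)

lemma fls_eq_shift_fps:
  assumes "\<forall>j<m. f $$ j = 0"
  shows "f = fls_shift (-m) (fps_to_fls (Abs_fps (\<lambda>k. f $$ (m + int k))))"
proof (rule fls_eqI)
  fix n
  show "f $$ n = fls_shift (-m) (fps_to_fls (Abs_fps (\<lambda>k. f $$ (m + int k)))) $$ n"
    using assms by auto
qed

text \<open>Only lower bounds m and n for the orders are assumed, so that the Cauchy product is
  available also when the coefficients at m and n happen to be 0.\<close>

lemma fls_mult_nth_shift:
  fixes f g :: "'a::field fls"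
  assumes "\<forall>j<m. f $$ j = 0" "\<forall>j<n. g $$ j = 0"
  shows "(f * g) $$ (m + n + int k) = (\<Sum>i=0..k. f $$ (m + int i) * g $$ (n + int (k - i)))"
    and "j < m + n \<Longrightarrow> (f * g) $$ j = 0"
proof -
  define F where "F = Abs_fps (\<lambda>k. f $$ (m + int k))"
  define G where "G = Abs_fps (\<lambda>k. g $$ (n + int k))"
  have f: "f = fls_shift (-m) (fps_to_fls F)" and g: "g = fls_shift (-n) (fps_to_fls G)"
    unfolding F_def G_def using fls_eq_shift_fps assms by blast+
  have fg: "f * g = fls_shift (-(m+n)) (fps_to_fls (F * G))"
    by (subst f, subst g) (simp add: fls_times_fps_to_fls fls_shifted_times_simps algebra_simps)
  show "(f * g) $$ (m + n + int k) = (\<Sum>i=0..k. f $$ (m + int i) * g $$ (n + int (k - i)))"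
    unfolding fg by (simp add: fps_mult_nth F_def G_def)
  show "j < m + n \<Longrightarrow> (f * g) $$ j = 0"
    unfolding fg by simp
qed

lemma lead_mult: "lead f m c \<Longrightarrow> lead g n d \<Longrightarrow> k = m + n \<Longrightarrow> lead (f * g) k (c * d)"
  using fls_mult_nth_shift(1)[of m f n g 0] fls_mult_nth_shift(2)[of m f n g] by (auto simp: lead_def)

text \<open>These rules hold without exceptions because the coefficient in \<open>lead\<close> may
  be 0: leading terms are added first, and whether they cancel is decided only at the end, by one
  scalar equation.\<close>

lemma lead_add: "lead f m c \<Longrightarrow> lead g m d \<Longrightarrow> lead (f + g) m (c + d)"
  and lead_diff: "lead f m c \<Longrightarrow> lead g m d \<Longrightarrow> lead (f - g) m (c - d)"
  by (auto simp: lead_def)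

lemma lead_weaken: "lead f m c \<Longrightarrow> m' < m \<Longrightarrow> lead f m' 0"
  by (auto simp: lead_def)

lemma lead_const: "lead (fls_const c) 0 c"
  by (auto simp: lead_def)

lemma lead_cmult: "lead f m c \<Longrightarrow> lead (fls_const a * f) m (a * c)"
  by (auto simp: lead_def)

lemma lead_deriv: "lead f m c \<Longrightarrow> k = m - 1 \<Longrightarrow> lead (fls_deriv f) k (of_int m * c)"
  by (auto simp: lead_def)

lemma lead_exists:
  assumes "f \<noteq> 0"
  shows "lead f (fls_subdegree f) (f $$ fls_subdegree f)" "f $$ fls_subdegree f \<noteq> 0"
  using assms by (auto simp: lead_def)

text \<open>The derivative d/dt in the coordinate 1/t at infinity: if \<open>fls_X\<close> stands
  for 1/t, then d/dt = - \<open>fls_X\<close>^2 d/d\<open>fls_X\<close>.\<close>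

definition fls_deriv_inf :: "'a::field fls \<Rightarrow> 'a fls" where
  "fls_deriv_inf f = - (fls_X ^ 2 * fls_deriv f)"

lemma lead_deriv_inf:
  assumes "lead f m c" "k = m + 1"
  shows "lead (fls_deriv_inf f) k (- of_int m * c)"
proof -
  have 1: "lead (fls_X ^ 2 :: 'a fls) 2 1" by (auto simp: lead_def)
  have "lead (fls_X ^ 2 * fls_deriv f) k (1 * (of_int m * c))"
    by (rule lead_mult[OF 1 lead_deriv[OF assms(1) refl]]) (use assms in simp)
  then show ?thesis by (auto simp: lead_def fls_deriv_inf_def)
qed

lemma lead_numeral: "lead (numeral k) 0 (numeral k :: 'a::field)"
  using lead_const[of "numeral k"] by simp

lemma lead_linear:
  shows "lead (fls_const b0 + fls_const b1 * fls_X) 0 b0"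
    and "b0 = 0 \<Longrightarrow> lead (fls_const b0 + fls_const b1 * fls_X) 1 b1"
  by (auto simp: lead_def)

text \<open>Intended for b = b0 + b1 x with D x = 1. By the Leibniz rule the linear terms are then
  (\<kappa>/4) times the fifth derivative of b Q on the left, and the third derivative of B Q on the
  right. In the application \<kappa> is h^2 and \<open>Q\<close> an antiderivative of the
  potential.\<close>

definition ode4 ::
  "(complex fls \<Rightarrow> complex fls) \<Rightarrow> complex \<Rightarrow> complex fls \<Rightarrow> complex \<Rightarrow> complex fls \<Rightarrow> complex fls \<Rightarrow> complex fls \<Rightarrow> bool"
  where "ode4 D \<kappa> b b1 B R Q \<longleftrightarrow>
     fls_const (\<kappa> / 4) * (b * D (D (D (D (D Q)))) + fls_const (5 * b1) * D (D (D (D Q))))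
     - (3 * b * (D (D Q) * D (D Q) + D Q * D (D (D Q)))
        + fls_const (12 * b1) * D Q * D (D Q) + fls_const b1 * Q * D (D (D Q)))
     = B * D (D (D Q)) + 3 * D B * D (D Q) + 3 * D (D B) * D Q + D (D (D B)) * Q - R"

lemma lead_derivs:
  assumes "lead Q (-\<mu>) (q::complex)"
  shows "lead (fls_deriv Q) (-\<mu>-1) (- of_int \<mu> * q)"
    "lead (fls_deriv (fls_deriv Q)) (-\<mu>-2) (of_int \<mu> * (of_int \<mu> + 1) * q)"
    "lead (fls_deriv (fls_deriv (fls_deriv Q))) (-\<mu>-3) (- of_int \<mu> * (of_int \<mu> + 1) * (of_int \<mu> + 2) * q)"
    "lead (fls_deriv (fls_deriv (fls_deriv (fls_deriv Q)))) (-\<mu>-4)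
       (of_int \<mu> * (of_int \<mu> + 1) * (of_int \<mu> + 2) * (of_int \<mu> + 3) * q)"
    "lead (fls_deriv (fls_deriv (fls_deriv (fls_deriv (fls_deriv Q))))) (-\<mu>-5)
       (- of_int \<mu> * (of_int \<mu> + 1) * (of_int \<mu> + 2) * (of_int \<mu> + 3) * (of_int \<mu> + 4) * q)"
proof -
  show 1: "lead (fls_deriv Q) (-\<mu>-1) (- of_int \<mu> * q)"
    using lead_deriv[OF assms, of "-\<mu>-1"] by simp
  show 2: "lead (fls_deriv (fls_deriv Q)) (-\<mu>-2) (of_int \<mu> * (of_int \<mu> + 1) * q)"
    using lead_deriv[OF 1, of "-\<mu>-2"] by (simp add: algebra_simps)
  show 3: "lead (fls_deriv (fls_deriv (fls_deriv Q))) (-\<mu>-3) (- of_int \<mu> * (of_int \<mu> + 1) * (of_int \<mu> + 2) * q)"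
    using lead_deriv[OF 2, of "-\<mu>-3"] by (simp add: algebra_simps)
  show 4: "lead (fls_deriv (fls_deriv (fls_deriv (fls_deriv Q)))) (-\<mu>-4)
       (of_int \<mu> * (of_int \<mu> + 1) * (of_int \<mu> + 2) * (of_int \<mu> + 3) * q)"
    using lead_deriv[OF 3, of "-\<mu>-4"] by (simp add: algebra_simps)
  show "lead (fls_deriv (fls_deriv (fls_deriv (fls_deriv (fls_deriv Q))))) (-\<mu>-5)
       (- of_int \<mu> * (of_int \<mu> + 1) * (of_int \<mu> + 2) * (of_int \<mu> + 3) * (of_int \<mu> + 4) * q)"
  proof (rule back_subst[of "lead _ _"])
    show "lead (fls_deriv (fls_deriv (fls_deriv (fls_deriv (fls_deriv Q))))) (-\<mu>-5)
       (of_int (-\<mu>-4) * (of_int \<mu> * (of_int \<mu> + 1) * (of_int \<mu> + 2) * (of_int \<mu> + 3) * q))"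
      by (rule lead_deriv[OF 4]) simp
  qed (simp, algebra)
qed

lemma lead_le: "lead f m c \<Longrightarrow> k \<le> m \<Longrightarrow> lead f k (if k = m then c else 0)"
  by (auto simp: lead_def)

text \<open>The constant term disappears under differentiation, so a power series stays one;
  \<open>lead_deriv\<close> alone would also apply but lower the bound to -1.\<close>

lemma lead_deriv_0: "lead f 0 c \<Longrightarrow> lead (fls_deriv f) 0 (f $$ 1)"
  unfolding lead_def
proof (intro conjI allI impI)
  fix j :: int
  assume f: "(\<forall>j<0. f $$ j = 0) \<and> f $$ 0 = c" and j: "j < 0"
  show "fls_deriv f $$ j = 0"
    using f j by (cases "j = -1") auto
qed simp

text \<open>The right-hand side is a third derivative of B Q minus R, with B and R regular. Its pole
  order is therefore at most \<mu> + 3, below that of the quadratic terms.\<close>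

lemma lead_ode4_rhs:
  assumes Q: "lead Q (-\<mu>) (q::complex)" and \<mu>: "\<mu> \<ge> 1" and B: "lead B 0 B0" and R: "lead R 0 R0"
    and N: "N < -\<mu> - 3"
  shows "lead (B * fls_deriv (fls_deriv (fls_deriv Q)) + 3 * fls_deriv B * fls_deriv (fls_deriv Q)
    + 3 * fls_deriv (fls_deriv B) * fls_deriv Q + fls_deriv (fls_deriv (fls_deriv B)) * Q - R) N 0"
proof -
  note Qk = lead_derivs[OF Q]
  note B1 = lead_deriv_0[OF B]
  note B2 = lead_deriv_0[OF B1]
  note B3 = lead_deriv_0[OF B2]
  have "lead (B * fls_deriv (fls_deriv (fls_deriv Q))) N 0"
    by (rule lead_weaken[OF lead_mult[OF B Qk(3) refl]]) (use N in simp)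
  moreover have "lead (3 * fls_deriv B * fls_deriv (fls_deriv Q)) N 0"
    by (rule lead_weaken[OF lead_mult[OF lead_mult[OF lead_numeral B1 refl] Qk(2) refl]]) (use N in simp)
  moreover have "lead (3 * fls_deriv (fls_deriv B) * fls_deriv Q) N 0"
    by (rule lead_weaken[OF lead_mult[OF lead_mult[OF lead_numeral B2 refl] Qk(1) refl]]) (use N in simp)
  moreover have "lead (fls_deriv (fls_deriv (fls_deriv B)) * Q) N 0"
    by (rule lead_weaken[OF lead_mult[OF B3 Q refl]]) (use N in simp)
  moreover have "lead R N 0"
    by (rule lead_weaken[OF R]) (use N \<mu> in simp)
  ultimately show ?thesis
    by (auto simp: lead_def)
qed

text \<open>With b non-zero at the pole, the quadratic terms have order -2\<mu> - 4 and leading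
  coefficient 3 b0 q^2 \<mu>^2 (\<mu> + 1) (2\<mu> + 3), which vanishes for no positive \<mu>. Only
  the fifth derivative, of order -\<mu> - 5, can cancel it; hence \<mu> = 1, and comparing the two
  coefficients gives the residue.\<close>

lemma ode4_pole_generic:
  assumes Q: "lead Q (-\<mu>) q" and q: "q \<noteq> 0" and \<mu>: "\<mu> \<ge> 1" and b0: "b0 \<noteq> 0"
    and B: "lead B 0 B0" and R: "lead R 0 R0"
    and ode: "ode4 fls_deriv \<kappa> (fls_const b0 + fls_const b1 * fls_X) b1 B R Q"
  shows "\<mu> = 1 \<and> q = - \<kappa>"
proof -
  define N where "N = -2*\<mu> - 4"
  define b where "b = fls_const b0 + fls_const b1 * fls_X"
  define m :: complex where "m = of_int \<mu>"
  have m0: "m \<noteq> 0" "m + 1 \<noteq> 0" "2 * m + 3 \<noteq> 0"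
    using \<mu> unfolding m_def by (simp_all add: complex_eq_iff)
  note Qk = lead_derivs[OF Q, folded m_def]
  have b: "lead b 0 b0" unfolding b_def by (rule lead_linear)
  define c5 where "c5 = - m * (m+1) * (m+2) * (m+3) * (m+4) * q"
  have T1: "lead (fls_const (\<kappa>/4) * (b * fls_deriv (fls_deriv (fls_deriv (fls_deriv (fls_deriv Q))))
     + fls_const (5 * b1) * fls_deriv (fls_deriv (fls_deriv (fls_deriv Q))))) N
     (if \<mu> = 1 then \<kappa>/4 * (b0 * c5) else 0)" 
  proof -
    have 1: "lead (b * fls_deriv (fls_deriv (fls_deriv (fls_deriv (fls_deriv Q))))) (-\<mu>-5) (b0 * c5)"
      unfolding c5_def by (rule lead_mult[OF b Qk(5)]) simp
    have 2: "lead (fls_const (5 * b1) * fls_deriv (fls_deriv (fls_deriv (fls_deriv Q)))) (-\<mu>-5) 0"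
      by (rule lead_weaken[OF lead_cmult[OF Qk(4)]]) simp
    from lead_cmult[OF lead_add[OF 1 2], of "\<kappa>/4"] have
      3: "lead (fls_const (\<kappa>/4) * (b * fls_deriv (fls_deriv (fls_deriv (fls_deriv (fls_deriv Q))))
     + fls_const (5 * b1) * fls_deriv (fls_deriv (fls_deriv (fls_deriv Q))))) (-\<mu>-5) (\<kappa>/4 * (b0 * c5))"
      by simp
    show ?thesis
      using lead_le[OF 3, of N] \<mu> by (auto simp: N_def split: if_splits)
  qed
  have T2: "lead (3 * b * (fls_deriv (fls_deriv Q) * fls_deriv (fls_deriv Q)
       + fls_deriv Q * fls_deriv (fls_deriv (fls_deriv Q)))) N
       (3 * b0 * ((m*(m+1)*q)*(m*(m+1)*q) + (-m*q)*(-m*(m+1)*(m+2)*q)))"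
    unfolding N_def
    by (rule lead_mult[OF lead_mult[OF lead_numeral b refl]
          lead_add[OF lead_mult[OF Qk(2) Qk(2) refl] lead_mult[OF Qk(1) Qk(3)]]]) simp_all
  have T3: "lead (fls_const (12 * b1) * fls_deriv Q * fls_deriv (fls_deriv Q)) N 0"
    unfolding N_def
    by (rule lead_weaken[OF lead_mult[OF lead_cmult[OF Qk(1)] Qk(2) refl]]) simp
  have T4: "lead (fls_const b1 * Q * fls_deriv (fls_deriv (fls_deriv Q))) N 0"
    unfolding N_def
    by (rule lead_weaken[OF lead_mult[OF lead_cmult[OF Q] Qk(3) refl]]) simp
  have rhs: "lead (B * fls_deriv (fls_deriv (fls_deriv Q)) + 3 * fls_deriv B * fls_deriv (fls_deriv Q)
    + 3 * fls_deriv (fls_deriv B) * fls_deriv Q + fls_deriv (fls_deriv (fls_deriv B)) * Q - R) N 0"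
    by (rule lead_ode4_rhs[OF Q \<mu> B R]) (use \<mu> in \<open>simp add: N_def\<close>)
  have "(if \<mu> = 1 then \<kappa>/4 * (b0 * c5) else 0)
     - (3 * b0 * ((m*(m+1)*q)*(m*(m+1)*q) + (-m*q)*(-m*(m+1)*(m+2)*q)) + 0 + 0) = 0"
    using leadD(1)[OF lead_diff[OF T1 lead_add[OF lead_add[OF T2 T3] T4]]] leadD(1)[OF rhs]
      ode[unfolded ode4_def, folded b_def] by simp
  then have eq: "(if \<mu> = 1 then \<kappa>/4 * (b0 * c5) else 0) = 3 * b0 * q^2 * m^2 * (m+1) * (2*m+3)"
    by (simp add: algebra_simps power2_eq_square)
  show ?thesis
  proof (cases "\<mu> = 1")
    case True
    then have "m = 1" by (simp add: m_def)
    \<comment> \<open>For a simple pole the fifth derivative brings -120 q, times \<kappa>/4, while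
      the quadratic terms give 3 * 2 * 5 b0 q^2.\<close>
    then have "- (30 * b0 * q) * (\<kappa> + q) = 0"
      using eq True by (simp add: c5_def algebra_simps power2_eq_square)
    then show ?thesis using True b0 q by (simp add: eq_neg_iff_add_eq_0 add.commute)
  next
    case False
    then show ?thesis using eq b0 q m0 by simp
  qed
qed

text \<open>Where b vanishes, the terms with \<open>b1\<close> reach the leading order -2\<mu> - 3
  too, and the total coefficient acquires the factor (3\<mu> + 1) (\<mu> - 1). This excludes \<mu>
  \<ge> 2. At \<mu> = 1 the linear terms also cancel, since -120 + 5 * 24 = 0, so the leading order
  says nothing about the residue there.\<close>

lemma ode4_pole_special:
  assumes Q: "lead Q (-\<mu>) q" and q: "q \<noteq> 0" and \<mu>: "\<mu> \<ge> 1" and b1: "b1 \<noteq> 0"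
    and B: "lead B 0 B0" and R: "lead R 0 R0"
    and ode: "ode4 fls_deriv \<kappa> (fls_const 0 + fls_const b1 * fls_X) b1 B R Q"
  shows "\<mu> = 1"
proof (rule ccontr)
  assume "\<mu> \<noteq> 1"
  with \<mu> have \<mu>: "\<mu> \<ge> 2" by simp
  define N where "N = -2*\<mu> - 3"
  define b where "b = fls_const 0 + fls_const b1 * fls_X"
  define m :: complex where "m = of_int \<mu>"
  have m0: "m \<noteq> 0" "m + 1 \<noteq> 0" "3 * m + 1 \<noteq> 0" "m - 1 \<noteq> 0"
    using \<mu> unfolding m_def by (simp_all add: complex_eq_iff)
  note Qk = lead_derivs[OF Q, folded m_def]
  have b: "lead b 1 b1" unfolding b_def by (rule lead_linear) simp
  have T1: "lead (fls_const (\<kappa>/4) * (b * fls_deriv (fls_deriv (fls_deriv (fls_deriv (fls_deriv Q))))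
     + fls_const (5 * b1) * fls_deriv (fls_deriv (fls_deriv (fls_deriv Q))))) N 0"
    by (rule lead_weaken[OF lead_cmult[OF lead_add[OF lead_mult[OF b Qk(5)] lead_cmult[OF Qk(4)]]]])
      (use \<mu> in \<open>auto simp: N_def\<close>)
  have T2: "lead (3 * b * (fls_deriv (fls_deriv Q) * fls_deriv (fls_deriv Q)
       + fls_deriv Q * fls_deriv (fls_deriv (fls_deriv Q)))) N
       (3 * b1 * ((m*(m+1)*q)*(m*(m+1)*q) + (-m*q)*(-m*(m+1)*(m+2)*q)))"
    unfolding N_def
    by (rule lead_mult[OF lead_mult[OF lead_numeral b refl]
          lead_add[OF lead_mult[OF Qk(2) Qk(2) refl] lead_mult[OF Qk(1) Qk(3)]]]) simp_all
  have T3: "lead (fls_const (12 * b1) * fls_deriv Q * fls_deriv (fls_deriv Q)) N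
      (12 * b1 * (-m*q) * (m*(m+1)*q))"
    unfolding N_def
    by (rule lead_mult[OF lead_cmult[OF Qk(1)] Qk(2)]) simp
  have T4: "lead (fls_const b1 * Q * fls_deriv (fls_deriv (fls_deriv Q))) N
      (b1 * q * (-m*(m+1)*(m+2)*q))"
    unfolding N_def
    by (rule lead_mult[OF lead_cmult[OF Q] Qk(3)]) simp
  have rhs: "lead (B * fls_deriv (fls_deriv (fls_deriv Q)) + 3 * fls_deriv B * fls_deriv (fls_deriv Q)
    + 3 * fls_deriv (fls_deriv B) * fls_deriv Q + fls_deriv (fls_deriv (fls_deriv B)) * Q - R) N 0"
    by (rule lead_ode4_rhs[OF Q _ B R]) (use \<mu> in \<open>auto simp: N_def\<close>)
  have "0 - (3 * b1 * ((m*(m+1)*q)*(m*(m+1)*q) + (-m*q)*(-m*(m+1)*(m+2)*q))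
      + 12 * b1 * (-m*q) * (m*(m+1)*q) + b1 * q * (-m*(m+1)*(m+2)*q)) = 0"
    using leadD(1)[OF lead_diff[OF T1 lead_add[OF lead_add[OF T2 T3] T4]]] leadD(1)[OF rhs]
      ode[unfolded ode4_def, folded b_def] by simp
  then have "2 * b1 * q^2 * m * (m+1) * (3*m+1) * (m-1) = 0"
    by algebra
  then show False using m0 b1 q by simp
qed

section \<open>Coefficients beyond the leading one at a simple pole\<close>

lemma simple_pole_square:
  assumes Q: "lead Q (-1) (q::complex)"
  defines "V \<equiv> fls_deriv Q"
  shows "(V * V) $$ (-4) = q^2" "(V * V) $$ (-3) = 0" "(V * V) $$ (-2) = - 2 * q * Q $$ 1"
    "(V * V) $$ (-1) = - 4 * q * Q $$ 2" "(V * V) $$ 1 = 2 * (Q $$ 1 * 2 * Q $$ 2 - q * 4 * Q $$ 4)"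
    "(V * V) $$ 0 = (Q $$ 1)^2 - 6 * q * Q $$ 3"
proof -
  have V: "\<forall>j<(-2). V $$ j = 0" using Q by (auto simp: V_def lead_def)
  note s = fls_mult_nth_shift(1)[OF V V]
  show "(V * V) $$ (-4) = q^2" using s[of 0] Q by (simp add: V_def lead_def power2_eq_square)
  show "(V * V) $$ (-3) = 0" using s[of 1] Q by (simp add: V_def lead_def)
  show "(V * V) $$ (-2) = - 2 * q * Q $$ 1" using s[of 2] Q by (simp add: V_def lead_def numeral_2_eq_2)
  show "(V * V) $$ (-1) = - 4 * q * Q $$ 2" using s[of 3] Q by (simp add: V_def lead_def numeral_3_eq_3)
  show "(V * V) $$ 0 = (Q $$ 1)^2 - 6 * q * Q $$ 3" using s[of 4] Q
    by (simp add: V_def lead_def eval_nat_numeral power2_eq_square)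
  show "(V * V) $$ 1 = 2 * (Q $$ 1 * 2 * Q $$ 2 - q * 4 * Q $$ 4)" using s[of 5] Q
    by (simp add: V_def lead_def eval_nat_numeral algebra_simps)
qed

lemma simple_pole_Q_dV:
  assumes Q: "lead Q (-1) (q::complex)"
  defines "V \<equiv> fls_deriv Q"
  shows "(Q * fls_deriv V) $$ (-2) = 2 * q * Q $$ 1"
    "(Q * fls_deriv V) $$ (-1) = 4 * q * Q $$ 2"
    "(Q * fls_deriv V) $$ 1 = 14 * q * Q $$ 4 + 2 * Q $$ 1 * Q $$ 2 + 6 * Q $$ 0 * Q $$ 3"
proof -
  have V: "\<forall>j<(-3). fls_deriv V $$ j = 0" and Q': "\<forall>j<(-1). Q $$ j = 0"
    using Q by (auto simp: V_def lead_def)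
  note s = fls_mult_nth_shift(1)[OF Q' V]
  show "(Q * fls_deriv V) $$ (-2) = 2 * q * Q $$ 1"
    using s[of 2] Q by (simp add: V_def lead_def eval_nat_numeral)
  show "(Q * fls_deriv V) $$ (-1) = 4 * q * Q $$ 2"
    using s[of 3] Q by (simp add: V_def lead_def eval_nat_numeral)
  show "(Q * fls_deriv V) $$ 1 = 14 * q * Q $$ 4 + 2 * Q $$ 1 * Q $$ 2 + 6 * Q $$ 0 * Q $$ 3"
    using s[of 5] Q by (simp add: V_def lead_def eval_nat_numeral algebra_simps)
qed

text \<open>Twice the equation is a sum of total derivatives, up to R. The k-th derivative of a
  Laurent series has no coefficients at the indices -k, ..., -1, so well chosen negative indices
  remove the linear terms and isolate the quadratic ones.\<close>

lemma ode4_derivative_form: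
  assumes ode: "ode4 fls_deriv \<kappa> b b1 B R Q" and b: "b = fls_const b0 + fls_const b1 * fls_X"
  defines "V \<equiv> fls_deriv Q"
  shows "fls_const (\<kappa> / 2) * fls_deriv (fls_deriv (fls_deriv (fls_deriv (fls_deriv (b * Q)))))
    - fls_deriv (3 * fls_deriv (b * (V * V)) + 5 * (fls_const b1 * (V * V)) + 2 * (fls_const b1 * (Q * fls_deriv V)))
    = 2 * fls_deriv (fls_deriv (fls_deriv (B * Q))) - 2 * R"
proof -
  define c where "c = fls_const b1"
  have nc: "fls_const (numeral k * x) = numeral k * fls_const x" for k and x :: complex
    by (metis fls_const_mult_const fls_const_numeral)
  have "\<kappa> / 2 = 2 * (\<kappa> / 4)" by simp
  then have c: "fls_const (12 * b1) = 12 * c" "fls_const (5 * b1) = 5 * c" "fls_const (\<kappa> / 2) = 2 * fls_const (\<kappa> / 4)"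
    unfolding c_def by (simp_all only: nc)
  have db: "fls_deriv b = c" and dc: "fls_deriv c = 0"
    by (simp_all add: b c_def)
  define K where "K = fls_const (\<kappa> / 4)"
  have "K * (b * fls_deriv (fls_deriv (fls_deriv (fls_deriv (fls_deriv Q)))) + 5 * c * fls_deriv (fls_deriv (fls_deriv (fls_deriv Q))))
     - (3 * b * (fls_deriv (fls_deriv Q) * fls_deriv (fls_deriv Q) + fls_deriv Q * fls_deriv (fls_deriv (fls_deriv Q)))
        + 12 * c * fls_deriv Q * fls_deriv (fls_deriv Q) + c * Q * fls_deriv (fls_deriv (fls_deriv Q)))
     = B * fls_deriv (fls_deriv (fls_deriv Q)) + 3 * fls_deriv B * fls_deriv (fls_deriv Q) + 3 * fls_deriv (fls_deriv B) * fls_deriv Q + fls_deriv (fls_deriv (fls_deriv B)) * Q - R"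
    using ode unfolding ode4_def c K_def c_def[symmetric] .
  then have "2 * K * (b * fls_deriv (fls_deriv (fls_deriv (fls_deriv (fls_deriv Q)))) + 5 * c * fls_deriv (fls_deriv (fls_deriv (fls_deriv Q))))
     - 2 * (3 * b * (fls_deriv (fls_deriv Q) * fls_deriv (fls_deriv Q) + fls_deriv Q * fls_deriv (fls_deriv (fls_deriv Q)))
        + 12 * c * fls_deriv Q * fls_deriv (fls_deriv Q) + c * Q * fls_deriv (fls_deriv (fls_deriv Q)))
     = 2 * (B * fls_deriv (fls_deriv (fls_deriv Q)) + 3 * fls_deriv B * fls_deriv (fls_deriv Q) + 3 * fls_deriv (fls_deriv B) * fls_deriv Q + fls_deriv (fls_deriv (fls_deriv B)) * Q) - 2 * R"
    by algebra
  then show ?thesis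
    unfolding c K_def[symmetric] c_def[symmetric] V_def
    by (simp add: db dc algebra_simps)
qed

lemma numeral_mult_nth: "(numeral k * f) $$ n = numeral k * (f $$ n :: complex)"
  by (metis fls_const_numeral fls_mult_const_nth(1))

lemma linear_times_nth:
  "((fls_const b0 + fls_const b1 * fls_X) * f) $$ n = (b0::complex) * f $$ n + b1 * f $$ (n - 1)"
  by (simp only: distrib_right mult.assoc fls_X_times_conv_shift(1) fls_plus_nth fls_mult_const_nth fls_shift_nth) simp

text \<open>The indices -3 and -2 give b0 q Q_2 = 0 and b1 q Q_2 = 0. If b vanishes at the pole, the
  indices -4 and 0 give the two further relations, which replace the missing information on the
  residue: they later exclude a second pole beside an exceptional one.\<close>

lemma ode4_simple_pole:
  assumes Q: "lead Q (-1) q" and q: "q \<noteq> 0" and b01: "b0 \<noteq> 0 \<or> b1 \<noteq> 0"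
    and B: "lead B 0 B0" and R: "lead R 0 R0"
    and ode: "ode4 fls_deriv \<kappa> (fls_const b0 + fls_const b1 * fls_X) b1 B R Q"
  shows "Q $$ 2 = 0"
    and "b0 = 0 \<Longrightarrow> B $$ 0 = - b1 * Q $$ 0"
    and "b0 = 0 \<Longrightarrow> B $$ 4 = 0 \<Longrightarrow>
      30 * b1 * Q $$ 4 * (\<kappa> + q) = 6 * B $$ 2 * Q $$ 1 + 6 * B $$ 3 * Q $$ 0 - R0"
proof -
  define b where "b = fls_const b0 + fls_const b1 * fls_X"
  define V where "V = fls_deriv Q"
  define K where "K = 3 * fls_deriv (b * (V * V)) + 5 * (fls_const b1 * (V * V)) + 2 * (fls_const b1 * (Q * fls_deriv V))"
  note eq = ode4_derivative_form[OF ode[folded b_def] b_def, folded V_def, folded K_def]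
  have eqn: "\<kappa> / 2 * (of_int (n+1) * (of_int (n+2) * (of_int (n+3) * (of_int (n+4) * (of_int (n+5) * (b * Q) $$ (n+5))))))
    - of_int (n+1) * K $$ (n+1) = 2 * (of_int (n+1) * (of_int (n+2) * (of_int (n+3) * (B * Q) $$ (n+3)))) - 2 * R $$ n" for n
    using arg_cong[OF eq, of "\<lambda>f. f $$ n"]
    unfolding fls_minus_nth fls_plus_nth fls_mult_const_nth numeral_mult_nth fls_deriv_nth
    by (simp add: add.assoc)
  have Rn: "R $$ n = 0" if "n < 0" for n using R that by (simp add: lead_def)
  have K: "K $$ n = 3 * of_int (n + 1) * (b0 * (V * V) $$ (n + 1) + b1 * (V * V) $$ n)
      + 5 * b1 * (V * V) $$ n + 2 * b1 * (Q * fls_deriv V) $$ n" for n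
  proof -
    define W where "W = b * (V * V)"
    have "W $$ k = b0 * (V * V) $$ k + b1 * (V * V) $$ (k - 1)" for k
      unfolding W_def b_def by (rule linear_times_nth)
    then show ?thesis
      unfolding K_def W_def[symmetric] by (simp add: mult.assoc numeral_mult_nth del: fls_deriv_mult)
  qed
  note s = simple_pole_square[OF Q, folded V_def] simple_pole_Q_dV[OF Q, folded V_def]
  \<comment> \<open>At the index -3 the factor n + 3, at -2 the factor n + 2 annihilates both linear
    terms; R has no negative coefficients.\<close>
  have k2: "K $$ (-2) = 0" and k1: "K $$ (-1) = 0"
    using eqn[of "-3"] eqn[of "-2"] Rn by simp_all
  have "12 * b0 * q * Q $$ 2 = 0" and "12 * b1 * q * Q $$ 2 = 0"
    using k2 k1 by (simp_all add: K s algebra_simps)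
  then show Q2: "Q $$ 2 = 0" using q b01 by auto
  have Q': "\<forall>j<(-1). Q $$ j = 0" and B': "\<forall>j<0. B $$ j = 0"
    using Q B by (auto simp: lead_def)
  have V': "\<forall>j<(-3). fls_deriv V $$ j = 0"
    using Q by (auto simp: V_def lead_def)
  note BQ = fls_mult_nth_shift(1)[OF B' Q']
  show B0: "B $$ 0 = - b1 * Q $$ 0" if "b0 = 0"
  proof -
    have "(Q * fls_deriv V) $$ (-3) = 2 * q * Q $$ 0"
      using fls_mult_nth_shift(1)[OF Q' V', of 1] Q by (simp add: V_def lead_def)
    then have "K $$ (-3) = 4 * b1 * q * Q $$ 0"
      using that by (simp add: K s)
    moreover have "(B * Q) $$ (-1) = B $$ 0 * q"
      using BQ[of 0] Q by (simp add: lead_def)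
    \<comment> \<open>At the index -4 the fifth derivative is annihilated by its factor n + 4, but
      the third derivative of B Q survives with the factor (-3) (-2) (-1) = -6.\<close>
    ultimately have "q * (B $$ 0 + b1 * Q $$ 0) = 0"
      using eqn[of "-4"] Rn[of "-4"] by (simp add: distrib_left mult.left_commute)
    then show ?thesis using q by (simp add: eq_neg_iff_add_eq_0)
  qed
  show "30 * b1 * Q $$ 4 * (\<kappa> + q) = 6 * B $$ 2 * Q $$ 1 + 6 * B $$ 3 * Q $$ 0 - R0"
    if "b0 = 0" "B $$ 4 = 0"
  proof -
    have "(B * Q) $$ 3 = B $$ 0 * Q $$ 3 + B $$ 2 * Q $$ 1 + B $$ 3 * Q $$ 0"
      using BQ[of 4] Q that Q2 by (simp add: lead_def eval_nat_numeral)
    moreover have "(b * Q) $$ 5 = b1 * Q $$ 4"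
      unfolding b_def linear_times_nth using that by simp
    moreover have "R $$ 0 = R0" using R by (simp add: lead_def)
    ultimately have "60 * b1 * Q $$ 4 * \<kappa> - K $$ 1
        = 12 * (B $$ 0 * Q $$ 3 + B $$ 2 * Q $$ 1 + B $$ 3 * Q $$ 0) - 2 * R0"
      using eqn[of 0] by (simp add: mult_ac)
    moreover have "K $$ 1 = 12 * b1 * Q $$ 0 * Q $$ 3 - 60 * b1 * q * Q $$ 4"
      using that Q2 by (simp add: K s algebra_simps)
    ultimately have "2 * (30 * b1 * Q $$ 4 * (\<kappa> + q))
        = 2 * (6 * B $$ 2 * Q $$ 1 + 6 * B $$ 3 * Q $$ 0 - R0)"
      using B0[OF that(1)] by (simp add: algebra_simps)
    then show ?thesis
      by (simp only: mult_cancel_left) simp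
  qed
qed

section \<open>Growth at infinity\<close>

lemma lead_derivs_inf:
  assumes "lead Q (-\<sigma>) (q::complex)"
  shows "lead (fls_deriv_inf Q) (-\<sigma>+1) (of_int \<sigma> * q)"
    "lead (fls_deriv_inf (fls_deriv_inf Q)) (-\<sigma>+2) (of_int \<sigma> * (of_int \<sigma> - 1) * q)"
    "lead (fls_deriv_inf (fls_deriv_inf (fls_deriv_inf Q))) (-\<sigma>+3) (of_int \<sigma> * (of_int \<sigma> - 1) * (of_int \<sigma> - 2) * q)"
    "\<exists>c. lead (fls_deriv_inf (fls_deriv_inf (fls_deriv_inf (fls_deriv_inf Q)))) (-\<sigma>+4) c"
    "\<exists>c. lead (fls_deriv_inf (fls_deriv_inf (fls_deriv_inf (fls_deriv_inf (fls_deriv_inf Q))))) (-\<sigma>+5) c"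
proof -
  show 1: "lead (fls_deriv_inf Q) (-\<sigma>+1) (of_int \<sigma> * q)"
    using lead_deriv_inf[OF assms, of "-\<sigma>+1"] by simp
  show 2: "lead (fls_deriv_inf (fls_deriv_inf Q)) (-\<sigma>+2) (of_int \<sigma> * (of_int \<sigma> - 1) * q)"
    using lead_deriv_inf[OF 1, of "-\<sigma>+2"] by (simp add: algebra_simps)
  show 3: "lead (fls_deriv_inf (fls_deriv_inf (fls_deriv_inf Q))) (-\<sigma>+3) (of_int \<sigma> * (of_int \<sigma> - 1) * (of_int \<sigma> - 2) * q)"
    using lead_deriv_inf[OF 2, of "-\<sigma>+3"] by (simp add: algebra_simps)
  show 4: "\<exists>c. lead (fls_deriv_inf (fls_deriv_inf (fls_deriv_inf (fls_deriv_inf Q)))) (-\<sigma>+4) c"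
    using lead_deriv_inf[OF 3, of "-\<sigma>+4"] by auto
  then obtain c where c: "lead (fls_deriv_inf (fls_deriv_inf (fls_deriv_inf (fls_deriv_inf Q)))) (-\<sigma>+4) c" by blast
  show "\<exists>c. lead (fls_deriv_inf (fls_deriv_inf (fls_deriv_inf (fls_deriv_inf (fls_deriv_inf Q))))) (-\<sigma>+5) c"
    using lead_deriv_inf[OF c, of "-\<sigma>+5"] by auto
qed

lemma lead_linear_inf:
  shows "lead (fls_const b0 + fls_const b1 * fls_X_inv) (-1) b1"
    and "b1 = 0 \<Longrightarrow> lead (fls_const b0 + fls_const b1 * fls_X_inv) 0 b0"
  by (auto simp: lead_def)

lemma lead_ode4_rhs_inf:
  assumes Q: "lead Q (-\<sigma>) (q::complex)" and B: "lead B (-\<beta>) B0" and R: "lead R (-\<beta>) R0"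
    and N: "N < -\<sigma> - \<beta> + 3" "N < -\<beta>"
  defines "D \<equiv> fls_deriv_inf"
  shows "lead (B * D (D (D Q)) + 3 * D B * D (D Q) + 3 * D (D B) * D Q + D (D (D B)) * Q - R) N 0"
proof -
  note Qk = lead_derivs_inf[OF Q, folded D_def]
  note Bk = lead_derivs_inf[OF B, folded D_def]
  have "lead (B * D (D (D Q))) N 0"
    by (rule lead_weaken[OF lead_mult[OF B Qk(3) refl]]) (use N in simp)
  moreover have "lead (3 * D B * D (D Q)) N 0"
    by (rule lead_weaken[OF lead_mult[OF lead_mult[OF lead_numeral Bk(1) refl] Qk(2) refl]]) (use N in simp)
  moreover have "lead (3 * D (D B) * D Q) N 0"
    by (rule lead_weaken[OF lead_mult[OF lead_mult[OF lead_numeral Bk(2) refl] Qk(1) refl]]) (use N in simp)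
  moreover have "lead (D (D (D B)) * Q) N 0"
    by (rule lead_weaken[OF lead_mult[OF Bk(3) Q refl]]) (use N in simp)
  moreover have "lead R N 0"
    by (rule lead_weaken[OF R]) (use N in simp)
  ultimately show ?thesis
    by (auto simp: lead_def)
qed

text \<open>If \<open>Q\<close> grows like t^\<sigma>, the quadratic terms grow like t^(2\<sigma> -
  4 + e), the right-hand side like t^(\<sigma> - 1 + e) apart from R, and R like t^(2 + e). From
  \<sigma> = 4 on the quadratic terms dominate, and their leading coefficient has no root \<sigma>
  \<ge> 4, both for e = 0 and for e = 1.\<close>

lemma ode4_inf:
  assumes Q: "lead Q (-\<sigma>) q" and q: "q \<noteq> 0" and \<sigma>: "\<sigma> \<ge> 4"
    and b: "lead b (-e) be" "be \<noteq> 0" "e = 1 \<and> be = b1 \<or> e = 0 \<and> b1 = 0"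
    and B: "lead B (-2-e) B0" and R: "lead R (-2-e) R0"
  shows "\<not> ode4 fls_deriv_inf \<kappa> b b1 B R Q"
proof
  define D :: "complex fls \<Rightarrow> complex fls" where "D = fls_deriv_inf"
  assume "ode4 fls_deriv_inf \<kappa> b b1 B R Q"
  note ode = this[folded D_def, unfolded ode4_def]
  define m :: complex where "m = of_int \<sigma>"
  have m0: "m \<noteq> 0" "m - 1 \<noteq> 0" "3 * m - 1 \<noteq> 0" "m + 1 \<noteq> 0" "2 * m - 3 \<noteq> 0"
    using \<sigma> unfolding m_def by (simp_all add: complex_eq_iff)
  note Qk = lead_derivs_inf[OF Q, folded D_def, folded m_def]
  obtain c4 where c4: "lead (D (D (D (D Q)))) (-\<sigma>+4) c4" using Qk(4) by blast
  obtain c5 where c5: "lead (D (D (D (D (D Q))))) (-\<sigma>+5) c5" using Qk(5) by blast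
  define N where "N = -2*\<sigma> + 4 - e"
  have e: "e \<le> 1" "e \<ge> 0" using b by auto
  have 1: "lead (b * D (D (D (D (D Q))))) N 0"
    by (rule lead_weaken[OF lead_mult[OF b(1) c5 refl]]) (use \<sigma> in \<open>simp add: N_def\<close>)
  have 2: "lead (fls_const (5 * b1) * D (D (D (D Q)))) N 0"
    by (rule lead_weaken[OF lead_cmult[OF c4]]) (use \<sigma> e in \<open>simp add: N_def\<close>)
  have T1: "lead (fls_const (\<kappa> / 4) * (b * D (D (D (D (D Q)))) + fls_const (5 * b1) * D (D (D (D Q))))) N 0"
    using lead_cmult[OF lead_add[OF 1 2]] by simp
  have T2: "lead (3 * b * (D (D Q) * D (D Q) + D Q * D (D (D Q)))) N
       (3 * be * ((m*(m-1)*q)*(m*(m-1)*q) + (m*q)*(m*(m-1)*(m-2)*q)))"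
    unfolding N_def
    by (rule lead_mult[OF lead_mult[OF lead_numeral b(1) refl]
          lead_add[OF lead_mult[OF Qk(2) Qk(2) refl] lead_mult[OF Qk(1) Qk(3)]]]) simp_all
  have T3': "lead (fls_const (12 * b1) * D Q * D (D Q)) (-2*\<sigma>+3) (12 * b1 * (m*q) * (m*(m-1)*q))"
    by (rule lead_mult[OF lead_cmult[OF Qk(1)] Qk(2)]) simp
  have T4': "lead (fls_const b1 * Q * D (D (D Q))) (-2*\<sigma>+3) (b1 * q * (m*(m-1)*(m-2)*q))"
    by (rule lead_mult[OF lead_cmult[OF Q] Qk(3)]) simp
  have T3: "lead (fls_const (12 * b1) * D Q * D (D Q)) N (12 * b1 * (m*q) * (m*(m-1)*q))"
    using b(3)
  proof
    assume "e = 1 \<and> be = b1" then show ?thesis using T3' by (simp add: N_def)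
  qed (auto simp: lead_def)
  have T4: "lead (fls_const b1 * Q * D (D (D Q))) N (b1 * q * (m*(m-1)*(m-2)*q))"
    using b(3)
  proof
    assume "e = 1 \<and> be = b1" then show ?thesis using T4' by (simp add: N_def)
  qed (auto simp: lead_def)
  have rhs: "lead (B * D (D (D Q)) + 3 * D B * D (D Q) + 3 * D (D B) * D Q + D (D (D B)) * Q - R) N 0"
    unfolding D_def
    by (rule lead_ode4_rhs_inf[where \<beta> = "2 + e" and q = q]) (use Q B R \<sigma> e in \<open>auto simp: N_def\<close>)
  have eq: "0 - (3 * be * ((m*(m-1)*q)*(m*(m-1)*q) + (m*q)*(m*(m-1)*(m-2)*q))
      + 12 * b1 * (m*q) * (m*(m-1)*q) + b1 * q * (m*(m-1)*(m-2)*q)) = 0"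
    using leadD(1)[OF lead_diff[OF T1 lead_add[OF lead_add[OF T2 T3] T4]]] leadD(1)[OF rhs] ode by simp
  from b(3) show False
  proof
    assume "e = 1 \<and> be = b1"
    then have "be = b1" by simp
    have "2 * be * q^2 * m * (m-1) * (3*m-1) * (m+1) = - (0 - (3 * be * ((m*(m-1)*q)*(m*(m-1)*q) + (m*q)*(m*(m-1)*(m-2)*q))
      + 12 * b1 * (m*q) * (m*(m-1)*q) + b1 * q * (m*(m-1)*(m-2)*q)))"
      unfolding \<open>be = b1\<close> by (simp add: power2_eq_square algebra_simps)
    also have "\<dots> = 0" unfolding eq by simp
    finally have "2 * be * q^2 * m * (m-1) * (3*m-1) * (m+1) = 0" .
    then show False using m0 b(2) q by simp
  next
    assume "e = 0 \<and> b1 = 0"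
    then have "b1 = 0" by simp
    have "3 * be * q^2 * m^2 * (m-1) * (2*m-3) = - (0 - (3 * be * ((m*(m-1)*q)*(m*(m-1)*q) + (m*q)*(m*(m-1)*(m-2)*q))
      + 12 * b1 * (m*q) * (m*(m-1)*q) + b1 * q * (m*(m-1)*(m-2)*q)))"
      unfolding \<open>b1 = 0\<close> by (simp add: power2_eq_square algebra_simps)
    also have "\<dots> = 0" unfolding eq by simp
    finally have "3 * be * q^2 * m^2 * (m-1) * (2*m-3) = 0" .
    then show False using m0 b(2) q by simp
  qed
qed

section \<open>The equation belonging to integrals of order three\<close>

definition ode3 ::
  "(complex fls \<Rightarrow> complex fls) \<Rightarrow> complex \<Rightarrow> complex \<Rightarrow> complex fls \<Rightarrow> complex fls \<Rightarrow> complex fls \<Rightarrow> bool"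
  where "ode3 D \<kappa> a B R Q \<longleftrightarrow>
     fls_const (\<kappa> / 4 * a) * D (D (D (D Q))) - fls_const (3 * a) * (D Q * D (D Q))
     = B * D (D Q) + 2 * D B * D Q + D (D B) * Q + R"

text \<open>The product of the first two derivatives has order -2\<mu> - 3, the fourth derivative
  -\<mu> - 4. They can balance only for \<mu> = 1, and then 6 a q (\<kappa> + q) = 0. The leading
  coefficient a is constant, so there is no exceptional pole.\<close>

lemma ode3_pole:
  assumes Q: "lead Q (-\<mu>) q" and q: "q \<noteq> 0" and \<mu>: "\<mu> \<ge> 1" and a: "a \<noteq> 0"
    and B: "lead B 0 B0" and R: "lead R 0 R0"
    and ode: "ode3 fls_deriv \<kappa> a B R Q"
  shows "\<mu> = 1 \<and> q = - \<kappa>"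
proof -
  define N where "N = -2*\<mu> - 3"
  define m :: complex where "m = of_int \<mu>"
  have m0: "m \<noteq> 0" "m + 1 \<noteq> 0"
    using \<mu> unfolding m_def by (simp_all add: complex_eq_iff)
  note Qk = lead_derivs[OF Q, folded m_def]
  define c4 where "c4 = m * (m+1) * (m+2) * (m+3) * q"
  have T1: "lead (fls_const (\<kappa>/4 * a) * fls_deriv (fls_deriv (fls_deriv (fls_deriv Q)))) N
     (if \<mu> = 1 then \<kappa>/4 * a * c4 else 0)"
    using lead_le[OF lead_cmult[OF Qk(4), of "\<kappa>/4 * a"], of N] \<mu>
    by (auto simp: N_def c4_def split: if_splits)
  have T2: "lead (fls_const (3 * a) * (fls_deriv Q * fls_deriv (fls_deriv Q))) N
      (3 * a * ((-m*q) * (m*(m+1)*q)))"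
    unfolding N_def
    by (rule lead_cmult[OF lead_mult[OF Qk(1) Qk(2)]]) simp
  note B1 = lead_deriv_0[OF B]
  note B2 = lead_deriv_0[OF B1]
  have "lead (B * fls_deriv (fls_deriv Q)) N 0"
    by (rule lead_weaken[OF lead_mult[OF B Qk(2) refl]]) (use \<mu> in \<open>simp add: N_def\<close>)
  moreover have "lead (2 * fls_deriv B * fls_deriv Q) N 0"
    by (rule lead_weaken[OF lead_mult[OF lead_mult[OF lead_numeral B1 refl] Qk(1) refl]]) (use \<mu> in \<open>simp add: N_def\<close>)
  moreover have "lead (fls_deriv (fls_deriv B) * Q) N 0"
    by (rule lead_weaken[OF lead_mult[OF B2 Q refl]]) (use \<mu> in \<open>simp add: N_def\<close>)
  moreover have "lead R N 0"
    by (rule lead_weaken[OF R]) (use \<mu> in \<open>simp add: N_def\<close>)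
  ultimately have rhs: "(B * fls_deriv (fls_deriv Q) + 2 * fls_deriv B * fls_deriv Q
      + fls_deriv (fls_deriv B) * Q + R) $$ N = 0"
    by (auto simp: lead_def)
  define L where "L = (if \<mu> = 1 then \<kappa>/4 * a * c4 else 0)"
  have "L - 3 * a * ((-m*q) * (m*(m+1)*q)) = 0"
    unfolding L_def
    by (rule trans[OF leadD(1)[OF lead_diff[OF T1 T2], symmetric]])
      (simp only: ode[unfolded ode3_def] rhs)
  moreover have "3 * a * ((-m*q) * (m*(m+1)*q)) = - 3 * a * q^2 * m^2 * (m+1)"
    by (simp add: power2_eq_square algebra_simps)
  ultimately have "L = - 3 * a * q^2 * m^2 * (m+1)"
    by (simp only: right_minus_eq)
  note eq = this[unfolded L_def]
  show ?thesis
  proof (cases "\<mu> = 1")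
    case True
    then have "m = 1" by (simp add: m_def)
    then have "6 * a * q * (\<kappa> + q) = \<kappa>/4 * a * c4 - (- 3 * a * q^2 * m^2 * (m+1))"
      by (simp add: c4_def algebra_simps power2_eq_square)
    also have "\<dots> = 0" using eq True by simp
    finally have "6 * a * q * (\<kappa> + q) = 0" .
    then show ?thesis using True a q by (simp add: eq_neg_iff_add_eq_0 add.commute)
  next
    case False
    then show ?thesis using eq a q m0 by simp
  qed
qed

text \<open>At the index -2 the fourth derivative and the second derivative of B Q have no
  coefficient. What remains is the derivative of V^2, and the coefficient of V^2 at -1 is -4 q
  Q_2.\<close>

lemma ode3_simple_pole:
  assumes Q: "lead Q (-1) q" and q: "q \<noteq> 0" and a: "a \<noteq> 0"
    and R: "lead R 0 R0"
    and ode: "ode3 fls_deriv \<kappa> a B R Q"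
  shows "Q $$ 2 = 0"
proof -
  define V where "V = fls_deriv Q"
  have "2 * (fls_const (\<kappa> / 4 * a) * fls_deriv (fls_deriv (fls_deriv (fls_deriv Q))))
     - fls_const (3 * a) * fls_deriv (V * V)
     = 2 * fls_deriv (fls_deriv (B * Q)) + 2 * R"
    using ode unfolding ode3_def V_def by (simp add: algebra_simps)
  from arg_cong[OF this, of "\<lambda>f. f $$ (-2)"] have "3 * a * (V * V) $$ (-1) = 0"
    unfolding fls_minus_nth fls_plus_nth fls_mult_const_nth numeral_mult_nth fls_deriv_nth
    using R by (simp add: lead_def)
  then show ?thesis
    using simple_pole_square(4)[OF Q] a q unfolding V_def by simp
qed

text \<open>The quadratic term grows like t^(2\<sigma> - 3), the linear ones at most like t^\<sigma>
  and R like t^3, so the quadratic term dominates from \<sigma> = 4 on.\<close>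

lemma ode3_inf:
  assumes Q: "lead Q (-\<sigma>) q" and q: "q \<noteq> 0" and \<sigma>: "\<sigma> \<ge> 4" and a: "a \<noteq> 0"
    and B: "lead B (-2) B0" and R: "lead R (-3) R0"
  shows "\<not> ode3 fls_deriv_inf \<kappa> a B R Q"
proof
  define D :: "complex fls \<Rightarrow> complex fls" where "D = fls_deriv_inf"
  assume "ode3 fls_deriv_inf \<kappa> a B R Q"
  note ode = this[folded D_def, unfolded ode3_def]
  define m :: complex where "m = of_int \<sigma>"
  have m0: "m \<noteq> 0" "m - 1 \<noteq> 0"
    using \<sigma> unfolding m_def by (simp_all add: complex_eq_iff)
  note Qk = lead_derivs_inf[OF Q, folded D_def, folded m_def]
  note Bk = lead_derivs_inf[OF B, folded D_def]
  obtain c4 where c4: "lead (D (D (D (D Q)))) (-\<sigma>+4) c4" using Qk(4) by blast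
  define N where "N = -2*\<sigma> + 3"
  have T1: "lead (fls_const (\<kappa> / 4 * a) * D (D (D (D Q)))) N 0"
    by (rule lead_weaken[OF lead_cmult[OF c4]]) (use \<sigma> in \<open>simp add: N_def\<close>)
  have T2: "lead (fls_const (3 * a) * (D Q * D (D Q))) N (3 * a * ((m*q) * (m*(m-1)*q)))"
    unfolding N_def by (rule lead_cmult[OF lead_mult[OF Qk(1) Qk(2)]]) simp
  have "lead (B * D (D Q)) N 0"
    by (rule lead_weaken[OF lead_mult[OF B Qk(2) refl]]) (use \<sigma> in \<open>simp add: N_def\<close>)
  moreover have "lead (2 * D B * D Q) N 0"
    by (rule lead_weaken[OF lead_mult[OF lead_mult[OF lead_numeral Bk(1) refl] Qk(1) refl]]) (use \<sigma> in \<open>simp add: N_def\<close>)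
  moreover have "lead (D (D B) * Q) N 0"
    by (rule lead_weaken[OF lead_mult[OF Bk(2) Q refl]]) (use \<sigma> in \<open>simp add: N_def\<close>)
  moreover have "lead R N 0"
    by (rule lead_weaken[OF R]) (use \<sigma> in \<open>simp add: N_def\<close>)
  ultimately have rhs: "(B * D (D Q) + 2 * D B * D Q + D (D B) * Q + R) $$ N = 0"
    by (auto simp: lead_def)
  have "0 - 3 * a * ((m*q) * (m*(m-1)*q)) = 0"
    by (rule trans[OF leadD(1)[OF lead_diff[OF T1 T2], symmetric]]) (simp only: ode rhs)
  then show False using m0 a q by simp
qed

section \<open>Polynomials in a differential field of Laurent series\<close>

text \<open>Substitution of the series \<open>x\<close> for the variable: the ring homomorphism that
  carries polynomial identities into the field of Laurent series.\<close>

definition emb :: "complex fls \<Rightarrow> complex poly \<Rightarrow> complex fls" where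
  "emb x p = poly (map_poly fls_const p) x"

lemma emb_pCons [simp]: "emb x (pCons a p) = fls_const a + x * emb x p"
  by (simp add: emb_def map_poly_pCons)

lemma emb_0 [simp]: "emb x 0 = 0"
  by (simp add: emb_def)

lemma emb_add [simp]: "emb x (p + q) = emb x p + emb x q"
  by (induction p q rule: poly_induct2) (auto simp: algebra_simps simp flip: fls_plus_const)

lemma emb_smult [simp]: "emb x (smult a p) = fls_const a * emb x p"
  by (induction p) (auto simp: algebra_simps simp flip: fls_const_mult_const)

lemma emb_mult [simp]: "emb x (p * q) = emb x p * emb x q"
  by (induction p) (auto simp: algebra_simps)

lemma emb_1 [simp]: "emb x 1 = 1"
  by (simp add: one_pCons)

lemma emb_minus [simp]: "emb x (- p) = - emb x p"
  using emb_smult[of x "-1" p] by simp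

lemma emb_diff [simp]: "emb x (p - q) = emb x p - emb x q"
  using emb_add[of x p "- q"] by simp

lemma emb_power [simp]: "emb x (p ^ n) = emb x p ^ n"
  by (induction n) auto

lemma emb_numeral [simp]: "emb x (numeral k) = numeral k"
  by (simp add: numeral_poly)

text \<open>One interface for both local pictures: \<open>x\<close> is the coordinate t written in a
  local parameter and \<open>D\<close> is d/dt. The instances are a finite point r and
  infinity.\<close>

locale fls_derivation =
  fixes D :: "complex fls \<Rightarrow> complex fls" and x :: "complex fls"
  assumes D_add: "D (f + g) = D f + D g" and D_mult: "D (f * g) = D f * g + f * D g"
    and D_const: "D (fls_const c) = 0" and D_x: "D x = 1"
begin

lemma D_emb: "D (emb x p) = emb x (pderiv p)"
proof (induction p)
  case 0
  then show ?case using D_const[of 0] by simp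
next
  case (pCons a p)
  then show ?case
    by (simp add: D_add D_mult D_const D_x pderiv_pCons)
qed

lemma D_quotient:
  assumes "g \<noteq> 0"
  shows "D (f / g) = (D f * g - f * D g) / g\<^sup>2"
proof -
  have "D f = D (f / g * g)" using assms by simp
  also have "\<dots> = D (f / g) * g + f / g * D g" by (rule D_mult)
  finally show ?thesis using assms by (simp add: field_simps power2_eq_square)
qed

lemma D_power: "D (g ^ Suc n) = of_nat (Suc n) * g ^ n * D g"
proof (induction n)
  case (Suc n)
  have "D (g ^ Suc (Suc n)) = D g * g ^ Suc n + g * D (g ^ Suc n)"
    using D_mult[of g "g ^ Suc n"] by simp
  then show ?case using Suc by (simp add: algebra_simps)
qed simp

end

text \<open>Unreduced numerators of the k-th derivative of N / D over \<open>D ^ Suc k\<close>. The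
  same recursion is valid for real functions and for Laurent series, which is what links the two
  kinds of derivative.\<close>

fun numer :: "'a::field_char_0 poly \<Rightarrow> 'a poly \<Rightarrow> nat \<Rightarrow> 'a poly" where
  "numer N D 0 = N"
| "numer N D (Suc k) = pderiv (numer N D k) * D - of_nat (Suc k) * numer N D k * pderiv D"

lemma emb_of_nat [simp]: "emb x (of_nat n) = of_nat n"
  by (induction n) auto

lemma (in fls_derivation) D_numer:
  assumes "emb x d \<noteq> 0"
  shows "D (emb x (numer N d k) / emb x d ^ Suc k) = emb x (numer N d (Suc k)) / emb x d ^ Suc (Suc k)"
proof -
  define g where "g = emb x d"
  define f where "f = emb x (numer N d k)"
  have g: "g \<noteq> 0" using assms by (simp add: g_def)
  have "D (f / g ^ Suc k) = (D f * g ^ Suc k - f * (of_nat (Suc k) * g ^ k * D g)) / (g ^ Suc k)\<^sup>2"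
    using g by (subst D_quotient) (simp_all only: D_power power_eq_0_iff not_False_eq_True simp_thms)
  also have "\<dots> = (D f * g - of_nat (Suc k) * f * D g) / g ^ Suc (Suc k)"
    using g by (simp add: field_simps power2_eq_square)
  also have "D f * g - of_nat (Suc k) * f * D g = emb x (numer N d (Suc k))"
    by (simp add: f_def g_def D_emb)
  finally show ?thesis by (simp only: f_def g_def)
qed

lemma has_derivative_numer:
  fixes N d :: "real poly"
  assumes "poly d t \<noteq> 0"
  shows "((\<lambda>t. poly (numer N d k) t / poly d t ^ Suc k) has_real_derivative
     poly (numer N d (Suc k)) t / poly d t ^ Suc (Suc k)) (at t)"
proof -
  define f g where "f = poly (numer N d k) t" and "g = poly d t"
  define f' g' where "f' = poly (pderiv (numer N d k)) t" and "g' = poly (pderiv d) t"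
  have g: "g \<noteq> 0" using assms by (simp add: g_def)
  have "((\<lambda>t. poly (numer N d k) t / poly d t ^ Suc k) has_real_derivative
     (f' * g ^ Suc k - f * (of_nat (Suc k) * g ^ k * g')) / (g ^ Suc k * g ^ Suc k)) (at t)"
    unfolding f_def g_def f'_def g'_def
    using assms by (auto intro!: derivative_eq_intros simp del: power_Suc)
  moreover have "(f' * g ^ Suc k - f * (of_nat (Suc k) * g ^ k * g')) / (g ^ Suc k * g ^ Suc k)
     = (f' * g - of_nat (Suc k) * f * g') / g ^ Suc (Suc k)"
    using g by (simp add: field_simps)
  ultimately show ?thesis
    by (simp add: f_def g_def f'_def g'_def)
qed

section \<open>Real polynomials over the complex numbers, and derivatives of rational
  functions\<close>

abbreviation cpoly :: "real poly \<Rightarrow> complex poly" where "cpoly \<equiv> map_poly complex_of_real"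

lemma cpoly_pCons [simp]: "cpoly (pCons a p) = pCons (of_real a) (cpoly p)"
  by (simp add: map_poly_pCons)

lemma cpoly_add [simp]: "cpoly (p + q) = cpoly p + cpoly q"
  by (simp add: poly_eq_iff coeff_map_poly)

lemma cpoly_diff [simp]: "cpoly (p - q) = cpoly p - cpoly q"
  by (simp add: poly_eq_iff coeff_map_poly)

lemma cpoly_mult [simp]: "cpoly (p * q) = cpoly p * cpoly q"
  by (simp add: poly_eq_iff coeff_map_poly coeff_mult)

lemma cpoly_pderiv [simp]: "cpoly (pderiv p) = pderiv (cpoly p)"
  by (simp add: poly_eq_iff coeff_map_poly coeff_pderiv)

lemma cpoly_smult [simp]: "cpoly (smult c p) = smult (of_real c) (cpoly p)"
  by (simp add: poly_eq_iff coeff_map_poly)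

lemma cpoly_of_nat [simp]: "cpoly (of_nat n) = of_nat n"
  by (simp add: of_nat_poly)

lemma cpoly_1 [simp]: "cpoly 1 = 1"
  by (simp add: one_pCons)

lemma cpoly_numeral [simp]: "cpoly (numeral n) = numeral n"
  using cpoly_of_nat[of "numeral n"] by simp

lemma cpoly_eq_0_iff [simp]: "cpoly p = 0 \<longleftrightarrow> p = 0"
  by (simp add: poly_eq_iff coeff_map_poly)

lemma degree_cpoly [simp]: "degree (cpoly p) = degree p"
  by (cases "p = 0") (auto intro: map_poly_degree_eq)

lemma cpoly_power [simp]: "cpoly (p ^ n) = cpoly p ^ n"
  by (induction n) auto

lemma poly_cpoly_of_real [simp]: "poly (cpoly p) (of_real t) = of_real (poly p t)"
  by (induction p) auto

lemma cpoly_numer [simp]: "cpoly (numer N d k) = numer (cpoly N) (cpoly d) k"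
  by (induction k) auto

lemma poly_eq_on_open:
  fixes p q :: "real poly"
  assumes "open I" "I \<noteq> {}" "\<And>t. t \<in> I \<Longrightarrow> poly p t = poly q t"
  shows "p = q"
proof (rule ccontr)
  assume "p \<noteq> q"
  then have "finite {t. poly (p - q) t = 0}"
    by (intro poly_roots_finite) simp
  moreover have "I \<subseteq> {t. poly (p - q) t = 0}"
    using assms(3) by auto
  ultimately have "finite I" by (rule rev_finite_subset)
  then show False
    using assms(1,2) using finite_imp_not_open by blast
qed

text \<open>Derivatives are unique, and openness of the set lets the formula for \<open>Q k\<close>
  be differentiated at each of its points.\<close>

lemma rational_chain:
  fixes N d :: "real poly" and Q :: "nat \<Rightarrow> real \<Rightarrow> real"
  assumes I: "open I" and d: "\<And>t. t \<in> I \<Longrightarrow> poly d t \<noteq> 0"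
    and Q0: "\<And>t. t \<in> I \<Longrightarrow> Q 0 t = poly N t / poly d t"
    and Q: "\<And>k t. k < m \<Longrightarrow> t \<in> I \<Longrightarrow> (Q k has_real_derivative Q (Suc k) t) (at t)"
    and k: "k \<le> m" and t: "t \<in> I"
  shows "Q k t = poly (numer N d k) t / poly d t ^ Suc k"
  using k t
proof (induction k arbitrary: t)
  case 0
  then show ?case by (simp add: Q0)
next
  case (Suc k)
  have "((\<lambda>t. poly (numer N d k) t / poly d t ^ Suc k) has_real_derivative
     poly (numer N d (Suc k)) t / poly d t ^ Suc (Suc k)) (at t)"
    by (rule has_derivative_numer) (use d Suc in auto)
  moreover have "((\<lambda>t. poly (numer N d k) t / poly d t ^ Suc k) has_real_derivative Q (Suc k) t) (at t)"
    by (rule has_field_derivative_transform_within_open[OF Q I]) (use Suc in auto)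
  ultimately show ?case
    using DERIV_unique by blast
qed

text \<open>The polynomial identity is \<open>d ^ 6\<close> times the differential equation.\<close>

lemma ode4_transfer:
  fixes N d B R :: "real poly" and Q :: "nat \<Rightarrow> real \<Rightarrow> real"
  assumes I: "open I" "I \<noteq> {}" and d: "\<And>t. t \<in> I \<Longrightarrow> poly d t \<noteq> 0"
    and Q0: "\<And>t. t \<in> I \<Longrightarrow> Q 0 t = poly N t / poly d t"
    and Q: "\<And>k t. k < 5 \<Longrightarrow> t \<in> I \<Longrightarrow> (Q k has_real_derivative Q (Suc k) t) (at t)"
    and ode: "\<And>t. t \<in> I \<Longrightarrow>
      \<kappa> / 4 * ((b0 + b1 * t) * Q 5 t + 5 * b1 * Q 4 t)
      - (3 * (b0 + b1 * t) * (Q 2 t * Q 2 t + Q 1 t * Q 3 t) + 12 * b1 * Q 1 t * Q 2 t + b1 * Q 0 t * Q 3 t)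
      = poly B t * Q 3 t + 3 * poly (pderiv B) t * Q 2 t + 3 * poly (pderiv (pderiv B)) t * Q 1 t
        + poly (pderiv (pderiv (pderiv B))) t * Q 0 t - poly R t"
    and D: "fls_derivation D x" and dx: "emb x (cpoly d) \<noteq> 0"
  shows "ode4 D \<kappa> (fls_const (of_real b0) + fls_const (of_real b1) * x) b1 (emb x (cpoly B)) (emb x (cpoly R))
     (emb x (cpoly N) / emb x (cpoly d))"
proof -
  interpret fls_derivation D x by (rule D)
  define n where "n = numer N d"
  have Qk: "Q k t = poly (n k) t / poly d t ^ Suc k" if "k \<le> 5" "t \<in> I" for k t
    unfolding n_def using rational_chain[OF I(1) d Q0 Q] that by blast
  define b where "b = [:b0, b1:]"
  have "[:\<kappa> / 4:] * (b * n 5 + [:5 * b1:] * n 4 * d)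
     - (3 * b * (n 2 * n 2 + n 1 * n 3) + [:12 * b1:] * n 1 * n 2 * d + [:b1:] * n 0 * n 3 * d)
     = d^2 * (B * n 3 + 3 * pderiv B * n 2 * d + 3 * pderiv (pderiv B) * n 1 * d^2 + pderiv (pderiv (pderiv B)) * n 0 * d^3)
       - R * d^6" (is "?l = ?r")
  proof (rule poly_eq_on_open[OF I])
    fix t assume t: "t \<in> I"
    define e where "e = poly d t"
    have e: "e \<noteq> 0" using d t by (simp add: e_def)
    define u where "u k = poly (n k) t" for k
    have q: "Q 0 t = u 0 / e" "Q 1 t = u 1 / e^2" "Q 2 t = u 2 / e^3" "Q 3 t = u 3 / e^4" "Q 4 t = u 4 / e^5" "Q 5 t = u 5 / e^6"
      using Qk[OF _ t] by (simp_all add: u_def e_def eval_nat_numeral)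
    note o = ode[OF t, unfolded q]
    have "poly ?l t = e^6 * (\<kappa> / 4 * ((b0 + b1 * t) * (u 5 / e^6) + 5 * b1 * (u 4 / e^5))
      - (3 * (b0 + b1 * t) * (u 2 / e^3 * (u 2 / e^3) + u 1 / e^2 * (u 3 / e^4)) + 12 * b1 * (u 1 / e^2) * (u 2 / e^3) + b1 * (u 0 / e) * (u 3 / e^4)))"
      using e by (simp add: b_def u_def[symmetric] e_def[symmetric]) (simp add: field_simps eval_nat_numeral)
    also have "\<dots> = poly ?r t"
      unfolding o using e by (simp add: u_def[symmetric] e_def[symmetric]) (simp add: field_simps eval_nat_numeral)
    finally show "poly ?l t = poly ?r t" .
  qed
  from arg_cong[OF this, of "\<lambda>p. emb x (cpoly p)"]
  have eq: "fls_const (\<kappa> / 4) * (emb x (cpoly b) * emb x (cpoly (n 5)) + fls_const (5 * b1) * emb x (cpoly (n 4)) * emb x (cpoly d))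
     - (3 * emb x (cpoly b) * (emb x (cpoly (n 2)) * emb x (cpoly (n 2)) + emb x (cpoly (n 1)) * emb x (cpoly (n 3))) 
       + fls_const (12 * b1) * emb x (cpoly (n 1)) * emb x (cpoly (n 2)) * emb x (cpoly d) + fls_const b1 * emb x (cpoly (n 0)) * emb x (cpoly (n 3)) * emb x (cpoly d))
     = emb x (cpoly d)^2 * (emb x (cpoly B) * emb x (cpoly (n 3)) + 3 * D (emb x (cpoly B)) * emb x (cpoly (n 2)) * emb x (cpoly d) + 3 * D (D (emb x (cpoly B))) * emb x (cpoly (n 1)) * emb x (cpoly d)^2 + D (D (D (emb x (cpoly B)))) * emb x (cpoly (n 0)) * emb x (cpoly d)^3)
       - emb x (cpoly R) * emb x (cpoly d)^6"
    by (simp add: D_emb mult.assoc)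
  define e u where "e = emb x (cpoly d)" and "u k = emb x (cpoly (n k))" for k
  have e: "e \<noteq> 0" using dx by (simp add: e_def)
  define q where "q k = u k / e ^ Suc k" for k
  have Dq: "D (q k) = q (Suc k)" for k
    unfolding q_def u_def e_def n_def using D_numer[OF dx, of "cpoly N" k] by simp
  have Q0: "emb x (cpoly N) / emb x (cpoly d) = q 0"
    by (simp add: q_def u_def n_def e_def)
  have q: "q 0 = u 0 / e" "q 1 = u 1 / e^2" "q 2 = u 2 / e^3" "q 3 = u 3 / e^4" "q 4 = u 4 / e^5" "q 5 = u 5 / e^6"
    by (simp_all add: q_def eval_nat_numeral)
  have q': "D (q 0) = q 1" "D (q 1) = q 2" "D (q 2) = q 3" "D (q 3) = q 4" "D (q 4) = q 5"
    by (simp_all add: Dq eval_nat_numeral)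
  have b: "fls_const (of_real b0) + fls_const (of_real b1) * x = emb x (cpoly b)"
    by (simp add: b_def mult.commute)
  define K B0 B1 B2 B3 R0 bb c5 c12 c1 where z: "K = fls_const (complex_of_real \<kappa> / 4)" "B0 = emb x (cpoly B)" "B1 = D B0" "B2 = D B1" "B3 = D B2"
    "R0 = emb x (cpoly R)" "bb = emb x (cpoly b)" "c5 = fls_const (complex_of_real (5 * b1))" "c12 = fls_const (complex_of_real (12 * b1))" "c1 = fls_const (complex_of_real b1)"
  have eq': "K * (bb * u 5 + c5 * u 4 * e) - (3 * bb * (u 2 * u 2 + u 1 * u 3) + c12 * u 1 * u 2 * e + c1 * u 0 * u 3 * e)
    = e^2 * (B0 * u 3 + 3 * B1 * u 2 * e + 3 * B2 * u 1 * e^2 + B3 * u 0 * e^3) - R0 * e^6"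
    using eq unfolding z e_def u_def by simp
  have "K * (bb * q 5 + c5 * q 4) - (3 * bb * (q 2 * q 2 + q 1 * q 3) + c12 * q 1 * q 2 + c1 * q 0 * q 3)
    = (K * (bb * u 5 + c5 * u 4 * e) - (3 * bb * (u 2 * u 2 + u 1 * u 3) + c12 * u 1 * u 2 * e + c1 * u 0 * u 3 * e)) / e^6"
    unfolding q using e by (simp add: field_simps eval_nat_numeral)
  also have "\<dots> = B0 * q 3 + 3 * B1 * q 2 + 3 * B2 * q 1 + B3 * q 0 - R0"
    unfolding eq' q using e by (simp add: field_simps eval_nat_numeral)
  finally show ?thesis
    unfolding ode4_def Q0 b q' z by simp
qed

text \<open>The same passage as for \<open>ode4_transfer\<close>; the common denominator is now
  \<open>d ^ 5\<close>.\<close>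

lemma ode3_transfer:
  fixes N d B R :: "real poly" and Q :: "nat \<Rightarrow> real \<Rightarrow> real"
  assumes I: "open I" "I \<noteq> {}" and d: "\<And>t. t \<in> I \<Longrightarrow> poly d t \<noteq> 0"
    and Q0: "\<And>t. t \<in> I \<Longrightarrow> Q 0 t = poly N t / poly d t"
    and Q: "\<And>k t. k < 4 \<Longrightarrow> t \<in> I \<Longrightarrow> (Q k has_real_derivative Q (Suc k) t) (at t)"
    and ode: "\<And>t. t \<in> I \<Longrightarrow>
      \<kappa> / 4 * a * Q 4 t - 3 * a * (Q 1 t * Q 2 t)
      = poly B t * Q 2 t + 2 * poly (pderiv B) t * Q 1 t + poly (pderiv (pderiv B)) t * Q 0 t + poly R t"
    and D: "fls_derivation D x" and dx: "emb x (cpoly d) \<noteq> 0"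
  shows "ode3 D \<kappa> a (emb x (cpoly B)) (emb x (cpoly R)) (emb x (cpoly N) / emb x (cpoly d))"
proof -
  interpret fls_derivation D x by (rule D)
  define n where "n = numer N d"
  have Qk: "Q k t = poly (n k) t / poly d t ^ Suc k" if "k \<le> 4" "t \<in> I" for k t
    unfolding n_def using rational_chain[OF I(1) d Q0 Q] that by blast
  have "[:\<kappa> / 4 * a:] * n 4 - [:3 * a:] * (n 1 * n 2)
     = d^2 * (B * n 2 + 2 * pderiv B * n 1 * d + pderiv (pderiv B) * n 0 * d^2) + R * d^5" (is "?l = ?r")
  proof (rule poly_eq_on_open[OF I])
    fix t assume t: "t \<in> I"
    define e where "e = poly d t"
    have e: "e \<noteq> 0" using d t by (simp add: e_def)
    define u where "u k = poly (n k) t" for k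
    have q: "Q 0 t = u 0 / e" "Q 1 t = u 1 / e^2" "Q 2 t = u 2 / e^3" "Q 4 t = u 4 / e^5"
      using Qk[OF _ t] by (simp_all add: u_def e_def eval_nat_numeral)
    note o = ode[OF t, unfolded q]
    have "poly ?l t = e^5 * (\<kappa> / 4 * a * (u 4 / e^5) - 3 * a * (u 1 / e^2 * (u 2 / e^3)))"
      using e by (simp add: u_def[symmetric] e_def[symmetric]) (simp add: field_simps eval_nat_numeral)
    also have "\<dots> = poly ?r t"
      unfolding o using e by (simp add: u_def[symmetric] e_def[symmetric]) (simp add: field_simps eval_nat_numeral)
    finally show "poly ?l t = poly ?r t" .
  qed
  from arg_cong[OF this, of "\<lambda>p. emb x (cpoly p)"]
  have eq: "fls_const (\<kappa> / 4 * a) * emb x (cpoly (n 4)) - fls_const (3 * a) * (emb x (cpoly (n 1)) * emb x (cpoly (n 2)))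
     = emb x (cpoly d)^2 * (emb x (cpoly B) * emb x (cpoly (n 2)) + 2 * D (emb x (cpoly B)) * emb x (cpoly (n 1)) * emb x (cpoly d) + D (D (emb x (cpoly B))) * emb x (cpoly (n 0)) * emb x (cpoly d)^2)
       + emb x (cpoly R) * emb x (cpoly d)^5"
    by (simp add: D_emb mult.assoc)
  define e u where "e = emb x (cpoly d)" and "u k = emb x (cpoly (n k))" for k
  have e: "e \<noteq> 0" using dx by (simp add: e_def)
  define q where "q k = u k / e ^ Suc k" for k
  have Dq: "D (q k) = q (Suc k)" for k
    unfolding q_def u_def e_def n_def using D_numer[OF dx, of "cpoly N" k] by simp
  have Q0: "emb x (cpoly N) / emb x (cpoly d) = q 0"
    by (simp add: q_def u_def n_def e_def)
  have q: "q 0 = u 0 / e" "q 1 = u 1 / e^2" "q 2 = u 2 / e^3" "q 3 = u 3 / e^4" "q 4 = u 4 / e^5"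
    by (simp_all add: q_def eval_nat_numeral)
  have q': "D (q 0) = q 1" "D (q 1) = q 2" "D (q 2) = q 3" "D (q 3) = q 4"
    by (simp_all add: Dq eval_nat_numeral)
  define K B0 B1 B2 R0 c3 where z: "K = fls_const (complex_of_real \<kappa> / 4 * a)" "B0 = emb x (cpoly B)" "B1 = D B0" "B2 = D B1"
    "R0 = emb x (cpoly R)" "c3 = fls_const (complex_of_real (3 * a))"
  have eq': "K * u 4 - c3 * (u 1 * u 2)
    = e^2 * (B0 * u 2 + 2 * B1 * u 1 * e + B2 * u 0 * e^2) + R0 * e^5"
    using eq unfolding z e_def u_def by simp
  have "K * q 4 - c3 * (q 1 * q 2) = (K * u 4 - c3 * (u 1 * u 2)) / e^5"
    unfolding q using e by (simp add: field_simps eval_nat_numeral)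
  also have "\<dots> = B0 * q 2 + 2 * B1 * q 1 + B2 * q 0 + R0"
    unfolding eq' q using e by (simp add: field_simps eval_nat_numeral)
  finally show ?thesis
    unfolding ode3_def Q0 q' z by simp
qed

subsection \<open>Expansion at a pole and at infinity\<close>

definition at_pt :: "complex \<Rightarrow> complex fls" where "at_pt r = fls_const r + fls_X"

lemma fls_derivation_at: "fls_derivation fls_deriv (at_pt r)"
  by unfold_locales (auto simp: at_pt_def algebra_simps)

lemma fls_derivation_inf: "fls_derivation fls_deriv_inf fls_X_inv"
proof
  show "fls_deriv_inf fls_X_inv = 1"
    by (simp add: fls_deriv_inf_def fls_X_times_conv_shift(1) flip: power_mult_distrib)
qed (auto simp: fls_deriv_inf_def algebra_simps)

lemma emb_at: "emb (at_pt r) p = fps_to_fls (fps_of_poly (pcompose p [:r, 1:]))"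
proof (induction p)
  case (pCons a p)
  have "at_pt r = fps_to_fls (fps_of_poly [:r, 1:])"
    by (simp add: at_pt_def fps_of_poly_pCons)
  then have "emb (at_pt r) (pCons a p) = fls_const a + fps_to_fls (fps_of_poly [:r, 1:]) * fps_to_fls (fps_of_poly (pcompose p [:r, 1:]))"
    using pCons by simp
  then show ?case
    by (simp only: pcompose_pCons fps_of_poly_add fps_of_poly_mult fps_of_poly_const
        fls_times_fps_to_fls fps_to_fls_plus fps_const_to_fls)
qed simp

lemma emb_at_nth_neg: "k < 0 \<Longrightarrow> emb (at_pt r) p $$ k = 0"
  by (simp add: emb_at)

lemma emb_at_nth_0: "emb (at_pt r) p $$ 0 = poly p r"
  by (simp add: emb_at poly_0_coeff_0[symmetric] poly_pcompose)

lemma emb_at_nth_Suc: "of_nat (Suc k) * emb (at_pt r) p $$ int (Suc k) = emb (at_pt r) (pderiv p) $$ int k"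
proof -
  interpret fls_derivation fls_deriv "at_pt r" by (rule fls_derivation_at)
  have "emb (at_pt r) (pderiv p) $$ int k = fls_deriv (emb (at_pt r) p) $$ int k"
    by (simp add: D_emb)
  then show ?thesis by (simp add: add.commute)
qed

lemma emb_at_nth_1: "emb (at_pt r) p $$ 1 = poly (pderiv p) r"
  using emb_at_nth_Suc[of 0 r p] by (simp add: emb_at_nth_0)

lemma emb_at_nth_2: "emb (at_pt r) p $$ 2 = poly (pderiv (pderiv p)) r / 2"
  using emb_at_nth_Suc[of 1 r p] by (simp add: emb_at_nth_1 mult.commute eq_divide_eq)

lemma emb_at_nth_3: "emb (at_pt r) p $$ 3 = poly (pderiv (pderiv (pderiv p))) r / 6"
  using emb_at_nth_Suc[of 2 r p] by (simp add: emb_at_nth_2 field_simps)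

lemma emb_at_nth_degree: "degree p < k \<Longrightarrow> emb (at_pt r) p $$ int k = 0"
  by (simp add: emb_at coeff_eq_0 degree_pcompose)

lemma lead_emb_at: "lead (emb (at_pt r) p) 0 (poly p r)"
  by (simp add: lead_def emb_at_nth_neg emb_at_nth_0)

lemma emb_at_linear: "emb (at_pt r) [:-r, 1:] = fls_X"
  by (simp add: at_pt_def)

lemma lead_emb_at_order:
  assumes "p \<noteq> 0"
  shows "\<exists>c. c \<noteq> 0 \<and> lead (emb (at_pt r) p) (int (order r p)) c"
proof -
  obtain p' where p': "p = [:-r, 1:] ^ order r p * p'" "\<not> [:-r, 1:] dvd p'"
    using order_decomp[OF assms] by blast
  have X: "lead (fls_X ^ order r p) (int (order r p)) 1"
    by (auto simp: lead_def)
  have "lead (fls_X ^ order r p * emb (at_pt r) p') (int (order r p)) (1 * poly p' r)"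
    by (rule lead_mult[OF X lead_emb_at]) simp
  moreover have "emb (at_pt r) p = fls_X ^ order r p * emb (at_pt r) p'"
    by (subst p'(1)) (simp only: emb_mult emb_power emb_at_linear)
  moreover have "poly p' r \<noteq> 0" using p'(2) by (simp add: poly_eq_0_iff_dvd)
  ultimately show ?thesis by auto
qed

lemma emb_at_nonzero: "p \<noteq> 0 \<Longrightarrow> emb (at_pt r) p \<noteq> 0"
  using lead_emb_at_order[of p r] by (auto simp: lead_def)

text \<open>As c may be 0, the true order of the quotient is not known in advance. It is recovered
  by multiplying back with g, whose leading coefficient is non-zero.\<close>

lemma lead_divide:
  assumes f: "lead f m c" and g: "lead g n d" "d \<noteq> 0" and k: "k = m - n"
  shows "lead (f / g) k (c / d)"
proof (cases "f = 0")
  case True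
  then show ?thesis using f by (auto simp: lead_def)
next
  case False
  have g0: "g \<noteq> 0" using g by (auto simp: lead_def)
  then have q0: "f / g \<noteq> 0" using False by simp
  define s e where "s = fls_subdegree (f / g)" and "e = (f / g) $$ s"
  have e: "lead (f / g) s e" "e \<noteq> 0"
    unfolding s_def e_def using lead_exists[OF q0] by auto
  have "lead (f / g * g) (s + n) (e * d)" by (rule lead_mult[OF e(1) g(1)]) simp
  then have fs: "lead f (s + n) (e * d)" using g0 by simp
  have "s + n \<ge> m"
  proof (rule ccontr)
    assume "\<not> s + n \<ge> m"
    then have "f $$ (s + n) = 0" using f by (simp add: lead_def)
    then show False using fs e(2) g(2) by (simp add: lead_def)
  qed
  show ?thesis
  proof (cases "s + n = m")
    case True
    then have "c = e * d" using f fs by (auto simp: lead_def)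
    then show ?thesis using e g True k by auto
  next
    case False
    then have "m < s + n" using \<open>s + n \<ge> m\<close> by simp
    then have "c = 0" using f fs by (auto simp: lead_def)
    then show ?thesis using lead_weaken[OF e(1), of k] k \<open>m < s + n\<close> by simp
  qed
qed

lemma lead_emb_inf: "degree p \<le> n \<Longrightarrow> lead (emb fls_X_inv p) (- int n) (coeff p n)"
proof (induction p arbitrary: n)
  case 0
  then show ?case by (simp add: lead_def)
next
  case (pCons a p)
  have X: "lead (fls_X_inv :: complex fls) (-1) 1" by (auto simp: lead_def)
  show ?case
  proof (cases n)
    case 0
    then have "p = 0" using pCons.prems by (auto split: if_splits)
    then show ?thesis using 0 lead_const[of a] by simp
  next
    case (Suc m)
    have "degree p \<le> m" using pCons.prems Suc by (auto split: if_splits)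
    from lead_mult[OF X pCons.IH[OF this], of "- int n"]
    have "lead (fls_X_inv * emb fls_X_inv p) (- int n) (1 * coeff p m)" using Suc by simp
    moreover have "lead (fls_const a) (- int n) 0"
      by (rule lead_weaken[OF lead_const]) (use Suc in simp)
    ultimately show ?thesis
      using lead_add[of "fls_const a" "- int n" 0] Suc by simp
  qed
qed

subsection \<open>Rational functions and their residues\<close>

abbreviation pole_at :: "real poly \<Rightarrow> complex \<Rightarrow> bool" where
  "pole_at d r \<equiv> poly (cpoly d) r = 0"

definition resid :: "real poly \<Rightarrow> real poly \<Rightarrow> complex \<Rightarrow> complex" where
  "resid N d r = poly (cpoly N) r / poly (pderiv (cpoly d)) r"

definition expand :: "real poly \<Rightarrow> real poly \<Rightarrow> complex \<Rightarrow> complex fls" where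
  "expand N d r = emb (at_pt r) (cpoly N) / emb (at_pt r) (cpoly d)"

text \<open>Coprimality, stated by a Bezout identity because this passes to complex coefficients and
  excludes common complex roots at once.\<close>

definition bezout :: "real poly \<Rightarrow> real poly \<Rightarrow> bool" where
  "bezout p q \<longleftrightarrow> (\<exists>u v. u * p + v * q = 1)"

lemma bezout_no_common_root:
  assumes "bezout N d" "pole_at d r"
  shows "poly (cpoly N) r \<noteq> 0"
proof
  assume N: "poly (cpoly N) r = 0"
  obtain u v where "u * N + v * d = 1"
    using assms(1) by (auto simp: bezout_def)
  from arg_cong[OF this, of "\<lambda>p. poly (cpoly p) r"] show False
    using N assms(2) by simp
qed

text \<open>Coprimality keeps the numerator away from 0, so the pole order is the multiplicity of
  the root of d. For a simple root the leading coefficient of d is its derivative, whence the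
  formula in \<open>resid\<close>.\<close>

lemma lead_expand:
  assumes "bezout N d" "d \<noteq> 0" "pole_at d r"
  shows "\<exists>\<mu> q. \<mu> \<ge> 1 \<and> q \<noteq> 0 \<and> lead (expand N d r) (-\<mu>) q
    \<and> (\<mu> = 1 \<longrightarrow> poly (pderiv (cpoly d)) r \<noteq> 0 \<and> q = resid N d r)"
proof -
  have N: "poly (cpoly N) r \<noteq> 0" by (rule bezout_no_common_root) fact+
  obtain c where c: "c \<noteq> 0" "lead (emb (at_pt r) (cpoly d)) (int (order r (cpoly d))) c"
    using lead_emb_at_order[of "cpoly d" r] assms by auto
  have l: "lead (expand N d r) (- int (order r (cpoly d))) (poly (cpoly N) r / c)"
    unfolding expand_def by (rule lead_divide[OF lead_emb_at c(2,1)]) simp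
  have "order r (cpoly d) \<noteq> 0" using assms by (simp add: order_root)
  moreover have "c = poly (pderiv (cpoly d)) r" if "int (order r (cpoly d)) = 1"
    using c(2) that emb_at_nth_1[of r "cpoly d"] by (simp add: lead_def)
  ultimately show ?thesis
    using l N c(1) by (intro exI[of _ "int (order r (cpoly d))"] exI[of _ "poly (cpoly N) r / c"])
      (auto simp: resid_def)
qed

lemma fls_X_plus_const_inverse_nth:
  fixes \<rho> :: complex
  assumes "\<rho> \<noteq> 0"
  shows "(1 / (fls_const \<rho> + fls_X)) $$ int k = (-1) ^ k / \<rho> ^ Suc k"
proof -
  define F where "F = Abs_fps (\<lambda>k. (-1) ^ k / \<rho> ^ Suc k)"
  have "(fps_const \<rho> + fps_X) * F = 1"
  proof (rule fps_ext)
    fix n show "((fps_const \<rho> + fps_X) * F) $ n = 1 $ n"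
      using assms by (cases n) (auto simp: F_def distrib_right field_simps)
  qed
  then have "fps_to_fls (fps_const \<rho> + fps_X) * fps_to_fls F = 1"
    by (metis fls_times_fps_to_fls fps_one_to_fls)
  then have "(fls_const \<rho> + fls_X) * fps_to_fls F = 1" by simp
  then have "1 / (fls_const \<rho> + fls_X) = fps_to_fls F"
    by (metis divide_eq_eq mult_zero_left zero_neq_one mult.commute)
  then show ?thesis by (simp add: F_def)
qed

lemma poly_pderiv_at_root:
  fixes p :: "'a::field poly"
  shows "poly (pderiv ([:-r, 1:] * p)) r = poly p r"
  by (simp add: pderiv_mult pderiv_pCons del: mult_pCons_left)

text \<open>Partial fractions over the complex numbers: each other pole contributes a geometric
  series in t - r, while the pole r itself contributes only at the index -1 and thus nothing at k
  \<ge> 0.\<close>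

lemma expand_nth:
  assumes d: "d \<noteq> 0" "lead_coeff d = 1" and sq: "\<And>s. pole_at d s \<Longrightarrow> poly (pderiv (cpoly d)) s \<noteq> 0"
    and r: "pole_at d r"
  shows "expand N d r $$ int k = emb (at_pt r) (cpoly (N div d)) $$ int k
     + (\<Sum>s\<in>{s. pole_at d s} - {r}. resid N d s * (-1) ^ k / (r - s) ^ Suc k)"
proof -
  define Z where "Z = {s. pole_at d s}"
  have fin: "finite Z" unfolding Z_def by (rule poly_roots_finite) (use d in simp)
  define dd where "dd s = (\<Prod>t\<in>Z - {s}. [:-t, 1:])" for s
  have "rsquarefree (cpoly d)"
    using sq d by (auto simp: rsquarefree_roots)
  from complex_poly_decompose_rsquarefree[OF this]
  have dec: "cpoly d = (\<Prod>t\<in>Z. [:-t, 1:])"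
    using d by (simp add: Z_def coeff_map_poly)
  have d_dd: "cpoly d = [:-s, 1:] * dd s" if "s \<in> Z" for s
    unfolding dec dd_def by (rule prod.remove) (use fin that in auto)
  have dds: "poly (dd s) s = poly (pderiv (cpoly d)) s" if "s \<in> Z" for s
    unfolding d_dd[OF that] by (rule poly_pderiv_at_root[symmetric])
  have ddt: "poly (dd s) t = 0" if "t \<in> Z" "s \<noteq> t" for s t
    unfolding dd_def poly_prod using that fin by (auto intro!: prod_zero)
  \<comment> \<open>Lagrange interpolation of N at the roots of d. Its degree is below that of d, so
    it must be the remainder N mod d.\<close>
  define M where "M = (\<Sum>s\<in>Z. smult (resid N d s) (dd s))"
  have degd: "degree (cpoly d) = card Z"
    unfolding dec by (subst degree_prod_eq_sum_degree) auto
  have Mt: "poly M t = poly (cpoly N) t" if t: "t \<in> Z" for t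
  proof -
    have "poly M t = (\<Sum>s\<in>Z. if s = t then resid N d t * poly (dd t) t else 0)"
      unfolding M_def poly_sum by (rule sum.cong) (use ddt t in auto)
    also have "\<dots> = resid N d t * poly (dd t) t"
      using fin t by simp
    also have "\<dots> = poly (cpoly N) t"
      using sq t by (simp add: dds resid_def Z_def)
    finally show ?thesis .
  qed
  have "M = cpoly (N mod d)"
  proof (cases "card Z = 0")
    case True
    then have "degree d = 0" using degd by simp
    then have "N mod d = 0" using d(1) by (meson is_unit_iff_degree mod_eq_0_iff_dvd unit_imp_dvd)
    moreover have "Z = {}" using True fin by simp
    ultimately show ?thesis by (simp add: M_def)
  next
    case False
    show ?thesis
    proof (rule poly_eqI_degree[of Z])
      fix t assume t: "t \<in> Z"
      have "cpoly N = cpoly (N div d) * cpoly d + cpoly (N mod d)"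
        by (metis cpoly_add cpoly_mult div_mult_mod_eq)
      then have "poly (cpoly N) t = poly (cpoly (N mod d)) t"
        using t by (simp add: Z_def)
      then show "poly M t = poly (cpoly (N mod d)) t" using Mt[OF t] by simp
    next
      have "degree (dd s) < card Z" if "s \<in> Z" for s
      proof -
        have "dd s \<noteq> 0" unfolding dd_def using fin by simp
        then show ?thesis
        using d_dd[OF that] degd degree_mult_eq[of "[:-s,1:]" "dd s"] by simp
      qed
      then show "degree M < card Z"
        unfolding M_def using False by (intro degree_sum_less) (auto intro: le_less_trans[OF degree_smult_le])
      show "degree (cpoly (N mod d)) < card Z"
        using degree_mod_less'[of d N] d False degd by (cases "N mod d = 0") auto
    qed
  qed
  then have N: "cpoly N = cpoly (N div d) * cpoly d + (\<Sum>s\<in>Z. smult (resid N d s) (dd s))"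
    by (metis M_def cpoly_add cpoly_mult div_mult_mod_eq)
  define E where "E = emb (at_pt r)"
  have Ed: "E (cpoly d) \<noteq> 0" unfolding E_def by (rule emb_at_nonzero) (use d in simp)
  have Esum: "E (\<Sum>s\<in>A. f s) = (\<Sum>s\<in>A. E (f s))" if "finite A" for A :: "complex set" and f
    using that by induction (auto simp: E_def)
  have q: "E (dd s) / E (cpoly d) = 1 / (fls_const (r - s) + fls_X)" if "s \<in> Z" for s
  proof -
    have "E (cpoly d) = (fls_const (r - s) + fls_X) * E (dd s)"
      unfolding d_dd[OF that] by (simp add: E_def at_pt_def algebra_simps flip: fls_minus_const)
    then show ?thesis using Ed by auto
  qed
  have "expand N d r = E (cpoly (N div d)) + (\<Sum>s\<in>Z. fls_const (resid N d s) * (E (dd s) / E (cpoly d)))"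
    unfolding expand_def E_def[symmetric]
    by (subst N) (use Ed fin in \<open>simp add: Esum[unfolded E_def] add_divide_distrib sum_divide_distrib E_def\<close>)
  also have "(\<Sum>s\<in>Z. fls_const (resid N d s) * (E (dd s) / E (cpoly d)))
     = (\<Sum>s\<in>Z. fls_const (resid N d s) * (1 / (fls_const (r - s) + fls_X)))"
    by (rule sum.cong) (simp_all add: q)
  also have "\<dots> = fls_const (resid N d r) * (1 / fls_X) + (\<Sum>s\<in>Z-{r}. fls_const (resid N d s) * (1 / (fls_const (r - s) + fls_X)))"
    using fin r by (subst sum.remove[of Z r]) (auto simp: Z_def)
  finally have ex: "expand N d r = E (cpoly (N div d)) + (fls_const (resid N d r) * (1 / fls_X)
     + (\<Sum>s\<in>Z-{r}. fls_const (resid N d s) * (1 / (fls_const (r - s) + fls_X))))" .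
  have "(1 / fls_X :: complex fls) = fls_X_inv"
    by (simp add: fls_inverse_X fls_X_inv_conv_shift_1 inverse_eq_divide[symmetric])
  moreover have "(\<Sum>s\<in>Z-{r}. resid N d s * (1 / (fls_const (r - s) + fls_X)) $$ int k)
     = (\<Sum>s\<in>Z-{r}. resid N d s * (-1) ^ k / (r - s) ^ Suc k)"
  proof (rule sum.cong)
    fix s assume "s \<in> Z - {r}"
    then have "r - s \<noteq> 0" by auto
    then show "resid N d s * (1 / (fls_const (r - s) + fls_X)) $$ int k = resid N d s * (-1) ^ k / (r - s) ^ Suc k"
      by (subst fls_X_plus_const_inverse_nth) simp_all
  qed simp
  ultimately show ?thesis
    unfolding ex fls_plus_nth fls_nth_sum fls_mult_const_nth E_def Z_def[symmetric] by simp
qed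

section \<open>Reduced fractions on an open set\<close>

lemma continuous_eq_off_finite:
  fixes f g :: "real \<Rightarrow> real"
  assumes I: "open I" and fin: "finite F" and fg: "continuous_on I f" "continuous_on I g"
    and eq: "\<And>t. t \<in> I - F \<Longrightarrow> f t = g t" and t: "t \<in> I"
  shows "f t = g t"
proof (rule ccontr)
  assume ne: "f t \<noteq> g t"
  have "open (I \<inter> (\<lambda>t. f t - g t) -` (- {0}))"
    using fg I by (intro continuous_open_preimage continuous_intros) auto
  moreover have "I \<inter> (\<lambda>t. f t - g t) -` (- {0}) \<subseteq> F"
    using eq by auto
  moreover have "t \<in> I \<inter> (\<lambda>t. f t - g t) -` (- {0})"
    using ne t by auto
  ultimately show False
    using fin finite_imp_not_open finite_subset by (metis empty_iff)
qed

text \<open>At the roots of g the hypothesis is void; these are finitely many points, and continuity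
  fills them in.\<close>

lemma poly_cancel_on_open:
  fixes g p q :: "real poly" and Q :: "real \<Rightarrow> real"
  assumes "open I" "g \<noteq> 0" "continuous_on I Q" "\<And>t. t \<in> I \<Longrightarrow> poly (g * p) t * Q t = poly (g * q) t" "t \<in> I"
  shows "poly p t * Q t = poly q t"
proof (rule continuous_eq_off_finite[where I = I and F = "{t. poly g t = 0}"
      and f = "\<lambda>t. poly p t * Q t" and g = "poly q"])
  show "finite {t. poly g t = 0}" by (rule poly_roots_finite) fact
  show "poly p t * Q t = poly q t" if "t \<in> I - {t. poly g t = 0}" for t
    using assms(4)[of t] that by simp
qed (use assms in \<open>auto intro!: continuous_intros\<close>)

text \<open>The denominator is chosen of least degree among all denominators.\<close>

lemma reduced_fraction:
  fixes P S :: "real poly" and Q :: "real \<Rightarrow> real"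
  assumes I: "open I" "I \<noteq> {}" and Q: "continuous_on I Q" and P: "P \<noteq> 0"
    and PQ: "\<And>t. t \<in> I \<Longrightarrow> poly P t * Q t = poly S t"
  obtains N d where "lead_coeff d = 1" "bezout N d"
    "\<And>t. t \<in> I \<Longrightarrow> poly d t \<noteq> 0 \<and> Q t = poly N t / poly d t"
    "\<And>p q. (\<And>t. t \<in> I \<Longrightarrow> poly p t * Q t = poly q t) \<Longrightarrow> d dvd p"
proof -
  define den where "den p \<longleftrightarrow> p \<noteq> 0 \<and> (\<exists>q. \<forall>t\<in>I. poly p t * Q t = poly q t)" for p
  have "den P" using P PQ by (auto simp: den_def)
  then obtain d1 where d1: "den d1" "\<And>p. den p \<Longrightarrow> degree d1 \<le> degree p"
    using ex_has_least_nat[of den P degree] by blast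
  define d where "d = smult (1 / lead_coeff d1) d1"
  have d10: "d1 \<noteq> 0" using d1 by (simp add: den_def)
  then have d: "lead_coeff d = 1" "degree d = degree d1" "d \<noteq> 0"
    by (simp_all add: d_def)
  have "den d"
  proof -
    obtain q where "\<forall>t\<in>I. poly d1 t * Q t = poly q t" using d1(1) by (auto simp: den_def)
    then have "\<forall>t\<in>I. poly d t * Q t = poly (smult (1 / lead_coeff d1) q) t"
      by (auto simp: d_def field_simps)
    then show ?thesis unfolding den_def using d(3) by blast
  qed
  then obtain N where N: "\<And>t. t \<in> I \<Longrightarrow> poly d t * Q t = poly N t" by (auto simp: den_def)
  have min: "\<not> den p" if "degree p < degree d" for p
    using d1(2)[of p] that d(2) by auto
  have dvd: "d dvd p" if p: "\<And>t. t \<in> I \<Longrightarrow> poly p t * Q t = poly q t" for p q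
  proof (rule ccontr)
    assume "\<not> d dvd p"
    then have r: "p mod d \<noteq> 0" by (simp add: mod_eq_0_iff_dvd)
    have "poly (p mod d) t * Q t = poly (q - (p div d) * N) t" if "t \<in> I" for t
    proof -
      have "poly p t = poly (p div d) t * poly d t + poly (p mod d) t"
        by (metis div_mult_mod_eq poly_add poly_mult)
      then have "poly (p mod d) t * Q t = poly p t * Q t - poly (p div d) t * (poly d t * Q t)"
        by (simp add: algebra_simps)
      then show ?thesis using p[OF that] N[OF that] by simp
    qed
    then have "den (p mod d)" using r unfolding den_def by blast
    then show False using min degree_mod_less'[OF d(3) r] by blast
  qed
  have bez: "bezout N d"
  proof -
    \<comment> \<open>Non-zero elements of the ideal generated by N and d. One of least degree
      divides both, and it must be constant: otherwise it could be cancelled from the fraction,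
      giving a smaller denominator than d.\<close>
    define J where "J p \<longleftrightarrow> p \<noteq> 0 \<and> (\<exists>u v. p = u * N + v * d)" for p
    have "J d" unfolding J_def using d(3) by (metis add_0 mult_1 mult_zero_left)
    then obtain g where g: "J g" "\<And>p. J p \<Longrightarrow> degree g \<le> degree p"
      using ex_has_least_nat[of J d degree] by blast
    then obtain u v where uv: "g = u * N + v * d" and g0: "g \<noteq> 0" by (auto simp: J_def)
    have gd: "g dvd w" if "w = a * N + b * d" for w a b
    proof (rule ccontr)
      assume "\<not> g dvd w"
      then have r: "w mod g \<noteq> 0" by (simp add: mod_eq_0_iff_dvd)
      define k where "k = w div g"
      have "w mod g = w - k * g" by (simp add: minus_div_mult_eq_mod k_def)
      also have "\<dots> = (a * N + b * d) - k * (u * N + v * d)"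
        by (simp only: uv[symmetric] that(1)[symmetric])
      also have "\<dots> = (a - k * u) * N + (b - k * v) * d"
        by (simp add: algebra_simps)
      finally have "J (w mod g)" using r unfolding J_def by blast
      then show False using g(2) degree_mod_less'[OF g0 r] by force
    qed
    obtain N' d' where N': "N = g * N'" and d': "d = g * d'"
      using gd[of N 1 0] gd[of d 0 1] by (auto elim!: dvdE)
    have "den d'"
      unfolding den_def using d' d(3) poly_cancel_on_open[OF I(1) g0 Q, of d' N'] N N' by auto
    then have "degree d \<le> degree d'" using min not_le by blast
    then have "degree g = 0" using d' d(3) by (auto simp: degree_mult_eq)
    then obtain c where c: "g = [:c:]" "c \<noteq> 0" using g0 by (metis degree_eq_zeroE pCons_0_0)
    have "smult (1/c) u * N + smult (1/c) v * d = smult (1/c) g"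
      unfolding uv by (simp add: smult_add_right)
    also have "\<dots> = 1" using c by (simp add: one_pCons)
    finally show ?thesis unfolding bezout_def by blast
  qed
  have "poly d t \<noteq> 0" if "t \<in> I" for t
  proof
    assume z: "poly d t = 0"
    then have "poly N t = 0" using N[OF that] by simp
    obtain u v where "u * N + v * d = 1" using bez by (auto simp: bezout_def)
    from arg_cong[OF this, of "\<lambda>p. poly p t"] show False using z \<open>poly N t = 0\<close> by simp
  qed
  with N have Qt: "poly d t \<noteq> 0 \<and> Q t = poly N t / poly d t" if "t \<in> I" for t
    using that by (metis nonzero_mult_div_cancel_left)
  show thesis
    by (rule that[OF d(1) bez Qt dvd])
qed

subsection \<open>Poles of rational solutions\<close>

definition derivs_on :: "nat \<Rightarrow> real set \<Rightarrow> (nat \<Rightarrow> real \<Rightarrow> real) \<Rightarrow> bool" where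
  "derivs_on m I Q \<longleftrightarrow> (\<forall>k<m. \<forall>t\<in>I. (Q k has_real_derivative Q (Suc k) t) (at t))"

definition reduced_on :: "real set \<Rightarrow> (real \<Rightarrow> real) \<Rightarrow> real poly \<Rightarrow> real poly \<Rightarrow> bool" where
  "reduced_on I Q N d \<longleftrightarrow> lead_coeff d = 1 \<and> bezout N d \<and> (\<forall>t\<in>I. poly d t \<noteq> 0 \<and> Q t = poly N t / poly d t)"

definition ode4_on ::
  "real set \<Rightarrow> real \<Rightarrow> real \<Rightarrow> real \<Rightarrow> real poly \<Rightarrow> real poly \<Rightarrow> (nat \<Rightarrow> real \<Rightarrow> real) \<Rightarrow> bool" where
  "ode4_on I \<kappa> b0 b1 B R Q \<longleftrightarrow> (\<forall>t\<in>I.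
      \<kappa> / 4 * ((b0 + b1 * t) * Q 5 t + 5 * b1 * Q 4 t)
      - (3 * (b0 + b1 * t) * (Q 2 t * Q 2 t + Q 1 t * Q 3 t) + 12 * b1 * Q 1 t * Q 2 t + b1 * Q 0 t * Q 3 t)
      = poly B t * Q 3 t + 3 * poly (pderiv B) t * Q 2 t + 3 * poly (pderiv (pderiv B)) t * Q 1 t
        + poly (pderiv (pderiv (pderiv B))) t * Q 0 t - poly R t)"

definition ode3_on ::
  "real set \<Rightarrow> real \<Rightarrow> real \<Rightarrow> real poly \<Rightarrow> real poly \<Rightarrow> (nat \<Rightarrow> real \<Rightarrow> real) \<Rightarrow> bool" where
  "ode3_on I \<kappa> a B R Q \<longleftrightarrow> (\<forall>t\<in>I.
      \<kappa> / 4 * a * Q 4 t - 3 * a * (Q 1 t * Q 2 t)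
      = poly B t * Q 2 t + 2 * poly (pderiv B) t * Q 1 t + poly (pderiv (pderiv B)) t * Q 0 t + poly R t)"

lemma ode4_expand:
  assumes "open I" "I \<noteq> {}" "reduced_on I (Q 0) N d" "derivs_on 5 I Q" "ode4_on I \<kappa> b0 b1 B R Q"
  shows "ode4 fls_deriv \<kappa> (fls_const (b0 + b1 * r) + fls_const (of_real b1) * fls_X) b1
      (emb (at_pt r) (cpoly B)) (emb (at_pt r) (cpoly R)) (expand N d r)"
proof -
  have "d \<noteq> 0" using assms(3) by (auto simp: reduced_on_def)
  then have "ode4 fls_deriv \<kappa> (fls_const (of_real b0) + fls_const (of_real b1) * at_pt r) b1
      (emb (at_pt r) (cpoly B)) (emb (at_pt r) (cpoly R)) (expand N d r)"
    unfolding expand_def using assms unfolding reduced_on_def derivs_on_def ode4_on_def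
    by (intro ode4_transfer[where Q = Q and I = I] fls_derivation_at emb_at_nonzero) auto
  also have "fls_const (of_real b0) + fls_const (of_real b1) * at_pt r
      = fls_const (b0 + b1 * r) + fls_const (of_real b1) * fls_X"
    by (simp add: at_pt_def algebra_simps flip: fls_plus_const)
  finally show ?thesis .
qed

text \<open>The value of b0 + b1 t at the pole decides whether the generic or the special local
  analysis applies. Simplicity and the vanishing coefficient at 2 hold in both cases; the residue is
  prescribed only in the first.\<close>

lemma ode4_poles:
  assumes I: "open I" "I \<noteq> {}" and Q: "reduced_on I (Q 0) N d" "derivs_on 5 I Q" "ode4_on I \<kappa> b0 b1 B R Q"
    and b: "b0 \<noteq> 0 \<or> b1 \<noteq> 0" and r: "pole_at d r"
  shows "poly (pderiv (cpoly d)) r \<noteq> 0" "expand N d r $$ 2 = 0"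
    "of_real b0 + of_real b1 * r \<noteq> 0 \<Longrightarrow> resid N d r = - of_real \<kappa>"
    "of_real b0 + of_real b1 * r = 0 \<Longrightarrow> poly (cpoly B) r = - of_real b1 * expand N d r $$ 0"
    "of_real b0 + of_real b1 * r = 0 \<Longrightarrow> degree B \<le> 3 \<Longrightarrow>
      30 * of_real b1 * expand N d r $$ 4 * (of_real \<kappa> + resid N d r)
      = 3 * poly (cpoly (pderiv (pderiv B))) r * expand N d r $$ 1
        + poly (cpoly (pderiv (pderiv (pderiv B)))) r * expand N d r $$ 0 - poly (cpoly R) r"
proof -
  note ode = ode4_expand[OF I Q, of r]
  have bd: "bezout N d" "d \<noteq> 0" using Q(1) by (auto simp: reduced_on_def)
  obtain \<mu> q where l: "\<mu> \<ge> 1" "q \<noteq> 0" "lead (expand N d r) (-\<mu>) q"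
    "\<mu> = 1 \<Longrightarrow> poly (pderiv (cpoly d)) r \<noteq> 0 \<and> q = resid N d r"
    using lead_expand[OF bd r] by blast
  note BR = lead_emb_at[of r "cpoly B"] lead_emb_at[of r "cpoly R"]
  have "\<mu> = 1 \<and> (of_real b0 + of_real b1 * r \<noteq> 0 \<longrightarrow> q = - of_real \<kappa>)"
  proof (cases "of_real b0 + of_real b1 * r = 0")
    case True
    then have "b1 \<noteq> 0" using b by auto
    then show ?thesis
      using ode4_pole_special[OF l(3,2,1) _ BR, of "of_real b1" "of_real \<kappa>"] ode True by simp
  next
    case False
    then show ?thesis using ode4_pole_generic[OF l(3,2,1) False BR ode] by simp
  qed
  then have \<mu>: "\<mu> = 1" and q: "of_real b0 + of_real b1 * r \<noteq> 0 \<Longrightarrow> q = - of_real \<kappa>" by auto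
  have dq: "poly (pderiv (cpoly d)) r \<noteq> 0" "q = resid N d r" using l(4) \<mu> by auto
  show "poly (pderiv (cpoly d)) r \<noteq> 0" by fact
  show "of_real b0 + of_real b1 * r \<noteq> 0 \<Longrightarrow> resid N d r = - of_real \<kappa>" using q dq by simp
  have b': "of_real b0 + of_real b1 * r \<noteq> 0 \<or> complex_of_real b1 \<noteq> 0" using b by auto
  have l1: "lead (expand N d r) (-1) q" using l \<mu> by simp
  note s = ode4_simple_pole[OF l1 l(2) b' BR ode]
  show "expand N d r $$ 2 = 0" by (rule s)
  show "of_real b0 + of_real b1 * r = 0 \<Longrightarrow> poly (cpoly B) r = - of_real b1 * expand N d r $$ 0"
    using s(2) by (simp add: emb_at_nth_0)
  show "30 * of_real b1 * expand N d r $$ 4 * (of_real \<kappa> + resid N d r)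
      = 3 * poly (cpoly (pderiv (pderiv B))) r * expand N d r $$ 1
        + poly (cpoly (pderiv (pderiv (pderiv B)))) r * expand N d r $$ 0 - poly (cpoly R) r"
    if "of_real b0 + of_real b1 * r = 0" "degree B \<le> 3"
    using s(3)[OF that(1)] emb_at_nth_degree[of "cpoly B" 4 r] that(2)
    by (simp add: emb_at_nth_2 emb_at_nth_3 dq(2))
qed

lemma lead_emb_frac_inf:
  assumes "N \<noteq> 0" "lead_coeff d = 1"
  shows "lead (emb fls_X_inv (cpoly N) / emb fls_X_inv (cpoly d)) (- (int (degree N) - int (degree d))) (of_real (lead_coeff N))"
    and "emb fls_X_inv (cpoly d) \<noteq> 0"
proof -
  have d: "lead (emb fls_X_inv (cpoly d)) (- int (degree d)) 1"
    using lead_emb_inf[of "cpoly d" "degree d"] assms by (simp add: coeff_map_poly)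
  then show "emb fls_X_inv (cpoly d) \<noteq> 0" by (auto simp: lead_def)
  have "lead (emb fls_X_inv (cpoly N)) (- int (degree N)) (of_real (lead_coeff N))"
    using lead_emb_inf[of "cpoly N" "degree N"] by (simp add: coeff_map_poly)
  from lead_divide[OF this d] show "lead (emb fls_X_inv (cpoly N) / emb fls_X_inv (cpoly d))
      (- (int (degree N) - int (degree d))) (of_real (lead_coeff N))" by simp
qed

lemma lead_emb_inf_poly: "degree p \<le> n \<Longrightarrow> lead (emb fls_X_inv (cpoly p)) (- int n) (of_real (coeff p n))"
  using lead_emb_inf[of "cpoly p" n] by (simp add: coeff_map_poly)

text \<open>The number e is the degree of b0 + b1 t. The bounds on B and R have to grow with it,
  since at infinity they compete with the quadratic terms multiplied by b0 + b1 t.\<close>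

lemma ode4_degree:
  assumes I: "open I" "I \<noteq> {}" and Q: "reduced_on I (Q 0) N d" "derivs_on 5 I Q" "ode4_on I \<kappa> b0 b1 B R Q"
    and b: "b1 \<noteq> 0 \<and> e = 1 \<or> b1 = 0 \<and> b0 \<noteq> 0 \<and> e = 0" and BR: "degree B \<le> 2 + e" "degree R \<le> 2 + e"
  shows "degree N \<le> degree d + 3"
proof (rule ccontr)
  assume deg: "\<not> degree N \<le> degree d + 3"
  then have "N \<noteq> 0" by auto
  have d: "lead_coeff d = 1" using Q(1) by (simp add: reduced_on_def)
  note l = lead_emb_frac_inf[OF \<open>N \<noteq> 0\<close> d]
  have "ode4 fls_deriv_inf \<kappa> (fls_const (of_real b0) + fls_const (of_real b1) * fls_X_inv) b1
      (emb fls_X_inv (cpoly B)) (emb fls_X_inv (cpoly R)) (emb fls_X_inv (cpoly N) / emb fls_X_inv (cpoly d))"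
    using I Q l(2) unfolding reduced_on_def derivs_on_def ode4_on_def
    by (intro ode4_transfer[where Q = Q and I = I] fls_derivation_inf) auto
  moreover have b1: "lead (fls_const (of_real b0) + fls_const (of_real b1) * fls_X_inv) (- int e) (of_real (if e = 1 then b1 else b0))"
    using b lead_linear_inf[of "of_real b0" "of_real b1"] lead_const by auto
  moreover have e2: "- int (2 + e) = -2 - int e" by simp
  moreover have BR': "lead (emb fls_X_inv (cpoly B)) (-2 - int e) (of_real (coeff B (2 + e)))"
    "lead (emb fls_X_inv (cpoly R)) (-2 - int e) (of_real (coeff R (2 + e)))"
    using lead_emb_inf_poly[OF BR(1)] lead_emb_inf_poly[OF BR(2)] e2 by simp_all
  moreover have "complex_of_real (lead_coeff N) \<noteq> 0" "int (degree N) - int (degree d) \<ge> 4"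
    using deg \<open>N \<noteq> 0\<close> by auto
  moreover have "complex_of_real (if e = 1 then b1 else b0) \<noteq> 0"
    "int e = 1 \<and> complex_of_real (if e = 1 then b1 else b0) = of_real b1 \<or> int e = 0 \<and> complex_of_real b1 = 0"
    using b by auto
  ultimately show False
    using ode4_inf[OF l(1)] by blast
qed

lemma ode3_poles:
  assumes I: "open I" "I \<noteq> {}" and Q: "reduced_on I (Q 0) N d" "derivs_on 4 I Q" "ode3_on I \<kappa> a B R Q"
    and a: "a \<noteq> 0" and r: "pole_at d r"
  shows "poly (pderiv (cpoly d)) r \<noteq> 0" "expand N d r $$ 2 = 0" "resid N d r = - of_real \<kappa>"
proof -
  have bd: "bezout N d" "d \<noteq> 0" using Q(1) by (auto simp: reduced_on_def)
  have ode: "ode3 fls_deriv \<kappa> a (emb (at_pt r) (cpoly B)) (emb (at_pt r) (cpoly R)) (expand N d r)"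
    unfolding expand_def using I Q bd unfolding reduced_on_def derivs_on_def ode3_on_def
    by (intro ode3_transfer[where Q = Q and I = I] fls_derivation_at emb_at_nonzero) auto
  obtain \<mu> q where l: "\<mu> \<ge> 1" "q \<noteq> 0" "lead (expand N d r) (-\<mu>) q"
    "\<mu> = 1 \<Longrightarrow> poly (pderiv (cpoly d)) r \<noteq> 0 \<and> q = resid N d r"
    using lead_expand[OF bd r] by blast
  note BR = lead_emb_at[of r "cpoly B"] lead_emb_at[of r "cpoly R"]
  have a': "complex_of_real a \<noteq> 0" using a by simp
  have \<mu>: "\<mu> = 1" "q = - of_real \<kappa>"
    using ode3_pole[OF l(3,2,1) a' BR ode] by auto
  then show "poly (pderiv (cpoly d)) r \<noteq> 0" "resid N d r = - of_real \<kappa>" using l(4) by auto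
  have l1: "lead (expand N d r) (-1) q" using l \<mu> by simp
  show "expand N d r $$ 2 = 0" by (rule ode3_simple_pole[OF l1 l(2) a' BR(2) ode])
qed

lemma ode3_degree:
  assumes I: "open I" "I \<noteq> {}" and Q: "reduced_on I (Q 0) N d" "derivs_on 4 I Q" "ode3_on I \<kappa> a B R Q"
    and a: "a \<noteq> 0" and BR: "degree B \<le> 2" "degree R \<le> 3"
  shows "degree N \<le> degree d + 3"
proof (rule ccontr)
  assume deg: "\<not> degree N \<le> degree d + 3"
  then have "N \<noteq> 0" by auto
  have d: "lead_coeff d = 1" using Q(1) by (simp add: reduced_on_def)
  note l = lead_emb_frac_inf[OF \<open>N \<noteq> 0\<close> d]
  have "ode3 fls_deriv_inf \<kappa> a
      (emb fls_X_inv (cpoly B)) (emb fls_X_inv (cpoly R)) (emb fls_X_inv (cpoly N) / emb fls_X_inv (cpoly d))"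
    using I Q l(2) unfolding reduced_on_def derivs_on_def ode3_on_def
    by (intro ode3_transfer[where Q = Q and I = I] fls_derivation_inf) auto
  moreover have "complex_of_real (lead_coeff N) \<noteq> 0" "int (degree N) - int (degree d) \<ge> 4"
    using deg \<open>N \<noteq> 0\<close> by auto
  moreover have "lead (emb fls_X_inv (cpoly B)) (-2) (of_real (coeff B 2))"
    "lead (emb fls_X_inv (cpoly R)) (-3) (of_real (coeff R 3))"
    using lead_emb_inf_poly[OF BR(1)] lead_emb_inf_poly[OF BR(2)] by simp_all
  moreover have "complex_of_real a \<noteq> 0" using a by simp
  ultimately show False
    using ode3_inf[OF l(1)] by blast
qed

section \<open>From pole data to the listed potentials\<close>

lemma cpoly_uminus [simp]: "cpoly (- p) = - cpoly p"
  by (simp add: poly_eq_iff coeff_map_poly)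

lemma card_simple_poles:
  assumes "lead_coeff d = 1" "\<And>s. pole_at d s \<Longrightarrow> poly (pderiv (cpoly d)) s \<noteq> 0"
  shows "card {s. pole_at d s} = degree d" "finite {s. pole_at d s}"
    "cpoly d = (\<Prod>s | pole_at d s. [:-s, 1:])"
proof -
  have d: "d \<noteq> 0" using assms(1) by auto
  show fin: "finite {s. pole_at d s}" by (rule poly_roots_finite) (use d in simp)
  have "rsquarefree (cpoly d)"
    using assms d by (auto simp: rsquarefree_roots)
  from complex_poly_decompose_rsquarefree[OF this]
  show dec: "cpoly d = (\<Prod>s | pole_at d s. [:-s, 1:])"
    using assms by (simp add: coeff_map_poly)
  have "degree (cpoly d) = card {s. pole_at d s}"
    by (subst dec, subst degree_prod_eq_sum_degree) auto
  then show "card {s. pole_at d s} = degree d" by simp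
qed

lemma up_to_translationI:
  "(\<And>q. q \<in> I \<Longrightarrow> V q = F (q - c) + e) \<Longrightarrow> up_to_translation I V F"
  by (auto simp: up_to_translation_def)

text \<open>Completing the square leads to (II) without its pole, unless the quadratic coefficient
  vanishes, which is (I).\<close>

lemma listed_quadratic:
  assumes "\<And>q. q \<in> I \<Longrightarrow> V q = a + b * q + c * q\<^sup>2"
  shows "listed_potential h I V"
proof (cases "c = 0")
  case True
  then have "up_to_translation I V (form_I b)"
    using assms by (intro up_to_translationI[of _ _ _ 0 a]) (auto simp: form_I_def)
  then show ?thesis by (auto simp: listed_potential_def)
next
  case False
  have "up_to_translation I V (form_II c 0)"
  proof (rule up_to_translationI)
    fix q assume "q \<in> I"
    show "V q = form_II c 0 (q - (- b / (2 * c))) + (a - b\<^sup>2 / (4 * c))"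
      using False by (simp add: assms[OF \<open>q \<in> I\<close>] form_II_def field_simps power2_eq_square)
  qed
  then show ?thesis by (auto simp: listed_potential_def)
qed

lemma listed_II:
  assumes "\<And>q. q \<in> I \<Longrightarrow> V q = a + b * (q - c)\<^sup>2 + l / (q - c)\<^sup>2"
  shows "listed_potential h I V"
proof -
  have "up_to_translation I V (form_II b l)"
    using assms by (intro up_to_translationI[of _ _ _ c a]) (auto simp: form_II_def)
  then show ?thesis by (auto simp: listed_potential_def)
qed

text \<open>Pole data yield the coefficients of q^2 and 1/q^2 separately. The second assumption is
  the coupling between them that \<open>form_III\<close> builds in, the h^2 / 8 coming from its last
  summand.\<close>

lemma listed_III:
  assumes "\<And>q. q \<in> I \<Longrightarrow> V q = a + b * (q - c)\<^sup>2 + l / (q - c)\<^sup>2 + 2 * h\<^sup>2 * ((q - c)\<^sup>2 + s) / ((q - c)\<^sup>2 - s)\<^sup>2"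
    and "b * s\<^sup>2 = l + h\<^sup>2 / 8"
  shows "listed_potential h I V"
proof -
  have "up_to_translation I V (form_III h b s)"
  proof (rule up_to_translationI)
    fix q assume q: "q \<in> I"
    \<comment> \<open>No exception at q = c: all three fractions are 0 there.\<close>
    have "b * s\<^sup>2 / (q - c)\<^sup>2 = l / (q - c)\<^sup>2 + h\<^sup>2 / (8 * (q - c)\<^sup>2)"
      unfolding assms(2) by (simp add: add_divide_distrib)
    then show "V q = form_III h b s (q - c) + a"
      unfolding assms(1)[OF q] form_III_def by (simp add: algebra_simps)
  qed
  then show ?thesis by (auto simp: listed_potential_def)
qed

lemma listed_IV:
  assumes "\<And>q. q \<in> I \<Longrightarrow> V q = a + 3 * h\<^sup>2 * (q - c) * ((q - c)^3 + 2 * b) / ((q - c)^3 - b)\<^sup>2"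
  shows "listed_potential h I V"
proof -
  have "up_to_translation I V (form_IV h b)"
    using assms by (intro up_to_translationI[of _ _ _ c a]) (auto simp: form_IV_def)
  then show ?thesis by (auto simp: listed_potential_def)
qed

lemma deriv_eq_on_open:
  fixes F :: "real \<Rightarrow> real"
  assumes "open I" "t \<in> I" "\<And>t. t \<in> I \<Longrightarrow> Q t = F t" "(Q has_real_derivative v) (at t)" "(F has_real_derivative g) (at t)"
  shows "v = g"
  using has_field_derivative_transform_within_open[OF assms(4,1,2,3)] assms(5) DERIV_unique by blast

lemma cubic_poly_eq:
  fixes p :: "'a::comm_ring_1 poly"
  assumes "degree p \<le> 3"
  shows "p = [:coeff p 0, coeff p 1, coeff p 2, coeff p 3:]"
proof (rule poly_eqI)
  fix n
  have "n = 0 \<or> n = 1 \<or> n = 2 \<or> n = 3 \<or> n > 3" for n :: nat by auto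
  from this[of n] show "coeff p n = coeff [:coeff p 0, coeff p 1, coeff p 2, coeff p 3:] n"
    using assms by (auto simp: coeff_pCons eval_nat_numeral coeff_eq_0 split: nat.splits)
qed

text \<open>The common outcome of the local analysis for orders three and four. Residues are left
  open, because an exceptional pole may have any non-zero one.\<close>

definition good_poles :: "real set \<Rightarrow> (nat \<Rightarrow> real \<Rightarrow> real) \<Rightarrow> real poly \<Rightarrow> real poly \<Rightarrow> bool" where
  "good_poles I Q N d \<longleftrightarrow> open I \<and> reduced_on I (Q 0) N d
     \<and> (\<forall>t\<in>I. (Q 0 has_real_derivative Q 1 t) (at t)) \<and> degree N \<le> degree d + 3
     \<and> (\<forall>r. pole_at d r \<longrightarrow> poly (pderiv (cpoly d)) r \<noteq> 0 \<and> expand N d r $$ 2 = 0)"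

text \<open>The growth bound makes the polynomial part of \<open>Q\<close> a cubic. Its coefficient
  at (t - r)^2 is u2 + 3 u3 r, and every other pole s adds resid / (r - s)^3; since the sum has to
  vanish, the poles form an equilibrium configuration.\<close>

lemma good_poles_quotient:
  assumes "good_poles I Q N d"
  obtains u0 u1 u2 u3 where "N div d = [:u0, u1, u2, u3:]"
    "\<And>r. pole_at d r \<Longrightarrow> of_real u2 + 3 * of_real u3 * r + (\<Sum>s\<in>{s. pole_at d s} - {r}. resid N d s / (r - s) ^ 3) = 0"
proof -
  have d: "lead_coeff d = 1" "d \<noteq> 0" using assms by (auto simp: good_poles_def reduced_on_def)
  have sq: "\<And>s. pole_at d s \<Longrightarrow> poly (pderiv (cpoly d)) s \<noteq> 0"
    using assms by (auto simp: good_poles_def)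
  define U where "U = N div d"
  have "degree U \<le> 3"
  proof (cases "U = 0")
    case False
    have "degree (U * d) \<le> degree d + 3"
    proof -
      have "U * d = N - N mod d" by (simp add: U_def minus_mod_eq_div_mult)
      moreover have "degree (N mod d) \<le> degree d + 3"
        using degree_mod_less[OF d(2), of N] by auto
      ultimately show ?thesis
        using assms by (auto simp: good_poles_def intro: degree_diff_le)
    qed
    then show ?thesis using False d by (simp add: degree_mult_eq)
  qed simp
  from cubic_poly_eq[OF this] obtain u0 u1 u2 u3 where U: "U = [:u0, u1, u2, u3:]" by blast
  have c1: "of_real u2 + 3 * of_real u3 * r + (\<Sum>s\<in>{s. pole_at d s} - {r}. resid N d s / (r - s) ^ 3) = 0"
    if r: "pole_at d r" for r
  proof -
    have "expand N d r $$ 2 = 0" using assms r by (auto simp: good_poles_def)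
    moreover have "emb (at_pt r) (cpoly U) $$ 2 = of_real u2 + 3 * of_real u3 * r"
      unfolding emb_at_nth_2 U by (simp add: pderiv_pCons algebra_simps)
    ultimately show ?thesis using expand_nth[OF d(2,1) sq r, of N 2] by (simp add: eval_nat_numeral U_def)
  qed
  show thesis
    by (rule that[OF U[unfolded U_def] c1])
qed

text \<open>The fractional part of \<open>Q\<close> is determined by the values of N at the simple
  roots of d. Any M of small degree with these values may be used, so the residues suggest M, and
  differentiating the closed form F gives the potential.\<close>

lemma good_poles_deriv:
  assumes g: "good_poles I Q N d" and U: "N div d = [:u0, u1, u2, u3:]"
    and M: "degree M < degree d \<or> M = 0" "\<And>r. pole_at d r \<Longrightarrow> poly (cpoly M) r = poly (cpoly N) r"
    and F: "\<And>t. t \<in> I \<Longrightarrow> poly M t / poly d t = F t" and t: "t \<in> I" and G: "(F has_real_derivative G) (at t)"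
  shows "Q 1 t = u1 + 2 * u2 * t + 3 * u3 * t\<^sup>2 + G"
proof -
  have d: "lead_coeff d = 1" "d \<noteq> 0" using g by (auto simp: good_poles_def reduced_on_def)
  have sq: "\<And>s. pole_at d s \<Longrightarrow> poly (pderiv (cpoly d)) s \<noteq> 0"
    using g by (auto simp: good_poles_def)
  note card = card_simple_poles[OF d(1) sq]
  define U where "U = N div d"
  have "M = N mod d"
  proof (cases "degree d = 0")
    case True
    then have "N mod d = 0" using d(2) by (meson is_unit_iff_degree mod_eq_0_iff_dvd unit_imp_dvd)
    then show ?thesis using M(1) True by simp
  next
    case False
    have "cpoly M = cpoly (N mod d)"
    proof (rule poly_eqI_degree[of "{s. pole_at d s}"])
      fix s assume s: "s \<in> {s. pole_at d s}"
      have "cpoly N = cpoly U * cpoly d + cpoly (N mod d)"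
        unfolding U_def by (metis cpoly_add cpoly_mult div_mult_mod_eq)
      then show "poly (cpoly M) s = poly (cpoly (N mod d)) s" using M(2)[of s] s by simp
    next
      show "degree (cpoly M) < card {s. pole_at d s}" using M(1) False card by auto
      show "degree (cpoly (N mod d)) < card {s. pole_at d s}"
        using degree_mod_less[OF d(2), of N] False card by auto
    qed
    then show ?thesis by (metis cpoly_eq_0_iff cpoly_diff right_minus_eq)
  qed
  have q0: "Q 0 t = poly U t + F t" if t: "t \<in> I" for t
  proof -
    have "poly d t \<noteq> 0" "Q 0 t = poly N t / poly d t" using g t by (auto simp: good_poles_def reduced_on_def)
    moreover have "poly N t = poly U t * poly d t + poly M t"
      unfolding U_def \<open>M = N mod d\<close> by (metis div_mult_mod_eq poly_add poly_mult)
    ultimately show ?thesis using F[OF t] by (simp add: add_divide_distrib)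
  qed
  have dv: "((\<lambda>t. poly U t + F t) has_real_derivative poly (pderiv U) t + G) (at t)"
    by (intro DERIV_add poly_DERIV G)
  have "open I" "(Q 0 has_real_derivative Q 1 t) (at t)" using g t by (auto simp: good_poles_def)
  then have "Q 1 t = poly (pderiv U) t + G"
    using deriv_eq_on_open[OF _ t q0 _ dv] by blast
  moreover have "poly (pderiv U) t = u1 + 2 * u2 * t + 3 * u3 * t\<^sup>2"
    unfolding U_def U by (simp add: pderiv_pCons power2_eq_square algebra_simps)
  ultimately show ?thesis by simp
qed

section \<open>Classification by the number of poles\<close>

lemma listed_degree_0:
  assumes "good_poles I Q N d" "degree d = 0"
  shows "listed_potential h I (Q 1)"
proof -
  obtain u0 u1 u2 u3 where U: "N div d = [:u0, u1, u2, u3:]"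
    by (rule good_poles_quotient[OF assms(1)]) blast
  have "lead_coeff d = 1" using assms by (auto simp: good_poles_def reduced_on_def)
  then have "d = 1" using assms(2) by (metis degree_eq_zeroE lead_coeff_pCons(2) one_pCons)
  then have np: "\<not> pole_at d r" for r by simp
  have "Q 1 t = u1 + 2 * u2 * t + 3 * u3 * t\<^sup>2" if t: "t \<in> I" for t
  proof -
    have "Q 1 t = u1 + 2 * u2 * t + 3 * u3 * t\<^sup>2 + 0"
      by (rule good_poles_deriv[OF assms(1) U, of 0 "\<lambda>_. 0"]) (use np t in auto)
    then show ?thesis by simp
  qed
  then show ?thesis by (rule listed_quadratic)
qed

lemma linear_coeff_eq:
  assumes "complex_of_real (u2 + 3 * u3 * c) = 0"
  shows "u2 = - 3 * u3 * c"
  using of_real_eq_0_iff[THEN iffD1, OF assms] by linarith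

lemma poles_linear: "{s. pole_at [:-c, 1:] s} = {of_real c}"
  by auto

text \<open>A single pole feels no other one, so the equilibrium equation reads u2 + 3 u3 c = 0: the
  quadratic part of the potential is centred at the pole. The residue remains arbitrary, which is
  (II).\<close>

lemma listed_degree_1:
  assumes g: "good_poles I Q N d" and d: "degree d = 1"
  shows "listed_potential h I (Q 1)"
proof -
  obtain u0 u1 u2 u3 where U: "N div d = [:u0, u1, u2, u3:]" and c1: "\<And>r. pole_at d r \<Longrightarrow> of_real u2 + 3 * of_real u3 * r + (\<Sum>s\<in>{s. pole_at d s} - {r}. resid N d s / (r - s) ^ 3) = 0"
    by (rule good_poles_quotient[OF g]) blast
  have "lead_coeff d = 1" using g by (auto simp: good_poles_def reduced_on_def)
  moreover have "d = [:coeff d 0, coeff d 1:]"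
    using cubic_poly_eq[of d] d by (simp add: coeff_eq_0)
  ultimately obtain c where dc: "d = [:-c, 1:]"
    using d by (metis add.inverse_inverse)
  define m where "m = poly N c"
  have cc: "of_real u2 + 3 * of_real u3 * of_real c = (0::complex)"
    using c1[of "of_real c"] unfolding dc poles_linear by simp
  have "complex_of_real (u2 + 3 * u3 * c) = 0" using cc by simp
  then have u2: "u2 = - 3 * u3 * c" by (rule linear_coeff_eq)
  have "Q 1 t = (u1 - 3 * u3 * c\<^sup>2) + 3 * u3 * (t - c)\<^sup>2 + (- m) / (t - c)\<^sup>2" if t: "t \<in> I" for t
  proof -
    have ne: "t - c \<noteq> 0" using g t unfolding good_poles_def reduced_on_def dc by auto
    have 1: "\<forall>t\<in>I. poly [:m:] t / poly d t = m / (t - c)" by (simp add: dc)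
    have 2: "((\<lambda>t. m / (t - c)) has_real_derivative - m / (t - c)\<^sup>2) (at t)"
      using ne by (auto intro!: derivative_eq_intros simp: power2_eq_square)
    have "Q 1 t = u1 + 2 * u2 * t + 3 * u3 * t\<^sup>2 + - m / (t - c)\<^sup>2"
      by (rule good_poles_deriv[OF g U, of "[:m:]" "\<lambda>t. m / (t - c)"]) (use d t 1 2 in \<open>auto simp: dc m_def\<close>)
    then show ?thesis unfolding u2 by (simp add: power2_eq_square algebra_simps)
  qed
  then show ?thesis by (rule listed_II)
qed

lemma poly_eq_quadratic:
  fixes d :: "'a::comm_ring_1 poly"
  assumes "degree d = 2" "lead_coeff d = 1"
  shows "d = [:coeff d 0, coeff d 1, 1:]"
  using cubic_poly_eq[of d] assms by (simp add: coeff_eq_0)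

lemma poly_eq_cubic:
  fixes d :: "'a::comm_ring_1 poly"
  assumes "degree d = 3" "lead_coeff d = 1"
  shows "d = [:coeff d 0, coeff d 1, coeff d 2, 1:]"
  using cubic_poly_eq[of d] assms by simp

text \<open>The sum of the two equilibrium equations centres the quadratic part at the midpoint c of
  the poles, their difference gives 3 u3 \<sigma>^2 = h^2 / 8, where 4 \<sigma> is the squared
  difference of the poles. This is (III) with cancelling inverse-square terms.\<close>

lemma listed_degree_2:
  assumes g: "good_poles I Q N d" and d: "degree d = 2"
    and res: "\<And>r. pole_at d r \<Longrightarrow> resid N d r = - of_real (h\<^sup>2)"
  shows "listed_potential h I (Q 1)"
proof -
  obtain u0 u1 u2 u3 where U: "N div d = [:u0, u1, u2, u3:]" and c1: "\<And>r. pole_at d r \<Longrightarrow> of_real u2 + 3 * of_real u3 * r + (\<Sum>s\<in>{s. pole_at d s} - {r}. resid N d s / (r - s) ^ 3) = 0"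
    by (rule good_poles_quotient[OF g]) blast
  have lc: "lead_coeff d = 1" using g by (auto simp: good_poles_def reduced_on_def)
  have sq: "\<And>s. pole_at d s \<Longrightarrow> poly (pderiv (cpoly d)) s \<noteq> 0"
    using g by (auto simp: good_poles_def)
  define k where "k = h\<^sup>2"
  define c where "c = - coeff d 1 / 2"
  define \<sigma> where "\<sigma> = c\<^sup>2 - coeff d 0"
  have dq: "d = [:c\<^sup>2 - \<sigma>, - 2 * c, 1:]"
    using poly_eq_quadratic[OF d lc] by (simp add: \<sigma>_def c_def)
  note card = card_simple_poles[OF lc sq]
  from card(1) d have "card {s. pole_at d s} = 2" by simp
  then obtain r s where Z: "{s. pole_at d s} = {r, s}" "r \<noteq> s" by (auto simp: card_2_iff)
  have "cpoly d = [:-r, 1:] * [:-s, 1:]"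
    using card(3) Z by simp
  then have e: "complex_of_real (c\<^sup>2 - \<sigma>) = r * s" "complex_of_real (- 2 * c) = - (r + s)"
    unfolding dq by simp_all
  have res': "resid N d r = - of_real k" "resid N d s = - of_real k"
    using res Z by (auto simp: k_def)
  have "{r, s} - {r} = {s}" "{r, s} - {s} = {r}" using Z by auto
  then have c1r: "of_real u2 + 3 * of_real u3 * r - of_real k / (r - s)^3 = 0"
    and c1s: "of_real u2 + 3 * of_real u3 * s - of_real k / (s - r)^3 = 0"
    using c1[of r] c1[of s] Z res' by auto
  define D where "D = r - s"
  have D: "D \<noteq> 0" using Z by (simp add: D_def)
  have sum: "s - r = - D" and rD: "r = s + D" by (simp_all add: D_def)
  have "2 * (of_real u2 + 3 * of_real u3 * of_real c) = (0::complex)"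
  proof -
    have "2 * (of_real u2 + 3 * of_real u3 * of_real c) = 2 * of_real u2 + 3 * of_real u3 * (r + s)"
      using e(2) by (simp add: algebra_simps)
    also have "\<dots> = (of_real u2 + 3 * of_real u3 * r - of_real k / (r - s)^3)
       + (of_real u2 + 3 * of_real u3 * s - of_real k / (s - r)^3)"
      unfolding sum D_def[symmetric] by (simp add: algebra_simps)
    finally show ?thesis using c1r c1s by simp
  qed
  then have "of_real u2 + 3 * of_real u3 * of_real c = (0::complex)"
    by (metis mult_eq_0_iff zero_neq_numeral)
  then have "complex_of_real (u2 + 3 * u3 * c) = 0" by simp
  then have u2: "u2 = - 3 * u3 * c" by (rule linear_coeff_eq)
  have D2: "D\<^sup>2 = of_real (4 * \<sigma>)"
  proof -
    have "D\<^sup>2 = (- (r + s))\<^sup>2 - 4 * (r * s)" by (simp add: D_def power2_eq_square algebra_simps)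
    also have "\<dots> = of_real (4 * \<sigma>)" unfolding e[symmetric] by (simp add: power2_eq_square algebra_simps)
    finally show ?thesis .
  qed
  have "3 * of_real u3 * D - 2 * of_real k / D^3 = 0"
  proof -
    have "3 * of_real u3 * D - 2 * of_real k / D^3 = (of_real u2 + 3 * of_real u3 * r - of_real k / (r - s)^3)
       - (of_real u2 + 3 * of_real u3 * s - of_real k / (s - r)^3)"
      unfolding sum rD by (simp add: algebra_simps)
    then show ?thesis using c1r c1s by simp
  qed
  then have "3 * of_real u3 * D^4 = 2 * complex_of_real k"
    using D by (simp add: field_simps eval_nat_numeral)
  moreover have "D^4 = (D\<^sup>2)\<^sup>2" by (simp flip: power_mult)
  ultimately have "3 * of_real u3 * (of_real (4 * \<sigma>))\<^sup>2 = 2 * complex_of_real k"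
    unfolding D2 by simp
  then have "complex_of_real (3 * u3 * (4 * \<sigma>)\<^sup>2) = complex_of_real (2 * k)" by simp
  then have u3: "3 * u3 * \<sigma>\<^sup>2 = 0 + h\<^sup>2 / 8"
    unfolding of_real_eq_iff by (simp add: k_def power2_eq_square mult_ac)
  have "Q 1 t = (u1 - 3 * u3 * c\<^sup>2) + 3 * u3 * (t - c)\<^sup>2 + 0 / (t - c)\<^sup>2 + 2 * h\<^sup>2 * ((t - c)\<^sup>2 + \<sigma>) / ((t - c)\<^sup>2 - \<sigma>)\<^sup>2"
    if t: "t \<in> I" for t
  proof -
    have pd: "poly d t = (t - c)\<^sup>2 - \<sigma>" for t by (simp add: dq power2_eq_square algebra_simps)
    have ne: "(t - c)\<^sup>2 - \<sigma> \<noteq> 0" using g t unfolding good_poles_def reduced_on_def pd by auto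
    \<comment> \<open>Equal residues -k at all roots mean that the fractional part of
      \<open>Q\<close> is -k times the logarithmic derivative of d.\<close>
    define M where "M = smult (-k) (pderiv d)"
    have M: "poly M t = - 2 * k * (t - c)" for t by (simp add: M_def dq pderiv_pCons algebra_simps)
    have 1: "\<forall>t\<in>I. poly M t / poly d t = - 2 * k * (t - c) / ((t - c)\<^sup>2 - \<sigma>)" by (simp add: M pd)
    have 2: "((\<lambda>t. - 2 * k * (t - c) / ((t - c)\<^sup>2 - \<sigma>)) has_real_derivative
        (2 * k * ((t - c)\<^sup>2 + \<sigma>) / ((t - c)\<^sup>2 - \<sigma>)\<^sup>2)) (at t)"
      using ne by (auto intro!: derivative_eq_intros simp: power2_eq_square algebra_simps)
    have 3: "degree M < degree d" using d by (simp add: M_def dq pderiv_pCons)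
    have 4: "poly (cpoly M) r = poly (cpoly N) r" if "pole_at d r" for r
    proof -
      have "resid N d r = - of_real k" using res[OF that] by (simp add: k_def)
      then show ?thesis using sq[OF that] by (simp add: resid_def M_def field_simps)
    qed
    have "Q 1 t = u1 + 2 * u2 * t + 3 * u3 * t\<^sup>2 + 2 * k * ((t - c)\<^sup>2 + \<sigma>) / ((t - c)\<^sup>2 - \<sigma>)\<^sup>2"
      by (rule good_poles_deriv[OF g U disjI1[OF 3] 4 1[rule_format] t 2])
    then show ?thesis unfolding u2 k_def by (simp add: power2_eq_square algebra_simps)
  qed
  then show ?thesis using u3 by (rule listed_III)
qed

text \<open>The centre c carries a free residue -m, the outer poles c + s and c - s have residue
  -h^2. Adding and subtracting the equations of the outer poles works as for two poles, with m
  joining h^2 / 8. As \<sigma> may be negative, s is a complex root of it.\<close>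

lemma listed_degree_3_symmetric:
  assumes g: "good_poles I Q N d" and d: "d = [:-c, 1:] * [:c\<^sup>2 - \<sigma>, - 2 * c, 1:]"
    and res: "\<And>r. pole_at d r \<Longrightarrow> r \<noteq> of_real c \<Longrightarrow> resid N d r = - of_real (h\<^sup>2)"
  shows "listed_potential h I (Q 1)"
proof -
  obtain u0 u1 u2 u3 where U: "N div d = [:u0, u1, u2, u3:]" and c1: "\<And>r. pole_at d r \<Longrightarrow> of_real u2 + 3 * of_real u3 * r + (\<Sum>s\<in>{s. pole_at d s} - {r}. resid N d s / (r - s) ^ 3) = 0"
    by (rule good_poles_quotient[OF g]) blast
  have sq: "\<And>s. pole_at d s \<Longrightarrow> poly (pderiv (cpoly d)) s \<noteq> 0"
    using g by (auto simp: good_poles_def)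
  have deg: "degree d = 3" unfolding d by simp
  define k where "k = h\<^sup>2"
  define s where "s = csqrt (of_real \<sigma>)"
  have s2: "s\<^sup>2 = of_real \<sigma>" by (simp add: s_def)
  define C where "C = complex_of_real c"
  have pd: "poly (cpoly d) z = (z - C) * (z - (C + s)) * (z - (C - s))" for z
  proof -
    have "poly (cpoly d) z = (z - C) * ((z - C)\<^sup>2 - of_real \<sigma>)"
      by (simp add: d C_def power2_eq_square algebra_simps)
    then show ?thesis by (simp flip: s2) (simp add: power2_eq_square algebra_simps)
  qed
  have pdc: "poly (pderiv (cpoly d)) C = - of_real \<sigma>"
    unfolding C_def by (simp add: d pderiv_mult pderiv_pCons power2_eq_square algebra_simps)
  have Z: "{z. pole_at d z} = {C, C + s, C - s}" unfolding pd by auto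
  have \<sigma>: "\<sigma> \<noteq> 0" using sq[of C] Z pdc by auto
  then have s0: "s \<noteq> 0" using s2 by auto
  define m where "m = poly N c / \<sigma>"
  have resC: "resid N d C = - of_real m"
    unfolding resid_def pdc using \<sigma> by (simp add: C_def m_def)
  have "pole_at d (C + s)" "pole_at d (C - s)" using Z by blast+
  then have ress: "resid N d (C + s) = - of_real k" "resid N d (C - s) = - of_real k"
    using res s0 by (auto simp: k_def C_def)
  have "{C, C + s, C - s} - {C + s} = {C, C - s}" "{C, C + s, C - s} - {C - s} = {C, C + s}"
    using s0 by auto
  then have e1: "of_real u2 + 3 * of_real u3 * (C + s) - (of_real m / s^3 + of_real k / (2 * s)^3) = 0"
    and e2: "of_real u2 + 3 * of_real u3 * (C - s) + (of_real m / s^3 + of_real k / (2 * s)^3) = 0"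
    using c1[of "C + s"] c1[of "C - s"] Z resC ress s0
    by (auto simp: algebra_simps power_mult_distrib)
  have "2 * (of_real u2 + 3 * of_real u3 * C) = 0"
    using arg_cong2[OF e1 e2, of "(+)"] by (simp add: algebra_simps)
  then have "of_real u2 + 3 * of_real u3 * C = 0"
    by (metis mult_eq_0_iff zero_neq_numeral)
  then have "complex_of_real (u2 + 3 * u3 * c) = 0" by (simp add: C_def)
  then have u2: "u2 = - 3 * u3 * c" by (rule linear_coeff_eq)
  have "2 * (3 * of_real u3 * s - (of_real m / s^3 + of_real k / (2 * s)^3)) = 0"
    using arg_cong2[OF e1 e2, of "(-)"] by (simp add: algebra_simps)
  then have "3 * of_real u3 * s - (of_real m / s^3 + of_real k / (2 * s)^3) = 0"
    by (metis mult_eq_0_iff zero_neq_numeral)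
  then have "3 * of_real u3 * s = of_real m / s^3 + of_real k / (2 * s)^3" by simp
  then have "3 * of_real u3 * s^4 = complex_of_real m + of_real k / 8"
    using s0 by (simp add: field_simps eval_nat_numeral)
  then have "3 * of_real u3 * (of_real \<sigma>)\<^sup>2 = complex_of_real m + of_real k / 8"
    by (simp flip: s2)
  then have "complex_of_real (3 * u3 * \<sigma>\<^sup>2) = complex_of_real (m + k / 8)" by simp
  then have u3: "3 * u3 * \<sigma>\<^sup>2 = m + h\<^sup>2 / 8"
    unfolding of_real_eq_iff by (simp add: k_def)
  have "Q 1 t = (u1 - 3 * u3 * c\<^sup>2) + 3 * u3 * (t - c)\<^sup>2 + m / (t - c)\<^sup>2 + 2 * h\<^sup>2 * ((t - c)\<^sup>2 + \<sigma>) / ((t - c)\<^sup>2 - \<sigma>)\<^sup>2"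
    if t: "t \<in> I" for t
  proof -
    have pr: "poly d t = (t - c) * ((t - c)\<^sup>2 - \<sigma>)" for t by (simp add: d power2_eq_square algebra_simps)
    have ne': "t - c \<noteq> 0 \<and> (t - c)\<^sup>2 - \<sigma> \<noteq> 0" if "t \<in> I" for t
      using g that unfolding good_poles_def reduced_on_def pr by auto
    note ne = ne'[OF t]
    define M where "M = smult (-m) [:c\<^sup>2 - \<sigma>, - 2 * c, 1:] + smult (- 2 * k) ([:-c, 1:] * [:-c, 1:])"
    have M: "poly M t = - m * ((t - c)\<^sup>2 - \<sigma>) - 2 * k * (t - c)\<^sup>2" for t
      by (simp add: M_def power2_eq_square algebra_simps)
    have cM: "poly (cpoly M) z = - of_real m * ((z - C)\<^sup>2 - s\<^sup>2) - 2 * of_real k * (z - C)\<^sup>2" for z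
      unfolding s2 by (simp add: M_def power2_eq_square C_def algebra_simps)
    have 1: "\<forall>t\<in>I. poly M t / poly d t = - m / (t - c) - 2 * k * (t - c) / ((t - c)\<^sup>2 - \<sigma>)"
      using ne' by (simp add: M pr) (simp add: field_simps power2_eq_square)
    have 2: "((\<lambda>t. - m / (t - c) - 2 * k * (t - c) / ((t - c)\<^sup>2 - \<sigma>)) has_real_derivative
        (m / (t - c)\<^sup>2 + 2 * k * ((t - c)\<^sup>2 + \<sigma>) / ((t - c)\<^sup>2 - \<sigma>)\<^sup>2)) (at t)"
    proof -
      have a: "((\<lambda>t. - m / (t - c)) has_real_derivative m / (t - c)\<^sup>2) (at t)"
        using ne by (auto intro!: derivative_eq_intros simp: power2_eq_square)
      have b: "((\<lambda>t. 2 * k * (t - c) / ((t - c)\<^sup>2 - \<sigma>)) has_real_derivative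
        - (2 * k * ((t - c)\<^sup>2 + \<sigma>) / ((t - c)\<^sup>2 - \<sigma>)\<^sup>2)) (at t)"
        using ne by (auto intro!: derivative_eq_intros simp: power2_eq_square algebra_simps)
          (simp add: divide_simps algebra_simps)?
      show ?thesis using DERIV_diff[OF a b] by simp
    qed
    have 3: "degree M < degree d"
    proof -
      have "degree M \<le> 2" unfolding M_def by (intro degree_add_le order_trans[OF degree_smult_le]) auto
      then show ?thesis using deg by simp
    qed
    have 4: "poly (cpoly M) r = poly (cpoly N) r" if r: "pole_at d r" for r
    proof -
      have N: "poly (cpoly N) r = resid N d r * poly (pderiv (cpoly d)) r"
        using sq[OF r] by (simp add: resid_def)
      have pd': "poly (pderiv (cpoly d)) r = 3 * (r - C)\<^sup>2 - s\<^sup>2" 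
        unfolding s2 by (simp add: d C_def pderiv_mult pderiv_pCons power2_eq_square algebra_simps)
      have "r = C \<or> r = C + s \<or> r = C - s" using r Z by blast
      then show ?thesis
        unfolding cM N pd' using resC ress by (auto simp: power2_eq_square algebra_simps)
    qed
    have "Q 1 t = u1 + 2 * u2 * t + 3 * u3 * t\<^sup>2 + (m / (t - c)\<^sup>2 + 2 * k * ((t - c)\<^sup>2 + \<sigma>) / ((t - c)\<^sup>2 - \<sigma>)\<^sup>2)"
      by (rule good_poles_deriv[OF g U disjI1[OF 3] 4 1[rule_format] t 2])
    then show ?thesis unfolding u2 k_def by (simp add: power2_eq_square algebra_simps)
  qed
  then show ?thesis using u3 by (rule listed_III)
qed

text \<open>The forces are odd, so they cancel in the sum and A = 0. In terms of the differences a,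
  b, c of the roots, each equation becomes B x^3 y^3 = -3 k s with the same s for all three pairs,
  unless two differences agree, in which case a root is 0. Were B non-zero, the three cubes would be
  equal, hence s = 0 and B = 0 after all.\<close>

lemma root_triple_equations:
  fixes r1 r2 r3 A B k :: complex
  assumes k: "k \<noteq> 0" and dist: "r1 \<noteq> r2" "r2 \<noteq> r3" "r3 \<noteq> r1" and sum: "r1 + r2 + r3 = 0"
    and e1: "A + B * r1 = k * (1 / (r1 - r2)^3 + 1 / (r1 - r3)^3)"
    and e2: "A + B * r2 = k * (1 / (r2 - r1)^3 + 1 / (r2 - r3)^3)"
    and e3: "A + B * r3 = k * (1 / (r3 - r1)^3 + 1 / (r3 - r2)^3)"
  shows "A = 0" "B = 0 \<and> r1 * r2 + r2 * r3 + r3 * r1 = 0 \<or> r1 * r2 * r3 = 0"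
proof -
  define a b c where "a = r1 - r2" and "b = r2 - r3" and "c = r3 - r1"
  have abc: "a \<noteq> 0" "b \<noteq> 0" "c \<noteq> 0" "a + b + c = 0" using dist by (auto simp: a_def b_def c_def)
  have m: "r2 - r1 = - a" "r3 - r2 = - b" "r1 - r3 = - c" by (auto simp: a_def b_def c_def)
  have E: "A + B * r1 = k / a^3 - k / c^3" "A + B * r2 = k / b^3 - k / a^3" "A + B * r3 = k / c^3 - k / b^3"
    using e1 e2 e3 unfolding m a_def[symmetric] b_def[symmetric] c_def[symmetric]
    by (simp_all add: algebra_simps)
  have "3 * A + B * (r1 + r2 + r3) = (A + B * r1) + (A + B * r2) + (A + B * r3)"
    by (simp add: algebra_simps)
  also have "\<dots> = 0" unfolding E by simp
  finally show A: "A = 0" using sum by simp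
  have r: "3 * r1 = a - c" "3 * r2 = b - a" "3 * r3 = c - b"
    using sum unfolding a_def b_def c_def by (simp_all add: algebra_simps)
  have f: "B * (x - y) * x^3 * y^3 = 3 * k * (y^3 - x^3)"
    if "B * (x - y) = 3 * (k / x^3 - k / y^3)" "x \<noteq> 0" "y \<noteq> 0" for x y
    unfolding that(1) using that(2,3) by (simp add: field_simps)
  have F: "B * (a - c) = 3 * (k / a^3 - k / c^3)" "B * (b - a) = 3 * (k / b^3 - k / a^3)" "B * (c - b) = 3 * (k / c^3 - k / b^3)"
    using E A r by (metis add_0 mult.left_commute)+
  \<comment> \<open>Because a + b + c = 0, this quadratic form is the same for every pair of
    differences. It equals -3 times the second elementary symmetric function of the roots.\<close>
  define s where "s = a^2 + a * b + b^2"
  have c: "c = - a - b" using abc(4) by (simp add: eq_neg_iff_add_eq_0 algebra_simps)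
  have key: "B * x^3 * y^3 = - 3 * k * s" if "B * (x - y) = 3 * (k / x^3 - k / y^3)" "x \<noteq> 0" "y \<noteq> 0" "x \<noteq> y"
     "x^2 + x * y + y^2 = s" for x y
  proof -
    have "(x - y) * (B * x^3 * y^3) = (x - y) * (- 3 * k * (x^2 + x * y + y^2))"
      using f[OF that(1-3)] by (simp add: power2_eq_square power3_eq_cube algebra_simps)
    then have "B * x^3 * y^3 = - 3 * k * (x^2 + x * y + y^2)"
      using that(4) by (metis mult_left_cancel right_minus_eq)
    then show ?thesis using that(5) by simp
  qed
  have ss: "a^2 + a * c + c^2 = s" "b^2 + b * c + c^2 = s" "b^2 + b * a + a^2 = s" "c^2 + c * b + b^2 = s"
    unfolding s_def c by (simp_all add: power2_eq_square algebra_simps)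
  have sr: "s = - 3 * (r1 * r2 + r2 * r3 + r3 * r1)"
  proof -
    have r3: "r3 = - r1 - r2" using sum by (simp add: eq_neg_iff_add_eq_0 algebra_simps)
    show ?thesis unfolding s_def a_def b_def r3 by (simp add: power2_eq_square algebra_simps)
  qed
  show "B = 0 \<and> r1 * r2 + r2 * r3 + r3 * r1 = 0 \<or> r1 * r2 * r3 = 0"
  proof (cases "a = b \<or> b = c \<or> c = a")
    case True
    then have "r1 = 0 \<or> r2 = 0 \<or> r3 = 0" using r by auto
    then show ?thesis by auto
  next
    case False
    have 1: "B * a^3 * c^3 = - 3 * k * s" by (rule key[OF F(1)]) (use abc False ss in auto)
    have 2: "B * b^3 * a^3 = - 3 * k * s" by (rule key[OF F(2)]) (use abc False ss in auto)
    have 3: "B * c^3 * b^3 = - 3 * k * s" by (rule key[OF F(3)]) (use abc False ss in auto)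
    show ?thesis
    proof (cases "B = 0")
      case True
      then have "s = 0" using 1 k by simp
      then have "- 3 * (r1 * r2 + r2 * r3 + r3 * r1) = 0" using sr by simp
      then have "r1 * r2 + r2 * r3 + r3 * r1 = 0" by (simp only: mult_eq_0_iff) simp
      then show ?thesis using True by simp
    next
      case B: False
      have "B * a^3 * c^3 = B * b^3 * a^3" "B * c^3 * b^3 = B * b^3 * a^3" using 1 2 3 by simp_all
      then have "c^3 = b^3" "c^3 = a^3" using B abc by auto
      then have "(a - b) * s = 0" unfolding s_def by (simp add: power2_eq_square power3_eq_cube algebra_simps)
      then have "s = 0" using False by simp
      then show ?thesis using 1 B abc by simp
    qed
  qed
qed

text \<open>With the origin at the centroid of the poles there are two possibilities. A pole at the
  centroid means a symmetric triple and (III). Otherwise the poles are the cube roots of one number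
  and the polynomial part of \<open>Q\<close> is linear, which gives (IV).\<close>

lemma listed_degree_3:
  assumes g: "good_poles I Q N d" and d: "degree d = 3" and h: "h \<noteq> 0"
    and res: "\<And>r. pole_at d r \<Longrightarrow> resid N d r = - of_real (h\<^sup>2)"
  shows "listed_potential h I (Q 1)"
proof -
  obtain u0 u1 u2 u3 where U: "N div d = [:u0, u1, u2, u3:]" and c1: "\<And>r. pole_at d r \<Longrightarrow> of_real u2 + 3 * of_real u3 * r + (\<Sum>s\<in>{s. pole_at d s} - {r}. resid N d s / (r - s) ^ 3) = 0"
    by (rule good_poles_quotient[OF g]) blast
  have lc: "lead_coeff d = 1" using g by (auto simp: good_poles_def reduced_on_def)
  have sq: "\<And>s. pole_at d s \<Longrightarrow> poly (pderiv (cpoly d)) s \<noteq> 0"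
    using g by (auto simp: good_poles_def)
  define k where "k = h\<^sup>2"
  have k: "complex_of_real k \<noteq> 0" using h by (simp add: k_def)
  define c where "c = - coeff d 2 / 3"
  define p where "p = coeff d 1 - 3 * c\<^sup>2"
  define g0 where "g0 = coeff d 0 + c * coeff d 1 - 2 * c^3"
  have dc: "d = [:-c, 1:] ^ 3 + smult p [:-c, 1:] + [:g0:]"
    by (subst poly_eq_cubic[OF d lc])
      (simp add: p_def g0_def c_def power2_eq_square power3_eq_cube algebra_simps)
  have pd: "poly d t = (t - c)^3 + p * (t - c) + g0" for t
    by (subst dc) (simp add: algebra_simps)
  have pdc: "poly (cpoly d) z = (z - of_real c)^3 + of_real p * (z - of_real c) + of_real g0" for z
    by (subst dc) (simp add: algebra_simps)
  note card = card_simple_poles[OF lc sq]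
  from card(1) d have "card {s. pole_at d s} = 3" by simp
  then obtain s1 s2 s3 where Z: "{s. pole_at d s} = {s1, s2, s3}" "s1 \<noteq> s2" "s2 \<noteq> s3" "s1 \<noteq> s3" by (auto simp: card_3_iff)
  define r1 r2 r3 where "r1 = s1 - of_real c" and "r2 = s2 - of_real c" and "r3 = s3 - of_real c"
  have r: "r1 \<noteq> r2" "r2 \<noteq> r3" "r3 \<noteq> r1" using Z by (auto simp: r1_def r2_def r3_def)
  have pf: "poly (cpoly d) z = (z - s1) * (z - s2) * (z - s3)" for z
  proof -
    have "cpoly d = [:-s1, 1:] * [:-s2, 1:] * [:-s3, 1:]"
      using card(3) Z by (simp add: mult.assoc del: mult_pCons_left mult_pCons_right)
    then show ?thesis by (simp add: algebra_simps)
  qed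
  have fac: "z^3 + of_real p * z + of_real g0 = (z - r1) * (z - r2) * (z - r3)" for z
  proof -
    have "z^3 + of_real p * z + of_real g0 = poly (cpoly d) (z + of_real c)"
      unfolding pdc by simp
    also have "\<dots> = (z - r1) * (z - r2) * (z - r3)"
      unfolding pf by (simp add: r1_def r2_def r3_def diff_diff_eq2 add.commute)
    finally show ?thesis .
  qed
  have "[:of_real g0, of_real p, 0, 1:] = [:-r1, 1:] * [:-r2, 1:] * [:-r3, 1:]"
  proof (rule poly_eq_poly_eq_iff[THEN iffD1], rule ext)
    fix z show "poly [:of_real g0, of_real p, 0, 1:] z = poly ([:-r1, 1:] * [:-r2, 1:] * [:-r3, 1:]) z"
      using fac[of z] by (simp add: power3_eq_cube algebra_simps)
  qed
  then have sym: "complex_of_real g0 = - (r1 * r2 * r3)" "complex_of_real p = r1 * r2 + r2 * r3 + r3 * r1" "r1 + r2 + r3 = 0"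
    by (simp_all add: algebra_simps)
  have res': "resid N d s1 = - of_real k" "resid N d s2 = - of_real k" "resid N d s3 = - of_real k"
    using res Z by (auto simp: k_def)
  define A B where "A = complex_of_real (u2 + 3 * u3 * c)" and "B = complex_of_real (3 * u3)"
  have df: "s1 - s2 = r1 - r2" "s1 - s3 = r1 - r3" "s2 - s1 = r2 - r1" "s2 - s3 = r2 - r3" "s3 - s1 = r3 - r1" "s3 - s2 = r3 - r2"
    by (simp_all add: r1_def r2_def r3_def)
  have "{s1, s2, s3} - {s1} = {s2, s3}" "{s1, s2, s3} - {s2} = {s1, s3}" "{s1, s2, s3} - {s3} = {s1, s2}" using Z by auto
  then have E: "of_real u2 + 3 * of_real u3 * s1 + (- of_real k / (s1 - s2)^3 + - of_real k / (s1 - s3)^3) = 0"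
    "of_real u2 + 3 * of_real u3 * s2 + (- of_real k / (s2 - s1)^3 + - of_real k / (s2 - s3)^3) = 0"
    "of_real u2 + 3 * of_real u3 * s3 + (- of_real k / (s3 - s1)^3 + - of_real k / (s3 - s2)^3) = 0"
    using c1[of s1] c1[of s2] c1[of s3] Z res' by auto
  have AB: "A + B * r1 = of_real u2 + 3 * of_real u3 * s1" "A + B * r2 = of_real u2 + 3 * of_real u3 * s2"
    "A + B * r3 = of_real u2 + 3 * of_real u3 * s3"
    by (simp_all add: A_def B_def r1_def r2_def r3_def algebra_simps)
  have solve: "X = K * (1 / x + 1 / y)" if "X + (- K / x + - K / y) = 0" for X K x y :: complex
  proof -
    have "X = - (- K / x + - K / y)" using that by (simp only: eq_neg_iff_add_eq_0)
    then show ?thesis by (simp add: distrib_left)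
  qed
  note e = solve[OF E(1), unfolded df, folded AB] solve[OF E(2), unfolded df, folded AB] solve[OF E(3), unfolded df, folded AB]
  note alt = root_triple_equations[OF k r sym(3) e]
  have u2: "u2 = - 3 * u3 * c" by (rule linear_coeff_eq) (use alt(1) in \<open>simp add: A_def\<close>)
  show ?thesis
  proof (cases "g0 = 0")
    case True
    have "d = [:-c, 1:] * [:c\<^sup>2 - (- p), - 2 * c, 1:]"
      unfolding dc True by (simp add: power2_eq_square power3_eq_cube algebra_simps)
    then show ?thesis using res by (rule listed_degree_3_symmetric[OF g])
  next
    case False
    then have "complex_of_real g0 \<noteq> 0" by simp
    then have "B = 0" "complex_of_real p = 0" using alt(2) sym(1,2) by auto
    then have u3: "u3 = 0" and p: "p = 0" by (simp_all add: B_def)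
    have "Q 1 t = u1 + 3 * h\<^sup>2 * (t - c) * ((t - c)^3 + 2 * (- g0)) / ((t - c)^3 - (- g0))\<^sup>2" if t: "t \<in> I" for t
    proof -
      have pd: "poly d t = (t - c)^3 + g0" for t unfolding pd p by simp
      have ne: "(t - c)^3 + g0 \<noteq> 0" using g t unfolding good_poles_def reduced_on_def pd by auto
      define M where "M = smult (-k) (pderiv d)"
      have M: "poly M t = - 3 * k * (t - c)\<^sup>2" for t
        by (simp add: M_def dc p pderiv_add pderiv_power pderiv_pCons algebra_simps)
      have 1: "poly M t / poly d t = - 3 * k * (t - c)\<^sup>2 / ((t - c)^3 + g0)" for t by (simp add: M pd)
      have 2: "((\<lambda>t. - 3 * k * (t - c)\<^sup>2 / ((t - c)^3 + g0)) has_real_derivative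
        (3 * k * (t - c) * ((t - c)^3 + 2 * (- g0)) / ((t - c)^3 - (- g0))\<^sup>2)) (at t)"
        using ne by (auto intro!: derivative_eq_intros simp: power2_eq_square power3_eq_cube algebra_simps)
      have 3: "degree M < degree d" using d by (simp add: M_def degree_pderiv)
      have 4: "poly (cpoly M) r = poly (cpoly N) r" if "pole_at d r" for r
      proof -
        have "resid N d r = - of_real k" using res[OF that] by (simp add: k_def)
        then show ?thesis using sq[OF that] by (simp add: resid_def M_def field_simps)
      qed
      have "Q 1 t = u1 + 2 * u2 * t + 3 * u3 * t\<^sup>2 + 3 * k * (t - c) * ((t - c)^3 + 2 * (- g0)) / ((t - c)^3 - (- g0))\<^sup>2"
        by (rule good_poles_deriv[OF g U disjI1[OF 3] 4 1 t 2])
      then show ?thesis unfolding u2 u3 k_def by simp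
    qed
    then show ?thesis by (rule listed_IV)
  qed
qed

lemma no_poles_if_classical:
  assumes "bezout N d" "pole_at d r" "poly (pderiv (cpoly d)) r \<noteq> 0"
  shows "resid N d r \<noteq> 0"
  using bezout_no_common_root[OF assms(1,2)] assms(3) by (simp add: resid_def)

lemma listed_generic:
  assumes g: "good_poles I Q N d" and d: "degree d \<le> 3"
    and res: "\<And>r. pole_at d r \<Longrightarrow> resid N d r = - of_real (h\<^sup>2)"
  shows "listed_potential h I (Q 1)"
proof -
  consider "degree d = 0" | "degree d = 1" | "degree d = 2" | "degree d = 3" using d by linarith
  then show ?thesis
  proof cases
    case 4
    \<comment> \<open>A pole exists, and its residue -h^2 cannot be 0 in a reduced fraction. So
      three poles occur only for h \<noteq> 0.\<close>
    have "\<not> constant (poly (cpoly d))"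
      using 4 by (simp add: constant_degree)
    then obtain r where r: "pole_at d r" using fundamental_theorem_of_algebra by blast
    then have "h \<noteq> 0"
      using no_poles_if_classical[of N d r] g res[OF r] by (auto simp: good_poles_def reduced_on_def)
    then show ?thesis using listed_degree_3[OF g 4 _ res] by blast
  qed (use listed_degree_0[OF g] listed_degree_1[OF g] listed_degree_2[OF g _ res] in blast)+
qed

section \<open>Calculus on open sets of the plane\<close>

abbreviation D1 :: "(real \<times> real \<Rightarrow> 'b::real_normed_vector) \<Rightarrow> real \<times> real \<Rightarrow> 'b" where
  "D1 f q \<equiv> frechet_derivative f (at q) (1, 0)"

abbreviation D2 :: "(real \<times> real \<Rightarrow> 'b::real_normed_vector) \<Rightarrow> real \<times> real \<Rightarrow> 'b" where
  "D2 f q \<equiv> frechet_derivative f (at q) (0, 1)"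

lemma frechet_derivative_cong_on_open:
  assumes "open S" "q \<in> S" "\<And>q. q \<in> S \<Longrightarrow> f q = g q"
  shows "frechet_derivative f (at q) = frechet_derivative g (at q)"
proof -
  have "(f has_derivative F) (at q) \<longleftrightarrow> (g has_derivative F) (at q)" for F
    using assms has_derivative_transform_within_open by (metis (no_types, lifting))
  then show ?thesis by (simp add: frechet_derivative_def)
qed

lemma differentiable_cong_on_open:
  assumes "open S" "q \<in> S" "\<And>q. q \<in> S \<Longrightarrow> f q = g q" "f differentiable (at q)"
  shows "g differentiable (at q)"
  using assms has_derivative_transform_within_open unfolding differentiable_def by (metis (no_types, lifting))

lemma differentiable_times_on_cong:
  assumes "open S" "\<And>q. q \<in> S \<Longrightarrow> f q = g q" "differentiable_times_on k S f"
  shows "differentiable_times_on k S g"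
  using assms(2,3)
proof (induction k arbitrary: f g)
  case 0
  then show ?case by (simp cong: continuous_on_cong)
next
  case (Suc k)
  have "differentiable_times_on k S (\<lambda>x. frechet_derivative g (at x) v)" for v
    by (rule Suc.IH[of "\<lambda>x. frechet_derivative f (at x) v"])
      (use Suc.prems frechet_derivative_cong_on_open[OF assms(1) _ Suc.prems(1)] in auto)
  then show ?case
    using Suc.prems differentiable_cong_on_open[OF assms(1) _ Suc.prems(1)] by auto
qed

lemma smooth_on_cong:
  "open S \<Longrightarrow> (\<And>q. q \<in> S \<Longrightarrow> f q = g q) \<Longrightarrow> smooth_on S f \<Longrightarrow> smooth_on S g"
  unfolding smooth_on_def using differentiable_times_on_cong by blast

lemma smooth_on_differentiable: "smooth_on S f \<Longrightarrow> q \<in> S \<Longrightarrow> f differentiable (at q)"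
  unfolding smooth_on_def by (metis differentiable_times_on.simps(2))

lemma smooth_on_has_derivative:
  "smooth_on S f \<Longrightarrow> q \<in> S \<Longrightarrow> (f has_derivative frechet_derivative f (at q)) (at q)"
  using smooth_on_differentiable frechet_derivative_works by blast

lemma smooth_on_frechet: "smooth_on S f \<Longrightarrow> smooth_on S (\<lambda>q. frechet_derivative f (at q) v)"
  unfolding smooth_on_def by (metis differentiable_times_on.simps(2))

lemma smooth_on_continuous: "smooth_on S f \<Longrightarrow> continuous_on S f"
  unfolding smooth_on_def by (metis differentiable_times_on.simps(1))

text \<open>Induction on the number of derivatives with f generalised: a directional derivative of L
  o f is L applied to the one of f, again of the same shape.\<close>

lemma smooth_on_linear:
  assumes S: "open S" and f: "smooth_on S f" and L: "bounded_linear L"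
  shows "smooth_on S (\<lambda>q. L (f q))"
proof -
  have "differentiable_times_on k S (\<lambda>q. L (f q))" if "differentiable_times_on k S f" for k
    using that
  proof (induction k arbitrary: f)
    case 0
    then show ?case using L bounded_linear.continuous_on by auto
  next
    case (Suc k)
    have d: "((\<lambda>q. L (f q)) has_derivative (\<lambda>v. L (frechet_derivative f (at q) v))) (at q)" if "q \<in> S" for q
      using Suc.prems that frechet_derivative_works bounded_linear.has_derivative[OF L] by fastforce
    have "differentiable_times_on k S (\<lambda>q. frechet_derivative (\<lambda>q. L (f q)) (at q) v)" for v
    proof (rule differentiable_times_on_cong[OF S _ Suc.IH])
      show "differentiable_times_on k S (\<lambda>q. frechet_derivative f (at q) v)"
        using Suc.prems by simp
      show "L (frechet_derivative f (at q) v) = frechet_derivative (\<lambda>q. L (f q)) (at q) v" if "q \<in> S" for q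
        using frechet_derivative_at[OF d[OF that]] by metis
    qed
    then show ?case using d differentiableI by fastforce
  qed
  then show ?thesis using f by (simp add: smooth_on_def)
qed

lemma smooth_on_add:
  assumes S: "open S" and f: "smooth_on S f" and g: "smooth_on S g"
  shows "smooth_on S (\<lambda>q. f q + g q)"
proof -
  have "differentiable_times_on k S (\<lambda>q. f q + g q)"
    if "differentiable_times_on k S f" "differentiable_times_on k S g" for k
    using that
  proof (induction k arbitrary: f g)
    case 0
    then show ?case by (simp add: continuous_on_add)
  next
    case (Suc k)
    have d: "((\<lambda>q. f q + g q) has_derivative (\<lambda>v. frechet_derivative f (at q) v + frechet_derivative g (at q) v)) (at q)"
      if "q \<in> S" for q
      using Suc.prems that by (intro has_derivative_add) (auto simp flip: frechet_derivative_works)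
    have "differentiable_times_on k S (\<lambda>q. frechet_derivative (\<lambda>q. f q + g q) (at q) v)" for v
    proof (rule differentiable_times_on_cong[OF S _ Suc.IH])
      show "differentiable_times_on k S (\<lambda>q. frechet_derivative f (at q) v)"
        "differentiable_times_on k S (\<lambda>q. frechet_derivative g (at q) v)"
        using Suc.prems by simp_all
      show "frechet_derivative f (at q) v + frechet_derivative g (at q) v
          = frechet_derivative (\<lambda>q. f q + g q) (at q) v" if "q \<in> S" for q
        using frechet_derivative_at[OF d[OF that]] by metis
    qed
    then show ?case using d differentiableI by fastforce
  qed
  then show ?thesis using f g by (simp add: smooth_on_def)
qed

lemma frechet_add:
  assumes "smooth_on S f" "smooth_on S g" "q \<in> S"
  shows "frechet_derivative (\<lambda>q. f q + g q) (at q) v = frechet_derivative f (at q) v + frechet_derivative g (at q) v"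
  using frechet_derivative_at[OF has_derivative_add[OF smooth_on_has_derivative[OF assms(1,3)] smooth_on_has_derivative[OF assms(2,3)]]]
  by metis

lemma frechet_linear:
  assumes "smooth_on S f" "bounded_linear L" "q \<in> S"
  shows "frechet_derivative (\<lambda>q. L (f q)) (at q) v = L (frechet_derivative f (at q) v)"
  using frechet_derivative_at[OF bounded_linear.has_derivative[OF assms(2) smooth_on_has_derivative[OF assms(1,3)]]]
  by metis

lemma has_derivative_D1:
  fixes f :: "real \<times> real \<Rightarrow> real"
  assumes "f differentiable (at (x, y))"
  shows "((\<lambda>t. f (t, y)) has_real_derivative D1 f (x, y)) (at x)"
proof -
  have f: "(f has_derivative frechet_derivative f (at (x, y))) (at (x, y))"
    using assms frechet_derivative_works by blast
  have "((\<lambda>t. (t, y)) has_derivative (\<lambda>t. (t, 0))) (at x)"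
    by (intro has_derivative_Pair has_derivative_ident has_derivative_const)
  from has_derivative_compose[OF this f]
  have "((\<lambda>t. f (t, y)) has_derivative (\<lambda>t. frechet_derivative f (at (x, y)) (t, 0))) (at x)" .
  moreover have "(\<lambda>t. frechet_derivative f (at (x, y)) (t, 0)) = (\<lambda>t. D1 f (x, y) * t)"
  proof
    fix t
    show "frechet_derivative f (at (x, y)) (t, 0) = D1 f (x, y) * t"
      using linear_scale[OF has_derivative_linear[OF f], of t "(1, 0)"] by simp
  qed
  ultimately show ?thesis unfolding has_field_derivative_def by argo
qed

lemma has_derivative_D2:
  fixes f :: "real \<times> real \<Rightarrow> real"
  assumes "f differentiable (at (x, y))"
  shows "((\<lambda>t. f (x, t)) has_real_derivative D2 f (x, y)) (at y)"
proof -
  have f: "(f has_derivative frechet_derivative f (at (x, y))) (at (x, y))"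
    using assms frechet_derivative_works by blast
  have "((\<lambda>t. (x, t)) has_derivative (\<lambda>t. (0, t))) (at y)"
    by (intro has_derivative_Pair has_derivative_ident has_derivative_const)
  from has_derivative_compose[OF this f]
  have "((\<lambda>t. f (x, t)) has_derivative (\<lambda>t. frechet_derivative f (at (x, y)) (0, t))) (at y)" .
  moreover have "(\<lambda>t. frechet_derivative f (at (x, y)) (0, t)) = (\<lambda>t. D2 f (x, y) * t)"
  proof
    fix t
    show "frechet_derivative f (at (x, y)) (0, t) = D2 f (x, y) * t"
      using linear_scale[OF has_derivative_linear[OF f], of t "(0, 1)"] by simp
  qed
  ultimately show ?thesis unfolding has_field_derivative_def by argo
qed

section \<open>Symmetry of second partial derivatives\<close>

lemma mixed_difference:
  fixes f :: "real \<times> real \<Rightarrow> real"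
  assumes box: "{x..x + e} \<times> {y..y + e} \<subseteq> S" and e: "0 < e"
    and f: "smooth_on S f"
  obtains \<xi> \<eta> where "\<xi> \<in> {x..x + e}" "\<eta> \<in> {y..y + e}"
    "f (x + e, y + e) - f (x, y + e) - f (x + e, y) + f (x, y) = e * (e * D2 (\<lambda>q. D1 f q) (\<xi>, \<eta>))"
proof -
  have d1: "((\<lambda>t. f (t, v)) has_real_derivative D1 f (u, v)) (at u)" if "u \<in> {x..x + e}" "v \<in> {y..y + e}" for u v
    by (rule has_derivative_D1, rule smooth_on_differentiable[OF f]) (use box that in blast)
  have d2: "((\<lambda>t. D1 f (u, t)) has_real_derivative D2 (\<lambda>q. D1 f q) (u, v)) (at v)" if "u \<in> {x..x + e}" "v \<in> {y..y + e}" for u v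
    by (rule has_derivative_D2, rule smooth_on_differentiable[OF smooth_on_frechet[OF f]]) (use box that in blast)
  have "\<exists>\<xi>. x < \<xi> \<and> \<xi> < x + e \<and> (f (x + e, y + e) - f (x + e, y)) - (f (x, y + e) - f (x, y))
     = (x + e - x) * (D1 f (\<xi>, y + e) - D1 f (\<xi>, y))"
    by (rule MVT2) (use e in \<open>auto intro!: DERIV_diff d1\<close>)
  then obtain \<xi> where \<xi>: "x < \<xi>" "\<xi> < x + e" "(f (x + e, y + e) - f (x + e, y)) - (f (x, y + e) - f (x, y))
     = e * (D1 f (\<xi>, y + e) - D1 f (\<xi>, y))" by auto
  have "\<exists>\<eta>. y < \<eta> \<and> \<eta> < y + e \<and> D1 f (\<xi>, y + e) - D1 f (\<xi>, y) = (y + e - y) * D2 (\<lambda>q. D1 f q) (\<xi>, \<eta>)"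
    by (rule MVT2) (use e \<xi> in \<open>auto intro!: d2\<close>)
  then obtain \<eta> where \<eta>: "y < \<eta>" "\<eta> < y + e" "D1 f (\<xi>, y + e) - D1 f (\<xi>, y) = e * D2 (\<lambda>q. D1 f q) (\<xi>, \<eta>)" by auto
  show thesis
    by (rule that[of \<xi> \<eta>]) (use \<xi> \<eta> in auto)
qed

lemma mixed_difference':
  fixes f :: "real \<times> real \<Rightarrow> real"
  assumes box: "{x..x + e} \<times> {y..y + e} \<subseteq> S" and e: "0 < e"
    and f: "smooth_on S f"
  obtains \<xi> \<eta> where "\<xi> \<in> {x..x + e}" "\<eta> \<in> {y..y + e}"
    "f (x + e, y + e) - f (x, y + e) - f (x + e, y) + f (x, y) = e * (e * D1 (\<lambda>q. D2 f q) (\<xi>, \<eta>))"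
proof -
  have d1: "((\<lambda>t. f (u, t)) has_real_derivative D2 f (u, v)) (at v)" if "u \<in> {x..x + e}" "v \<in> {y..y + e}" for u v
    by (rule has_derivative_D2, rule smooth_on_differentiable[OF f]) (use box that in blast)
  have d2: "((\<lambda>t. D2 f (t, v)) has_real_derivative D1 (\<lambda>q. D2 f q) (u, v)) (at u)" if "u \<in> {x..x + e}" "v \<in> {y..y + e}" for u v
    by (rule has_derivative_D1, rule smooth_on_differentiable[OF smooth_on_frechet[OF f]]) (use box that in blast)
  have "\<exists>\<eta>. y < \<eta> \<and> \<eta> < y + e \<and> (f (x + e, y + e) - f (x, y + e)) - (f (x + e, y) - f (x, y))
     = (y + e - y) * (D2 f (x + e, \<eta>) - D2 f (x, \<eta>))"
    by (rule MVT2) (use e in \<open>auto intro!: DERIV_diff d1\<close>)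
  then obtain \<eta> where \<eta>: "y < \<eta>" "\<eta> < y + e" "(f (x + e, y + e) - f (x, y + e)) - (f (x + e, y) - f (x, y))
     = e * (D2 f (x + e, \<eta>) - D2 f (x, \<eta>))" by auto
  have "\<exists>\<xi>. x < \<xi> \<and> \<xi> < x + e \<and> D2 f (x + e, \<eta>) - D2 f (x, \<eta>) = (x + e - x) * D1 (\<lambda>q. D2 f q) (\<xi>, \<eta>)"
    by (rule MVT2) (use e \<eta> in \<open>auto intro!: d2\<close>)
  then obtain \<xi> where \<xi>: "x < \<xi>" "\<xi> < x + e" "D2 f (x + e, \<eta>) - D2 f (x, \<eta>) = e * D1 (\<lambda>q. D2 f q) (\<xi>, \<eta>)" by auto
  show thesis
    by (rule that[of \<xi> \<eta>]) (use \<xi> \<eta> in auto)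
qed

text \<open>The second difference of f over a small square equals e^2 times either mixed derivative,
  each taken at some point of the square. If the two differed at q, continuity would keep them apart
  on small squares.\<close>

lemma D1_D2_commute:
  fixes f :: "real \<times> real \<Rightarrow> real"
  assumes S: "open S" and f: "smooth_on S f" and q: "q \<in> S"
  shows "D1 (\<lambda>q. D2 f q) q = D2 (\<lambda>q. D1 f q) q"
proof (rule ccontr)
  obtain x y where xy: "q = (x, y)" by (cases q)
  define A B where "A = (\<lambda>q. D1 (\<lambda>q. D2 f q) q)" and "B = (\<lambda>q. D2 (\<lambda>q. D1 f q) q)"
  assume "D1 (\<lambda>q. D2 f q) q \<noteq> D2 (\<lambda>q. D1 f q) q"
  then have ne: "0 < \<bar>A q - B q\<bar>" by (simp add: A_def B_def)
  have cA: "continuous_on S A" and cB: "continuous_on S B"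
    unfolding A_def B_def using smooth_on_continuous smooth_on_frechet f by blast+
  have "continuous (at q) A" "continuous (at q) B"
    using cA cB S q by (auto simp: continuous_on_eq_continuous_at)
  then have "\<exists>d>0. \<forall>z. dist z q < d \<longrightarrow> dist (A z) (A q) < \<bar>A q - B q\<bar> / 2"
    "\<exists>d>0. \<forall>z. dist z q < d \<longrightarrow> dist (B z) (B q) < \<bar>A q - B q\<bar> / 2"
    unfolding continuous_at_eps_delta using half_gt_zero[OF ne] by blast+
  then obtain d1 d2 where d1: "d1 > 0" "\<And>z. dist z q < d1 \<Longrightarrow> dist (A z) (A q) < \<bar>A q - B q\<bar> / 2"
    and d2: "d2 > 0" "\<And>z. dist z q < d2 \<Longrightarrow> dist (B z) (B q) < \<bar>A q - B q\<bar> / 2"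
    by blast
  obtain d3 where d3: "d3 > 0" "ball q d3 \<subseteq> S" using S q open_contains_ball by blast
  \<comment> \<open>Points of the square of side e are less than 4 e away from its corner q, so that
    the square lies within all three radii.\<close>
  define e where "e = min d1 (min d2 d3) / 4"
  have e: "0 < e" "4 * e \<le> d1" "4 * e \<le> d2" "4 * e \<le> d3" using d1 d2 d3 by (auto simp: e_def)
  have near: "dist (u, v) q < 4 * e" if "u \<in> {x..x + e}" "v \<in> {y..y + e}" for u v
  proof -
    have "dist (u, v) q \<le> \<bar>u - x\<bar> + \<bar>v - y\<bar>"
      unfolding xy dist_prod_def dist_real_def by (simp add: sqrt_sum_squares_le_sum_abs)
    also have "\<dots> < 4 * e" using that e(1) by auto
    finally show ?thesis .
  qed
  have box: "{x..x + e} \<times> {y..y + e} \<subseteq> S"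
    using near e d3 by (force simp: dist_commute)
  obtain a b where ab: "a \<in> {x..x + e}" "b \<in> {y..y + e}"
    "f (x + e, y + e) - f (x, y + e) - f (x + e, y) + f (x, y) = e * (e * B (a, b))"
    using mixed_difference[OF box e(1) f] unfolding B_def by metis
  obtain a' b' where ab': "a' \<in> {x..x + e}" "b' \<in> {y..y + e}"
    "f (x + e, y + e) - f (x, y + e) - f (x + e, y) + f (x, y) = e * (e * A (a', b'))"
    using mixed_difference'[OF box e(1) f] unfolding A_def by metis
  have eq: "A (a', b') = B (a, b)" using ab(3) ab'(3) e(1) by simp
  have l1: "\<bar>B (a, b) - A q\<bar> < \<bar>A q - B q\<bar> / 2"
    using d1(2)[of "(a', b')"] near[OF ab'(1,2)] e unfolding eq dist_real_def by simp
  have l2: "\<bar>B (a, b) - B q\<bar> < \<bar>A q - B q\<bar> / 2"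
    using d2(2)[of "(a, b)"] near[OF ab(1,2)] e unfolding dist_real_def by simp
  have "\<bar>A q - B q\<bar> \<le> \<bar>B (a, b) - A q\<bar> + \<bar>B (a, b) - B q\<bar>"
    by linarith
  from le_less_trans[OF this add_strict_mono[OF l1 l2]] show False by simp
qed

section \<open>Coefficients of observables\<close>

lemma lookup_component: "Poly_Mapping.lookup (component d f) k = (if fst k + snd k = d then Poly_Mapping.lookup f k else 0)"
proof -
  have fin: "finite {k \<in> Poly_Mapping.keys f. fst k + snd k = d}" by simp
  have "Poly_Mapping.lookup (component d f) k
      = (\<Sum>l\<in>{k \<in> Poly_Mapping.keys f. fst k + snd k = d}. if l = k then Poly_Mapping.lookup f l else 0)"
    unfolding component_def lookup_sum by (rule sum.cong) (auto simp: lookup_single when_def)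
  also have "\<dots> = (if fst k + snd k = d then Poly_Mapping.lookup f k else 0)"
    using fin by (auto simp: sum.delta in_keys_iff)
  finally show ?thesis .
qed

lemma sum_fun_apply: "(\<Sum>x\<in>A. f x) q = (\<Sum>x\<in>A. f x q)" for f :: "'a \<Rightarrow> 'b \<Rightarrow> 'c::comm_monoid_add"
  by (induction A rule: infinite_finite_induct) auto

lemma frechet_derivative_zero: "frechet_derivative (0 :: real \<times> real \<Rightarrow> complex) (at q) v = 0"
proof -
  have "((0 :: real \<times> real \<Rightarrow> complex) has_derivative (\<lambda>v. 0)) (at q)"
    unfolding zero_fun_def by (rule has_derivative_const)
  from frechet_derivative_at[OF this] show ?thesis by metis
qed

lemma lookup_dq1: "Poly_Mapping.lookup (dq1 f) k = D1 (Poly_Mapping.lookup f k)"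
proof (cases "Poly_Mapping.lookup f k = 0")
  case True
  show ?thesis unfolding dq1_def Poly_Mapping.map.rep_eq True by (rule ext) (simp add: frechet_derivative_zero)
qed (simp add: dq1_def Poly_Mapping.map.rep_eq)

lemma lookup_dq2: "Poly_Mapping.lookup (dq2 f) k = D2 (Poly_Mapping.lookup f k)"
proof (cases "Poly_Mapping.lookup f k = 0")
  case True
  show ?thesis unfolding dq2_def Poly_Mapping.map.rep_eq True by (rule ext) (simp add: frechet_derivative_zero)
qed (simp add: dq2_def Poly_Mapping.map.rep_eq)

lemma lookup_dp1: "Poly_Mapping.lookup (dp1 f) (i, j) q = of_nat (i + 1) * Poly_Mapping.lookup f (i + 1, j) q"
proof -
  have "Poly_Mapping.lookup (dp1 f) (i, j) q
      = (\<Sum>k\<in>Poly_Mapping.keys f. if k = (i + 1, j) then of_nat (i + 1) * Poly_Mapping.lookup f (i + 1, j) q else 0)"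
    unfolding dp1_def lookup_sum sum_fun_apply
  proof (rule sum.cong)
    fix k assume "k \<in> Poly_Mapping.keys f"
    show "Poly_Mapping.lookup (case k of (a, b) \<Rightarrow> Poly_Mapping.single (a - 1, b) (\<lambda>q. of_nat a * Poly_Mapping.lookup f (a, b) q)) (i, j) q
      = (if k = (i + 1, j) then of_nat (i + 1) * Poly_Mapping.lookup f (i + 1, j) q else 0)"
      by (cases k; cases "fst k") (auto simp: lookup_single when_def)
  qed simp
  also have "\<dots> = of_nat (i + 1) * Poly_Mapping.lookup f (i + 1, j) q"
    by (auto simp: sum.delta in_keys_iff)
  finally show ?thesis .
qed

lemma lookup_dp2: "Poly_Mapping.lookup (dp2 f) (i, j) q = of_nat (j + 1) * Poly_Mapping.lookup f (i, j + 1) q"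
proof -
  have "Poly_Mapping.lookup (dp2 f) (i, j) q
      = (\<Sum>k\<in>Poly_Mapping.keys f. if k = (i, j + 1) then of_nat (j + 1) * Poly_Mapping.lookup f (i, j + 1) q else 0)"
    unfolding dp2_def lookup_sum sum_fun_apply
  proof (rule sum.cong)
    fix k assume "k \<in> Poly_Mapping.keys f"
    show "Poly_Mapping.lookup (case k of (a, b) \<Rightarrow> Poly_Mapping.single (a, b - 1) (\<lambda>q. of_nat b * Poly_Mapping.lookup f (a, b) q)) (i, j) q
      = (if k = (i, j + 1) then of_nat (j + 1) * Poly_Mapping.lookup f (i, j + 1) q else 0)"
      by (cases k; cases "snd k") (auto simp: lookup_single when_def)
  qed simp
  also have "\<dots> = of_nat (j + 1) * Poly_Mapping.lookup f (i, j + 1) q"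
    by (auto simp: sum.delta in_keys_iff)
  finally show ?thesis .
qed

lemma lookup_single_times:
  fixes f :: observable
  shows "Poly_Mapping.lookup (Poly_Mapping.single (a, b) c * f) (i, j) q
    = (if a \<le> i \<and> b \<le> j then c q * Poly_Mapping.lookup f (i - a, j - b) q else 0)"
proof -
  have f: "f = (\<Sum>k\<in>Poly_Mapping.keys f. Poly_Mapping.single k (Poly_Mapping.lookup f k))"
    by (rule poly_mapping_eqI) (auto simp: lookup_sum lookup_single when_def sum.delta in_keys_iff)
  have "Poly_Mapping.lookup (Poly_Mapping.single (a, b) c * f) (i, j) q
      = (\<Sum>k\<in>Poly_Mapping.keys f. if k = (i - a, j - b) \<and> a \<le> i \<and> b \<le> j then c q * Poly_Mapping.lookup f (i - a, j - b) q else 0)"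
    apply (subst f)
    unfolding sum_distrib_left mult_single lookup_sum sum_fun_apply
    by (rule sum.cong) (auto simp: lookup_single when_def)
  also have "\<dots> = (if a \<le> i \<and> b \<le> j then c q * Poly_Mapping.lookup f (i - a, j - b) q else 0)"
    by (auto simp: sum.delta in_keys_iff)
  finally show ?thesis .
qed

lemma lookup_coord_times: "Poly_Mapping.lookup (coord c * f) k q = c q * Poly_Mapping.lookup f k q"
  unfolding coord_def by (cases k) (simp add: lookup_single_times)

lemma lookup_const_times: "Poly_Mapping.lookup (const c * f) k q = c * Poly_Mapping.lookup f k q"
  by (simp add: const_def lookup_coord_times)

abbreviation lk :: "observable \<Rightarrow> nat \<Rightarrow> nat \<Rightarrow> real \<times> real \<Rightarrow> complex" where
  "lk f i j \<equiv> Poly_Mapping.lookup f (i, j)"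

subsection \<open>The bracket with a separable Hamiltonian\<close>

lemma p1_power: "p1 ^ i = Poly_Mapping.single (i, 0) 1"
proof (induction i)
  case 0
  have "(0, 0) = (0 :: nat \<times> nat)" by (simp add: zero_prod_def)
  then show ?case by (simp only: power_0 single_one)
next
  case (Suc i)
  have "Poly_Mapping.single (1, 0) (1 :: real \<times> real \<Rightarrow> complex) * Poly_Mapping.single (i, 0) 1
      = Poly_Mapping.single ((1, 0) + (i, 0)) (1 * 1)"
    by (rule mult_single)
  then have "p1 * Poly_Mapping.single (i, 0) 1 = Poly_Mapping.single (Suc i, 0) 1"
    by (simp only: p1_def mult_1_left add_Pair plus_1_eq_Suc add_0_left)
  then show ?case by (simp only: power_Suc Suc)
qed

lemma p2_power: "p2 ^ i = Poly_Mapping.single (0, i) 1"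
proof (induction i)
  case 0
  have "(0, 0) = (0 :: nat \<times> nat)" by (simp add: zero_prod_def)
  then show ?case by (simp only: power_0 single_one)
next
  case (Suc i)
  have "Poly_Mapping.single (0, 1) (1 :: real \<times> real \<Rightarrow> complex) * Poly_Mapping.single (0, i) 1
      = Poly_Mapping.single ((0, 1) + (0, i)) (1 * 1)"
    by (rule mult_single)
  then have "p2 * Poly_Mapping.single (0, i) 1 = Poly_Mapping.single (0, Suc i) 1"
    by (simp only: p2_def mult_1_left add_Pair plus_1_eq_Suc add_0_left)
  then show ?case by (simp only: power_Suc Suc)
qed

definition pot :: "(real \<Rightarrow> real) \<Rightarrow> (real \<Rightarrow> real) \<Rightarrow> real \<times> real \<Rightarrow> complex" where
  "pot V1 V2 q = of_real (V1 (fst q)) + of_real (V2 (snd q))"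

lemma lookup_H: "lk (H1 V1 + H2 V2) i j =
   (if (i, j) = (2, 0) \<or> (i, j) = (0, 2) then (\<lambda>q. 1/2) else if (i, j) = (0, 0) then pot V1 V2 else 0)"
proof
  fix q
  show "lk (H1 V1 + H2 V2) i j q = (if (i, j) = (2, 0) \<or> (i, j) = (0, 2) then (\<lambda>q. 1/2) else if (i, j) = (0, 0) then pot V1 V2 else 0) q"
    unfolding H1_def H2_def lookup_add plus_fun_apply lookup_const_times p1_power p2_power coord_def
    by (auto simp: lookup_single when_def pot_def)
qed

lemma lookup_dq: "Poly_Mapping.lookup (dq (s, t) f) k = (D1 ^^ s) ((D2 ^^ t) (Poly_Mapping.lookup f k))"
proof -
  have 1: "Poly_Mapping.lookup ((dq1 ^^ s) g) k = (D1 ^^ s) (Poly_Mapping.lookup g k)" for g s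
    by (induction s) (simp_all add: lookup_dq1)
  have 2: "Poly_Mapping.lookup ((dq2 ^^ t) g) k = (D2 ^^ t) (Poly_Mapping.lookup g k)" for g t
    by (induction t) (simp_all add: lookup_dq2)
  show ?thesis by (simp add: dq_def 1 2)
qed

lemma lookup_dp: "lk (dp (s, t) f) i j q = fact (i + s) / fact i * (fact (j + t) / fact j) * lk f (i + s) (j + t) q"
proof -
  have 1: "lk ((dp1 ^^ s) g) i j q = fact (i + s) / fact i * lk g (i + s) j q" for g i j s
  proof (induction s arbitrary: i)
    case (Suc s)
    have "of_nat (i + 1) * (fact (i + 1 + s) / fact (i + 1)) = (fact (i + Suc s) / fact i :: complex)"
      by (simp del: of_nat_Suc)
    then have "of_nat (i + 1) * (fact (i + 1 + s) / fact (i + 1) * lk g (i + 1 + s) j q) = fact (i + Suc s) / fact i * lk g (i + 1 + s) j q"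
      by (simp only: mult.assoc[symmetric])
    then show ?case by (simp only: funpow.simps o_apply lookup_dp1 Suc.IH add_Suc add_Suc_right One_nat_def add_0_right)
  qed simp
  have 2: "lk ((dp2 ^^ t) g) i j q = fact (j + t) / fact j * lk g i (j + t) q" for g i j t
  proof (induction t arbitrary: j)
    case (Suc t)
    have "of_nat (j + 1) * (fact (j + 1 + t) / fact (j + 1)) = (fact (j + Suc t) / fact j :: complex)"
      by (simp del: of_nat_Suc)
    then have "of_nat (j + 1) * (fact (j + 1 + t) / fact (j + 1) * lk g i (j + 1 + t) q) = fact (j + Suc t) / fact j * lk g i (j + 1 + t) q"
      by (simp only: mult.assoc[symmetric])
    then show ?case by (simp only: funpow.simps o_apply lookup_dp2 Suc.IH add_Suc add_Suc_right One_nat_def add_0_right)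
  qed simp
  show ?thesis by (simp add: dp_def 1 2)
qed

lemma D_const: "D1 (\<lambda>q. c) = 0" "D2 (\<lambda>q. c) = 0" for c :: complex
  by (auto simp: fun_eq_iff)

lemma D_iter_zero: "(D1 ^^ s) (0 :: real \<times> real \<Rightarrow> complex) = 0" "(D2 ^^ s) (0 :: real \<times> real \<Rightarrow> complex) = 0"
  by (induction s) (simp_all add: frechet_derivative_zero flip: zero_fun_def)

text \<open>The kinetic terms have constant coefficients, so every position derivative leaves only
  the potential.\<close>

lemma dq_H:
  assumes "s + t \<ge> 1"
  shows "dq (s, t) (H1 V1 + H2 V2) = coord ((D1 ^^ s) ((D2 ^^ t) (pot V1 V2)))"
proof (rule poly_mapping_eqI)
  fix k :: "nat \<times> nat"
  obtain i j where k: "k = (i, j)" by (cases k)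
  have c: "(D1 ^^ s) ((D2 ^^ t) (\<lambda>q. 1/2)) = (0 :: real \<times> real \<Rightarrow> complex)"
  proof (cases t)
    case 0
    then obtain s' where "s = Suc s'" using assms by (cases s) auto
    then show ?thesis using 0 by (simp add: funpow_Suc_right D_const D_iter_zero D_iter_zero[unfolded zero_fun_def] fun_eq_iff del: funpow.simps(2))
  next
    case (Suc t')
    then show ?thesis by (simp add: funpow_Suc_right D_const D_iter_zero D_iter_zero[unfolded zero_fun_def] fun_eq_iff del: funpow.simps(2))
  qed
  show "Poly_Mapping.lookup (dq (s, t) (H1 V1 + H2 V2)) k = Poly_Mapping.lookup (coord ((D1 ^^ s) ((D2 ^^ t) (pot V1 V2)))) k"
    unfolding k lookup_dq lookup_H coord_def by (auto simp: c lookup_single when_def D_iter_zero)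
qed

text \<open>A chain of successive derivatives is given as data, so that high derivatives of the
  potentials stay plain functions of one variable in all formulas.\<close>

definition all_derivs :: "real set \<Rightarrow> (nat \<Rightarrow> real \<Rightarrow> real) \<Rightarrow> bool" where
  "all_derivs I v \<longleftrightarrow> (\<forall>k. \<forall>x\<in>I. (v k has_real_derivative v (Suc k) x) (at x))"

lemma D_fst:
  assumes "(g has_real_derivative g') (at (fst q))"
  shows "D1 (\<lambda>q. complex_of_real (g (fst q))) q = of_real g'" "D2 (\<lambda>q. complex_of_real (g (fst q))) q = 0"
proof -
  have "(g has_derivative (\<lambda>t. g' * t)) (at (fst q))" using assms by (simp add: has_field_derivative_def)
  from has_derivative_compose[OF has_derivative_fst[OF has_derivative_ident] this]
  have "((\<lambda>q. g (fst q)) has_derivative (\<lambda>v. g' * fst v)) (at q)" .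
  from bounded_linear.has_derivative[OF bounded_linear_of_real this]
  have "((\<lambda>q. complex_of_real (g (fst q))) has_derivative (\<lambda>v. of_real (g' * fst v))) (at q)" .
  from frechet_derivative_at[OF this, symmetric]
  show "D1 (\<lambda>q. complex_of_real (g (fst q))) q = of_real g'" "D2 (\<lambda>q. complex_of_real (g (fst q))) q = 0"
    by simp_all
qed

lemma D_snd:
  assumes "(g has_real_derivative g') (at (snd q))"
  shows "D2 (\<lambda>q. complex_of_real (g (snd q))) q = of_real g'" "D1 (\<lambda>q. complex_of_real (g (snd q))) q = 0"
proof -
  have "(g has_derivative (\<lambda>t. g' * t)) (at (snd q))" using assms by (simp add: has_field_derivative_def)
  from has_derivative_compose[OF has_derivative_snd[OF has_derivative_ident] this]
  have "((\<lambda>q. g (snd q)) has_derivative (\<lambda>v. g' * snd v)) (at q)" .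
  from bounded_linear.has_derivative[OF bounded_linear_of_real this]
  have "((\<lambda>q. complex_of_real (g (snd q))) has_derivative (\<lambda>v. of_real (g' * snd v))) (at q)" .
  from frechet_derivative_at[OF this, symmetric]
  show "D2 (\<lambda>q. complex_of_real (g (snd q))) q = of_real g'" "D1 (\<lambda>q. complex_of_real (g (snd q))) q = 0"
    by simp_all
qed

lemma D_pot:
  assumes "(V1 has_real_derivative v1') (at (fst q))" "(V2 has_real_derivative v2') (at (snd q))"
  shows "D1 (pot V1 V2) q = of_real v1'" "D2 (pot V1 V2) q = of_real v2'"
proof -
  have "(V1 has_derivative (\<lambda>t. v1' * t)) (at (fst q))" "(V2 has_derivative (\<lambda>t. v2' * t)) (at (snd q))"
    using assms by (simp_all add: has_field_derivative_def)
  from has_derivative_compose[OF has_derivative_fst[OF has_derivative_ident] this(1)]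
    has_derivative_compose[OF has_derivative_snd[OF has_derivative_ident] this(2)]
  have "((\<lambda>q. V1 (fst q)) has_derivative (\<lambda>v. v1' * fst v)) (at q)" "((\<lambda>q. V2 (snd q)) has_derivative (\<lambda>v. v2' * snd v)) (at q)" .
  from has_derivative_add[OF bounded_linear.has_derivative[OF bounded_linear_of_real this(1)]
      bounded_linear.has_derivative[OF bounded_linear_of_real this(2)]]
  have "(pot V1 V2 has_derivative (\<lambda>v. of_real (v1' * fst v) + of_real (v2' * snd v))) (at q)"
    unfolding pot_def .
  from frechet_derivative_at[OF this, symmetric]
  show "D1 (pot V1 V2) q = of_real v1'" "D2 (pot V1 V2) q = of_real v2'" by simp_all
qed

lemma D_iter_pot:
  assumes S: "open (I1 \<times> I2)" and v1: "all_derivs I1 v1" and v2: "all_derivs I2 v2"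
    and q: "q \<in> I1 \<times> I2" and st: "s + t \<ge> 1"
  shows "(D1 ^^ s) ((D2 ^^ t) (pot (v1 0) (v2 0))) q
     = (if t = 0 then of_real (v1 s (fst q)) else if s = 0 then of_real (v2 t (snd q)) else 0)"
proof -
  have d1: "(v1 k has_real_derivative v1 (Suc k) (fst q)) (at (fst q))" if "q \<in> I1 \<times> I2" for k q
    using v1 that by (auto simp: all_derivs_def)
  have d2: "(v2 k has_real_derivative v2 (Suc k) (snd q)) (at (snd q))" if "q \<in> I1 \<times> I2" for k q
    using v2 that by (auto simp: all_derivs_def)
  note cong = frechet_derivative_cong_on_open[OF S]
  have A: "(D2 ^^ Suc t) (pot (v1 0) (v2 0)) q = of_real (v2 (Suc t) (snd q))" if "q \<in> I1 \<times> I2" for q t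
    using that
  proof (induction t arbitrary: q)
    case 0
    then show ?case using D_pot(2)[OF d1 d2, of q 0 0] by simp
  next
    case (Suc t)
    have "(D2 ^^ Suc (Suc t)) (pot (v1 0) (v2 0)) q = D2 ((D2 ^^ Suc t) (pot (v1 0) (v2 0))) q" by simp
    also have "\<dots> = D2 (\<lambda>q. complex_of_real (v2 (Suc t) (snd q))) q"
      using cong[OF Suc.prems Suc.IH] by simp
    also have "\<dots> = of_real (v2 (Suc (Suc t)) (snd q))" by (rule D_snd(1)[OF d2[OF Suc.prems]])
    finally show ?case .
  qed
  have B: "(D1 ^^ Suc s) (pot (v1 0) (v2 0)) q = of_real (v1 (Suc s) (fst q))" if "q \<in> I1 \<times> I2" for q s
    using that
  proof (induction s arbitrary: q)
    case 0
    then show ?case using D_pot(1)[OF d1 d2, of q 0 0] by simp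
  next
    case (Suc s)
    have "(D1 ^^ Suc (Suc s)) (pot (v1 0) (v2 0)) q = D1 ((D1 ^^ Suc s) (pot (v1 0) (v2 0))) q" by simp
    also have "\<dots> = D1 (\<lambda>q. complex_of_real (v1 (Suc s) (fst q))) q"
      using cong[OF Suc.prems Suc.IH] by simp
    also have "\<dots> = of_real (v1 (Suc (Suc s)) (fst q))" by (rule D_fst(1)[OF d1[OF Suc.prems]])
    finally show ?case .
  qed
  have C: "(D1 ^^ Suc s) ((D2 ^^ Suc t) (pot (v1 0) (v2 0))) q = 0" if "q \<in> I1 \<times> I2" for q s t
    using that
  proof (induction s arbitrary: q)
    case 0
    have "D1 ((D2 ^^ Suc t) (pot (v1 0) (v2 0))) q = D1 (\<lambda>q. complex_of_real (v2 (Suc t) (snd q))) q"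
      using cong[OF 0 A] by simp
    also have "\<dots> = 0" by (rule D_snd(2)[OF d2[OF 0]])
    finally show ?case by simp
  next
    case (Suc s)
    have "(D1 ^^ Suc (Suc s)) ((D2 ^^ Suc t) (pot (v1 0) (v2 0))) q = D1 ((D1 ^^ Suc s) ((D2 ^^ Suc t) (pot (v1 0) (v2 0)))) q" by simp
    also have "\<dots> = D1 (\<lambda>q. 0 :: complex) q"
      using cong[OF Suc.prems Suc.IH] by simp
    also have "\<dots> = 0" by simp
    finally show ?case .
  qed
  show ?thesis
    by (cases s; cases t) (use A[OF q] B[OF q] C[OF q] st in \<open>simp_all del: funpow.simps(2)\<close>)
qed

lemma lookup_times_single:
  "lk (f * Poly_Mapping.single (a, b) c) i j q = (if a \<le> i \<and> b \<le> j then c q * lk f (i - a) (j - b) q else 0)"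
  by (subst mult.commute) (rule lookup_single_times)

lemma dp_H:
  "dp (s, t) (H1 V1 + H2 V2) = (if (s, t) = (1, 0) then Poly_Mapping.single (1, 0) 1
     else if (s, t) = (0, 1) then Poly_Mapping.single (0, 1) 1
     else if (s, t) = (2, 0) \<or> (s, t) = (0, 2) then Poly_Mapping.single (0, 0) 1 else 0)" if "s + t \<ge> 1"
proof (rule poly_mapping_eqI, rule ext)
  fix k :: "nat \<times> nat" and q :: "real \<times> real"
  obtain i j where k: "k = (i, j)" by (cases k)
  have H: "lk (H1 V1 + H2 V2) (i + s) (j + t) q = (if (i + s, j + t) = (2, 0) \<or> (i + s, j + t) = (0, 2) then 1/2 else 0)"
    unfolding lookup_H using that by auto
  have "lk (dp (s, t) (H1 V1 + H2 V2)) i j q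
     = (if (i + s, j + t) = (2, 0) \<or> (i + s, j + t) = (0, 2) then fact (i + s) / fact i * (fact (j + t) / fact j) / 2 else 0)"
    unfolding lookup_dp H by simp
  moreover consider "s = 0" "t = 0" | "s = 1" "t = 0" | "s = 2" "t = 0" | "s = 0" "t = 1" | "s = 0" "t = 2"
    | "s \<ge> 3 \<or> t \<ge> 3 \<or> s \<ge> 1 \<and> t \<ge> 1" by linarith
  ultimately show "Poly_Mapping.lookup (dp (s, t) (H1 V1 + H2 V2)) k q = Poly_Mapping.lookup (if (s, t) = (1, 0) then Poly_Mapping.single (1, 0) 1
     else if (s, t) = (0, 1) then Poly_Mapping.single (0, 1) 1
     else if (s, t) = (2, 0) \<or> (s, t) = (0, 2) then Poly_Mapping.single (0, 0) 1 else 0) k q"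
    unfolding k using that by cases (auto simp: lookup_single when_def numeral_2_eq_2)
qed

text \<open>The bound turns \<open>Sum_any\<close> into a sum over a finite grid, and
  \<open>4 \<le> M\<close> keeps all orders up to four inside this grid.\<close>

lemma lookup_eq_0_of_large: obtains M where "4 \<le> M" "\<And>i j. M < i + j \<Longrightarrow> lk f i j = 0"
proof -
  define M where "M = Max (insert 4 ((\<lambda>k. fst k + snd k) ` Poly_Mapping.keys f))"
  have "lk f i j = 0" if "M < i + j" for i j
  proof (rule ccontr)
    assume "lk f i j \<noteq> 0"
    then have "(i, j) \<in> Poly_Mapping.keys f" by (simp add: in_keys_iff)
    then have "i + j \<in> insert 4 ((\<lambda>k. fst k + snd k) ` Poly_Mapping.keys f)" by force
    then have "i + j \<le> M" unfolding M_def by (intro Max_ge) auto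
    then show False using that by simp
  qed
  moreover have "4 \<le> M" unfolding M_def by (intro Max_ge) auto
  ultimately show thesis using that by blast
qed

lemma lookup_sum_apply: "Poly_Mapping.lookup (\<Sum>x\<in>A. f x) k q = (\<Sum>x\<in>A. Poly_Mapping.lookup (f x) k q)"
  for f :: "'a \<Rightarrow> observable"
  by (simp add: lookup_sum sum_fun_apply)

text \<open>This is where separability enters: mixed derivatives of the Hamiltonian vanish, so only
  multi-indices on the two axes survive.\<close>

lemma sum_grid_axes:
  fixes T :: "nat \<Rightarrow> nat \<Rightarrow> complex"
  assumes M: "4 \<le> M" and 0: "T 0 0 = 0" "\<And>s t. 1 \<le> s \<Longrightarrow> 1 \<le> t \<Longrightarrow> T s t = 0"
    "\<And>s. 4 < s \<Longrightarrow> T s 0 = 0" "\<And>t. 4 < t \<Longrightarrow> T 0 t = 0"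
  shows "(\<Sum>k\<in>{..M} \<times> {..M}. T (fst k) (snd k)) = (\<Sum>s\<in>{1..4}. T s 0 + T 0 s)"
proof -
  have "(\<Sum>k\<in>{..M} \<times> {..M}. T (fst k) (snd k)) = (\<Sum>k\<in>{1..4} \<times> {0} \<union> {0} \<times> {1..4}. T (fst k) (snd k))"
  proof (rule sum.mono_neutral_right)
    show "\<forall>k\<in>{..M} \<times> {..M} - ({1..4} \<times> {0} \<union> {0} \<times> {1..4}). T (fst k) (snd k) = 0"
    proof
      fix k assume k: "k \<in> {..M} \<times> {..M} - ({1..4} \<times> {0} \<union> {0} \<times> {1..4})"
      obtain s t where st: "k = (s, t)" by (cases k)
      consider "s = 0" "t = 0" | "1 \<le> s" "1 \<le> t" | "t = 0" "4 < s" | "s = 0" "4 < t"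
        using k st by fastforce
      then show "T (fst k) (snd k) = 0" using 0 st by cases auto
    qed
  qed (use M in auto)
  also have "\<dots> = (\<Sum>k\<in>{1..4} \<times> {0}. T (fst k) (snd k)) + (\<Sum>k\<in>{0} \<times> {1..4}. T (fst k) (snd k))"
    by (rule sum.union_disjoint) auto
  also have "(\<Sum>k\<in>{1..4} \<times> {0}. T (fst k) (snd k)) = (\<Sum>s\<in>{1..4}. T s 0)"
    unfolding sum.cartesian_product' by simp
  also have "(\<Sum>k\<in>{0} \<times> {1..4}. T (fst k) (snd k)) = (\<Sum>s\<in>{1..4}. T 0 s)"
    unfolding sum.cartesian_product' by simp
  finally show ?thesis by (simp add: sum.distrib)
qed

lemma lookup_times_coord: "Poly_Mapping.lookup (f * coord c) k q = Poly_Mapping.lookup f k q * c q"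
  by (subst mult.commute) (simp add: lookup_coord_times)

text \<open>The Hamiltonian is quadratic in the momenta. Its momentum derivatives thus contribute a
  transport term at first order and a Laplacian at second order, and nothing later. The s-th
  derivatives of the potentials are paired with s-th momentum derivatives of f, where s is at most
  four.\<close>

lemma lookup_bracket:
  assumes S: "open (I1 \<times> I2)" and v1: "all_derivs I1 v1" and v2: "all_derivs I2 v2"
    and q: "q \<in> I1 \<times> I2" and deg: "\<And>i j. 4 < i + j \<Longrightarrow> lk f i j q = 0"
  shows "lk (bracket h f (H1 (v1 0) + H2 (v2 0))) i j q =
     (if i \<ge> 1 then D1 (lk f (i - 1) j) q else 0) + (if j \<ge> 1 then D2 (lk f i (j - 1)) q else 0)
     + of_real h / \<i> / 2 * (D1 (D1 (lk f i j)) q + D2 (D2 (lk f i j)) q)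
     - (\<Sum>s\<in>{1..4}. 1 / fact s * (of_real h / \<i>) ^ (s - 1) *
          (fact (i + s) / fact i * lk f (i + s) j q * of_real (v1 s (fst q))
           + fact (j + s) / fact j * lk f i (j + s) q * of_real (v2 s (snd q))))"
proof -
  define H where "H = H1 (v1 0) + H2 (v2 0)"
  define F where "F k = (if fst k + snd k \<ge> 1
       then const (1 / (fact (fst k) * fact (snd k)) * (of_real h / \<i>) ^ (fst k + snd k - 1))
            * (dq k f * dp k H - dp k f * dq k H)
       else 0)" for k :: "nat \<times> nat"
  obtain M where M: "4 \<le> M" "\<And>i j. M < i + j \<Longrightarrow> lk f i j = 0" using lookup_eq_0_of_large by blast
  have supp: "{k. F k \<noteq> 0} \<subseteq> {..M} \<times> {..M}"
  proof (rule subsetI, rule ccontr)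
    fix k assume k: "k \<in> {k. F k \<noteq> 0}" "k \<notin> {..M} \<times> {..M}"
    obtain s t where st: "k = (s, t)" by (cases k)
    have big: "M < s \<or> M < t" using k(2) st by auto
    have "dp (s, t) f = 0"
    proof (rule poly_mapping_eqI, rule ext)
      fix l :: "nat \<times> nat" and z
      obtain i' j' where l: "l = (i', j')" by (cases l)
      have "M < i' + s + (j' + t)" using big by auto
      then show "Poly_Mapping.lookup (dp (s, t) f) l z = Poly_Mapping.lookup 0 l z"
        unfolding l lookup_dp by (simp add: M(2))
    qed
    moreover have "dp (s, t) H = 0" using big M(1) unfolding H_def by (subst dp_H) auto
    ultimately have "F k = 0" unfolding F_def st by simp
    then show False using k by simp
  qed
  \<comment> \<open>\<open>P\<close> is the contribution of the momentum derivatives of the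
    Hamiltonian, \<open>R\<close> that of its position derivatives.\<close>
  define P where "P s t = (if (s, t) = (1, 0) then (if i \<ge> 1 then D1 (lk f (i - 1) j) q else 0)
      else if (s, t) = (0, 1) then (if j \<ge> 1 then D2 (lk f i (j - 1)) q else 0)
      else if (s, t) = (2, 0) then D1 (D1 (lk f i j)) q
      else if (s, t) = (0, 2) then D2 (D2 (lk f i j)) q else 0)" for s t :: nat
  define R where "R s t = fact (i + s) / fact i * (fact (j + t) / fact j) * lk f (i + s) (j + t) q
      * (if t = 0 then of_real (v1 s (fst q)) else if s = 0 then of_real (v2 t (snd q)) else 0)" for s t
  define T where "T s t = (if s + t \<ge> 1 then 1 / (fact s * fact t) * (of_real h / \<i>) ^ (s + t - 1) * (P s t - R s t) else 0)" for s t
  have FT: "lk (F k) i j q = T (fst k) (snd k)" for k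
  proof -
    obtain s t where st: "k = (s, t)" by (cases k)
    show ?thesis
    proof (cases "s + t \<ge> 1")
      case True
      have "lk (dq (s, t) f * dp (s, t) H) i j q = P s t"
        unfolding H_def dp_H[OF True] P_def
        by (auto simp: lookup_times_single lookup_dq numeral_2_eq_2)
      moreover have "lk (dp (s, t) f * dq (s, t) H) i j q = R s t"
        unfolding H_def dq_H[OF True] lookup_times_coord lookup_dp D_iter_pot[OF S v1 v2 q True] R_def by simp
      ultimately show ?thesis unfolding F_def T_def st using True
        by (simp only: fst_conv snd_conv if_True lookup_const_times lookup_minus minus_apply fun_diff_def)
    qed (simp add: F_def T_def st)
  qed
  have "bracket h f H = (\<Sum>k\<in>{..M} \<times> {..M}. F k)"
    unfolding bracket_def F_def[symmetric]
    by (rule Sum_any.expand_superset[OF _ supp]) simp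
  then have "lk (bracket h f H) i j q = (\<Sum>k\<in>{..M} \<times> {..M}. T (fst k) (snd k))"
    by (simp add: lookup_sum_apply FT)
  also have "\<dots> = (\<Sum>s\<in>{1..4}. T s 0 + T 0 s)"
  proof (rule sum_grid_axes[OF M(1)])
    show "T s 0 = 0" if "4 < s" for s using that deg[of "i + s" j] by (simp add: T_def P_def R_def)
    show "T 0 t = 0" if "4 < t" for t using that deg[of i "j + t"] by (simp add: T_def P_def R_def)
  qed (auto simp: T_def P_def R_def)
  also have "\<dots> = (\<Sum>s\<in>{1..4}. 1 / fact s * (of_real h / \<i>) ^ (s - 1) * (P s 0 + P 0 s)
      - 1 / fact s * (of_real h / \<i>) ^ (s - 1) * (R s 0 + R 0 s))"
  proof (rule sum.cong)
    fix s :: nat assume "s \<in> {1..4}"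
    then have s: "(1 \<le> s) = True" by simp
    have alg: "c * (a - b) + c * (a' - b') = c * (a + a') - c * (b + b')" for a b a' b' c :: complex
      by (simp add: algebra_simps)
    show "T s 0 + T 0 s = 1 / fact s * (of_real h / \<i>) ^ (s - 1) * (P s 0 + P 0 s)
      - 1 / fact s * (of_real h / \<i>) ^ (s - 1) * (R s 0 + R 0 s)"
      by (simp only: T_def add_0_right add_0_left s if_True fact_0 mult_1_right mult_1_left alg)
  qed simp
  also have "\<dots> = (\<Sum>s\<in>{1..4}. 1 / fact s * (of_real h / \<i>) ^ (s - 1) * (P s 0 + P 0 s))
      - (\<Sum>s\<in>{1..4}. 1 / fact s * (of_real h / \<i>) ^ (s - 1) * (R s 0 + R 0 s))"
    by (rule sum_subtractf)
  also have "(\<Sum>s\<in>{1..4}. 1 / fact s * (of_real h / \<i>) ^ (s - 1) * (P s 0 + P 0 s))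
      = (P 1 0 + P 0 1) + of_real h / \<i> / 2 * (P 2 0 + P 0 2)"
  proof -
    have "{1..4} = {1, 2, 3, 4 :: nat}" by auto
    then show ?thesis by (simp add: P_def fact_numeral)
  qed
  also have "(\<Sum>s\<in>{1..4}. 1 / fact s * (of_real h / \<i>) ^ (s - 1) * (R s 0 + R 0 s))
     = (\<Sum>s\<in>{1..4}. 1 / fact s * (of_real h / \<i>) ^ (s - 1) *
          (fact (i + s) / fact i * lk f (i + s) j q * of_real (v1 s (fst q))
           + fact (j + s) / fact j * lk f i (j + s) q * of_real (v2 s (snd q))))"
    by (rule sum.cong) (auto simp: R_def)
  finally show ?thesis unfolding H_def by (simp add: P_def)
qed

subsection \<open>The formal adjoint of a real observable\<close>

text \<open>The operator \<delta> = \<Sum> d^2/(dq_i dp_i) on families of real coefficients. As 2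
  a_0 = (h/i) \<delta>, the formal adjoint of a real observable is exp((h/i) \<delta>) applied to
  it.\<close>

definition del :: "(nat \<Rightarrow> nat \<Rightarrow> real \<times> real \<Rightarrow> real) \<Rightarrow> nat \<Rightarrow> nat \<Rightarrow> real \<times> real \<Rightarrow> real" where
  "del y i j q = of_nat (i + 1) * D1 (y (i + 1) j) q + of_nat (j + 1) * D2 (y i (j + 1)) q"

lemma smooth_on_scale: "open S \<Longrightarrow> smooth_on S f \<Longrightarrow> smooth_on S (\<lambda>q. c * f q)" for c :: real
  by (rule smooth_on_linear[of S f "\<lambda>t. c * t"]) (auto intro: bounded_linear_mult_right)

lemma smooth_on_del:
  assumes "open S" "\<And>i j. smooth_on S (y i j)"
  shows "smooth_on S (del y i j)"
  unfolding del_def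
  by (intro smooth_on_add smooth_on_scale smooth_on_frechet assms)

lemma smooth_on_del_iter:
  assumes "open S" "\<And>i j. smooth_on S (y i j)"
  shows "smooth_on S ((del ^^ k) y i j)"
proof (induction k arbitrary: i j)
  case (Suc k)
  then show ?case using smooth_on_del[OF assms(1)] by simp
qed (use assms in simp)

lemma D_zero_on:
  assumes "open S" "\<And>q. q \<in> S \<Longrightarrow> f q = 0" "q \<in> S"
  shows "frechet_derivative f (at q) v = 0"
  using frechet_derivative_cong_on_open[OF assms(1,3), of f "\<lambda>q. 0"] assms(2) by simp

lemma del_iter_eq_0:
  assumes S: "open S" and y: "\<And>i j q. N < i + j \<Longrightarrow> q \<in> S \<Longrightarrow> y i j q = 0"
    and "N < i + j + k" "q \<in> S"
  shows "(del ^^ k) y i j q = 0"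
  using assms(3,4)
proof (induction k arbitrary: i j q)
  case (Suc k)
  have "D1 ((del ^^ k) y (i + 1) j) q = 0" "D2 ((del ^^ k) y i (j + 1)) q = 0"
    by (rule D_zero_on[OF S Suc.IH Suc.prems(2)]; use Suc.prems in simp)+
  then have "del ((del ^^ k) y) i j q = 0" unfolding del_def[of "(del ^^ k) y"] by simp
  then show ?case by simp
qed (use y in auto)

lemma lookup_a0:
  assumes S: "open S" and y: "\<And>i j. smooth_on S (y i j)" and q: "q \<in> S"
    and f: "\<And>i j q. q \<in> S \<Longrightarrow> lk f i j q = c * of_real (y i j q)"
  shows "lk (const 2 * a0 h f) i j q = of_real h / \<i> * c * of_real (del y i j q)"
proof -
  have L: "bounded_linear (\<lambda>t. a * of_real t :: complex)" for a
    by (rule bounded_linear_const_mult[OF bounded_linear_of_real])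
  have 1: "D1 (lk (dp1 f) i j) q = of_nat (i + 1) * c * of_real (D1 (y (i + 1) j) q)"
  proof -
    have "lk (dp1 f) i j z = of_nat (i + 1) * c * of_real (y (i + 1) j z)" if "z \<in> S" for z
      by (simp only: lookup_dp1 f[OF that] mult.assoc)
    then have "D1 (lk (dp1 f) i j) q = D1 (\<lambda>z. of_nat (i + 1) * c * of_real (y (i + 1) j z)) q"
      by (rule frechet_derivative_cong_on_open[OF S q, THEN fun_cong])
    also note frechet_linear[OF y L q]
    finally show ?thesis .
  qed
  have 2: "D2 (lk (dp2 f) i j) q = of_nat (j + 1) * c * of_real (D2 (y i (j + 1)) q)"
  proof -
    have "lk (dp2 f) i j z = of_nat (j + 1) * c * of_real (y i (j + 1) z)" if "z \<in> S" for z
      by (simp only: lookup_dp2 f[OF that] mult.assoc)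
    then have "D2 (lk (dp2 f) i j) q = D2 (\<lambda>z. of_nat (j + 1) * c * of_real (y i (j + 1) z)) q"
      by (rule frechet_derivative_cong_on_open[OF S q, THEN fun_cong])
    also note frechet_linear[OF y L q]
    finally show ?thesis .
  qed
  show ?thesis
    unfolding a0_def lookup_const_times lookup_add plus_fun_apply lookup_dq1 lookup_dq2 1 2 del_def
    by (simp add: algebra_simps)
qed

text \<open>Since \<delta> lowers the degree in the momenta by one, the exponential series stops at
  the order four.\<close>

lemma lookup_adjoint:
  assumes S: "open S" and y: "\<And>i j. smooth_on S (y i j)"
    and Y: "\<And>i j q. q \<in> S \<Longrightarrow> lk Y i j q = of_real (y i j q)"
    and deg: "\<And>i j q. 4 < i + j \<Longrightarrow> q \<in> S \<Longrightarrow> y i j q = 0" and q: "q \<in> S"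
  shows "lk (adjoint_obs h Y) i j q = (\<Sum>k\<le>4. (of_real h / \<i>) ^ k / fact k * of_real ((del ^^ k) y i j q))"
proof -
  define T where "T = (\<lambda>f. const 2 * a0 h f)"
  define F where "F k = const (1 / fact k) * (T ^^ k) (conj_obs Y)" for k :: nat
  have cY: "Poly_Mapping.lookup (conj_obs Y) l = (\<lambda>q. cnj (Poly_Mapping.lookup Y l q))" for l
    by (cases "Poly_Mapping.lookup Y l = 0") (simp_all add: conj_obs_def Poly_Mapping.map.rep_eq fun_eq_iff)
  \<comment> \<open>The degree bound four is known only on \<open>S\<close>. The bound M holds
    everywhere and makes the formal sum finite; afterwards the terms beyond four are dropped on
    \<open>S\<close>.\<close>
  obtain M where M: "4 \<le> M" "\<And>i j. M < i + j \<Longrightarrow> lk Y i j = 0" using lookup_eq_0_of_large by blast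
  have nil: "lk ((T ^^ k) (conj_obs Y)) i j = 0" if "M < i + j + k" for i j k
    using that
  proof (induction k arbitrary: i j)
    case 0
    then show ?case using M(2)[of i j] by (simp add: cY fun_eq_iff)
  next
    case (Suc k)
    let ?g = "(T ^^ k) (conj_obs Y)"
    have g: "lk (dp1 ?g) i j = 0" "lk (dp2 ?g) i j = 0"
      using Suc.IH[of "i + 1" j] Suc.IH[of i "j + 1"] Suc.prems
      by (auto simp: fun_eq_iff lookup_dp1 lookup_dp2)
    have "lk (const 2 * a0 h ?g) i j = 0"
      by (rule ext) (simp add: a0_def lookup_const_times lookup_add lookup_dq1 lookup_dq2 g frechet_derivative_zero)
    then show ?case by (simp add: T_def)
  qed
  have supp: "{k. F k \<noteq> 0} \<subseteq> {..M}"
  proof (rule subsetI, rule ccontr)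
    fix k assume k: "k \<in> {k. F k \<noteq> 0}" "k \<notin> {..M}"
    have "(T ^^ k) (conj_obs Y) = 0"
    proof (rule poly_mapping_eqI)
      fix l :: "nat \<times> nat"
      show "Poly_Mapping.lookup ((T ^^ k) (conj_obs Y)) l = Poly_Mapping.lookup 0 l"
        using nil[of "fst l" "snd l" k] k(2) by simp
    qed
    then show False using k(1) by (simp add: F_def)
  qed
  have it: "lk ((T ^^ k) (conj_obs Y)) i j q = (of_real h / \<i>) ^ k * of_real ((del ^^ k) y i j q)" if "q \<in> S" for k i j q
    using that
  proof (induction k arbitrary: i j q)
    case 0
    then show ?case by (simp add: cY Y)
  next
    case (Suc k)
    have "lk (T ((T ^^ k) (conj_obs Y))) i j q
        = of_real h / \<i> * (of_real h / \<i>) ^ k * of_real (del ((del ^^ k) y) i j q)"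
      unfolding T_def
      by (rule lookup_a0[OF S smooth_on_del_iter[OF S y] Suc.prems Suc.IH[unfolded T_def]])
    then show ?case by simp
  qed
  have "adjoint_obs h Y = (\<Sum>k\<le>M. F k)"
    unfolding adjoint_obs_def T_def[symmetric] F_def[symmetric]
    by (rule Sum_any.expand_superset[OF _ supp]) simp
  then have "lk (adjoint_obs h Y) i j q = (\<Sum>k\<le>M. (of_real h / \<i>) ^ k / fact k * of_real ((del ^^ k) y i j q))"
    by (simp add: lookup_sum_apply F_def lookup_const_times it[OF q])
  also have "\<dots> = (\<Sum>k\<le>4. (of_real h / \<i>) ^ k / fact k * of_real ((del ^^ k) y i j q))"
    by (rule sum.mono_neutral_right) (use M(1) in \<open>auto simp: del_iter_eq_0[OF S deg _ q]\<close>)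
  finally show ?thesis .
qed

subsection \<open>Real form of the determining equations\<close>

text \<open>With \<open>\<epsilon> = h / \<i>\<close>, the real part and the coefficient of \<open>\<epsilon> / 2\<close> of
  \<open>(1 + exp (\<epsilon> \<delta>)) / 2\<close> applied to \<open>y\<close>, up to the order \<open>\<epsilon>\<^sup>4\<close>, where \<open>\<delta> = del\<close>.\<close>

definition even_part :: "real \<Rightarrow> (nat \<Rightarrow> nat \<Rightarrow> real \<times> real \<Rightarrow> real) \<Rightarrow> nat \<Rightarrow> nat \<Rightarrow> real \<times> real \<Rightarrow> real" where
  "even_part h y i j q = y i j q + (- (h\<^sup>2 / 4)) * (del ^^ 2) y i j q + h ^ 4 / 48 * (del ^^ 4) y i j q"

definition odd_part :: "real \<Rightarrow> (nat \<Rightarrow> nat \<Rightarrow> real \<times> real \<Rightarrow> real) \<Rightarrow> nat \<Rightarrow> nat \<Rightarrow> real \<times> real \<Rightarrow> real" where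
  "odd_part h y i j q = del y i j q + (- (h\<^sup>2 / 6)) * (del ^^ 3) y i j q"

lemma smooth_on_parts:
  assumes S: "open S" and y: "\<And>i j. smooth_on S (y i j)"
  shows "smooth_on S (even_part h y i j)" "smooth_on S (odd_part h y i j)"
  unfolding even_part_def odd_part_def
  by (intro smooth_on_add smooth_on_scale smooth_on_del_iter smooth_on_del S y)+

lemma standard_form_real:
  assumes S: "open S" and n: "n \<le> 4" and std: "standard_form h S n X"
  obtains y where "\<And>i j. smooth_on S (y i j)"
    "\<And>i j q. q \<in> S \<Longrightarrow> n < i + j \<or> odd (n - (i + j)) \<Longrightarrow> y i j q = 0"
    "\<And>i j q. q \<in> S \<Longrightarrow> lk X i j q = of_real (even_part h y i j q) + of_real h / \<i> / 2 * of_real (odd_part h y i j q)"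
proof -
  obtain Y where Y: "smooth_coeffs S Y" "\<And>k q. q \<in> S \<Longrightarrow> Poly_Mapping.lookup Y k q \<in> \<real>"
    "\<And>d. d > n \<or> odd (n - d) \<Longrightarrow> eq_on S (component d Y) 0"
    "eq_on S X (const (1/2) * (Y + adjoint_obs h Y))"
    using std unfolding standard_form_def by blast
  define y where "y i j = (\<lambda>q. Re (lk Y i j q))" for i j
  have y: "smooth_on S (y i j)" for i j
    unfolding y_def using Y(1) smooth_on_linear[OF S _ bounded_linear_Re] by (auto simp: smooth_coeffs_def)
  have Yy: "lk Y i j q = of_real (y i j q)" if "q \<in> S" for i j q
    using Y(2)[OF that, of "(i, j)"] by (simp add: y_def of_real_Re)
  have 0: "y i j q = 0" if "q \<in> S" "n < i + j \<or> odd (n - (i + j))" for i j q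
  proof -
    have "Poly_Mapping.lookup (component (i + j) Y) (i, j) q = 0"
      using Y(3)[OF that(2)] that(1) by (simp add: eq_on_def)
    then show ?thesis by (simp add: lookup_component y_def)
  qed
  have deg: "y i j q = 0" if "4 < i + j" "q \<in> S" for i j q
    using 0[of q i j] that n by simp
  show thesis
  proof (rule that[OF y 0])
    fix i j q assume q: "q \<in> S"
    have "lk X i j q = 1/2 * (lk Y i j q + lk (adjoint_obs h Y) i j q)"
      using Y(4) q unfolding eq_on_def by (simp add: lookup_const_times lookup_add)
    also have "lk (adjoint_obs h Y) i j q
        = (\<Sum>k\<le>4. (of_real h / \<i>) ^ k / fact k * of_real ((del ^^ k) y i j q))"
      by (rule lookup_adjoint[OF S y Yy deg q])
    also have "\<dots> = of_real (y i j q) + (of_real h / \<i>) * of_real (del y i j q)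
        + (of_real h / \<i>) ^ 2 / 2 * of_real ((del ^^ 2) y i j q) + (of_real h / \<i>) ^ 3 / 6 * of_real ((del ^^ 3) y i j q)
        + (of_real h / \<i>) ^ 4 / 24 * of_real ((del ^^ 4) y i j q)"
    proof -
      have "{..4} = {0, 1, 2, 3, 4 :: nat}" by auto
      moreover have "(del ^^ 1) y = del y" "(del ^^ 0) y = y" by simp_all
      ultimately show ?thesis
        by (simp add: fact_numeral del: One_nat_def)
    qed
    finally have X: "lk X i j q = 1/2 * (lk Y i j q + (of_real (y i j q) + (of_real h / \<i>) * of_real (del y i j q)
        + (of_real h / \<i>) ^ 2 / 2 * of_real ((del ^^ 2) y i j q) + (of_real h / \<i>) ^ 3 / 6 * of_real ((del ^^ 3) y i j q)
        + (of_real h / \<i>) ^ 4 / 24 * of_real ((del ^^ 4) y i j q)))" .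
    \<comment> \<open>Sorting by the parity of the power of e = h/i: even powers are real, odd ones
      are real multiples of e.\<close>
    have alg: "1/2 * (a + (a + e * b + e ^ 2 / 2 * c + e ^ 3 / 6 * d + e ^ 4 / 24 * f))
       = (a + (- (t ^ 2 / 4)) * c + t ^ 4 / 48 * f) + e / 2 * (b + (- (t ^ 2 / 6)) * d)"
      if "e ^ 2 = - (t ^ 2)" "e ^ 3 = - (t ^ 2) * e" "e ^ 4 = t ^ 4" for a b c d e f t :: complex
      unfolding that by (simp add: algebra_simps)
    have e2: "(of_real h / \<i>) ^ 2 = - (complex_of_real h ^ 2)" by (simp add: power_mult_distrib)
    have e3: "(of_real h / \<i>) ^ 3 = - (complex_of_real h ^ 2) * (of_real h / \<i>)"
      unfolding e2[symmetric] by (simp only: power3_eq_cube power2_eq_square)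
    have p4: "z ^ 4 = (z ^ 2) ^ 2" for z :: complex by (simp flip: power_mult)
    have e4: "(of_real h / \<i>) ^ 4 = complex_of_real h ^ 4" unfolding p4 e2 by (rule power2_minus)
    show "lk X i j q = of_real (even_part h y i j q) + of_real h / \<i> / 2 * of_real (odd_part h y i j q)"
      unfolding X Yy[OF q] even_part_def odd_part_def
      by (rule trans[OF alg[OF e2 e3 e4]])
        (simp only: of_real_add of_real_mult of_real_minus of_real_divide of_real_power of_real_numeral)
  qed
qed

lemma D_real_imag:
  assumes S: "open S" and u: "smooth_on S u" and s: "smooth_on S s" and q: "q \<in> S"
    and f: "\<And>q. q \<in> S \<Longrightarrow> f q = complex_of_real (u q) + c * of_real (s q)"
  shows "frechet_derivative f (at q) v = of_real (frechet_derivative u (at q) v) + c * of_real (frechet_derivative s (at q) v)"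
proof -
  have L: "bounded_linear (\<lambda>t. c * of_real t :: complex)"
    by (rule bounded_linear_const_mult[OF bounded_linear_of_real])
  have "frechet_derivative f (at q) v = frechet_derivative (\<lambda>q. complex_of_real (u q) + c * of_real (s q)) (at q) v"
    by (rule frechet_derivative_cong_on_open[OF S q, THEN fun_cong]) (rule f)
  also have "\<dots> = frechet_derivative (\<lambda>q. complex_of_real (u q)) (at q) v + frechet_derivative (\<lambda>q. c * of_real (s q)) (at q) v"
    by (rule frechet_add[OF smooth_on_linear[OF S u bounded_linear_of_real] smooth_on_linear[OF S s L] q])
  finally show ?thesis
    unfolding frechet_linear[OF u bounded_linear_of_real q] frechet_linear[OF s L q] .
qed

text \<open>As h/i is imaginary, the real part of the determining equations pairs the even part of X
  with even powers of h/i and the odd part with odd powers. All unknowns are now real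
  functions.\<close>

lemma real_bracket:
  assumes S: "open (I1 \<times> I2)" and v1: "all_derivs I1 v1" and v2: "all_derivs I2 v2"
    and X: "\<And>i j q. q \<in> I1 \<times> I2 \<Longrightarrow> lk X i j q = of_real (u i j q) + of_real h / \<i> / 2 * of_real (s i j q)"
    and u: "\<And>i j. smooth_on (I1 \<times> I2) (u i j)" and s: "\<And>i j. smooth_on (I1 \<times> I2) (s i j)"
    and deg: "\<And>i j q. 4 < i + j \<Longrightarrow> q \<in> I1 \<times> I2 \<Longrightarrow> u i j q = 0"
      "\<And>i j q. 4 < i + j \<Longrightarrow> q \<in> I1 \<times> I2 \<Longrightarrow> s i j q = 0"
    and q: "q \<in> I1 \<times> I2" and int: "eq_on (I1 \<times> I2) (bracket h X (H1 (v1 0) + H2 (v2 0))) 0"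
  shows "(if i \<ge> 1 then D1 (u (i - 1) j) q else 0) + (if j \<ge> 1 then D2 (u i (j - 1)) q else 0)
     - h\<^sup>2 / 4 * (D1 (D1 (s i j)) q + D2 (D2 (s i j)) q)
   = fact (i + 1) / fact i * u (i + 1) j q * v1 1 (fst q) + fact (j + 1) / fact j * u i (j + 1) q * v2 1 (snd q)
     - h\<^sup>2 / 4 * (fact (i + 2) / fact i * s (i + 2) j q * v1 2 (fst q) + fact (j + 2) / fact j * s i (j + 2) q * v2 2 (snd q))
     - h\<^sup>2 / 6 * (fact (i + 3) / fact i * u (i + 3) j q * v1 3 (fst q) + fact (j + 3) / fact j * u i (j + 3) q * v2 3 (snd q))
     + h ^ 4 / 48 * (fact (i + 4) / fact i * s (i + 4) j q * v1 4 (fst q) + fact (j + 4) / fact j * s i (j + 4) q * v2 4 (snd q))"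
proof -
  have D: "D1 (lk X i j) q = of_real (D1 (u i j) q) + of_real h / \<i> / 2 * of_real (D1 (s i j) q)"
    "D2 (lk X i j) q = of_real (D2 (u i j) q) + of_real h / \<i> / 2 * of_real (D2 (s i j) q)" if "q \<in> I1 \<times> I2" for i j q
    by (rule D_real_imag[OF S u s that X], assumption)+
  have D11: "D1 (D1 (lk X i j)) q = of_real (D1 (D1 (u i j)) q) + of_real h / \<i> / 2 * of_real (D1 (D1 (s i j)) q)"
    by (rule D_real_imag[OF S smooth_on_frechet[OF u] smooth_on_frechet[OF s] q D(1)])
  have D22: "D2 (D2 (lk X i j)) q = of_real (D2 (D2 (u i j)) q) + of_real h / \<i> / 2 * of_real (D2 (D2 (s i j)) q)"
    by (rule D_real_imag[OF S smooth_on_frechet[OF u] smooth_on_frechet[OF s] q D(2)])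
  have deg': "lk X i j q = 0" if "4 < i + j" for i j
    using deg[OF that q] X[OF q, of i j] by simp
  define F G where "F k = fact (i + k) / (fact i :: real)" and "G k = fact (j + k) / (fact j :: real)" for k
  have F: "fact (i + k) / fact i = complex_of_real (F k)" "fact (j + k) / fact j = complex_of_real (G k)" for k
    by (simp_all add: F_def G_def)
  define e where "e = of_real h / \<i>"
  define A A' B B' where "A = (if i \<ge> 1 then D1 (u (i - 1) j) q else 0)" and "A' = (if i \<ge> 1 then D1 (s (i - 1) j) q else 0)"
    and "B = (if j \<ge> 1 then D2 (u i (j - 1)) q else 0)" and "B' = (if j \<ge> 1 then D2 (s i (j - 1)) q else 0)"
  have AB: "(if i \<ge> 1 then D1 (lk X (i - 1) j) q else 0) = of_real A + e / 2 * of_real A'"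
    "(if j \<ge> 1 then D2 (lk X i (j - 1)) q else 0) = of_real B + e / 2 * of_real B'"
    using D[OF q] by (auto simp: A_def A'_def B_def B'_def e_def)
  have set: "(\<Sum>k\<in>{1..4}. f k) = f 1 + f 2 + f 3 + f 4" for f :: "nat \<Rightarrow> complex"
  proof -
    have "{1..4} = {1, 2, 3, 4 :: nat}" by auto
    then show ?thesis by (simp add: add.assoc)
  qed
  have "lk (bracket h X (H1 (v1 0) + H2 (v2 0))) i j q = 0"
    using int[unfolded eq_on_def, rule_format, OF q, of "(i, j)"] by simp
  note lookup_bracket[OF S v1 v2 q deg', of h i j, unfolded this set F AB D11 D22 X[OF q] e_def[symmetric]]
  note eq = arg_cong[OF this, of Re]
  have e: "Re e = 0" "Im e = - h" by (simp_all add: e_def)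
  show ?thesis
    unfolding A_def[symmetric] B_def[symmetric] F_def[symmetric] G_def[symmetric]
    using eq by (simp add: e fact_numeral power_numeral_reduce power2_eq_square power3_eq_cube power4_eq_xxxx)
      (simp add: algebra_simps add_divide_distrib diff_divide_distrib)
qed

subsection \<open>The leading component\<close>

lemma lookup_p1_power_times: "lk (p1 ^ a * f) i j q = (if a \<le> i then lk f (i - a) j q else 0)"
  by (simp add: p1_power lookup_single_times)

lemma lookup_p2_power_times: "lk (p2 ^ a * f) i j q = (if a \<le> j then lk f i (j - a) q else 0)"
  by (simp add: p2_power lookup_single_times)

lemma lookup_m12_times: "lk (m12 * f) i j q = (if 1 \<le> j then of_real (fst q) * lk f i (j - 1) q else 0)
    - (if 1 \<le> i then of_real (snd q) * lk f (i - 1) j q else 0)"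
  using lookup_p1_power_times[of 1 f i j q] lookup_p2_power_times[of 1 f i j q]
  by (simp add: m12_def left_diff_distrib mult.assoc lookup_minus fun_diff_def lookup_coord_times)

lemma lookup_m12_power:
  "lk (m12 ^ k) i j q = (if i + j = k then of_nat (k choose i) * of_real (fst q) ^ j * (- of_real (snd q)) ^ i else 0)"
proof (induction k arbitrary: i j)
  case 0
  have "(0, 0) = (0 :: nat \<times> nat)" by (simp add: zero_prod_def)
  then have "lk (1 :: observable) i j q = (if i + j = 0 then 1 else 0)"
    by (simp only: single_one[symmetric] lookup_single) (auto simp: when_def zero_prod_def)
  then show ?case by simp
next
  case (Suc k)
  show ?case unfolding power_Suc lookup_m12_times
    by (cases i; cases j) (auto simp: Suc.IH algebra_simps)
qed

lemma lookup_monomial: "lk (const c * p1 ^ a * p2 ^ b * m12 ^ k) i j q =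
   (if a \<le> i \<and> b \<le> j \<and> i + j = a + b + k
    then c * of_nat (k choose (i - a)) * of_real (fst q) ^ (j - b) * (- of_real (snd q)) ^ (i - a) else 0)"
  unfolding mult.assoc lookup_const_times lookup_p1_power_times lookup_p2_power_times lookup_m12_power
  by (auto simp: mult.assoc)

text \<open>The coefficient of p1^i p2^j in the leading component, after expanding the powers of
  \<open>m12\<close> by the binomial theorem.\<close>

definition lead_sum :: "nat \<Rightarrow> (nat \<Rightarrow> nat \<Rightarrow> nat \<Rightarrow> real) \<Rightarrow> nat \<Rightarrow> nat \<Rightarrow> real \<times> real \<Rightarrow> real" where
  "lead_sum n \<alpha> i j q = (\<Sum>a\<le>i. \<Sum>b\<le>j. \<alpha> a b (n - a - b) * of_nat ((n - a - b) choose (i - a)) * fst q ^ (j - b) * (- snd q) ^ (i - a))"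

lemma lookup_leading:
  assumes lead: "leading_coeffs S n X \<alpha>" and q: "q \<in> S" and ij: "i + j = n"
  shows "lk X i j q = of_real (lead_sum n \<alpha> i j q)"
proof -
  let ?f = "\<lambda>a b k. \<alpha> a b k * of_nat (k choose (i - a)) * fst q ^ (j - b) * (- snd q) ^ (i - a)"
  have fin: "finite {(a, b, k). a + b + k = n}"
    by (rule finite_subset[of _ "{..n} \<times> {..n} \<times> {..n}"]) auto
  have "lk X i j q = lk (component n X) i j q" using ij by (simp add: lookup_component)
  also have "\<dots> = lk (\<Sum>(a, b, k)\<in>{(a, b, k). a + b + k = n}. const (of_real (\<alpha> a b k)) * p1 ^ a * p2 ^ b * m12 ^ k) i j q"
    using lead[unfolded leading_coeffs_def eq_on_def] q by blast
  also have "\<dots> = (\<Sum>(a, b, k)\<in>{(a, b, k). a + b + k = n}. if a \<le> i \<and> b \<le> j then of_real (?f a b k) else 0)"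
    unfolding lookup_sum_apply
  proof (rule sum.cong)
    fix x assume "x \<in> {(a, b, k). a + b + k = n}"
    then obtain a b k where x: "x = (a, b, k)" "a + b + k = n" by blast
    show "lk (case x of (a, b, k) \<Rightarrow> const (of_real (\<alpha> a b k)) * p1 ^ a * p2 ^ b * m12 ^ k) i j q
       = (case x of (a, b, k) \<Rightarrow> if a \<le> i \<and> b \<le> j then of_real (?f a b k) else 0)"
      unfolding x(1) prod.case lookup_monomial using x(2) ij by simp
  qed simp
  also have "\<dots> = (\<Sum>(a, b, k)\<in>{(a, b, k). a \<le> i \<and> b \<le> j \<and> k = n - a - b}. of_real (?f a b k))"
    using ij by (intro sum.mono_neutral_cong_right[OF fin]) (auto split: if_splits)
  also have "\<dots> = (\<Sum>x\<in>{..i} \<times> {..j}. of_real (?f (fst x) (snd x) (n - fst x - snd x)))"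
    by (rule sum.reindex_bij_witness[where i = "\<lambda>x. (fst x, snd x, n - fst x - snd x)" and j = "\<lambda>(a, b, k). (a, b)"])
      auto
  also have "\<dots> = of_real (\<Sum>a\<le>i. \<Sum>b\<le>j. ?f a b (n - a - b))"
    by (simp only: sum.cartesian_product' of_real_sum fst_conv snd_conv)
  finally show ?thesis unfolding lead_sum_def .
qed

section \<open>Reduction of the determining equations to ordinary differential equations\<close>

declare One_nat_def [simp del]

lemma derivs_onD: "derivs_on m I Q \<Longrightarrow> k < m \<Longrightarrow> t \<in> I \<Longrightarrow> (Q k has_real_derivative Q (k + 1) t) (at t)"
  by (simp add: derivs_on_def One_nat_def)

lemma eq_up_to_constant:
  fixes f g :: "real \<Rightarrow> real"
  assumes "open I" "is_interval I" "x0 \<in> I" "x \<in> I"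
    and "\<And>t. t \<in> I \<Longrightarrow> (f has_real_derivative D t) (at t)"
    and "\<And>t. t \<in> I \<Longrightarrow> (g has_real_derivative D t) (at t)"
  shows "f x = g x + (f x0 - g x0)"
proof -
  have "\<exists>c. \<forall>t\<in>I. f t - g t = c"
  proof (rule has_field_derivative_zero_constant)
    show "convex I" using assms(2) is_interval_convex by blast
    fix t assume t: "t \<in> I"
    have "((\<lambda>t. f t - g t) has_real_derivative D t - D t) (at t)"
      by (intro DERIV_diff assms t)
    then show "((\<lambda>t. f t - g t) has_real_derivative 0) (at t within I)"
      by (simp add: has_field_derivative_at_within)
  qed
  then show ?thesis using assms(3,4) by (metis add_diff_cancel_left' diff_add_cancel diff_diff_eq2 add.commute)
qed

text \<open>The coefficients of \<open>p\<^sub>1\<^sup>3 p\<^sub>2\<close>, \<open>p\<^sub>1\<^sup>2 p\<^sub>2\<^sup>2\<close>, \<open>p\<^sub>1 p\<^sub>2\<^sup>3\<close> of a quartic Killing tensor are, as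
  polynomials in \<open>x\<close>, successive Taylor sums of the coefficient polynomials in \<open>y\<close>.\<close>

definition kb :: "real poly \<Rightarrow> real poly \<Rightarrow> real \<Rightarrow> real \<Rightarrow> real" where
  "kb a b x y = poly b y - x * poly (pderiv a) y"

definition kc :: "real poly \<Rightarrow> real poly \<Rightarrow> real poly \<Rightarrow> real \<Rightarrow> real \<Rightarrow> real" where
  "kc a b c x y = poly c y - x * poly (pderiv b) y + x\<^sup>2 / 2 * poly (pderiv (pderiv a)) y"

definition kd :: "real poly \<Rightarrow> real poly \<Rightarrow> real poly \<Rightarrow> real poly \<Rightarrow> real \<Rightarrow> real \<Rightarrow> real" where
  "kd a b c d x y = poly d y - x * poly (pderiv c) y + x\<^sup>2 / 2 * poly (pderiv (pderiv b)) y
     - x ^ 3 / 6 * poly (pderiv (pderiv (pderiv a))) y"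

text \<open>At fixed y this is \<open>kd\<close> as a polynomial in x. For order four it coincides
  with \<xi>_01 - y \<xi>_00', which is why linear compatibility makes its product with
  \<open>Q\<close> a polynomial.\<close>

definition kdp :: "real poly \<Rightarrow> real poly \<Rightarrow> real poly \<Rightarrow> real poly \<Rightarrow> real \<Rightarrow> real poly" where
  "kdp a b c d y = [:poly d y, - poly (pderiv c) y, poly (pderiv (pderiv b)) y / 2, - poly (pderiv (pderiv (pderiv a))) y / 6:]"

lemma poly_kdp: "poly (kdp a b c d y) x = kd a b c d x y"
  by (simp add: kdp_def kd_def power2_eq_square power3_eq_cube algebra_simps)

text \<open>Integration of the equations for w20 and w11 along x leaves unknown functions of y
  alone. These, like the other potential, enter only as coefficients of polynomials in x. Inserting
  everything into the cross-differentiated equation leaves, for each y, an ordinary equation in x;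
  \<open>B y\<close> is the part of w11 that is polynomial in x, and \<open>B'\<close> is its
  derivative in y.\<close>

lemma ode4_of_pde:
  fixes a b c d :: "real poly" and w20 w11 p p2 r :: "real \<Rightarrow> real \<Rightarrow> real" and Q v :: "nat \<Rightarrow> real \<Rightarrow> real"
  assumes I1: "open I1" "is_interval I1" "x0 \<in> I1" and I2: "open I2"
    and Q: "derivs_on 5 I1 Q" and v: "derivs_on 4 I2 v"
    and h1: "\<And>x y. x \<in> I1 \<Longrightarrow> y \<in> I2 \<Longrightarrow>
        ((\<lambda>t. w20 t y) has_real_derivative 4 * poly a y * Q 2 x + kb a b x y * v 1 y) (at x)"
    and h2: "\<And>x y. x \<in> I1 \<Longrightarrow> y \<in> I2 \<Longrightarrow> ((\<lambda>t. w20 x t) has_real_derivative p x y) (at y)"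
    and h3: "\<And>x y. x \<in> I1 \<Longrightarrow> y \<in> I2 \<Longrightarrow> ((\<lambda>t. p x t) has_real_derivative p2 x y) (at y)"
    and h4: "\<And>x y. x \<in> I1 \<Longrightarrow> y \<in> I2 \<Longrightarrow>
        ((\<lambda>t. w11 t y) has_real_derivative 3 * kb a b x y * Q 2 x + 2 * kc a b c x y * v 1 y - p x y) (at x)"
    and h5: "\<And>x y. x \<in> I1 \<Longrightarrow> y \<in> I2 \<Longrightarrow> ((\<lambda>t. w11 x t) has_real_derivative r x y) (at y)"
    and h6: "\<And>x y. x \<in> I1 \<Longrightarrow> y \<in> I2 \<Longrightarrow>
        2 * p x y * Q 2 x + r x y * v 1 y + w11 x y * v 2 y
          - \<kappa> * (poly (pderiv a) y * Q 4 x + kd (pderiv a) (pderiv b) (pderiv c) (pderiv d) x y / 4 * v 3 y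
                + kd a b c d x y / 4 * v 4 y)
        = (3 * kb a b x y * Q 2 x + 2 * kc a b c x y * v 1 y - p x y) * Q 2 x + w11 x y * Q 3 x
          + 2 * (2 * kc a b c x y * Q 2 x + 3 * kd a b c d x y * v 1 y - r x y) * v 1 y
          - \<kappa> * (- poly (pderiv a) y / 4 * Q 4 x + kb a b x y / 4 * Q 5 x
                - kd (pderiv a) (pderiv b) (pderiv c) (pderiv d) x y * v 3 y)"
  obtains B B' :: "real \<Rightarrow> real poly" where
    "\<And>y. y \<in> I2 \<Longrightarrow> degree (B y) \<le> 3"
    "\<And>x y. y \<in> I2 \<Longrightarrow> ((\<lambda>t. poly (B t) x) has_real_derivative poly (B' y) x) (at y)"
    "\<And>y. y \<in> I2 \<Longrightarrow> coeff (B y) 3 = v 1 y * poly (pderiv (pderiv a)) y / 2 + v 2 y * poly (pderiv a) y / 6"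
    "\<And>y. y \<in> I2 \<Longrightarrow> coeff (B' y) 3 = v 1 y * poly (pderiv (pderiv (pderiv a))) y / 2
         + 2 * v 2 y * poly (pderiv (pderiv a)) y / 3 + v 3 y * poly (pderiv a) y / 6" "\<And>y. degree (B' y) \<le> 3"
    "\<And>y. y \<in> I2 \<Longrightarrow> coeff (B y) 2 = - 3 / 2 * v 1 y * poly (pderiv b) y - v 2 y * poly b y / 2"
    "\<And>y. y \<in> I2 \<Longrightarrow> ode4_on I1 \<kappa> (poly b y) (- poly (pderiv a) y) (B y)
       (smult (3 * v 1 y) (B' y) - smult (6 * (v 1 y)\<^sup>2) (kdp a b c d y) + smult (v 2 y) (B y)
         - smult \<kappa> (smult (5 / 4 * v 3 y) (kdp (pderiv a) (pderiv b) (pderiv c) (pderiv d) y)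
              + smult (v 4 y / 4) (kdp a b c d y))) Q"
proof -
  have Qd: "(Q 0 has_real_derivative Q 1 x) (at x)" "(Q 1 has_real_derivative Q 2 x) (at x)" if "x \<in> I1" for x
    using derivs_onD[OF Q _ that, of 0] derivs_onD[OF Q _ that, of 1] by simp_all
  have vd: "(v 1 has_real_derivative v 2 y) (at y)" "(v 2 has_real_derivative v 3 y) (at y)" if "y \<in> I2" for y
    using derivs_onD[OF v _ that, of 1] derivs_onD[OF v _ that, of 2] by simp_all
  define A A1 A2 A3 where "A = poly a" and "A1 = poly (pderiv a)" and "A2 = poly (pderiv (pderiv a))"
    and "A3 = poly (pderiv (pderiv (pderiv a)))"
  define E E1 E2 where "E = poly b" and "E1 = poly (pderiv b)" and "E2 = poly (pderiv (pderiv b))"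
  define C C1 where "C = poly c" and "C1 = poly (pderiv c)"
  note fold = A_def[symmetric] A1_def[symmetric] A2_def[symmetric] A3_def[symmetric]
    E_def[symmetric] E1_def[symmetric] E2_def[symmetric] C_def[symmetric] C1_def[symmetric]
  have pdd: "(A has_real_derivative A1 y) (at y)" "(A1 has_real_derivative A2 y) (at y)"
    "(A2 has_real_derivative A3 y) (at y)" "(E has_real_derivative E1 y) (at y)"
    "(E1 has_real_derivative E2 y) (at y)" "(C has_real_derivative C1 y) (at y)" for y
    unfolding A_def A1_def A2_def A3_def E_def E1_def E2_def C_def C1_def by (rule poly_DERIV)+
  \<comment> \<open>An x-primitive of the right-hand side for w20, followed by its first two
    y-derivatives.\<close>
  define s where "s x y = 4 * A y * Q 1 x + v 1 y * (E y * x - A1 y * x\<^sup>2 / 2)" for x y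
  define s1 where "s1 x y = 4 * A1 y * Q 1 x + v 2 y * (E y * x - A1 y * x\<^sup>2 / 2)
     + v 1 y * (E1 y * x - A2 y * x\<^sup>2 / 2)" for x y
  define s2 where "s2 x y = 4 * A2 y * Q 1 x + v 3 y * (E y * x - A1 y * x\<^sup>2 / 2)
     + 2 * v 2 y * (E1 y * x - A2 y * x\<^sup>2 / 2) + v 1 y * (E2 y * x - A3 y * x\<^sup>2 / 2)" for x y
  have ds: "((\<lambda>t. s x t) has_real_derivative s1 x y) (at y)" if "y \<in> I2" for x y
    unfolding s_def s1_def by (auto intro!: derivative_eq_intros pdd vd that simp: field_simps)
  have ds1: "((\<lambda>t. s1 x t) has_real_derivative s2 x y) (at y)" if "y \<in> I2" for x y
    unfolding s1_def s2_def by (auto intro!: derivative_eq_intros pdd vd that simp: field_simps)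
  define \<alpha> \<alpha>1 \<alpha>2 where "\<alpha> y = w20 x0 y - s x0 y" and "\<alpha>1 y = p x0 y - s1 x0 y" and "\<alpha>2 y = p2 x0 y - s2 x0 y" for y
  have d\<alpha>: "(\<alpha> has_real_derivative \<alpha>1 y) (at y)" "(\<alpha>1 has_real_derivative \<alpha>2 y) (at y)" if "y \<in> I2" for y
    unfolding \<alpha>_def \<alpha>1_def \<alpha>2_def by (intro DERIV_diff ds ds1 h2 h3 I1 that)+
  have w20: "w20 x y = s x y + \<alpha> y" if x: "x \<in> I1" and y: "y \<in> I2" for x y
    unfolding \<alpha>_def
  proof (rule eq_up_to_constant[OF I1(1,2,3) x h1[OF _ y]])
    fix t assume t: "t \<in> I1"
    show "((\<lambda>t. s t y) has_real_derivative 4 * poly a y * Q 2 t + kb a b t y * v 1 y) (at t)"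
      unfolding s_def kb_def fold by (auto intro!: derivative_eq_intros Qd t simp: algebra_simps)
  qed
  have pxy: "p x y = s1 x y + \<alpha>1 y" if x: "x \<in> I1" and y: "y \<in> I2" for x y
    by (rule deriv_eq_on_open[OF I2 y w20[OF x] h2[OF x y] DERIV_add[OF ds[OF y] d\<alpha>(1)[OF y]]])
  \<comment> \<open>Integration by parts of 3 kb Q'' gives 3 kb Q' + 3 a' Q, because the
    x-derivative of kb is -a'. The term 4 a' Q' of p contributes -4 a' Q, so -a' Q remains.\<close>
  define q where "q x y = 3 * kb a b x y * Q 1 x - A1 y * Q 0 x
     + 2 * v 1 y * (C y * x - E1 y * x\<^sup>2 / 2 + A2 y * x^3 / 6)
     - v 2 y * (E y * x\<^sup>2 / 2 - A1 y * x^3 / 6) - v 1 y * (E1 y * x\<^sup>2 / 2 - A2 y * x^3 / 6) - \<alpha>1 y * x" for x y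
  define q1 where "q1 x y = 3 * kb (pderiv a) (pderiv b) x y * Q 1 x - A2 y * Q 0 x
     + 2 * v 2 y * (C y * x - E1 y * x\<^sup>2 / 2 + A2 y * x^3 / 6)
     + 2 * v 1 y * (C1 y * x - E2 y * x\<^sup>2 / 2 + A3 y * x^3 / 6)
     - v 3 y * (E y * x\<^sup>2 / 2 - A1 y * x^3 / 6) - v 2 y * (E1 y * x\<^sup>2 / 2 - A2 y * x^3 / 6)
     - v 2 y * (E1 y * x\<^sup>2 / 2 - A2 y * x^3 / 6) - v 1 y * (E2 y * x\<^sup>2 / 2 - A3 y * x^3 / 6) - \<alpha>2 y * x" for x y
  have dq: "((\<lambda>t. q x t) has_real_derivative q1 x y) (at y)" if "y \<in> I2" for x y
    unfolding q_def q1_def kb_def fold by (auto intro!: derivative_eq_intros pdd vd d\<alpha> that simp: field_simps)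
  define \<gamma> \<gamma>1 where "\<gamma> y = w11 x0 y - q x0 y" and "\<gamma>1 y = r x0 y - q1 x0 y" for y
  have d\<gamma>: "(\<gamma> has_real_derivative \<gamma>1 y) (at y)" if "y \<in> I2" for y
    unfolding \<gamma>_def \<gamma>1_def by (intro DERIV_diff dq h5 I1 that)
  have w11: "w11 x y = q x y + \<gamma> y" if x: "x \<in> I1" and y: "y \<in> I2" for x y
    unfolding \<gamma>_def
  proof (rule eq_up_to_constant[OF I1(1,2,3) x h4[OF _ y]])
    fix t assume t: "t \<in> I1"
    show "((\<lambda>t. q t y) has_real_derivative 3 * kb a b t y * Q 2 t + 2 * kc a b c t y * v 1 y - p t y) (at t)"
      unfolding q_def kb_def kc_def pxy[OF t y] s1_def fold
      by (auto intro!: derivative_eq_intros Qd t simp: power2_eq_square field_simps)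
  qed
  have rxy: "r x y = q1 x y + \<gamma>1 y" if x: "x \<in> I1" and y: "y \<in> I2" for x y
    by (rule deriv_eq_on_open[OF I2 y w11[OF x] h5[OF x y] DERIV_add[OF dq[OF y] d\<gamma>[OF y]]])
  define B where "B y = [:\<gamma> y, 2 * v 1 y * C y - \<alpha>1 y, - 3 / 2 * v 1 y * E1 y - v 2 y * E y / 2,
     v 1 y * A2 y / 2 + v 2 y * A1 y / 6:]" for y
  define B' where "B' y = [:\<gamma>1 y, 2 * v 2 y * C y + 2 * v 1 y * C1 y - \<alpha>2 y,
     - 2 * v 2 y * E1 y - 3 / 2 * v 1 y * E2 y - v 3 y * E y / 2,
     v 1 y * A3 y / 2 + 2 * v 2 y * A2 y / 3 + v 3 y * A1 y / 6:]" for y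
  show thesis
  proof (rule that[of B B'])
    fix x y assume y: "y \<in> I2"
    show "((\<lambda>t. poly (B t) x) has_real_derivative poly (B' y) x) (at y)"
      unfolding B_def B'_def by (auto intro!: derivative_eq_intros pdd vd d\<alpha> d\<gamma> y simp: field_simps)
  next
    fix y assume y: "y \<in> I2"
    show "ode4_on I1 \<kappa> (poly b y) (- poly (pderiv a) y) (B y)
       (smult (3 * v 1 y) (B' y) - smult (6 * (v 1 y)\<^sup>2) (kdp a b c d y) + smult (v 2 y) (B y)
         - smult \<kappa> (smult (5 / 4 * v 3 y) (kdp (pderiv a) (pderiv b) (pderiv c) (pderiv d) y)
              + smult (v 4 y / 4) (kdp a b c d y))) Q"
      unfolding ode4_on_def
    proof
      fix x assume x: "x \<in> I1"
      define KD KD1 where "KD = kd a b c d x y" and "KD1 = kd (pderiv a) (pderiv b) (pderiv c) (pderiv d) x y"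
      have w: "w11 x y = 3 * kb a b x y * Q 1 x - A1 y * Q 0 x + poly (B y) x"
        unfolding w11[OF x y] q_def B_def by (simp add: power2_eq_square power3_eq_cube algebra_simps)
      have rr: "r x y = 3 * kb (pderiv a) (pderiv b) x y * Q 1 x - A2 y * Q 0 x + poly (B' y) x"
        unfolding rxy[OF x y] q1_def B'_def by (simp add: power2_eq_square power3_eq_cube algebra_simps)
      have pp: "p x y = 4 * A1 y * Q 1 x + 2 * kc a b c x y * v 1 y - poly (pderiv (B y)) x"
        unfolding pxy[OF x y] s1_def B_def kc_def fold by (simp add: pderiv_pCons power2_eq_square algebra_simps)
      have B2: "poly (pderiv (pderiv (B y))) x = - 3 * v 1 y * kb (pderiv a) (pderiv b) x y - v 2 y * kb a b x y"
        unfolding B_def kb_def fold by (simp add: pderiv_pCons algebra_simps)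
      have B3: "poly (pderiv (pderiv (pderiv (B y)))) x = 3 * v 1 y * A2 y + v 2 y * A1 y"
        unfolding B_def by (simp add: pderiv_pCons algebra_simps)
      define KB KB1 KC P0 P1 PB where "KB = kb a b x y" "KB1 = kb (pderiv a) (pderiv b) x y" "KC = kc a b c x y"
        "P0 = poly (B y) x" "P1 = poly (pderiv (B y)) x" "PB = poly (B' y) x"
      note z = this
      have kb: "E y + - A1 y * x = KB" unfolding z kb_def fold by simp
      show "\<kappa> / 4 * ((poly b y + - poly (pderiv a) y * x) * Q 5 x + 5 * - poly (pderiv a) y * Q 4 x)
        - (3 * (poly b y + - poly (pderiv a) y * x) * (Q 2 x * Q 2 x + Q 1 x * Q 3 x) + 12 * - poly (pderiv a) y * Q 1 x * Q 2 x + - poly (pderiv a) y * Q 0 x * Q 3 x)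
        = poly (B y) x * Q 3 x + 3 * poly (pderiv (B y)) x * Q 2 x + 3 * poly (pderiv (pderiv (B y))) x * Q 1 x
        + poly (pderiv (pderiv (pderiv (B y)))) x * Q 0 x
        - poly (smult (3 * v 1 y) (B' y) - smult (6 * (v 1 y)\<^sup>2) (kdp a b c d y) + smult (v 2 y) (B y)
         - smult \<kappa> (smult (5 / 4 * v 3 y) (kdp (pderiv a) (pderiv b) (pderiv c) (pderiv d) y)
              + smult (v 4 y / 4) (kdp a b c d y))) x"
        using h6[OF x y]
        unfolding kb B2 B3 poly_add poly_diff poly_smult poly_kdp w rr pp fold
          KD_def[symmetric] KD1_def[symmetric] z[symmetric]
        by (simp add: power2_eq_square algebra_simps)
    qed
  qed (simp_all add: B_def B'_def fold numeral_3_eq_3 numeral_2_eq_2 One_nat_def)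
qed

lemma poly_eq_0_on_open: "open I \<Longrightarrow> I \<noteq> {} \<Longrightarrow> (\<And>t. t \<in> I \<Longrightarrow> poly p t = 0) \<Longrightarrow> p = (0::real poly)"
  using poly_eq_on_open[of I p 0] by simp

text \<open>One function \<open>Q\<close> satisfies an equation for every y, and its denominator
  divides every \<open>kdp a b c d y\<close>, a polynomial of degree at most three. Varying y is
  what controls a pole with a residue other than -h^2: it fixes the position of this pole and ties b
  to the derivative of a.\<close>

lemma listed_order_4:
  fixes a b c d :: "real poly" and Q v :: "nat \<Rightarrow> real \<Rightarrow> real" and B B' :: "real \<Rightarrow> real poly"
  assumes I1: "open I1" "I1 \<noteq> {}" and I2: "open I2" "I2 \<noteq> {}"
    and Q: "derivs_on 5 I1 Q"
    and lin: "\<And>y. y \<in> I2 \<Longrightarrow> \<exists>S. \<forall>x\<in>I1. poly (kdp a b c d y) x * Q 0 x = poly S x"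
    and nontriv: "\<exists>y\<in>I2. kdp a b c d y \<noteq> 0" "\<exists>y\<in>I2. poly b y \<noteq> 0 \<or> poly (pderiv a) y \<noteq> 0"
    and B: "\<And>y. y \<in> I2 \<Longrightarrow> degree (B y) \<le> 3"
    and B': "\<And>x y. y \<in> I2 \<Longrightarrow> ((\<lambda>t. poly (B t) x) has_real_derivative poly (B' y) x) (at y)" "\<And>y. degree (B' y) \<le> 3"
    and B3: "\<And>y. y \<in> I2 \<Longrightarrow> coeff (B y) 3 = v 1 y * poly (pderiv (pderiv a)) y / 2 + v 2 y * poly (pderiv a) y / 6"
      "\<And>y. y \<in> I2 \<Longrightarrow> coeff (B' y) 3 = v 1 y * poly (pderiv (pderiv (pderiv a))) y / 2
         + 2 * v 2 y * poly (pderiv (pderiv a)) y / 3 + v 3 y * poly (pderiv a) y / 6"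
    and B2: "\<And>y. y \<in> I2 \<Longrightarrow> coeff (B y) 2 = - 3 / 2 * v 1 y * poly (pderiv b) y - v 2 y * poly b y / 2"
    and ode: "\<And>y. y \<in> I2 \<Longrightarrow> ode4_on I1 (h\<^sup>2) (poly b y) (- poly (pderiv a) y) (B y)
       (smult (3 * v 1 y) (B' y) - smult (6 * (v 1 y)\<^sup>2) (kdp a b c d y) + smult (v 2 y) (B y)
         - smult (h\<^sup>2) (smult (5 / 4 * v 3 y) (kdp (pderiv a) (pderiv b) (pderiv c) (pderiv d) y)
              + smult (v 4 y / 4) (kdp a b c d y))) Q"
  shows "listed_potential h I1 (Q 1)"
proof -
  have Qd: "(Q 0 has_real_derivative Q 1 x) (at x)" if "x \<in> I1" for x
    using derivs_onD[OF Q _ that, of 0] by simp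
  then have cont: "continuous_on I1 (Q 0)"
    by (meson DERIV_isCont continuous_at_imp_continuous_on)
  obtain ys where ys: "ys \<in> I2" "kdp a b c d ys \<noteq> 0" using nontriv(1) by blast
  obtain S where S: "\<And>x. x \<in> I1 \<Longrightarrow> poly (kdp a b c d ys) x * Q 0 x = poly S x" using lin[OF ys(1)] by blast
  obtain N D where ND: "lead_coeff D = 1" "bezout N D"
    "\<And>t. t \<in> I1 \<Longrightarrow> poly D t \<noteq> 0 \<and> Q 0 t = poly N t / poly D t"
    and min: "\<And>p q. (\<And>t. t \<in> I1 \<Longrightarrow> poly p t * Q 0 t = poly q t) \<Longrightarrow> D dvd p"
  proof (rule reduced_fraction[OF I1 cont ys(2) S])
    fix N D
    assume *: "lead_coeff D = 1" "bezout N D" "\<And>t. t \<in> I1 \<Longrightarrow> poly D t \<noteq> 0 \<and> Q 0 t = poly N t / poly D t"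
      "\<And>p q. (\<And>t. t \<in> I1 \<Longrightarrow> poly p t * Q 0 t = poly q t) \<Longrightarrow> D dvd p"
    show thesis by (rule that[OF *])
  qed
  have dvd: "D dvd kdp a b c d y" if "y \<in> I2" for y
    using lin[OF that] min by blast
  have degk: "degree (kdp a b c d y) \<le> 3" for y
    unfolding kdp_def by (simp add: One_nat_def)
  have degD: "degree D \<le> 3"
    using dvd_imp_degree_le[OF dvd[OF ys(1)] ys(2)] degk[of ys] by simp
  have red: "reduced_on I1 (Q 0) N D" unfolding reduced_on_def using ND by blast
  \<comment> \<open>The value yb gives the leading coefficient its largest degree e in x. If e = 0,
    then \<open>pderiv a = 0\<close> and the cubic coefficients of B and R vanish as well, so the
    bound 2 + e holds either way.\<close>
  obtain yb and e :: nat where yb: "yb \<in> I2" and be: "- poly (pderiv a) yb \<noteq> 0 \<and> e = 1 \<or> - poly (pderiv a) yb = 0 \<and> poly b yb \<noteq> 0 \<and> e = 0"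
    and e0: "e = 0 \<Longrightarrow> pderiv a = 0"
  proof (cases "pderiv a = 0")
    case True
    then show thesis using nontriv(2) that[of _ 0] by auto
  next
    case False
    then obtain y where "y \<in> I2" "poly (pderiv a) y \<noteq> 0"
      using poly_eq_0_on_open[OF I2] by blast
    then show thesis using that[of y 1] by auto
  qed
  define Rp where "Rp y = smult (3 * v 1 y) (B' y) - smult (6 * (v 1 y)\<^sup>2) (kdp a b c d y) + smult (v 2 y) (B y)
         - smult (h\<^sup>2) (smult (5 / 4 * v 3 y) (kdp (pderiv a) (pderiv b) (pderiv c) (pderiv d) y)
              + smult (v 4 y / 4) (kdp a b c d y))" for y
  note ode' = ode[folded Rp_def]
  have degs: "degree (B yb) \<le> 2 + e \<and> degree (Rp yb) \<le> 2 + e"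
  proof -
    have deg2: "degree p \<le> 2" if "degree p \<le> 3" "coeff p 3 = 0" for p :: "real poly"
      by (metis One_nat_def Suc_1 that eval_nat_numeral(3) le_SucE leading_coeff_0_iff degree_0 le0)
    have kd3: "degree (kdp (pderiv a) (pderiv b) (pderiv c) (pderiv d) yb) \<le> 3"
      unfolding kdp_def by (simp add: One_nat_def)
    show ?thesis
    proof (cases "e = 0")
      case True
      then have a: "pderiv a = 0" by (rule e0)
      have "degree (B yb) \<le> 2" by (rule deg2[OF B[OF yb]]) (simp add: B3[OF yb] a)
      moreover have "degree (B' yb) \<le> 2" by (rule deg2[OF B'(2)]) (simp add: B3[OF yb] a)
      moreover have "degree (kdp a b c d yb) \<le> 2"
        by (rule deg2[OF degk]) (simp add: kdp_def a numeral_3_eq_3)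
      moreover have "degree (kdp (pderiv a) (pderiv b) (pderiv c) (pderiv d) yb) \<le> 2"
        by (rule deg2[OF kd3]) (simp add: kdp_def a numeral_3_eq_3)
      ultimately show ?thesis unfolding Rp_def True
        by (auto intro!: degree_diff_le degree_add_le order_trans[OF degree_smult_le])
    next
      case False
      then have "e = 1" using be by auto
      then show ?thesis unfolding Rp_def using B[OF yb] B'(2) degk kd3
        by (auto intro!: degree_diff_le degree_add_le order_trans[OF degree_smult_le])
    qed
  qed
  have degN: "degree N \<le> degree D + 3"
    by (rule ode4_degree[OF I1 red Q ode'[OF yb] be]) (use degs in auto)
  have bb: "poly b yb \<noteq> 0 \<or> - poly (pderiv a) yb \<noteq> 0" using be by auto
  note P = ode4_poles[OF I1 red Q ode']
  have good: "good_poles I1 Q N D"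
    unfolding good_poles_def using I1 red Qd degN P(1,2)[OF yb bb] by blast
  show ?thesis
  proof (cases "\<forall>r. pole_at D r \<longrightarrow> resid N D r = - of_real (h\<^sup>2)")
    case True
    then show ?thesis using listed_generic[OF good degD] by blast
  next
    case False
    then obtain r0 where r0: "pole_at D r0" "resid N D r0 \<noteq> - of_real (h\<^sup>2)" by blast
    \<comment> \<open>A deviating residue is possible only at a zero of the leading coefficient. As
      r0 does not depend on y, it is a zero for all y at once.\<close>
    have br: "of_real (poly b y) + of_real (- poly (pderiv a) y) * r0 = (0::complex)" if y: "y \<in> I2" for y
      using P(3)[OF y _ r0(1)] r0(2) by fastforce
    have ab: "poly (pderiv a) yb \<noteq> 0"
      using br[OF yb] be by auto
    define c0 where "c0 = poly b yb / poly (pderiv a) yb"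
    have "r0 = of_real c0" using br[OF yb] ab by (simp add: c0_def field_simps)
    then have bc: "poly b y = c0 * poly (pderiv a) y" if "y \<in> I2" for y
      using br[OF that] by (metis add_uminus_conv_diff eq_iff_diff_eq_0 mult.commute mult_minus_left of_real_eq_iff of_real_minus of_real_mult)
    have bpoly: "b = smult c0 (pderiv a)"
      by (rule poly_eq_on_open[OF I2]) (simp add: bc)
    have gen: "resid N D r = - of_real (h\<^sup>2)" if "pole_at D r" "r \<noteq> of_real c0" for r
    proof (rule P(3)[OF yb bb that(1)])
      have "of_real (poly b yb) + of_real (- poly (pderiv a) yb) * r = of_real (poly (pderiv a) yb) * (of_real c0 - r)"
        by (simp add: bc[OF yb] algebra_simps)
      then show "of_real (poly b yb) + of_real (- poly (pderiv a) yb) * r \<noteq> 0"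
        using that(2) ab by simp
    qed
    have Dc: "poly D c0 = 0"
      using r0(1) \<open>r0 = of_real c0\<close> by simp
    have k0: "poly (kdp a b c d y) c0 = 0" if "y \<in> I2" for y
      using dvd[OF that] Dc by (auto elim!: dvdE)
    \<comment> \<open>The relation b = c0 a' ties the x^2-coefficient to the x^3-coefficient.
      Together with the root c0 this makes the cubic an odd function of x - c0.\<close>
    have kfac: "kdp a b c d y = smult (coeff (kdp a b c d y) 3) ([:-c0, 1:] * [:c0\<^sup>2, -2 * c0, 1:])
        + smult (coeff (kdp a b c d y) 1 - 3 * c0\<^sup>2 * coeff (kdp a b c d y) 3) [:-c0, 1:]" if y: "y \<in> I2" for y
    proof -
      define K where "K = kdp a b c d y"
      have K: "K = [:coeff K 0, coeff K 1, coeff K 2, coeff K 3:]"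
        unfolding K_def by (rule cubic_poly_eq[OF degk])
      have c2: "coeff K 2 = - 3 * c0 * coeff K 3"
        unfolding K_def kdp_def bpoly by (simp add: pderiv_smult numeral_3_eq_3 numeral_2_eq_2)
      have "poly K c0 = 0" using k0[OF y] by (simp add: K_def)
      then have "coeff K 0 + c0 * coeff K 1 + c0\<^sup>2 * coeff K 2 + c0^3 * coeff K 3 = 0"
        by (subst (asm) K) (simp add: power2_eq_square power3_eq_cube algebra_simps)
      then have "coeff K 0 = - c0 * coeff K 1 + 2 * c0^3 * coeff K 3"
        unfolding c2 by (simp add: power2_eq_square power3_eq_cube algebra_simps)
      then show ?thesis unfolding K_def[symmetric]
        by (subst K) (simp add: c2 power2_eq_square power3_eq_cube algebra_simps)
    qed
    define \<delta> \<epsilon> where "\<delta> = coeff (kdp a b c d ys) 3" and "\<epsilon> = coeff (kdp a b c d ys) 1 - 3 * c0\<^sup>2 * coeff (kdp a b c d ys) 3"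
    have kys: "kdp a b c d ys = [:-c0, 1:] * (smult \<delta> [:c0\<^sup>2, -2 * c0, 1:] + [:\<epsilon>:])"
      using kfac[OF ys(1)] unfolding \<delta>_def \<epsilon>_def by (simp add: algebra_simps)
    have deg: "degree D = 1 \<or> degree D = 2 \<or> degree D = 3"
    proof -
      have "degree D \<noteq> 0"
      proof
        assume "degree D = 0"
        then have "D = 1" using ND(1) by (metis degree_eq_zeroE lead_coeff_pCons(2) one_pCons)
        then show False using Dc by simp
      qed
      then show ?thesis using degD by linarith
    qed
    then consider "degree D = 1" | "degree D = 2" | "degree D = 3" by blast
    then show ?thesis
    proof cases
      case 1
      then show ?thesis by (rule listed_degree_1[OF good])
    next
      case 3
      \<comment> \<open>With three poles the denominator is a constant multiple of
        \<open>kdp\<close>, so the poles are symmetric about c0.\<close>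
      obtain K where K: "kdp a b c d ys = D * K" using dvd[OF ys(1)] by (auto elim: dvdE)
      then have "K \<noteq> 0" "D \<noteq> 0" using ys(2) by auto
      then have "degree K = 0" using K degk[of ys] 3 by (simp add: degree_mult_eq)
      then obtain k where k: "K = [:k:]" "k \<noteq> 0" using \<open>K \<noteq> 0\<close> by (metis degree_eq_zeroE pCons_0_0)
      have "\<delta> = k" unfolding \<delta>_def K k using 3 ND(1) by simp
      have "D = smult (1 / k) (kdp a b c d ys)" unfolding K k using k(2) by simp
      also have "\<dots> = [:-c0, 1:] * [:c0\<^sup>2 - (- \<epsilon> / k), -2 * c0, 1:]"
        unfolding kys \<open>\<delta> = k\<close> using k(2) by (simp add: field_simps)
      finally show ?thesis using gen by (rule listed_degree_3_symmetric[OF good])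
    next
      case 2
      \<comment> \<open>Two poles are impossible here: the other pole s alone produces the
        coefficient at 4 in the expansion at c0, which is therefore non-zero, whereas the right-hand
        side of the residue relation vanishes. Then the residue at c0 would be -h^2 after
        all.\<close>
      define C where "C = complex_of_real c0"
      have pC: "pole_at D C" unfolding C_def using Dc by simp
      have sq: "\<And>s. pole_at D s \<Longrightarrow> poly (pderiv (cpoly D)) s \<noteq> 0" by (rule P(1)[OF yb bb])
      have "card {s. pole_at D s} = 2" using card_simple_poles(1)[OF ND(1) sq] 2 by simp
      then obtain s1 s2 where s12: "{s. pole_at D s} = {s1, s2}" "s1 \<noteq> s2"
        by (auto simp: card_2_iff)
      define s where "s = (if C = s1 then s2 else s1)"
      have "C \<in> {s1, s2}" using pC s12(1) by blast
      then have s: "{s. pole_at D s} = {C, s}" "s \<noteq> C"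
        using s12 by (auto simp: s_def)
      have ps: "pole_at D s" using s by blast
      have rs: "resid N D s \<noteq> 0" by (rule no_poles_if_classical[OF ND(2) ps sq[OF ps]])
      obtain u0 u1 u2 u3 where U: "N div D = [:u0, u1, u2, u3:]"
        by (rule good_poles_quotient[OF good]) blast
      have D0: "D \<noteq> 0" using ND(1) by auto
      have "expand N D C $$ 4 = emb (at_pt C) (cpoly (N div D)) $$ 4 + resid N D s / (C - s) ^ 5"
      proof -
        have "{C, s} - {C} = {s}" using s(2) by auto
        then show ?thesis using expand_nth[OF D0 ND(1) sq pC, of N 4] s(1) by simp
      qed
      moreover have "emb (at_pt C) (cpoly (N div D)) $$ 4 = 0"
        using emb_at_nth_degree[of "cpoly (N div D)" 4 C] unfolding U by (simp add: One_nat_def)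
      ultimately have e4: "expand N D C $$ 4 \<noteq> 0" using rs s(2) by simp
      define k where "k = expand N D C $$ 0"
      have Bk: "of_real (poly (B y) c0) = of_real (poly (pderiv a) y) * k"
        if "y \<in> I2" "poly (pderiv a) y \<noteq> 0" for y
        using P(4)[OF that(1) _ pC] that(2) br[OF that(1)] \<open>r0 = of_real c0\<close> by (simp add: k_def C_def)
      define kk where "kk = poly (B yb) c0 / poly (pderiv a) yb"
      have k: "k = of_real kk" using Bk[OF yb ab] ab by (simp add: kk_def field_simps)
      have Bkk: "poly (B y) c0 = poly (pderiv a) y * kk" if "y \<in> I2" "poly (pderiv a) y \<noteq> 0" for y
        using Bk[OF that] unfolding k of_real_mult[symmetric] of_real_eq_iff .
      \<comment> \<open>The constant term kk of \<open>Q\<close> at c0 does not depend on y. Hence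
        the relation between B and kk may be differentiated in y, near yb, where the derivative of a
        is non-zero.\<close>
      have By: "poly (B' yb) c0 = poly (pderiv (pderiv a)) yb * kk"
      proof (rule deriv_eq_on_open[where I = "I2 \<inter> (\<lambda>y. poly (pderiv a) y) -` (- {0})"
            and Q = "\<lambda>y. poly (B y) c0" and F = "\<lambda>y. poly (pderiv a) y * kk"])
        show "open (I2 \<inter> (\<lambda>y. poly (pderiv a) y) -` (- {0}))"
          using I2 by (intro continuous_open_preimage continuous_intros) auto
        show "((\<lambda>y. poly (pderiv a) y * kk) has_real_derivative poly (pderiv (pderiv a)) yb * kk) (at yb)"
          by (rule DERIV_cmult_right[OF poly_DERIV])
        show "((\<lambda>y. poly (B y) c0) has_real_derivative poly (B' yb) c0) (at yb)"
          by (rule B'(1)[OF yb])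
      qed (use yb ab Bkk in auto)
      have kd0: "poly (kdp (pderiv a) (pderiv b) (pderiv c) (pderiv d) yb) c0 = 0"
      proof (rule deriv_eq_on_open[OF I2(1) yb, of "\<lambda>y. kd a b c d c0 y" "\<lambda>_. 0"])
        show "((\<lambda>y. kd a b c d c0 y) has_real_derivative poly (kdp (pderiv a) (pderiv b) (pderiv c) (pderiv d) yb) c0) (at yb)"
          unfolding poly_kdp kd_def by (auto intro!: derivative_eq_intros)
      qed (use k0 in \<open>auto simp: poly_kdp\<close>)
      have by1: "poly b yb = c0 * poly (pderiv a) yb" "poly (pderiv b) yb = c0 * poly (pderiv (pderiv a)) yb"
        unfolding bpoly by (simp_all add: pderiv_smult)
      have Bc: "B yb = [:coeff (B yb) 0, coeff (B yb) 1, coeff (B yb) 2, coeff (B yb) 3:]"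
        by (rule cubic_poly_eq[OF B[OF yb]])
      have Bd2: "poly (pderiv (pderiv (B yb))) c0 = 0"
      proof -
        have "poly (pderiv (pderiv (B yb))) c0 = 2 * coeff (B yb) 2 + 6 * c0 * coeff (B yb) 3"
          by (subst Bc) (simp add: pderiv_pCons algebra_simps)
        then show ?thesis unfolding B2[OF yb] B3(1)[OF yb] by1 by (simp add: algebra_simps)
      qed
      have Bd3: "poly (pderiv (pderiv (pderiv (B yb)))) c0 = 3 * v 1 yb * poly (pderiv (pderiv a)) yb + v 2 yb * poly (pderiv a) yb"
      proof -
        have "poly (pderiv (pderiv (pderiv (B yb)))) c0 = 6 * coeff (B yb) 3"
          by (subst Bc) (simp add: pderiv_pCons algebra_simps)
        then show ?thesis unfolding B3(1)[OF yb] by (simp add: algebra_simps)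
      qed
      have R0: "poly (Rp yb) c0 = 3 * v 1 yb * (poly (pderiv (pderiv a)) yb * kk) + v 2 yb * (poly (pderiv a) yb * kk)"
        unfolding Rp_def poly_diff poly_add poly_smult kd0 k0[OF yb] By Bkk[OF yb ab] by simp
      have "30 * of_real (- poly (pderiv a) yb) * expand N D C $$ 4 * (of_real (h\<^sup>2) + resid N D C)
        = 3 * poly (cpoly (pderiv (pderiv (B yb)))) C * expand N D C $$ 1
        + poly (cpoly (pderiv (pderiv (pderiv (B yb))))) C * expand N D C $$ 0 - poly (cpoly (Rp yb)) C"
        by (rule P(5)[OF yb bb pC _ B[OF yb]]) (use br[OF yb] \<open>r0 = of_real c0\<close> C_def in simp)
      also have "\<dots> = 0"
        unfolding k_def[symmetric] unfolding C_def poly_cpoly_of_real Bd2 Bd3 R0 k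
        by (simp add: algebra_simps)
      finally have "of_real (h\<^sup>2) + resid N D C = 0"
        using e4 ab by simp
      then have "resid N D C = - of_real (h\<^sup>2)"
        by (simp only: eq_neg_iff_add_eq_0 add.commute)
      then show ?thesis using r0(2) \<open>r0 = of_real c0\<close> by (simp add: C_def)
    qed
  qed
qed

section \<open>Integrals of orders two and three\<close>

definition kcp :: "real poly \<Rightarrow> real poly \<Rightarrow> real poly \<Rightarrow> real \<Rightarrow> real poly" where
  "kcp a b c y = [:poly c y, - poly (pderiv b) y, poly (pderiv (pderiv a)) y / 2:]"

text \<open>After multiplication by x - s the left-hand side is the derivative of (x - s)^2 V, so a
  quadrature solves the equation.\<close>

lemma linear_ode_solution:
  fixes V V' :: "real \<Rightarrow> real"
  assumes I: "open I" "is_interval I" "x0 \<in> I"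
    and V: "\<And>x. x \<in> I \<Longrightarrow> (V has_real_derivative V' x) (at x)"
    and ode: "\<And>x. x \<in> I \<Longrightarrow> (x - s) * V' x + 2 * V x = r0 + r1 * (x - s) + r2 * (x - s)\<^sup>2"
  obtains l where "\<And>x. x \<in> I \<Longrightarrow> V x = r0 / 2 + r1 / 3 * (x - s) + r2 / 4 * (x - s)\<^sup>2 + l / (x - s)\<^sup>2"
proof -
  define p0 p1 p2 where p: "p0 = r0 / 2" "p1 = r1 / 3" "p2 = r2 / 4"
  then have r: "r0 = 2 * p0" "r1 = 3 * p1" "r2 = 4 * p2" by simp_all
  define l where "l = (x0 - s)\<^sup>2 * V x0 - (p0 * (x0 - s)\<^sup>2 + p1 * (x0 - s)^3 + p2 * (x0 - s)^4)"
  have *: "(x - s)\<^sup>2 * V x = p0 * (x - s)\<^sup>2 + p1 * (x - s)^3 + p2 * (x - s)^4 + l" if x: "x \<in> I" for x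
    unfolding l_def
  proof (rule eq_up_to_constant[OF I x])
    fix t assume t: "t \<in> I"
    have "((\<lambda>x. (x - s)\<^sup>2 * V x) has_real_derivative (t - s) * ((t - s) * V' t + 2 * V t)) (at t)"
      by (auto intro!: derivative_eq_intros V t simp: power2_eq_square algebra_simps)
    then show "((\<lambda>x. (x - s)\<^sup>2 * V x) has_real_derivative (t - s) * (r0 + r1 * (t - s) + r2 * (t - s)\<^sup>2)) (at t)"
      by (simp only: ode[OF t])
    show "((\<lambda>x. p0 * (x - s)\<^sup>2 + p1 * (x - s)^3 + p2 * (x - s)^4) has_real_derivative
        (t - s) * (r0 + r1 * (t - s) + r2 * (t - s)\<^sup>2)) (at t)"
    proof (rule DERIV_cong)
      show "((\<lambda>x. p0 * (x - s)\<^sup>2 + p1 * (x - s)^3 + p2 * (x - s)^4) has_real_derivative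
          p0 * (2 * (t - s)) + p1 * (3 * (t - s)\<^sup>2) + p2 * (4 * (t - s)^3)) (at t)"
        by (auto intro!: derivative_eq_intros)
      show "p0 * (2 * (t - s)) + p1 * (3 * (t - s)\<^sup>2) + p2 * (4 * (t - s)^3) = (t - s) * (r0 + r1 * (t - s) + r2 * (t - s)\<^sup>2)"
        unfolding r by (simp add: power2_eq_square power3_eq_cube distrib_left mult_ac)
    qed
  qed
  show thesis
  proof (rule that)
    fix x assume x: "x \<in> I"
    show "V x = r0 / 2 + r1 / 3 * (x - s) + r2 / 4 * (x - s)\<^sup>2 + l / (x - s)\<^sup>2"
    proof (cases "x = s")
      case True
      \<comment> \<open>At x = s the equation itself gives V = r0 / 2, and l / 0 = 0.\<close>
      then show ?thesis using ode[OF x] by simp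
    next
      case False
      have "(x - s)\<^sup>2 * V x = (x - s)\<^sup>2 * (p0 + p1 * (x - s) + p2 * (x - s)\<^sup>2) + l"
        unfolding *[OF x] by (simp add: power2_eq_square power3_eq_cube power4_eq_xxxx algebra_simps)
      then have "V x = ((x - s)\<^sup>2 * (p0 + p1 * (x - s) + p2 * (x - s)\<^sup>2) + l) / (x - s)\<^sup>2"
        using False by (simp add: eq_divide_eq mult.commute)
      also have "\<dots> = p0 + p1 * (x - s) + p2 * (x - s)\<^sup>2 + l / (x - s)\<^sup>2"
        using False by (simp only: add_divide_distrib) simp
      finally show ?thesis by (simp only: p)
    qed
  qed
qed

text \<open>A linear term next to an inverse square about the same point is in none of the listed
  forms. The disjunction excludes this; it is obtained in each application by varying the other
  coordinate.\<close>

lemma listed_linear_ode: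
  assumes V: "\<And>x. x \<in> I \<Longrightarrow> V x = r0 / 2 + r1 / 3 * (x - s) + r2 / 4 * (x - s)\<^sup>2 + l / (x - s)\<^sup>2"
    and "r1 = 0 \<or> l = 0"
  shows "listed_potential h I V"
  using assms(2)
proof
  assume "r1 = 0"
  then show ?thesis using V by (intro listed_II[where a = "r0 / 2" and b = "r2 / 4" and c = s and l = l]) auto
next
  assume l: "l = 0"
  show ?thesis
  proof (rule listed_quadratic[where a = "r0 / 2 - r1 / 3 * s + r2 / 4 * s\<^sup>2" and b = "r1 / 3 - r2 / 2 * s" and c = "r2 / 4"])
    fix q assume q: "q \<in> I"
    show "V q = r0 / 2 - r1 / 3 * s + r2 / 4 * s\<^sup>2 + (r1 / 3 - r2 / 2 * s) * q + r2 / 4 * q\<^sup>2"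
      unfolding V[OF q] l by (simp add: power2_eq_square field_simps)
  qed
qed

lemma listed_second_derivative_const:
  fixes V V' :: "real \<Rightarrow> real"
  assumes I: "open I" "is_interval I" "x0 \<in> I"
    and V: "\<And>x. x \<in> I \<Longrightarrow> (V has_real_derivative m0 + m1 * x) (at x)"
  shows "listed_potential h I V"
proof -
  have "V x = (m0 * x + m1 / 2 * x\<^sup>2) + (V x0 - (m0 * x0 + m1 / 2 * x0\<^sup>2))" if "x \<in> I" for x
    by (rule eq_up_to_constant[OF I that V]) (auto intro!: derivative_eq_intros)
  then show ?thesis
    by (intro listed_quadratic[where a = "V x0 - (m0 * x0 + m1 / 2 * x0\<^sup>2)" and b = m0 and c = "m1 / 2"]) auto
qed

text \<open>The derivative of V has a triple pole at s that nothing else can cancel. Clearing it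
  turns the equation into a polynomial identity, whose value at s is -2 l (g0 + g1 s) = 0.\<close>

lemma pole_coefficient_vanishes:
  fixes V V' :: "real \<Rightarrow> real" and R :: "real poly"
  assumes I: "open I" "I \<noteq> {}" and l: "l \<noteq> 0"
    and VV: "\<And>x. x \<in> I \<Longrightarrow> (V has_real_derivative V' x) (at x)"
    and V: "\<And>x. x \<in> I \<Longrightarrow> V x = r0 / 2 + r1 / 3 * (x - s) + r2 / 4 * (x - s)\<^sup>2 + l / (x - s)\<^sup>2"
    and ode: "\<And>x. x \<in> I \<Longrightarrow> (g0 + g1 * x) * V' x + e * V x = poly R x"
  shows "g0 + g1 * s = 0"
proof -
  define J where "J = I - {s}"
  have J: "open J" using I by (simp add: J_def open_delete)
  have "J \<noteq> {}"
  proof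
    assume "J = {}"
    then have "I = {s}" using I by (auto simp: J_def)
    then show False using finite_imp_not_open[of I] I by simp
  qed
  have frac: "(0 * u\<^sup>2 - l * (2 * u)) / (u\<^sup>2 * u\<^sup>2) = - (2 * l / u^3)" if "u \<noteq> 0" for u :: real
    using that by (simp add: power2_eq_square power3_eq_cube mult_ac)
  define X where "X = [:-s, 1:]"
  have X: "poly X x = x - s" for x by (simp add: X_def)
  define P where "P = [:r0 / 2:] + smult (r1 / 3) X + smult (r2 / 4) (X * X)"
  define P' where "P' = [:r1 / 3:] + smult (r2 / 2) X"
  have "[:g0, g1:] * (X^3 * P' - [:2 * l:]) + smult e (X^3 * P + smult l X) = X^3 * R"
  proof (rule poly_eq_on_open[OF J \<open>J \<noteq> {}\<close>])
    fix x assume "x \<in> J"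
    then have x: "x \<in> I" and ne: "x - s \<noteq> 0" by (auto simp: J_def)
    have V': "V' x = poly P' x - 2 * l / (x - s)^3"
    proof (rule deriv_eq_on_open[OF I(1) x V VV[OF x]])
      have 1: "((\<lambda>x. r0 / 2 + r1 / 3 * (x - s) + r2 / 4 * (x - s)\<^sup>2) has_real_derivative poly P' x) (at x)"
        unfolding P'_def by (auto intro!: derivative_eq_intros simp: X field_simps)
      have "((\<lambda>x. l / (x - s)\<^sup>2) has_real_derivative
          (0 * (x - s)\<^sup>2 - l * (2 * (x - s))) / ((x - s)\<^sup>2 * (x - s)\<^sup>2)) (at x)"
        using ne by (auto intro!: derivative_eq_intros)
      also have "(0 * (x - s)\<^sup>2 - l * (2 * (x - s))) / ((x - s)\<^sup>2 * (x - s)\<^sup>2) = - (2 * l / (x - s)^3)"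
        using frac[OF ne] .
      finally have 2: "((\<lambda>x. l / (x - s)\<^sup>2) has_real_derivative - (2 * l / (x - s)^3)) (at x)" .
      show "((\<lambda>x. r0 / 2 + r1 / 3 * (x - s) + r2 / 4 * (x - s)\<^sup>2 + l / (x - s)\<^sup>2) has_real_derivative
        poly P' x - 2 * l / (x - s)^3) (at x)"
        using DERIV_add[OF 1 2] by simp
    qed
    have Vx: "V x = poly P x + l / (x - s)\<^sup>2"
      unfolding V[OF x] P_def by (simp add: X power2_eq_square)
    have "poly (X^3 * R) x = (x - s)^3 * ((g0 + g1 * x) * (poly P' x - 2 * l / (x - s)^3) + e * (poly P x + l / (x - s)\<^sup>2))"
      using ode[OF x] unfolding V' Vx by (simp add: X)
    also have "\<dots> = (g0 + g1 * x) * ((x - s)^3 * poly P' x - (x - s)^3 * (2 * l / (x - s)^3))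
        + e * ((x - s)^3 * poly P x + (x - s) * (x - s)\<^sup>2 * (l / (x - s)\<^sup>2))"
      by (simp add: power2_eq_square power3_eq_cube power4_eq_xxxx algebra_simps)
    also have "\<dots> = (g0 + g1 * x) * ((x - s)^3 * poly P' x - 2 * l) + e * ((x - s)^3 * poly P x + l * (x - s))"
      using ne by simp
    also have "\<dots> = poly ([:g0, g1:] * (X^3 * P' - [:2 * l:]) + smult e (X^3 * P + smult l X)) x"
      by (simp add: X algebra_simps)
    finally show "poly ([:g0, g1:] * (X^3 * P' - [:2 * l:]) + smult e (X^3 * P + smult l X)) x = poly (X^3 * R) x" ..
  qed
  from arg_cong[OF this, of "\<lambda>p. poly p s"] have "(g0 + g1 * s) * (- 2 * l) = 0"
    by (simp add: X algebra_simps)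
  then show ?thesis using l by simp
qed

text \<open>The two gradient equations for w are compatible only if the potential solves, for each
  y, a linear first-order equation. An inverse-square term then forces the leading coefficient to
  vanish at the same x1 for all y, so b = x1 a', and this makes the linear term r1 zero.\<close>

lemma listed_order_2:
  fixes a b c :: "real poly" and w :: "real \<Rightarrow> real \<Rightarrow> real" and Q v :: "nat \<Rightarrow> real \<Rightarrow> real"
  assumes I1: "open I1" "is_interval I1" "x0 \<in> I1" and I2: "open I2" "I2 \<noteq> {}"
    and Q: "derivs_on 2 I1 Q" and v: "derivs_on 2 I2 v"
    and h1: "\<And>x y. x \<in> I1 \<Longrightarrow> y \<in> I2 \<Longrightarrow>
        ((\<lambda>t. w t y) has_real_derivative 2 * poly a y * Q 2 x + kb a b x y * v 1 y) (at x)"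
    and h2: "\<And>x y. x \<in> I1 \<Longrightarrow> y \<in> I2 \<Longrightarrow>
        ((\<lambda>t. w x t) has_real_derivative kb a b x y * Q 2 x + 2 * kc a b c x y * v 1 y) (at y)"
    and nontriv: "\<exists>y\<in>I2. poly b y \<noteq> 0 \<or> poly (pderiv a) y \<noteq> 0"
  shows "listed_potential h I1 (Q 1)"
proof -
  have Qd: "(Q 0 has_real_derivative Q 1 x) (at x)" "(Q 1 has_real_derivative Q 2 x) (at x)" if "x \<in> I1" for x
    using derivs_onD[OF Q _ that, of 0] derivs_onD[OF Q _ that, of 1] by simp_all
  have vd: "(v 1 has_real_derivative v 2 y) (at y)" if "y \<in> I2" for y
    using derivs_onD[OF v _ that, of 1] by simp_all
  define A A1 A2 where "A = poly a" and "A1 = poly (pderiv a)" and "A2 = poly (pderiv (pderiv a))"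
  define E E1 where "E = poly b" and "E1 = poly (pderiv b)"
  define C where "C = poly c"
  note fold = A_def[symmetric] A1_def[symmetric] A2_def[symmetric] E_def[symmetric] E1_def[symmetric] C_def[symmetric]
  have pdd: "(A has_real_derivative A1 y) (at y)" "(A1 has_real_derivative A2 y) (at y)"
    "(E has_real_derivative E1 y) (at y)" for y
    unfolding A_def A1_def A2_def E_def E1_def by (rule poly_DERIV)+
  define s where "s x y = 2 * A y * Q 1 x + v 1 y * (E y * x - A1 y * x\<^sup>2 / 2)" for x y
  define s1 where "s1 x y = 2 * A1 y * Q 1 x + v 2 y * (E y * x - A1 y * x\<^sup>2 / 2)
     + v 1 y * (E1 y * x - A2 y * x\<^sup>2 / 2)" for x y
  have ds: "((\<lambda>t. s x t) has_real_derivative s1 x y) (at y)" if "y \<in> I2" for x y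
    unfolding s_def s1_def by (auto intro!: derivative_eq_intros pdd vd that simp: field_simps)
  define \<alpha> \<alpha>1 where "\<alpha> y = w x0 y - s x0 y" and "\<alpha>1 y = kb a b x0 y * Q 2 x0 + 2 * kc a b c x0 y * v 1 y - s1 x0 y" for y
  have d\<alpha>: "(\<alpha> has_real_derivative \<alpha>1 y) (at y)" if "y \<in> I2" for y
    unfolding \<alpha>_def \<alpha>1_def by (intro DERIV_diff ds h2 I1 that)+
  have wxy: "w x y = s x y + \<alpha> y" if x: "x \<in> I1" and y: "y \<in> I2" for x y
    unfolding \<alpha>_def
  proof (rule eq_up_to_constant[OF I1(1,2,3) x h1[OF _ y]])
    fix t assume t: "t \<in> I1"
    show "((\<lambda>t. s t y) has_real_derivative 2 * poly a y * Q 2 t + kb a b t y * v 1 y) (at t)"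
      unfolding s_def kb_def fold by (auto intro!: derivative_eq_intros Qd t simp: algebra_simps)
  qed
  have eq: "kb a b x y * Q 2 x + 2 * kc a b c x y * v 1 y = s1 x y + \<alpha>1 y" if x: "x \<in> I1" and y: "y \<in> I2" for x y
    by (rule deriv_eq_on_open[OF I2(1) y wxy[OF x] h2[OF x y] DERIV_add[OF ds[OF y] d\<alpha>[OF y]]])
  define R where "R y = [:\<alpha>1 y - 2 * v 1 y * C y, v 2 y * E y + 3 * v 1 y * E1 y, - v 2 y * A1 y / 2 - 3 / 2 * v 1 y * A2 y:]" for y
  have ode: "(E y + - A1 y * x) * Q 2 x + (- 2 * A1 y) * Q 1 x = poly (R y) x" if x: "x \<in> I1" and y: "y \<in> I2" for x y
    using eq[OF x y] unfolding s1_def kb_def kc_def R_def fold by (simp add: power2_eq_square field_simps)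
  obtain y where y: "y \<in> I2" "A1 y \<noteq> 0 \<or> pderiv a = 0 \<and> E y \<noteq> 0"
  proof (cases "pderiv a = 0")
    case True
    then show thesis using nontriv that by (auto simp: E_def)
  next
    case False
    then obtain y where "y \<in> I2" "poly (pderiv a) y \<noteq> 0" 
      using poly_eq_on_open[OF I2, of "pderiv a" 0] by auto
    then show thesis using that by (auto simp: A1_def)
  qed
  from y(2) show ?thesis
  proof
    assume a: "pderiv a = 0 \<and> E y \<noteq> 0"
    show ?thesis
    proof (rule listed_second_derivative_const[OF I1])
      fix x assume x: "x \<in> I1"
      have "Q 2 x = ((\<alpha>1 y - 2 * v 1 y * C y) + (v 2 y * E y + 3 * v 1 y * E1 y) * x) / E y"
        using ode[OF x y(1)] a by (simp add: R_def A1_def A2_def eq_divide_eq algebra_simps)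
      then have "Q 2 x = (\<alpha>1 y - 2 * v 1 y * C y) / E y + (v 2 y * E y + 3 * v 1 y * E1 y) / E y * x"
        by (simp only: add_divide_distrib times_divide_eq_left distrib_right)
      then show "(Q 1 has_real_derivative (\<alpha>1 y - 2 * v 1 y * C y) / E y + (v 2 y * E y + 3 * v 1 y * E1 y) / E y * x) (at x)"
        using Qd(2)[OF x] by simp
    qed
  next
    assume A1: "A1 y \<noteq> 0"
    define x1 where "x1 = E y / A1 y"
    define r0 r1 r2 where "r0 = poly (R y) x1 / (- A1 y)" and "r1 = poly (pderiv (R y)) x1 / (- A1 y)"
      and "r2 = coeff (R y) 2 / (- A1 y)"
    have Rt: "poly (R y) x = - A1 y * (r0 + r1 * (x - x1) + r2 * (x - x1)\<^sup>2)" for x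
      unfolding r0_def r1_def r2_def using A1
      by (simp add: R_def pderiv_pCons numeral_2_eq_2 power2_eq_square field_simps)
    have "(x - x1) * Q 2 x + 2 * Q 1 x = r0 + r1 * (x - x1) + r2 * (x - x1)\<^sup>2" if x: "x \<in> I1" for x
    proof -
      have "- A1 y * ((x - x1) * Q 2 x + 2 * Q 1 x) = poly (R y) x"
        unfolding ode[OF x y(1), symmetric] x1_def using A1 by (simp add: field_simps)
      then show ?thesis unfolding Rt using A1 by simp
    qed
    then obtain l where V: "\<And>x. x \<in> I1 \<Longrightarrow> Q 1 x = r0 / 2 + r1 / 3 * (x - x1) + r2 / 4 * (x - x1)\<^sup>2 + l / (x - x1)\<^sup>2"
      using linear_ode_solution[OF I1 Qd(2)] by blast
    have "r1 = 0 \<or> l = 0"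
    proof (rule disjCI)
      assume l: "l \<noteq> 0"
      have "poly b t = x1 * poly (pderiv a) t" if t: "t \<in> I2" for t
        using pole_coefficient_vanishes[OF I1(1) _ l Qd(2) V ode[OF _ t]] I1(3) by (auto simp: E_def A1_def mult.commute)
      then have "b = smult x1 (pderiv a)"
        by (intro poly_eq_on_open[OF I2]) simp
      then have "E y = x1 * A1 y" "E1 y = x1 * A2 y" by (simp_all add: E_def E1_def A1_def A2_def pderiv_smult)
      then show "r1 = 0" unfolding r1_def by (simp add: R_def pderiv_pCons algebra_simps)
    qed
    with V show ?thesis by (rule listed_linear_ode)
  qed
qed

text \<open>Two consequences of the determining equations at order three are kept: the nonlinear
  equation, and the compatibility of the two gradient equations for w01. If a = 0, the first one
  becomes linear and may even be trivial, so that the second has to take over. The functions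
  \<alpha> and \<gamma> arise as constants of integration in x.\<close>

definition ode3_data ::
  "real set \<Rightarrow> real set \<Rightarrow> real \<Rightarrow> real poly \<Rightarrow> real poly \<Rightarrow> real poly \<Rightarrow> real poly
    \<Rightarrow> (nat \<Rightarrow> real \<Rightarrow> real) \<Rightarrow> (nat \<Rightarrow> real \<Rightarrow> real)
    \<Rightarrow> (real \<Rightarrow> real) \<Rightarrow> (real \<Rightarrow> real) \<Rightarrow> (real \<Rightarrow> real) \<Rightarrow> (real \<Rightarrow> real) \<Rightarrow> (real \<Rightarrow> real) \<Rightarrow> bool" where
  "ode3_data I1 I2 \<kappa> a b c d v Q \<alpha> \<alpha>1 \<alpha>2 \<gamma> \<gamma>1 \<longleftrightarrow>
    (\<forall>y\<in>I2. (\<alpha> has_real_derivative \<alpha>1 y) (at y)) \<and> (\<forall>y\<in>I2. (\<alpha>1 has_real_derivative \<alpha>2 y) (at y)) \<and>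
    (\<forall>y\<in>I2. ode3_on I1 \<kappa> (poly a y)
       [:\<alpha> y, v 1 y * poly b y, - v 1 y * poly (pderiv a) y / 2:]
       (smult (v 1 y) [:\<gamma> y, 2 * v 1 y * poly c y - \<alpha>1 y, - 3 / 2 * v 1 y * poly (pderiv b) y - v 2 y * poly b y / 2,
           v 1 y * poly (pderiv (pderiv a)) y / 2 + v 2 y * poly (pderiv a) y / 6:]
        - smult (\<kappa> / 4 * v 3 y) (kdp a b c d y)) Q) \<and>
    (\<forall>x\<in>I1. \<forall>y\<in>I2. 2 * kb (pderiv a) (pderiv b) x y * Q 1 x - poly (pderiv (pderiv a)) y * Q 0 x
       + (\<gamma>1 y + (2 * v 2 y * poly c y + 2 * v 1 y * poly (pderiv c) y - \<alpha>2 y) * x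
       + (- 2 * v 2 y * poly (pderiv b) y - 3 / 2 * v 1 y * poly (pderiv (pderiv b)) y - v 3 y * poly b y / 2) * x\<^sup>2
       + (v 1 y * poly (pderiv (pderiv (pderiv a))) y / 2 + 2 * v 2 y * poly (pderiv (pderiv a)) y / 3 + v 3 y * poly (pderiv a) y / 6) * x^3)
       = kc a b c x y * Q 2 x + 3 * kd a b c d x y * v 1 y)"

lemma ode3_of_pde:
  fixes a b c d :: "real poly" and w10 w01 p p2 :: "real \<Rightarrow> real \<Rightarrow> real" and Q v :: "nat \<Rightarrow> real \<Rightarrow> real"
  assumes I1: "open I1" "is_interval I1" "x0 \<in> I1" and I2: "open I2"
    and Q: "derivs_on 4 I1 Q" and v: "derivs_on 3 I2 v"
    and h1: "\<And>x y. x \<in> I1 \<Longrightarrow> y \<in> I2 \<Longrightarrow>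
        ((\<lambda>t. w10 t y) has_real_derivative 3 * poly a y * Q 2 x + kb a b x y * v 1 y) (at x)"
    and h2: "\<And>x y. x \<in> I1 \<Longrightarrow> y \<in> I2 \<Longrightarrow> ((\<lambda>t. w10 x t) has_real_derivative p x y) (at y)"
    and h3: "\<And>x y. x \<in> I1 \<Longrightarrow> y \<in> I2 \<Longrightarrow> ((\<lambda>t. p x t) has_real_derivative p2 x y) (at y)"
    and h4: "\<And>x y. x \<in> I1 \<Longrightarrow> y \<in> I2 \<Longrightarrow>
        ((\<lambda>t. w01 t y) has_real_derivative 2 * kb a b x y * Q 2 x + 2 * kc a b c x y * v 1 y - p x y) (at x)"
    and h5: "\<And>x y. x \<in> I1 \<Longrightarrow> y \<in> I2 \<Longrightarrow>
        ((\<lambda>t. w01 x t) has_real_derivative kc a b c x y * Q 2 x + 3 * kd a b c d x y * v 1 y) (at y)"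
    and h6: "\<And>x y. x \<in> I1 \<Longrightarrow> y \<in> I2 \<Longrightarrow>
        Q 2 x * w10 x y + v 1 y * w01 x y - \<kappa> / 4 * (poly a y * Q 4 x + kd a b c d x y * v 3 y) = 0"
  shows "\<exists>\<alpha> \<alpha>1 \<alpha>2 \<gamma> \<gamma>1. ode3_data I1 I2 \<kappa> a b c d v Q \<alpha> \<alpha>1 \<alpha>2 \<gamma> \<gamma>1"
proof -
  have Qd: "(Q 0 has_real_derivative Q 1 x) (at x)" "(Q 1 has_real_derivative Q 2 x) (at x)" if "x \<in> I1" for x
    using derivs_onD[OF Q _ that, of 0] derivs_onD[OF Q _ that, of 1] by simp_all
  have vd: "(v 1 has_real_derivative v 2 y) (at y)" "(v 2 has_real_derivative v 3 y) (at y)" if "y \<in> I2" for y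
    using derivs_onD[OF v _ that, of 1] derivs_onD[OF v _ that, of 2] by simp_all
  define A A1 A2 A3 where "A = poly a" and "A1 = poly (pderiv a)" and "A2 = poly (pderiv (pderiv a))"
    and "A3 = poly (pderiv (pderiv (pderiv a)))"
  define E E1 E2 where "E = poly b" and "E1 = poly (pderiv b)" and "E2 = poly (pderiv (pderiv b))"
  define C C1 where "C = poly c" and "C1 = poly (pderiv c)"
  note fold = A_def[symmetric] A1_def[symmetric] A2_def[symmetric] A3_def[symmetric]
    E_def[symmetric] E1_def[symmetric] E2_def[symmetric] C_def[symmetric] C1_def[symmetric]
  have pdd: "(A has_real_derivative A1 y) (at y)" "(A1 has_real_derivative A2 y) (at y)"
    "(A2 has_real_derivative A3 y) (at y)" "(E has_real_derivative E1 y) (at y)"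
    "(E1 has_real_derivative E2 y) (at y)" "(C has_real_derivative C1 y) (at y)" for y
    unfolding A_def A1_def A2_def A3_def E_def E1_def E2_def C_def C1_def by (rule poly_DERIV)+
  define s where "s x y = 3 * A y * Q 1 x + v 1 y * (E y * x - A1 y * x\<^sup>2 / 2)" for x y
  define s1 where "s1 x y = 3 * A1 y * Q 1 x + v 2 y * (E y * x - A1 y * x\<^sup>2 / 2)
     + v 1 y * (E1 y * x - A2 y * x\<^sup>2 / 2)" for x y
  define s2 where "s2 x y = 3 * A2 y * Q 1 x + v 3 y * (E y * x - A1 y * x\<^sup>2 / 2)
     + 2 * v 2 y * (E1 y * x - A2 y * x\<^sup>2 / 2) + v 1 y * (E2 y * x - A3 y * x\<^sup>2 / 2)" for x y
  have ds: "((\<lambda>t. s x t) has_real_derivative s1 x y) (at y)" if "y \<in> I2" for x y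
    unfolding s_def s1_def by (auto intro!: derivative_eq_intros pdd vd that simp: field_simps)
  have ds1: "((\<lambda>t. s1 x t) has_real_derivative s2 x y) (at y)" if "y \<in> I2" for x y
    unfolding s1_def s2_def by (auto intro!: derivative_eq_intros pdd vd that simp: field_simps)
  define \<alpha> \<alpha>1 \<alpha>2 where "\<alpha> y = w10 x0 y - s x0 y" and "\<alpha>1 y = p x0 y - s1 x0 y" and "\<alpha>2 y = p2 x0 y - s2 x0 y" for y
  have d\<alpha>: "(\<alpha> has_real_derivative \<alpha>1 y) (at y)" "(\<alpha>1 has_real_derivative \<alpha>2 y) (at y)" if "y \<in> I2" for y
    unfolding \<alpha>_def \<alpha>1_def \<alpha>2_def by (intro DERIV_diff ds ds1 h2 h3 I1 that)+
  have w10: "w10 x y = s x y + \<alpha> y" if x: "x \<in> I1" and y: "y \<in> I2" for x y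
    unfolding \<alpha>_def
  proof (rule eq_up_to_constant[OF I1(1,2,3) x h1[OF _ y]])
    fix t assume t: "t \<in> I1"
    show "((\<lambda>t. s t y) has_real_derivative 3 * poly a y * Q 2 t + kb a b t y * v 1 y) (at t)"
      unfolding s_def kb_def fold by (auto intro!: derivative_eq_intros Qd t simp: algebra_simps)
  qed
  have pxy: "p x y = s1 x y + \<alpha>1 y" if x: "x \<in> I1" and y: "y \<in> I2" for x y
    by (rule deriv_eq_on_open[OF I2 y w10[OF x] h2[OF x y] DERIV_add[OF ds[OF y] d\<alpha>(1)[OF y]]])
  define q where "q x y = 2 * kb a b x y * Q 1 x - A1 y * Q 0 x
     + 2 * v 1 y * (C y * x - E1 y * x\<^sup>2 / 2 + A2 y * x^3 / 6)
     - v 2 y * (E y * x\<^sup>2 / 2 - A1 y * x^3 / 6) - v 1 y * (E1 y * x\<^sup>2 / 2 - A2 y * x^3 / 6) - \<alpha>1 y * x" for x y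
  define q1 where "q1 x y = 2 * kb (pderiv a) (pderiv b) x y * Q 1 x - A2 y * Q 0 x
     + 2 * v 2 y * (C y * x - E1 y * x\<^sup>2 / 2 + A2 y * x^3 / 6)
     + 2 * v 1 y * (C1 y * x - E2 y * x\<^sup>2 / 2 + A3 y * x^3 / 6)
     - v 3 y * (E y * x\<^sup>2 / 2 - A1 y * x^3 / 6) - v 2 y * (E1 y * x\<^sup>2 / 2 - A2 y * x^3 / 6)
     - v 2 y * (E1 y * x\<^sup>2 / 2 - A2 y * x^3 / 6) - v 1 y * (E2 y * x\<^sup>2 / 2 - A3 y * x^3 / 6) - \<alpha>2 y * x" for x y
  have dq: "((\<lambda>t. q x t) has_real_derivative q1 x y) (at y)" if "y \<in> I2" for x y
    unfolding q_def q1_def kb_def fold by (auto intro!: derivative_eq_intros pdd vd d\<alpha> that simp: field_simps)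
  define \<gamma> \<gamma>1 where "\<gamma> y = w01 x0 y - q x0 y" and
    "\<gamma>1 y = (kc a b c x0 y * Q 2 x0 + 3 * kd a b c d x0 y * v 1 y) - q1 x0 y" for y
  have d\<gamma>: "(\<gamma> has_real_derivative \<gamma>1 y) (at y)" if "y \<in> I2" for y
    unfolding \<gamma>_def \<gamma>1_def by (intro DERIV_diff dq h5 I1 that)
  have w01: "w01 x y = q x y + \<gamma> y" if x: "x \<in> I1" and y: "y \<in> I2" for x y
    unfolding \<gamma>_def
  proof (rule eq_up_to_constant[OF I1(1,2,3) x h4[OF _ y]])
    fix t assume t: "t \<in> I1"
    show "((\<lambda>t. q t y) has_real_derivative 2 * kb a b t y * Q 2 t + 2 * kc a b c t y * v 1 y - p t y) (at t)"
      unfolding q_def kb_def kc_def pxy[OF t y] s1_def fold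
      by (auto intro!: derivative_eq_intros Qd t simp: power2_eq_square field_simps)
  qed
  have rxy: "kc a b c x y * Q 2 x + 3 * kd a b c d x y * v 1 y = q1 x y + \<gamma>1 y" if x: "x \<in> I1" and y: "y \<in> I2" for x y
    by (rule deriv_eq_on_open[OF I2 y w01[OF x] h5[OF x y] DERIV_add[OF dq[OF y] d\<gamma>[OF y]]])
  have "ode3_data I1 I2 \<kappa> a b c d v Q \<alpha> \<alpha>1 \<alpha>2 \<gamma> \<gamma>1"
    unfolding ode3_data_def
  proof (intro conjI ballI)
    fix y assume y: "y \<in> I2"
    show "ode3_on I1 \<kappa> (poly a y)
       [:\<alpha> y, v 1 y * poly b y, - v 1 y * poly (pderiv a) y / 2:]
       (smult (v 1 y) [:\<gamma> y, 2 * v 1 y * poly c y - \<alpha>1 y, - 3 / 2 * v 1 y * poly (pderiv b) y - v 2 y * poly b y / 2,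
           v 1 y * poly (pderiv (pderiv a)) y / 2 + v 2 y * poly (pderiv a) y / 6:]
        - smult (\<kappa> / 4 * v 3 y) (kdp a b c d y)) Q"
      unfolding ode3_on_def
    proof
      fix x assume x: "x \<in> I1"
      define KD where "KD = kd a b c d x y"
      show "\<kappa> / 4 * poly a y * Q 4 x - 3 * poly a y * (Q 1 x * Q 2 x)
        = poly [:\<alpha> y, v 1 y * poly b y, - v 1 y * poly (pderiv a) y / 2:] x * Q 2 x
         + 2 * poly (pderiv [:\<alpha> y, v 1 y * poly b y, - v 1 y * poly (pderiv a) y / 2:]) x * Q 1 x
         + poly (pderiv (pderiv [:\<alpha> y, v 1 y * poly b y, - v 1 y * poly (pderiv a) y / 2:])) x * Q 0 x
         + poly (smult (v 1 y) [:\<gamma> y, 2 * v 1 y * poly c y - \<alpha>1 y, - 3 / 2 * v 1 y * poly (pderiv b) y - v 2 y * poly b y / 2,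
           v 1 y * poly (pderiv (pderiv a)) y / 2 + v 2 y * poly (pderiv a) y / 6:]
        - smult (\<kappa> / 4 * v 3 y) (kdp a b c d y)) x"
        using h6[OF x y]
        unfolding poly_diff poly_smult poly_kdp w10[OF x y] w01[OF x y] s_def q_def kb_def fold KD_def[symmetric]
        by (simp add: pderiv_pCons power2_eq_square power3_eq_cube field_simps)
    qed
  next
    fix x y assume "x \<in> I1" and y: "y \<in> I2"
    then show "2 * kb (pderiv a) (pderiv b) x y * Q 1 x - poly (pderiv (pderiv a)) y * Q 0 x
       + (\<gamma>1 y + (2 * v 2 y * poly c y + 2 * v 1 y * poly (pderiv c) y - \<alpha>2 y) * x
       + (- 2 * v 2 y * poly (pderiv b) y - 3 / 2 * v 1 y * poly (pderiv (pderiv b)) y - v 3 y * poly b y / 2) * x\<^sup>2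
       + (v 1 y * poly (pderiv (pderiv (pderiv a))) y / 2 + 2 * v 2 y * poly (pderiv (pderiv a)) y / 3 + v 3 y * poly (pderiv a) y / 6) * x^3)
       = kc a b c x y * Q 2 x + 3 * kd a b c d x y * v 1 y"
      unfolding rxy[OF \<open>x \<in> I1\<close> y] q1_def fold by (simp add: field_simps)
  qed (use d\<alpha> in auto)
  then show ?thesis by blast
qed

text \<open>The coefficient a(y) of the highest derivative is free of x. Either it is non-zero for
  some y, and then all poles have residue -h^2, or a = 0 and both equations are linear in the
  potential, as at order two.\<close>

lemma listed_order_3:
  fixes a b c d :: "real poly" and w10 w01 p p2 :: "real \<Rightarrow> real \<Rightarrow> real" and Q v :: "nat \<Rightarrow> real \<Rightarrow> real"
  assumes I1: "open I1" "is_interval I1" "x0 \<in> I1" and I2: "open I2" "I2 \<noteq> {}"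
    and Q: "derivs_on 4 I1 Q" and v: "derivs_on 3 I2 v"
    and h1: "\<And>x y. x \<in> I1 \<Longrightarrow> y \<in> I2 \<Longrightarrow>
        ((\<lambda>t. w10 t y) has_real_derivative 3 * poly a y * Q 2 x + kb a b x y * v 1 y) (at x)"
    and h2: "\<And>x y. x \<in> I1 \<Longrightarrow> y \<in> I2 \<Longrightarrow> ((\<lambda>t. w10 x t) has_real_derivative p x y) (at y)"
    and h3: "\<And>x y. x \<in> I1 \<Longrightarrow> y \<in> I2 \<Longrightarrow> ((\<lambda>t. p x t) has_real_derivative p2 x y) (at y)"
    and h4: "\<And>x y. x \<in> I1 \<Longrightarrow> y \<in> I2 \<Longrightarrow>
        ((\<lambda>t. w01 t y) has_real_derivative 2 * kb a b x y * Q 2 x + 2 * kc a b c x y * v 1 y - p x y) (at x)"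
    and h5: "\<And>x y. x \<in> I1 \<Longrightarrow> y \<in> I2 \<Longrightarrow>
        ((\<lambda>t. w01 x t) has_real_derivative kc a b c x y * Q 2 x + 3 * kd a b c d x y * v 1 y) (at y)"
    and h6: "\<And>x y. x \<in> I1 \<Longrightarrow> y \<in> I2 \<Longrightarrow>
        Q 2 x * w10 x y + v 1 y * w01 x y - h\<^sup>2 / 4 * (poly a y * Q 4 x + kd a b c d x y * v 3 y) = 0"
    and lin: "\<And>y. y \<in> I2 \<Longrightarrow> \<exists>S. \<forall>x\<in>I1. poly (kcp a b c y) x * Q 0 x = poly S x"
    and nontriv: "\<exists>y\<in>I2. kcp a b c y \<noteq> 0" "\<exists>y\<in>I2. poly b y \<noteq> 0 \<or> poly (pderiv a) y \<noteq> 0"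
  shows "listed_potential h I1 (Q 1)"
proof -
  have I1': "I1 \<noteq> {}" using I1 by auto
  have Qd: "(Q 0 has_real_derivative Q 1 x) (at x)" "(Q 1 has_real_derivative Q 2 x) (at x)" if "x \<in> I1" for x
    using derivs_onD[OF Q _ that, of 0] derivs_onD[OF Q _ that, of 1] by simp_all
  have vd: "(v 1 has_real_derivative v 2 y) (at y)" "(v 2 has_real_derivative v 3 y) (at y)" if "y \<in> I2" for y
    using derivs_onD[OF v _ that, of 1] derivs_onD[OF v _ that, of 2] by simp_all
  obtain \<alpha> \<alpha>1 \<alpha>2 \<gamma> \<gamma>1 :: "real \<Rightarrow> real" where
    d\<alpha>: "\<And>y. y \<in> I2 \<Longrightarrow> (\<alpha> has_real_derivative \<alpha>1 y) (at y)" and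
    ode: "\<And>y. y \<in> I2 \<Longrightarrow> ode3_on I1 (h\<^sup>2) (poly a y)
       [:\<alpha> y, v 1 y * poly b y, - v 1 y * poly (pderiv a) y / 2:]
       (smult (v 1 y) [:\<gamma> y, 2 * v 1 y * poly c y - \<alpha>1 y, - 3 / 2 * v 1 y * poly (pderiv b) y - v 2 y * poly b y / 2,
           v 1 y * poly (pderiv (pderiv a)) y / 2 + v 2 y * poly (pderiv a) y / 6:]
        - smult (h\<^sup>2 / 4 * v 3 y) (kdp a b c d y)) Q" and
    eq: "\<And>x y. x \<in> I1 \<Longrightarrow> y \<in> I2 \<Longrightarrow> 2 * kb (pderiv a) (pderiv b) x y * Q 1 x - poly (pderiv (pderiv a)) y * Q 0 x
       + (\<gamma>1 y + (2 * v 2 y * poly c y + 2 * v 1 y * poly (pderiv c) y - \<alpha>2 y) * x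
       + (- 2 * v 2 y * poly (pderiv b) y - 3 / 2 * v 1 y * poly (pderiv (pderiv b)) y - v 3 y * poly b y / 2) * x\<^sup>2
       + (v 1 y * poly (pderiv (pderiv (pderiv a))) y / 2 + 2 * v 2 y * poly (pderiv (pderiv a)) y / 3 + v 3 y * poly (pderiv a) y / 6) * x^3)
       = kc a b c x y * Q 2 x + 3 * kd a b c d x y * v 1 y" and
    d\<alpha>1: "\<And>y. y \<in> I2 \<Longrightarrow> (\<alpha>1 has_real_derivative \<alpha>2 y) (at y)"
    using ode3_of_pde[OF I1 I2(1) Q v h1 h2 h3 h4 h5 h6] unfolding ode3_data_def by metis
  show ?thesis
  proof (cases "a = 0")
    case False
    obtain yb where yb: "yb \<in> I2" "poly a yb \<noteq> 0"
      using poly_eq_on_open[OF I2, of a 0] False by auto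
    have cont: "continuous_on I1 (Q 0)"
      using Qd(1) by (meson DERIV_isCont continuous_at_imp_continuous_on)
    obtain ys where ys: "ys \<in> I2" "kcp a b c ys \<noteq> 0" using nontriv(1) by blast
    obtain S where S: "\<And>x. x \<in> I1 \<Longrightarrow> poly (kcp a b c ys) x * Q 0 x = poly S x" using lin[OF ys(1)] by blast
    obtain N D where ND: "lead_coeff D = 1" "bezout N D"
      "\<And>t. t \<in> I1 \<Longrightarrow> poly D t \<noteq> 0 \<and> Q 0 t = poly N t / poly D t"
      and min: "\<And>p q. (\<And>t. t \<in> I1 \<Longrightarrow> poly p t * Q 0 t = poly q t) \<Longrightarrow> D dvd p"
    proof (rule reduced_fraction[OF I1(1) I1' cont ys(2) S])
      fix N D
      assume *: "lead_coeff D = 1" "bezout N D" "\<And>t. t \<in> I1 \<Longrightarrow> poly D t \<noteq> 0 \<and> Q 0 t = poly N t / poly D t"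
        "\<And>p q. (\<And>t. t \<in> I1 \<Longrightarrow> poly p t * Q 0 t = poly q t) \<Longrightarrow> D dvd p"
      show thesis by (rule that[OF *])
    qed
    have red: "reduced_on I1 (Q 0) N D" unfolding reduced_on_def using ND by blast
    have "degree (kcp a b c ys) \<le> 2" unfolding kcp_def by (simp add: One_nat_def)
    moreover have "D dvd kcp a b c ys" using S min by blast
    ultimately have degD: "degree D \<le> 3" using dvd_imp_degree_le[OF _ ys(2)] by fastforce
    note P = ode3_poles[OF I1(1) I1' red Q ode[OF yb(1)] yb(2)]
    have "degree N \<le> degree D + 3"
    proof (rule ode3_degree[OF I1(1) I1' red Q ode[OF yb(1)] yb(2)])
      have kd3: "degree (kdp a b c d yb) \<le> 3" unfolding kdp_def by (simp add: One_nat_def)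
      show "degree (smult (v 1 yb) [:\<gamma> yb, 2 * v 1 yb * poly c yb - \<alpha>1 yb, - 3 / 2 * v 1 yb * poly (pderiv b) yb - v 2 yb * poly b yb / 2,
           v 1 yb * poly (pderiv (pderiv a)) yb / 2 + v 2 yb * poly (pderiv a) yb / 6:]
        - smult (h\<^sup>2 / 4 * v 3 yb) (kdp a b c d yb)) \<le> 3"
        by (intro degree_diff_le order_trans[OF degree_smult_le] kd3) (simp add: One_nat_def)
    qed (simp add: One_nat_def)
    then have "good_poles I1 Q N D"
      unfolding good_poles_def using I1 red Qd P(1,2) by blast
    then show ?thesis using listed_generic degD P(3) by blast
  next
    case True
    \<comment> \<open>Without a term in p1^3 the quadratic and the fourth-order terms are absent,
      and two first-order linear equations remain.\<close>
    define R where "R y = smult (v 1 y) [:\<gamma> y, 2 * v 1 y * poly c y - \<alpha>1 y, - 3 / 2 * v 1 y * poly (pderiv b) y - v 2 y * poly b y / 2:]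
        - smult (h\<^sup>2 / 4 * v 3 y) [:poly d y, - poly (pderiv c) y, poly (pderiv (pderiv b)) y / 2:]" for y
    have ode': "(\<alpha> y + v 1 y * poly b y * x) * Q 2 x + 2 * v 1 y * poly b y * Q 1 x = poly (- R y) x" if x: "x \<in> I1" and y: "y \<in> I2" for x y
      using ode[OF y] x unfolding ode3_on_def R_def kdp_def True by (fastforce simp: pderiv_pCons algebra_simps)
    have eq': "(poly c y + (- poly (pderiv b) y) * x) * Q 2 x + (- 2 * poly (pderiv b) y) * Q 1 x
       = poly [:\<gamma>1 y - 3 * poly d y * v 1 y, 2 * v 2 y * poly c y + 2 * v 1 y * poly (pderiv c) y - \<alpha>2 y + 3 * v 1 y * poly (pderiv c) y,
          - 2 * v 2 y * poly (pderiv b) y - 3 / 2 * v 1 y * poly (pderiv (pderiv b)) y - v 3 y * poly b y / 2 - 3 / 2 * v 1 y * poly (pderiv (pderiv b)) y:] x"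
      if x: "x \<in> I1" and y: "y \<in> I2" for x y
      using eq[OF x y] unfolding kb_def kc_def kd_def True by (simp add: power2_eq_square field_simps)
    show ?thesis
    proof (cases "\<exists>y\<in>I2. v 1 y * poly b y \<noteq> 0")
      case vb: True
      then obtain y where y: "y \<in> I2" "v 1 y * poly b y \<noteq> 0" by blast
      define g where "g = v 1 y * poly b y"
      have g: "g \<noteq> 0" using y by (simp add: g_def)
      define x1 where "x1 = - \<alpha> y / g"
      define r0 r1 r2 where "r0 = poly (- R y) x1 / g" and "r1 = poly (pderiv (- R y)) x1 / g"
        and "r2 = coeff (- R y) 2 / g"
      have Rt: "poly (- R y) x = g * (r0 + r1 * (x - x1) + r2 * (x - x1)\<^sup>2)" for x
        unfolding r0_def r1_def r2_def using g
        by (simp add: R_def pderiv_pCons numeral_2_eq_2 power2_eq_square field_simps)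
      have "(x - x1) * Q 2 x + 2 * Q 1 x = r0 + r1 * (x - x1) + r2 * (x - x1)\<^sup>2" if x: "x \<in> I1" for x
      proof -
        have "g * ((x - x1) * Q 2 x + 2 * Q 1 x) = poly (- R y) x"
          unfolding ode'[OF x y(1), symmetric] g_def[symmetric] x1_def using g
          by (simp add: g_def[symmetric] mult.assoc[symmetric]) (simp add: g_def algebra_simps)
        then show ?thesis unfolding Rt using g by simp
      qed
      then obtain l where V: "\<And>x. x \<in> I1 \<Longrightarrow> Q 1 x = r0 / 2 + r1 / 3 * (x - x1) + r2 / 4 * (x - x1)\<^sup>2 + l / (x - x1)\<^sup>2"
        using linear_ode_solution[OF I1 Qd(2)] by blast
      have "r1 = 0 \<or> l = 0"
      proof (rule disjCI)
        assume l: "l \<noteq> 0"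
        have \<alpha>x: "\<alpha> t = - x1 * (v 1 t * poly b t)" if t: "t \<in> I2" for t
          using pole_coefficient_vanishes[OF I1(1) I1' l Qd(2) V ode'[OF _ t]] by (simp add: algebra_simps)
        have a1: "\<alpha>1 y = - x1 * (v 2 y * poly b y + v 1 y * poly (pderiv b) y)"
        proof (rule deriv_eq_on_open[OF I2(1) y(1) \<alpha>x d\<alpha>[OF y(1)]])
          show "((\<lambda>t. - x1 * (v 1 t * poly b t)) has_real_derivative - x1 * (v 2 y * poly b y + v 1 y * poly (pderiv b) y)) (at y)"
            by (auto intro!: derivative_eq_intros vd y simp: algebra_simps)
        qed
        have "poly c t = x1 * poly (pderiv b) t" if t: "t \<in> I2" for t
          using pole_coefficient_vanishes[OF I1(1) I1' l Qd(2) V eq'[OF _ t]] by (simp add: algebra_simps)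
        then have "c = smult x1 (pderiv b)"
          by (intro poly_eq_on_open[OF I2]) simp
        then have "poly c y = x1 * poly (pderiv b) y" "poly (pderiv c) y = x1 * poly (pderiv (pderiv b)) y"
          by (simp_all add: pderiv_smult)
        then have "poly (pderiv (- R y)) x1 = 0"
          by (simp add: R_def a1 pderiv_minus pderiv_pCons pderiv_diff pderiv_smult field_simps)
        then show "r1 = 0" unfolding r1_def by simp
      qed
      with V show ?thesis by (rule listed_linear_ode)
    next
      case False
      \<comment> \<open>Here b is a non-zero polynomial, so V2 is constant. The first equation
        collapses to \<alpha> Q'' = 0, and the second one has to decide.\<close>
      then have vb: "v 1 y * poly b y = 0" if "y \<in> I2" for y using that by blast
      have "b \<noteq> 0" using nontriv(2) True by auto
      have v1: "v 1 y = 0" if y: "y \<in> I2" for y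
      proof (rule continuous_eq_off_finite[OF I2(1) _ _ _ _ y, where F = "{t. poly b t = 0}" and g = "\<lambda>_. 0"])
        show "finite {t. poly b t = 0}" using \<open>b \<noteq> 0\<close> by (rule poly_roots_finite)
        show "continuous_on I2 (v 1)" using vd(1) by (meson DERIV_isCont continuous_at_imp_continuous_on)
      qed (use vb in auto)
      have v2: "v 2 y = 0" if y: "y \<in> I2" for y
        by (rule deriv_eq_on_open[OF I2(1) y v1 vd(1)[OF y]]) auto
      have v3: "v 3 y = 0" if y: "y \<in> I2" for y
        by (rule deriv_eq_on_open[OF I2(1) y v2 vd(2)[OF y]]) auto
      have aQ: "\<alpha> y * Q 2 x = 0" if "x \<in> I1" "y \<in> I2" for x y
        using ode'[OF that] v1[OF that(2)] v3[OF that(2)] by (simp add: R_def)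
      show ?thesis
      proof (cases "\<forall>x\<in>I1. Q 2 x = 0")
        case True
        then show ?thesis using listed_second_derivative_const[OF I1, of "Q 1" 0 0] Qd(2) by auto
      next
        case False
        then have \<alpha>0: "\<alpha> y = 0" if "y \<in> I2" for y using aQ that by force
        have \<alpha>10: "\<alpha>1 y = 0" if y: "y \<in> I2" for y
          by (rule deriv_eq_on_open[OF I2(1) y \<alpha>0 d\<alpha>[OF y]]) auto
        have \<alpha>20: "\<alpha>2 y = 0" if y: "y \<in> I2" for y
          by (rule deriv_eq_on_open[OF I2(1) y \<alpha>10 d\<alpha>1[OF y]]) auto
        \<comment> \<open>With V2 and \<alpha> gone the right-hand side does not depend on x. Its
          solutions have no linear term, so the inverse square causes no conflict.\<close>
        have e: "(poly c y - poly (pderiv b) y * x) * Q 2 x - 2 * poly (pderiv b) y * Q 1 x = \<gamma>1 y" if x: "x \<in> I1" and y: "y \<in> I2" for x y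
          using eq'[OF x y] v1[OF y] v2[OF y] v3[OF y] \<alpha>20[OF y] by simp
        show ?thesis
        proof (cases "pderiv b = 0")
          case True
          obtain y where y: "y \<in> I2" "poly c y \<noteq> 0"
            using nontriv(1) True \<open>a = 0\<close> by (auto simp: kcp_def)
          have "Q 2 x = \<gamma>1 y / poly c y + 0 * x" if "x \<in> I1" for x
            using e[OF that y(1)] y(2) True by (simp add: field_simps)
          then show ?thesis using listed_second_derivative_const[OF I1, of "Q 1" "\<gamma>1 y / poly c y" 0] Qd(2) by auto
        next
          case False
          then obtain y where y: "y \<in> I2" "poly (pderiv b) y \<noteq> 0"
            using poly_eq_on_open[OF I2, of "pderiv b" 0] by auto
          define x1 where "x1 = poly c y / poly (pderiv b) y"
          have "(x - x1) * Q 2 x + 2 * Q 1 x = - \<gamma>1 y / poly (pderiv b) y + 0 * (x - x1) + 0 * (x - x1)\<^sup>2" if x: "x \<in> I1" for x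
          proof -
            have "poly (pderiv b) y * ((x - x1) * Q 2 x + 2 * Q 1 x) = - \<gamma>1 y"
              unfolding e[OF x y(1), symmetric] x1_def using y(2) by (simp add: field_simps)
            then show ?thesis using y(2) by (simp add: field_simps)
          qed
          then obtain l where V: "\<And>x. x \<in> I1 \<Longrightarrow> Q 1 x = - \<gamma>1 y / poly (pderiv b) y / 2 + 0 / 3 * (x - x1) + 0 / 4 * (x - x1)\<^sup>2 + l / (x - x1)\<^sup>2"
            using linear_ode_solution[OF I1 Qd(2), where ?r0.0 = "- \<gamma>1 y / poly (pderiv b) y" and ?r1.0 = 0 and ?r2.0 = 0] by blast
          then show ?thesis using listed_linear_ode[OF V] by blast
        qed
      qed
    qed
  qed
qed

subsection \<open>Calculus of the Weyl symbol\<close>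

lemma D_eqI:
  fixes f g :: "real \<times> real \<Rightarrow> real"
  assumes "open S" "q \<in> S" "\<And>z. z \<in> S \<Longrightarrow> f z = g z"
    and "(g has_derivative (\<lambda>v. fst v * f1 + snd v * f2)) (at q)"
  shows "D1 f q = f1 \<and> D2 f q = f2"
proof -
  have "frechet_derivative f (at q) = (\<lambda>v. fst v * f1 + snd v * f2)"
    by (rule trans[OF frechet_derivative_cong_on_open[OF assms(1-3)] frechet_derivative_at[OF assms(4), symmetric]])
  then show ?thesis by simp
qed

lemma D_linear_combination:
  fixes f g :: "real \<times> real \<Rightarrow> real"
  assumes S: "open S" and f: "smooth_on S f" and g: "smooth_on S g" and q: "q \<in> S"
    and F: "\<And>q. q \<in> S \<Longrightarrow> F q = a * f q + b * g q"
  shows "frechet_derivative F (at q) v = a * frechet_derivative f (at q) v + b * frechet_derivative g (at q) v"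
proof -
  have "frechet_derivative F (at q) v = frechet_derivative (\<lambda>q. a * f q + b * g q) (at q) v"
    by (rule frechet_derivative_cong_on_open[OF S q, THEN fun_cong]) (rule F)
  also have "\<dots> = frechet_derivative (\<lambda>q. a * f q) (at q) v + frechet_derivative (\<lambda>q. b * g q) (at q) v"
    by (rule frechet_add[OF smooth_on_scale[OF S f] smooth_on_scale[OF S g] q])
  finally show ?thesis
    unfolding frechet_linear[OF f bounded_linear_mult_right q] frechet_linear[OF g bounded_linear_mult_right q] .
qed

lemma D_cong:
  assumes "open S" "q \<in> S" "\<And>q. q \<in> S \<Longrightarrow> f q = g q"
  shows "frechet_derivative f (at q) v = frechet_derivative g (at q) v"
  using frechet_derivative_cong_on_open[OF assms] by simp

lemma D_third_order:
  fixes f :: "real \<times> real \<Rightarrow> real"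
  assumes S: "open S" and f: "smooth_on S f" and q: "q \<in> S"
  shows "D1 (\<lambda>q. D2 (\<lambda>q. D2 f q) q) q = D2 (\<lambda>q. D2 (\<lambda>q. D1 f q) q) q"
    "D1 (\<lambda>q. D1 (\<lambda>q. D2 f q) q) q = D1 (\<lambda>q. D2 (\<lambda>q. D1 f q) q) q"
    "D2 (\<lambda>q. D2 (\<lambda>q. D1 f q) q) q = D2 (\<lambda>q. D1 (\<lambda>q. D2 f q) q) q"
    "D1 (\<lambda>q. D2 (\<lambda>q. D1 f q) q) q = D2 (\<lambda>q. D1 (\<lambda>q. D1 f q) q) q"
proof -
  have c: "D1 (\<lambda>q. D2 f q) q = D2 (\<lambda>q. D1 f q) q" if "q \<in> S" for q
    by (rule D1_D2_commute[OF S f that])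
  show "D1 (\<lambda>q. D1 (\<lambda>q. D2 f q) q) q = D1 (\<lambda>q. D2 (\<lambda>q. D1 f q) q) q"
    by (rule D_cong[OF S q c])
  show A: "D2 (\<lambda>q. D2 (\<lambda>q. D1 f q) q) q = D2 (\<lambda>q. D1 (\<lambda>q. D2 f q) q) q"
    by (rule D_cong[OF S q c[symmetric]])
  show "D1 (\<lambda>q. D2 (\<lambda>q. D2 f q) q) q = D2 (\<lambda>q. D2 (\<lambda>q. D1 f q) q) q"
    unfolding A by (rule D1_D2_commute[OF S smooth_on_frechet[OF f] q])
  show "D1 (\<lambda>q. D2 (\<lambda>q. D1 f q) q) q = D2 (\<lambda>q. D1 (\<lambda>q. D1 f q) q) q"
    by (rule D1_D2_commute[OF S smooth_on_frechet[OF f] q])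
qed

text \<open>Both lemmas come from the relation \<open>\<delta>\<^sup>2 (p \<partial>) = (p \<partial>) \<delta>\<^sup>2 + 2 \<Delta> \<delta>\<close> for \<open>p \<partial> = p\<^sub>1 \<partial>\<^sub>1 + p\<^sub>2 \<partial>\<^sub>2\<close>.\<close>

lemma del_commutator_1:
  assumes S: "open S" and w: "\<And>i j. smooth_on S (w i j)" and q: "q \<in> S"
    and E: "\<And>q. q \<in> S \<Longrightarrow> D1 (w 1 0) q = E20 q" "\<And>q. q \<in> S \<Longrightarrow> D2 (w 1 0) q + D1 (w 0 1) q = E11 q"
      "\<And>q. q \<in> S \<Longrightarrow> D2 (w 0 1) q = E02 q"
  shows "D1 (D1 (del w 0 0)) q + D2 (D2 (del w 0 0)) q = D1 (D1 E20) q + D2 (D1 E11) q + D2 (D2 E02) q"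
proof -
  note sm = smooth_on_frechet w smooth_on_frechet[OF w] smooth_on_frechet[OF smooth_on_frechet[OF w]]
  note lin = D_linear_combination[OF S]
  have e0: "del w 0 0 q = 1 * D1 (w 1 0) q + 1 * D2 (w 0 1) q" if "q \<in> S" for q
    by (simp add: del_def)
  have e1: "D1 (del w 0 0) q = 1 * D1 (D1 (w 1 0)) q + 1 * D1 (D2 (w 0 1)) q" if "q \<in> S" for q
    by (rule lin[OF sm(3) sm(3) that e0])
  have e2: "D2 (del w 0 0) q = 1 * D2 (D1 (w 1 0)) q + 1 * D2 (D2 (w 0 1)) q" if "q \<in> S" for q
    by (rule lin[OF sm(3) sm(3) that e0])
  have e11: "D1 (D1 (del w 0 0)) q = 1 * D1 (D1 (D1 (w 1 0))) q + 1 * D1 (D1 (D2 (w 0 1))) q"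
    by (rule lin[OF sm(4) sm(4) q e1])
  have e22: "D2 (D2 (del w 0 0)) q = 1 * D2 (D2 (D1 (w 1 0))) q + 1 * D2 (D2 (D2 (w 0 1))) q"
    by (rule lin[OF sm(4) sm(4) q e2])
  have g1: "D1 E20 q = D1 (D1 (w 1 0)) q" if "q \<in> S" for q by (rule D_cong[OF S that E(1)[symmetric]])
  have g2: "D1 E11 q = 1 * D1 (D2 (w 1 0)) q + 1 * D1 (D1 (w 0 1)) q" if "q \<in> S" for q
    by (rule lin[OF sm(3) sm(3) that]) (simp only: mult_1_left E)
  have g3: "D2 E02 q = D2 (D2 (w 0 1)) q" if "q \<in> S" for q by (rule D_cong[OF S that E(3)[symmetric]])
  have g11: "D1 (D1 E20) q = D1 (D1 (D1 (w 1 0))) q" by (rule D_cong[OF S q g1])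
  have g12: "D2 (D1 E11) q = 1 * D2 (D1 (D2 (w 1 0))) q + 1 * D2 (D1 (D1 (w 0 1))) q"
    by (rule lin[OF sm(4) sm(4) q g2])
  have g22: "D2 (D2 E02) q = D2 (D2 (D2 (w 0 1))) q" by (rule D_cong[OF S q g3])
  show ?thesis unfolding e11 e22 g11 g12 g22
    using D_third_order[OF S w q, of 1 0] D_third_order[OF S w q, of 0 1] by simp
qed

lemma del_commutator_2:
  assumes S: "open S" and w: "\<And>i j. smooth_on S (w i j)" and q: "q \<in> S"
    and E: "\<And>q. q \<in> S \<Longrightarrow> D1 (w 2 0) q = E30 q" "\<And>q. q \<in> S \<Longrightarrow> D2 (w 2 0) q + D1 (w 1 1) q = E21 q"
      "\<And>q. q \<in> S \<Longrightarrow> D2 (w 1 1) q + D1 (w 0 2) q = E12 q" "\<And>q. q \<in> S \<Longrightarrow> D2 (w 0 2) q = E03 q"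
  shows "D1 (del (del w) 0 0) q + 2 * (D1 (D1 (del w 1 0)) q + D2 (D2 (del w 1 0)) q)
      = 6 * D1 (D1 E30) q + 4 * D2 (D1 E21) q + 2 * D2 (D2 E12) q"
    "D2 (del (del w) 0 0) q + 2 * (D1 (D1 (del w 0 1)) q + D2 (D2 (del w 0 1)) q)
      = 6 * D2 (D2 E03) q + 4 * D2 (D1 E12) q + 2 * D1 (D1 E21) q"
proof -
  note sm = smooth_on_frechet w smooth_on_frechet[OF w] smooth_on_frechet[OF smooth_on_frechet[OF w]]
  note lin = D_linear_combination[OF S]
  have sd: "smooth_on S (\<lambda>q. frechet_derivative (del w i j) (at q) v)" for i j v
    by (rule smooth_on_frechet[OF smooth_on_del[OF S w]])
  have a0: "del w 1 0 q = 2 * D1 (w 2 0) q + 1 * D2 (w 1 1) q"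
    "del w 0 1 q = 1 * D1 (w 1 1) q + 2 * D2 (w 0 2) q" if "q \<in> S" for q
    by (simp_all add: del_def)
  have a1: "D1 (del w 1 0) q = 2 * D1 (D1 (w 2 0)) q + 1 * D1 (D2 (w 1 1)) q"
    "D2 (del w 1 0) q = 2 * D2 (D1 (w 2 0)) q + 1 * D2 (D2 (w 1 1)) q"
    "D1 (del w 0 1) q = 1 * D1 (D1 (w 1 1)) q + 2 * D1 (D2 (w 0 2)) q"
    "D2 (del w 0 1) q = 1 * D2 (D1 (w 1 1)) q + 2 * D2 (D2 (w 0 2)) q" if "q \<in> S" for q
    using lin[OF sm(3) sm(3) that a0(1)] lin[OF sm(3) sm(3) that a0(2)] by blast+
  have a2: "D1 (D1 (del w 1 0)) q = 2 * D1 (D1 (D1 (w 2 0))) q + 1 * D1 (D1 (D2 (w 1 1))) q"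
    "D2 (D2 (del w 1 0)) q = 2 * D2 (D2 (D1 (w 2 0))) q + 1 * D2 (D2 (D2 (w 1 1))) q"
    "D1 (D1 (del w 0 1)) q = 1 * D1 (D1 (D1 (w 1 1))) q + 2 * D1 (D1 (D2 (w 0 2))) q"
    "D2 (D2 (del w 0 1)) q = 1 * D2 (D2 (D1 (w 1 1))) q + 2 * D2 (D2 (D2 (w 0 2))) q"
    "D2 (D1 (del w 1 0)) q = 2 * D2 (D1 (D1 (w 2 0))) q + 1 * D2 (D1 (D2 (w 1 1))) q"
    "D1 (D2 (del w 0 1)) q = 1 * D1 (D2 (D1 (w 1 1))) q + 2 * D1 (D2 (D2 (w 0 2))) q"
    using lin[OF sm(4) sm(4) q a1(1)] lin[OF sm(4) sm(4) q a1(2)] lin[OF sm(4) sm(4) q a1(3)] lin[OF sm(4) sm(4) q a1(4)] by blast+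
  have b0: "del (del w) 0 0 q = 1 * D1 (del w 1 0) q + 1 * D2 (del w 0 1) q" if "q \<in> S" for q
    unfolding del_def[of "del w"] by simp
  have b1: "D1 (del (del w) 0 0) q = 1 * D1 (D1 (del w 1 0)) q + 1 * D1 (D2 (del w 0 1)) q"
    "D2 (del (del w) 0 0) q = 1 * D2 (D1 (del w 1 0)) q + 1 * D2 (D2 (del w 0 1)) q"
    using lin[OF sd sd q b0] by blast+
  have g: "D1 E30 q = D1 (D1 (w 2 0)) q" "D2 E03 q = D2 (D2 (w 0 2)) q" if "q \<in> S" for q
    by (rule D_cong[OF S that E(1)[symmetric]], assumption, rule D_cong[OF S that E(4)[symmetric]], assumption)
  have k: "D1 E21 q = 1 * D1 (D2 (w 2 0)) q + 1 * D1 (D1 (w 1 1)) q"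
     "D1 E12 q = 1 * D1 (D2 (w 1 1)) q + 1 * D1 (D1 (w 0 2)) q"
     "D2 E12 q = 1 * D2 (D2 (w 1 1)) q + 1 * D2 (D1 (w 0 2)) q" if "q \<in> S" for q
    by (rule lin[OF sm(3) sm(3) that], simp only: mult_1_left E)+
  have g2: "D1 (D1 E30) q = D1 (D1 (D1 (w 2 0))) q" by (rule D_cong[OF S q g(1)])
  have g3: "D2 (D2 E03) q = D2 (D2 (D2 (w 0 2))) q" by (rule D_cong[OF S q g(2)])
  have k2: "D2 (D1 E21) q = 1 * D2 (D1 (D2 (w 2 0))) q + 1 * D2 (D1 (D1 (w 1 1))) q"
    "D1 (D1 E21) q = 1 * D1 (D1 (D2 (w 2 0))) q + 1 * D1 (D1 (D1 (w 1 1))) q"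
    by (rule lin[OF sm(4) sm(4) q k(1)], assumption)+
  have k3: "D2 (D1 E12) q = 1 * D2 (D1 (D2 (w 1 1))) q + 1 * D2 (D1 (D1 (w 0 2))) q"
    by (rule lin[OF sm(4) sm(4) q k(2)])
  have k4: "D2 (D2 E12) q = 1 * D2 (D2 (D2 (w 1 1))) q + 1 * D2 (D2 (D1 (w 0 2))) q"
    by (rule lin[OF sm(4) sm(4) q k(3)])
  note t = D_third_order[OF S w q, of 2 0] D_third_order[OF S w q, of 1 1] D_third_order[OF S w q, of 0 2]
  show "D1 (del (del w) 0 0) q + 2 * (D1 (D1 (del w 1 0)) q + D2 (D2 (del w 1 0)) q)
      = 6 * D1 (D1 E30) q + 4 * D2 (D1 E21) q + 2 * D2 (D2 E12) q"
    unfolding b1 a2 g2 k2 k4 using t by simp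
  show "D2 (del (del w) 0 0) q + 2 * (D1 (D1 (del w 0 1)) q + D2 (D2 (del w 0 1)) q)
      = 6 * D2 (D2 E03) q + 4 * D2 (D1 E12) q + 2 * D1 (D1 E21) q"
    unfolding b1 a2 g3 k2 k3 using t by simp
qed

section \<open>Killing tensors as functions on the plane\<close>

definition PA :: "real poly \<Rightarrow> real \<times> real \<Rightarrow> real" where "PA a q = poly a (snd q)"
definition PB :: "real poly \<Rightarrow> real poly \<Rightarrow> real \<times> real \<Rightarrow> real" where "PB a b q = kb a b (fst q) (snd q)"
definition PC :: "real poly \<Rightarrow> real poly \<Rightarrow> real poly \<Rightarrow> real \<times> real \<Rightarrow> real" where
  "PC a b c q = kc a b c (fst q) (snd q)"
definition PD :: "real poly \<Rightarrow> real poly \<Rightarrow> real poly \<Rightarrow> real poly \<Rightarrow> real \<times> real \<Rightarrow> real" where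
  "PD a b c d q = kd a b c d (fst q) (snd q)"
definition PE :: "real poly \<Rightarrow> real poly \<Rightarrow> real poly \<Rightarrow> real poly \<Rightarrow> real poly \<Rightarrow> real \<times> real \<Rightarrow> real" where
  "PE a b c d e q = poly e (snd q) - fst q * poly (pderiv d) (snd q) + (fst q)\<^sup>2 / 2 * poly (pderiv (pderiv c)) (snd q)
     - fst q ^ 3 / 6 * poly (pderiv (pderiv (pderiv b))) (snd q)
     + fst q ^ 4 / 24 * poly (pderiv (pderiv (pderiv (pderiv a)))) (snd q)"

lemma has_derivative_poly_snd [derivative_intros]:
  "((\<lambda>q :: real \<times> real. poly (p :: real poly) (snd q)) has_derivative (\<lambda>v. snd v * poly (pderiv p) (snd q))) (at q)"
proof -
  have "(poly p has_derivative (\<lambda>t. poly (pderiv p) (snd q) * t)) (at (snd q))"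
    using poly_DERIV[of p "snd q"] by (simp add: has_field_derivative_def)
  from has_derivative_compose[OF has_derivative_snd[OF has_derivative_ident] this]
  show ?thesis by (simp add: mult.commute)
qed

text \<open>Each q1-derivative is minus the q2-derivative of the preceding coefficient. This chain
  expresses the Killing equations, and differentiation only replaces the polynomials by their
  derivatives.\<close>

lemma P_derivatives [derivative_intros]:
  "(PA a has_derivative (\<lambda>v. snd v * PA (pderiv a) q)) (at q)"
  "(PB a b has_derivative (\<lambda>v. fst v * - PA (pderiv a) q + snd v * PB (pderiv a) (pderiv b) q)) (at q)"
  "(PC a b c has_derivative (\<lambda>v. fst v * - PB (pderiv a) (pderiv b) q + snd v * PC (pderiv a) (pderiv b) (pderiv c) q)) (at q)"
  "(PD a b c d has_derivative (\<lambda>v. fst v * - PC (pderiv a) (pderiv b) (pderiv c) q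
      + snd v * PD (pderiv a) (pderiv b) (pderiv c) (pderiv d) q)) (at q)"
  "(PE a b c d e has_derivative (\<lambda>v. fst v * - PD (pderiv a) (pderiv b) (pderiv c) (pderiv d) q
      + snd v * PE (pderiv a) (pderiv b) (pderiv c) (pderiv d) (pderiv e) q)) (at q)"
  unfolding PA_def[abs_def] PB_def[abs_def] PC_def[abs_def] PD_def[abs_def] PE_def[abs_def] kb_def kc_def kd_def
  by (auto intro!: derivative_eq_intros simp: fun_eq_iff field_simps power2_eq_square power3_eq_cube power4_eq_xxxx)

lemma smooth_on_partials:
  fixes f :: "real \<times> real \<Rightarrow> real"
  assumes "smooth_on S f" "q \<in> S"
  shows "(f has_derivative (\<lambda>v. fst v * D1 f q + snd v * D2 f q)) (at q)"
proof -
  note f = smooth_on_has_derivative[OF assms]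
  have "frechet_derivative f (at q) v = fst v * D1 f q + snd v * D2 f q" for v
  proof -
    have "v = fst v *\<^sub>R (1, 0) + snd v *\<^sub>R (0, 1)" by (cases v) simp
    then have "frechet_derivative f (at q) v = frechet_derivative f (at q) (fst v *\<^sub>R (1, 0) + snd v *\<^sub>R (0, 1))"
      by simp
    then show ?thesis
      using has_derivative_linear[OF f] by (simp only: linear_add linear_scale real_scaleR_def)
  qed
  then show ?thesis by (intro has_derivative_eq_rhs[OF f] ext)
qed

lemma del_linear_combination:
  assumes S: "open S" and f: "\<And>i j. smooth_on S (f i j)" and g: "\<And>i j. smooth_on S (g i j)" and q: "q \<in> S"
    and F: "\<And>i j q. q \<in> S \<Longrightarrow> F i j q = a * f i j q + b * g i j q"
  shows "del F i j q = a * del f i j q + b * del g i j q"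
proof -
  have 1: "D1 (F (i + 1) j) q = a * D1 (f (i + 1) j) q + b * D1 (g (i + 1) j) q"
    by (rule D_linear_combination[OF S f g q F])
  have 2: "D2 (F i (j + 1)) q = a * D2 (f i (j + 1)) q + b * D2 (g i (j + 1)) q"
    by (rule D_linear_combination[OF S f g q F])
  show ?thesis unfolding del_def 1 2 by (simp add: algebra_simps)
qed

text \<open>Below, the integral enters only through the real family y, from which X arises by
  ordering corrections; the components of y have degrees n, n - 2, ...\<close>

locale determining_equations =
  fixes h :: real and I1 I2 :: "real set" and v1 v2 :: "nat \<Rightarrow> real \<Rightarrow> real"
    and n :: nat and y :: "nat \<Rightarrow> nat \<Rightarrow> real \<times> real \<Rightarrow> real"
  assumes I1: "open I1" and I2: "open I2" and v1: "all_derivs I1 v1" and v2: "all_derivs I2 v2"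
    and y: "\<And>i j. smooth_on (I1 \<times> I2) (y i j)" and n: "n \<le> 4"
    and y0: "\<And>i j q. q \<in> I1 \<times> I2 \<Longrightarrow> n < i + j \<or> odd (n - (i + j)) \<Longrightarrow> y i j q = 0"
    and bracket: "\<And>i j q. q \<in> I1 \<times> I2 \<Longrightarrow>
     (if i \<ge> 1 then D1 (even_part h y (i - 1) j) q else 0) + (if j \<ge> 1 then D2 (even_part h y i (j - 1)) q else 0)
     - h\<^sup>2 / 4 * (D1 (D1 (odd_part h y i j)) q + D2 (D2 (odd_part h y i j)) q)
   = fact (i + 1) / fact i * even_part h y (i + 1) j q * v1 1 (fst q) + fact (j + 1) / fact j * even_part h y i (j + 1) q * v2 1 (snd q)
     - h\<^sup>2 / 4 * (fact (i + 2) / fact i * odd_part h y (i + 2) j q * v1 2 (fst q) + fact (j + 2) / fact j * odd_part h y i (j + 2) q * v2 2 (snd q))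
     - h\<^sup>2 / 6 * (fact (i + 3) / fact i * even_part h y (i + 3) j q * v1 3 (fst q) + fact (j + 3) / fact j * even_part h y i (j + 3) q * v2 3 (snd q))
     + h ^ 4 / 48 * (fact (i + 4) / fact i * odd_part h y (i + 4) j q * v1 4 (fst q) + fact (j + 4) / fact j * odd_part h y i (j + 4) q * v2 4 (snd q))"
begin

abbreviation "S \<equiv> I1 \<times> I2"

lemma S: "open S" using I1 I2 by (rule open_Times)

lemma del_eq_0: "q \<in> S \<Longrightarrow> n < i + j + k \<Longrightarrow> (del ^^ k) y i j q = 0"
  by (rule del_iter_eq_0[OF S, of n y]) (use y0 in auto)

lemma v_derivatives:
  assumes "q \<in> S"
  shows "((\<lambda>q. v1 k (fst q)) has_derivative (\<lambda>v. fst v * v1 (Suc k) (fst q))) (at q)"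
    "((\<lambda>q. v2 k (snd q)) has_derivative (\<lambda>v. snd v * v2 (Suc k) (snd q))) (at q)"
proof -
  have "(v1 k has_derivative (\<lambda>t. v1 (Suc k) (fst q) * t)) (at (fst q))" "(v2 k has_derivative (\<lambda>t. v2 (Suc k) (snd q) * t)) (at (snd q))"
    using v1 v2 assms by (auto simp: all_derivs_def has_field_derivative_def)
  from has_derivative_compose[OF has_derivative_fst[OF has_derivative_ident] this(1)]
    has_derivative_compose[OF has_derivative_snd[OF has_derivative_ident] this(2)]
  show "((\<lambda>q. v1 k (fst q)) has_derivative (\<lambda>v. fst v * v1 (Suc k) (fst q))) (at q)"
    "((\<lambda>q. v2 k (snd q)) has_derivative (\<lambda>v. snd v * v2 (Suc k) (snd q))) (at q)"
    by (simp_all add: mult.commute)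
qed

text \<open>The Weyl symbol \<open>cosh (\<epsilon> \<delta> / 2) y\<close>, up to the order \<open>\<epsilon>\<^sup>2\<close>.\<close>

definition w :: "nat \<Rightarrow> nat \<Rightarrow> real \<times> real \<Rightarrow> real" where
  "w i j q = 1 * y i j q + (- (h\<^sup>2 / 8)) * (del ^^ 2) y i j q"

lemma smooth_w: "smooth_on S (w i j)"
  unfolding w_def by (intro smooth_on_add smooth_on_scale smooth_on_del_iter S y)

lemma del_w: "q \<in> S \<Longrightarrow> del w i j q = del y i j q + (- (h\<^sup>2 / 8)) * (del ^^ 3) y i j q"
  using del_linear_combination[OF S y smooth_on_del_iter[OF S y] _ w_def, where i = i and j = j]
  by (simp add: numeral_3_eq_3 numeral_2_eq_2)

text \<open>X is exp(\<epsilon> \<delta> / 2) applied to the Weyl symbol, so this is the expansion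
  of 2 sinh(\<epsilon> \<delta> / 2) / \<epsilon>. In the cubic term y may stand for w, because
  \<delta>^5 y = 0 for n \<le> 4.\<close>

lemma odd_part_w: "q \<in> S \<Longrightarrow> odd_part h y i j q = 1 * del w i j q + (- (h\<^sup>2 / 24)) * (del ^^ 3) y i j q"
  by (simp add: del_w odd_part_def algebra_simps)

lemma even_part_w: "q \<in> S \<Longrightarrow> n < i + j + 4 \<Longrightarrow>
    even_part h y i j q = 1 * w i j q + (- (h\<^sup>2 / 8)) * (del ^^ 2) y i j q"
  by (simp add: even_part_def w_def del_eq_0 algebra_simps)

lemma even_part_top: "q \<in> S \<Longrightarrow> n < i + j + 2 \<Longrightarrow> even_part h y i j q = y i j q"
  by (simp add: even_part_def del_eq_0)

lemma odd_part_top: "q \<in> S \<Longrightarrow> n < i + j + 3 \<Longrightarrow> odd_part h y i j q = del y i j q"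
  by (simp add: odd_part_def del_eq_0)

lemma odd_part_0: "q \<in> S \<Longrightarrow> n < i + j + 1 \<Longrightarrow> odd_part h y i j q = 0"
  using del_eq_0[of q i j 1] by (simp add: odd_part_def del_eq_0 One_nat_def)

lemma D_even_part: "q \<in> S \<Longrightarrow> n < i + j + 4 \<Longrightarrow> frechet_derivative (even_part h y i j) (at q) v
    = frechet_derivative (w i j) (at q) v + (- (h\<^sup>2 / 8)) * frechet_derivative ((del ^^ 2) y i j) (at q) v"
  using D_linear_combination[OF S smooth_w smooth_on_del_iter[OF S y] _ even_part_w, of q i j v] by simp

lemma funpow_3: "(f ^^ 3) y = f ((f ^^ 2) y)"
  by (simp add: numeral_3_eq_3 numeral_2_eq_2)

lemma funpow_2: "(f ^^ 2) y = f (f y)"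
  by (simp add: numeral_2_eq_2)

lemma laplace_odd_part:
  assumes q: "q \<in> S"
  shows "D1 (D1 (odd_part h y i j)) q = 1 * D1 (D1 (del w i j)) q + (- (h\<^sup>2 / 24)) * D1 (D1 ((del ^^ 3) y i j)) q"
    "D2 (D2 (odd_part h y i j)) q = 1 * D2 (D2 (del w i j)) q + (- (h\<^sup>2 / 24)) * D2 (D2 ((del ^^ 3) y i j)) q"
proof -
  note sm = smooth_on_del[OF S smooth_w] smooth_on_del_iter[OF S y]
  note lin = D_linear_combination[OF S]
  have l: "frechet_derivative (odd_part h y i j) (at z) v = 1 * frechet_derivative (del w i j) (at z) v
      + (- (h\<^sup>2 / 24)) * frechet_derivative ((del ^^ 3) y i j) (at z) v" if "z \<in> S" for z v
    by (rule lin[OF sm that odd_part_w])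
  show "D1 (D1 (odd_part h y i j)) q = 1 * D1 (D1 (del w i j)) q + (- (h\<^sup>2 / 24)) * D1 (D1 ((del ^^ 3) y i j)) q"
    "D2 (D2 (odd_part h y i j)) q = 1 * D2 (D2 (del w i j)) q + (- (h\<^sup>2 / 24)) * D2 (D2 ((del ^^ 3) y i j)) q"
    by (rule lin[OF smooth_on_frechet[OF sm(1)] smooth_on_frechet[OF sm(2)] q l], assumption)+
qed

text \<open>In Weyl ordering the bracket becomes the Moyal bracket, where only odd derivatives of
  the potentials occur. All ordering corrections are explicit, since the powers of \<delta> act on
  the known Killing tensor or are handled by the commutator lemmas. The first four equations have
  degree three in the momenta; the last one is the integrability condition of the degree-one
  equations.\<close>

lemma moyal_4:
  assumes n4: "n = 4"
    and lead: "\<And>q. q \<in> S \<Longrightarrow> y 4 0 q = PA a q" "\<And>q. q \<in> S \<Longrightarrow> y 3 1 q = PB a b q" "\<And>q. q \<in> S \<Longrightarrow> y 2 2 q = PC a b c q"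
      "\<And>q. q \<in> S \<Longrightarrow> y 1 3 q = PD a b c d q" "\<And>q. q \<in> S \<Longrightarrow> y 0 4 q = PE a b c d e q"
    and deg: "pderiv (pderiv (pderiv (pderiv (pderiv a)))) = 0" "pderiv (pderiv (pderiv (pderiv b))) = 0"
      "pderiv (pderiv (pderiv c)) = 0" "pderiv (pderiv d) = 0" "pderiv e = 0"
    and q: "q \<in> S"
  shows "D1 (w 2 0) q = 4 * PA a q * v1 1 (fst q) + PB a b q * v2 1 (snd q)"
    "D2 (w 2 0) q + D1 (w 1 1) q = 3 * PB a b q * v1 1 (fst q) + 2 * PC a b c q * v2 1 (snd q)"
    "D2 (w 1 1) q + D1 (w 0 2) q = 2 * PC a b c q * v1 1 (fst q) + 3 * PD a b c d q * v2 1 (snd q)"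
    "D2 (w 0 2) q = PD a b c d q * v1 1 (fst q) + 4 * PE a b c d e q * v2 1 (snd q)"
    "2 * D2 (w 2 0) q * v1 1 (fst q) + D2 (w 1 1) q * v2 1 (snd q) + w 1 1 q * v2 2 (snd q)
       - h\<^sup>2 * (PA (pderiv a) q * v1 3 (fst q) + PD (pderiv a) (pderiv b) (pderiv c) (pderiv d) q / 4 * v2 3 (snd q)
         + PD a b c d q / 4 * v2 4 (snd q))
     = D1 (w 1 1) q * v1 1 (fst q) + w 1 1 q * v1 2 (fst q) + 2 * D1 (w 0 2) q * v2 1 (snd q)
       - h\<^sup>2 * (- PA (pderiv a) q / 4 * v1 3 (fst q) + PB a b q / 4 * v1 4 (fst q)
         - PD (pderiv a) (pderiv b) (pderiv c) (pderiv d) q * v2 3 (snd q))"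
proof -
  let ?A0 = "PA a"
    and ?A1 = "PA (pderiv a)"
    and ?A2 = "PA (pderiv (pderiv a))"
    and ?A3 = "PA (pderiv (pderiv (pderiv a)))"
    and ?A4 = "PA (pderiv (pderiv (pderiv (pderiv a))))"
    and ?B0 = "PB a b"
    and ?B1 = "PB (pderiv a) (pderiv b)"
    and ?B2 = "PB (pderiv (pderiv a)) (pderiv (pderiv b))"
    and ?B3 = "PB (pderiv (pderiv (pderiv a))) (pderiv (pderiv (pderiv b)))"
    and ?C0 = "PC a b c"
    and ?C1 = "PC (pderiv a) (pderiv b) (pderiv c)"
    and ?C2 = "PC (pderiv (pderiv a)) (pderiv (pderiv b)) (pderiv (pderiv c))"
    and ?C3 = "PC (pderiv (pderiv (pderiv a))) (pderiv (pderiv (pderiv b))) (pderiv (pderiv (pderiv c)))"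
    and ?D0 = "PD a b c d"
    and ?D1 = "PD (pderiv a) (pderiv b) (pderiv c) (pderiv d)"
    and ?D2 = "PD (pderiv (pderiv a)) (pderiv (pderiv b)) (pderiv (pderiv c)) (pderiv (pderiv d))"
    and ?D3 = "PD (pderiv (pderiv (pderiv a))) (pderiv (pderiv (pderiv b))) (pderiv (pderiv (pderiv c))) (pderiv (pderiv (pderiv d)))"
    and ?E0 = "PE a b c d e"
    and ?E1 = "PE (pderiv a) (pderiv b) (pderiv c) (pderiv d) (pderiv e)"
  have Z: "?C3 z = 0" "?D3 z = 0" "?E1 z = 0" for z
    by (simp_all add: PA_def PB_def PC_def PD_def PE_def kb_def kc_def kd_def deg)
  have l40: "D1 (y 4 0) z = 0 \<and> D2 (y 4 0) z = ?A1 z" if z: "z \<in> S" for z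
    by (rule D_eqI[OF S z lead(1)], assumption)
      (auto intro!: derivative_eq_intros v_derivatives[OF z] simp: fun_eq_iff algebra_simps)
  have l31: "D1 (y 3 1) z = - ?A1 z \<and> D2 (y 3 1) z = ?B1 z" if z: "z \<in> S" for z
    by (rule D_eqI[OF S z lead(2)], assumption)
      (auto intro!: derivative_eq_intros v_derivatives[OF z] simp: fun_eq_iff algebra_simps)
  have l22: "D1 (y 2 2) z = - ?B1 z \<and> D2 (y 2 2) z = ?C1 z" if z: "z \<in> S" for z
    by (rule D_eqI[OF S z lead(3)], assumption)
      (auto intro!: derivative_eq_intros v_derivatives[OF z] simp: fun_eq_iff algebra_simps)
  have l13: "D1 (y 1 3) z = - ?C1 z \<and> D2 (y 1 3) z = ?D1 z" if z: "z \<in> S" for z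
    by (rule D_eqI[OF S z lead(4)], assumption)
      (auto intro!: derivative_eq_intros v_derivatives[OF z] simp: fun_eq_iff algebra_simps)
  have l04: "D1 (y 0 4) z = - ?D1 z \<and> D2 (y 0 4) z = 0" if z: "z \<in> S" for z
    by (rule D_eqI[OF S z lead(5)], assumption)
      (auto intro!: derivative_eq_intros v_derivatives[OF z] simp: fun_eq_iff algebra_simps Z)
  have m: "del y 3 0 z = ?B1 z" "del y 2 1 z = - 3 * ?A1 z + 2 * ?C1 z"
    "del y 1 2 z = - 2 * ?B1 z + 3 * ?D1 z" "del y 0 3 z = - ?C1 z" if "z \<in> S" for z
    using l40[OF that] l31[OF that] l22[OF that] l13[OF that] l04[OF that] by (simp_all add: del_def)
  have m30: "D1 (del y 3 0) z = - ?A2 z \<and> D2 (del y 3 0) z = ?B2 z" if z: "z \<in> S" for z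
    by (rule D_eqI[OF S z m(1)], assumption)
      (auto intro!: derivative_eq_intros v_derivatives[OF z] simp: fun_eq_iff algebra_simps)
  have m21: "D1 (del y 2 1) z = - 2 * ?B2 z \<and> D2 (del y 2 1) z = - 3 * ?A2 z + 2 * ?C2 z" if z: "z \<in> S" for z
    by (rule D_eqI[OF S z m(2)], assumption)
      (auto intro!: derivative_eq_intros v_derivatives[OF z] simp: fun_eq_iff algebra_simps)
  have m12: "D1 (del y 1 2) z = 2 * ?A2 z - 3 * ?C2 z \<and> D2 (del y 1 2) z = - 2 * ?B2 z + 3 * ?D2 z" if z: "z \<in> S" for z
    by (rule D_eqI[OF S z m(3)], assumption)
      (auto intro!: derivative_eq_intros v_derivatives[OF z] simp: fun_eq_iff algebra_simps)
  have m03: "D1 (del y 0 3) z = ?B2 z \<and> D2 (del y 0 3) z = - ?C2 z" if z: "z \<in> S" for z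
    by (rule D_eqI[OF S z m(4)], assumption)
      (auto intro!: derivative_eq_intros v_derivatives[OF z] simp: fun_eq_iff algebra_simps)
  have k: "(del ^^ 2) y 2 0 z = - 6 * ?A2 z + 2 * ?C2 z" "(del ^^ 2) y 1 1 z = - 8 * ?B2 z + 6 * ?D2 z"
    "(del ^^ 2) y 0 2 z = 2 * ?A2 z - 6 * ?C2 z" if "z \<in> S" for z
    unfolding funpow_2 del_def[of "del y"] using m30[OF that] m21[OF that] m12[OF that] m03[OF that] by simp_all
  have k20: "D1 ((del ^^ 2) y 2 0) z = - 2 * ?B3 z \<and> D2 ((del ^^ 2) y 2 0) z = - 6 * ?A3 z" if z: "z \<in> S" for z
    by (rule D_eqI[OF S z k(1)], assumption)
      (auto intro!: derivative_eq_intros v_derivatives[OF z] simp: fun_eq_iff algebra_simps Z)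
  have k11: "D1 ((del ^^ 2) y 1 1) z = 8 * ?A3 z \<and> D2 ((del ^^ 2) y 1 1) z = - 8 * ?B3 z" if z: "z \<in> S" for z
    by (rule D_eqI[OF S z k(2)], assumption)
      (auto intro!: derivative_eq_intros v_derivatives[OF z] simp: fun_eq_iff algebra_simps Z)
  have k02: "D1 ((del ^^ 2) y 0 2) z = 6 * ?B3 z \<and> D2 ((del ^^ 2) y 0 2) z = 2 * ?A3 z" if z: "z \<in> S" for z
    by (rule D_eqI[OF S z k(3)], assumption)
      (auto intro!: derivative_eq_intros v_derivatives[OF z] simp: fun_eq_iff algebra_simps Z)
  have j: "(del ^^ 3) y 1 0 z = - 12 * ?B3 z" "(del ^^ 3) y 0 1 z = 12 * ?A3 z" if "z \<in> S" for z
    unfolding funpow_3 del_def[of "(del ^^ 2) y"] using k20[OF that] k11[OF that] k02[OF that] by simp_all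
  have j10: "D1 ((del ^^ 3) y 1 0) z = 12 * ?A4 z \<and> D2 ((del ^^ 3) y 1 0) z = 0" if z: "z \<in> S" for z
    by (rule D_eqI[OF S z j(1)], assumption)
      (auto intro!: derivative_eq_intros v_derivatives[OF z] simp: fun_eq_iff algebra_simps PA_def PB_def PC_def PD_def PE_def kb_def kc_def kd_def deg)
  have j01: "D1 ((del ^^ 3) y 0 1) z = 0 \<and> D2 ((del ^^ 3) y 0 1) z = 12 * ?A4 z" if z: "z \<in> S" for z
    by (rule D_eqI[OF S z j(2)], assumption)
      (auto intro!: derivative_eq_intros v_derivatives[OF z] simp: fun_eq_iff algebra_simps PA_def PB_def PC_def PD_def PE_def kb_def kc_def kd_def deg)
  have j10a: "D1 (D1 ((del ^^ 3) y 1 0)) z = 0 \<and> D2 (D1 ((del ^^ 3) y 1 0)) z = 0" if z: "z \<in> S" for z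
    by (rule D_eqI[OF S z j10[THEN conjunct1]], assumption)
      (auto intro!: derivative_eq_intros v_derivatives[OF z] simp: fun_eq_iff algebra_simps PA_def PB_def PC_def PD_def PE_def kb_def kc_def kd_def deg)
  have j10b: "D1 (D2 ((del ^^ 3) y 1 0)) z = 0 \<and> D2 (D2 ((del ^^ 3) y 1 0)) z = 0" if z: "z \<in> S" for z
    by (rule D_eqI[OF S z j10[THEN conjunct2]], assumption)
      (auto intro!: derivative_eq_intros v_derivatives[OF z] simp: fun_eq_iff algebra_simps PA_def PB_def PC_def PD_def PE_def kb_def kc_def kd_def deg)
  have j01a: "D1 (D1 ((del ^^ 3) y 0 1)) z = 0 \<and> D2 (D1 ((del ^^ 3) y 0 1)) z = 0" if z: "z \<in> S" for z
    by (rule D_eqI[OF S z j01[THEN conjunct1]], assumption)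
      (auto intro!: derivative_eq_intros v_derivatives[OF z] simp: fun_eq_iff algebra_simps PA_def PB_def PC_def PD_def PE_def kb_def kc_def kd_def deg)
  have j01b: "D1 (D2 ((del ^^ 3) y 0 1)) z = 0 \<and> D2 (D2 ((del ^^ 3) y 0 1)) z = 0" if z: "z \<in> S" for z
    by (rule D_eqI[OF S z j01[THEN conjunct2]], assumption)
      (auto intro!: derivative_eq_intros v_derivatives[OF z] simp: fun_eq_iff algebra_simps PA_def PB_def PC_def PD_def PE_def kb_def kc_def kd_def deg)
  have o: "odd_part h y 3 0 z = del y 3 0 z" "odd_part h y 2 1 z = del y 2 1 z" "odd_part h y 1 2 z = del y 1 2 z"
    "odd_part h y 0 3 z = del y 0 3 z" if "z \<in> S" for z
    using that n4 by (simp_all add: odd_part_top)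
  have n30: "D1 (odd_part h y 3 0) z = - ?A2 z" "D2 (odd_part h y 3 0) z = ?B2 z" if z: "z \<in> S" for z
    using m30[OF z] D_cong[OF S z o(1)] by simp_all
  have n21: "D1 (odd_part h y 2 1) z = - 2 * ?B2 z" "D2 (odd_part h y 2 1) z = - 3 * ?A2 z + 2 * ?C2 z" if z: "z \<in> S" for z
    using m21[OF z] D_cong[OF S z o(2)] by simp_all
  have n12: "D1 (odd_part h y 1 2) z = 2 * ?A2 z - 3 * ?C2 z" "D2 (odd_part h y 1 2) z = - 2 * ?B2 z + 3 * ?D2 z" if z: "z \<in> S" for z
    using m12[OF z] D_cong[OF S z o(3)] by simp_all
  have n03: "D1 (odd_part h y 0 3) z = ?B2 z" "D2 (odd_part h y 0 3) z = - ?C2 z" if z: "z \<in> S" for z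
    using m03[OF z] D_cong[OF S z o(4)] by simp_all
  have n30a: "D1 (D1 (odd_part h y 3 0)) z = 0 \<and> D2 (D1 (odd_part h y 3 0)) z = - ?A3 z" if z: "z \<in> S" for z
    by (rule D_eqI[OF S z n30(1)], assumption)
      (auto intro!: derivative_eq_intros v_derivatives[OF z] simp: fun_eq_iff algebra_simps Z)
  have n30b: "D1 (D2 (odd_part h y 3 0)) z = - ?A3 z \<and> D2 (D2 (odd_part h y 3 0)) z = ?B3 z" if z: "z \<in> S" for z
    by (rule D_eqI[OF S z n30(2)], assumption)
      (auto intro!: derivative_eq_intros v_derivatives[OF z] simp: fun_eq_iff algebra_simps Z)
  have n21a: "D1 (D1 (odd_part h y 2 1)) z = 2 * ?A3 z \<and> D2 (D1 (odd_part h y 2 1)) z = - 2 * ?B3 z" if z: "z \<in> S" for z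
    by (rule D_eqI[OF S z n21(1)], assumption)
      (auto intro!: derivative_eq_intros v_derivatives[OF z] simp: fun_eq_iff algebra_simps Z)
  have n21b: "D1 (D2 (odd_part h y 2 1)) z = - 2 * ?B3 z \<and> D2 (D2 (odd_part h y 2 1)) z = - 3 * ?A3 z" if z: "z \<in> S" for z
    by (rule D_eqI[OF S z n21(2)], assumption)
      (auto intro!: derivative_eq_intros v_derivatives[OF z] simp: fun_eq_iff algebra_simps Z)
  have n12a: "D1 (D1 (odd_part h y 1 2)) z = 3 * ?B3 z \<and> D2 (D1 (odd_part h y 1 2)) z = 2 * ?A3 z" if z: "z \<in> S" for z
    by (rule D_eqI[OF S z n12(1)], assumption)
      (auto intro!: derivative_eq_intros v_derivatives[OF z] simp: fun_eq_iff algebra_simps Z)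
  have n12b: "D1 (D2 (odd_part h y 1 2)) z = 2 * ?A3 z \<and> D2 (D2 (odd_part h y 1 2)) z = - 2 * ?B3 z" if z: "z \<in> S" for z
    by (rule D_eqI[OF S z n12(2)], assumption)
      (auto intro!: derivative_eq_intros v_derivatives[OF z] simp: fun_eq_iff algebra_simps Z)
  have n03a: "D1 (D1 (odd_part h y 0 3)) z = - ?A3 z \<and> D2 (D1 (odd_part h y 0 3)) z = ?B3 z" if z: "z \<in> S" for z
    by (rule D_eqI[OF S z n03(1)], assumption)
      (auto intro!: derivative_eq_intros v_derivatives[OF z] simp: fun_eq_iff algebra_simps Z)
  have n03b: "D1 (D2 (odd_part h y 0 3)) z = ?B3 z \<and> D2 (D2 (odd_part h y 0 3)) z = 0" if z: "z \<in> S" for z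
    by (rule D_eqI[OF S z n03(2)], assumption)
      (auto intro!: derivative_eq_intros v_derivatives[OF z] simp: fun_eq_iff algebra_simps Z)
  \<comment> \<open>Right-hand sides of the degree-three equations. Their second derivatives express
    the Laplacian of \<delta> w in the degree-one equations through
    \<open>del_commutator_2\<close>.\<close>
  define E30 E21 E12 E03 where "E30 z = 4 * ?A0 z * v1 1 (fst z) + ?B0 z * v2 1 (snd z)"
    and "E21 z = 3 * ?B0 z * v1 1 (fst z) + 2 * ?C0 z * v2 1 (snd z)"
    and "E12 z = 2 * ?C0 z * v1 1 (fst z) + 3 * ?D0 z * v2 1 (snd z)"
    and "E03 z = ?D0 z * v1 1 (fst z) + 4 * ?E0 z * v2 1 (snd z)" for z
  note E_defs = E30_def E21_def E12_def E03_def
  \<comment> \<open>In degree three the h^2-terms coming from \<delta>^2 y and from the Laplacian of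
    \<delta> y cancel each other.\<close>
  have E: "D1 (w 2 0) z = E30 z" "D2 (w 2 0) z + D1 (w 1 1) z = E21 z"
    "D2 (w 1 1) z + D1 (w 0 2) z = E12 z" "D2 (w 0 2) z = E03 z" if z: "z \<in> S" for z
    using bracket[OF z, of 3 0] bracket[OF z, of 2 1] bracket[OF z, of 1 2] bracket[OF z, of 0 3] z n4 lead
      k20[OF z] k11[OF z] k02[OF z] n30a[OF z] n30b[OF z] n21a[OF z] n21b[OF z] n12a[OF z] n12b[OF z] n03a[OF z] n03b[OF z]
    by (simp_all add: D_even_part even_part_top odd_part_0 y0 fact_numeral E_defs algebra_simps One_nat_def[symmetric])
  have e30: "D1 (E30) z = 4 * ?A0 z * v1 2 (fst z) - ?A1 z * v2 1 (snd z) \<and> D2 (E30) z = 4 * ?A1 z * v1 1 (fst z) + ?B1 z * v2 1 (snd z) + ?B0 z * v2 2 (snd z)" if z: "z \<in> S" for z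
    by (rule D_eqI[OF S z E30_def])
      (auto intro!: derivative_eq_intros v_derivatives[OF z] simp: fun_eq_iff algebra_simps Z)
  have e30a: "D1 (D1 E30) z = 4 * ?A0 z * v1 3 (fst z) \<and> D2 (D1 E30) z = 4 * ?A1 z * v1 2 (fst z) - ?A2 z * v2 1 (snd z) - ?A1 z * v2 2 (snd z)" if z: "z \<in> S" for z
    by (rule D_eqI[OF S z e30[THEN conjunct1]], assumption)
      (auto intro!: derivative_eq_intros v_derivatives[OF z] simp: fun_eq_iff algebra_simps Z)
  have e21: "D1 (E21) z = - 3 * ?A1 z * v1 1 (fst z) + 3 * ?B0 z * v1 2 (fst z) - 2 * ?B1 z * v2 1 (snd z) \<and> D2 (E21) z = 3 * ?B1 z * v1 1 (fst z) + 2 * ?C1 z * v2 1 (snd z) + 2 * ?C0 z * v2 2 (snd z)" if z: "z \<in> S" for z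
    by (rule D_eqI[OF S z E21_def])
      (auto intro!: derivative_eq_intros v_derivatives[OF z] simp: fun_eq_iff algebra_simps Z)
  have e21a: "D1 (D1 E21) z = - 6 * ?A1 z * v1 2 (fst z) + 3 * ?B0 z * v1 3 (fst z) + 2 * ?A2 z * v2 1 (snd z) \<and> D2 (D1 E21) z = - 3 * ?A2 z * v1 1 (fst z) + 3 * ?B1 z * v1 2 (fst z) - 2 * ?B2 z * v2 1 (snd z) - 2 * ?B1 z * v2 2 (snd z)" if z: "z \<in> S" for z
    by (rule D_eqI[OF S z e21[THEN conjunct1]], assumption)
      (auto intro!: derivative_eq_intros v_derivatives[OF z] simp: fun_eq_iff algebra_simps Z)
  have e12: "D1 (E12) z = - 2 * ?B1 z * v1 1 (fst z) + 2 * ?C0 z * v1 2 (fst z) - 3 * ?C1 z * v2 1 (snd z) \<and> D2 (E12) z = 2 * ?C1 z * v1 1 (fst z) + 3 * ?D1 z * v2 1 (snd z) + 3 * ?D0 z * v2 2 (snd z)" if z: "z \<in> S" for z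
    by (rule D_eqI[OF S z E12_def])
      (auto intro!: derivative_eq_intros v_derivatives[OF z] simp: fun_eq_iff algebra_simps Z)
  have e12a: "D1 (D1 E12) z = 2 * ?A2 z * v1 1 (fst z) - 4 * ?B1 z * v1 2 (fst z) + 2 * ?C0 z * v1 3 (fst z) + 3 * ?B2 z * v2 1 (snd z) \<and> D2 (D1 E12) z = - 2 * ?B2 z * v1 1 (fst z) + 2 * ?C1 z * v1 2 (fst z) - 3 * ?C2 z * v2 1 (snd z) - 3 * ?C1 z * v2 2 (snd z)" if z: "z \<in> S" for z
    by (rule D_eqI[OF S z e12[THEN conjunct1]], assumption)
      (auto intro!: derivative_eq_intros v_derivatives[OF z] simp: fun_eq_iff algebra_simps Z)
  have e12b: "D1 (D2 E12) z = - 2 * ?B2 z * v1 1 (fst z) + 2 * ?C1 z * v1 2 (fst z) - 3 * ?C2 z * v2 1 (snd z) - 3 * ?C1 z * v2 2 (snd z) \<and> D2 (D2 E12) z = 2 * ?C2 z * v1 1 (fst z) + 3 * ?D2 z * v2 1 (snd z) + 6 * ?D1 z * v2 2 (snd z) + 3 * ?D0 z * v2 3 (snd z)" if z: "z \<in> S" for z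
    by (rule D_eqI[OF S z e12[THEN conjunct2]], assumption)
      (auto intro!: derivative_eq_intros v_derivatives[OF z] simp: fun_eq_iff algebra_simps Z)
  have e03: "D1 (E03) z = - ?C1 z * v1 1 (fst z) + ?D0 z * v1 2 (fst z) - 4 * ?D1 z * v2 1 (snd z) \<and> D2 (E03) z = ?D1 z * v1 1 (fst z) + 4 * ?E0 z * v2 2 (snd z)" if z: "z \<in> S" for z
    by (rule D_eqI[OF S z E03_def])
      (auto intro!: derivative_eq_intros v_derivatives[OF z] simp: fun_eq_iff algebra_simps Z)
  have e03b: "D1 (D2 E03) z = - ?C2 z * v1 1 (fst z) + ?D1 z * v1 2 (fst z) - 4 * ?D1 z * v2 2 (snd z) \<and> D2 (D2 E03) z = ?D2 z * v1 1 (fst z) + 4 * ?E0 z * v2 3 (snd z)" if z: "z \<in> S" for z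
    by (rule D_eqI[OF S z e03[THEN conjunct2]], assumption)
      (auto intro!: derivative_eq_intros v_derivatives[OF z] simp: fun_eq_iff algebra_simps Z)
  \<comment> \<open>Up to an additive constant this is the degree-zero component of the Weyl symbol:
    the two differ by a multiple of \<delta>^4 y, which is 24 times the fourth derivative of
    a.\<close>
  define W where "W z = 1 * even_part h y 0 0 z + (h\<^sup>2 / 8) * del (del w) 0 0 z" for z
  have sW: "smooth_on S W"
    unfolding W_def by (intro smooth_on_add smooth_on_scale smooth_on_del smooth_on_parts S y smooth_w)
  have DW: "frechet_derivative W (at z) v = 1 * frechet_derivative (even_part h y 0 0) (at z) v
      + (h\<^sup>2 / 8) * frechet_derivative (del (del w) 0 0) (at z) v" if "z \<in> S" for z v
    by (rule D_linear_combination[OF S smooth_on_parts(1)[OF S y] smooth_on_del[OF S smooth_on_del[OF S smooth_w]] that W_def])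
  \<comment> \<open>The degree-one component of the Moyal bracket. The third derivatives carry h^2 /
    24 times a third momentum derivative: 24 / 24 = 1 from a fourth power of one momentum, 6 / 24 =
    1 / 4 from a cube times the other momentum.\<close>
  have WD: "D1 W z = 2 * w 2 0 z * v1 1 (fst z) + w 1 1 z * v2 1 (snd z) - h\<^sup>2 * (?A0 z * v1 3 (fst z) + ?D0 z / 4 * v2 3 (snd z))"
    "D2 W z = w 1 1 z * v1 1 (fst z) + 2 * w 0 2 z * v2 1 (snd z) - h\<^sup>2 * (?B0 z / 4 * v1 3 (fst z) + ?E0 z * v2 3 (snd z))" if z: "z \<in> S" for z
  proof -
    note c = del_commutator_2[OF S smooth_w z E]
    note lo = laplace_odd_part[OF z, of 1 0] laplace_odd_part[OF z, of 0 1]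
    have g1: "D1 (even_part h y 0 0) z - h\<^sup>2 / 4 * (D1 (D1 (del w 1 0)) z + D2 (D2 (del w 1 0)) z)
      = 2 * (w 2 0 z - h\<^sup>2 / 8 * (del ^^ 2) y 2 0 z) * v1 1 (fst z) + (w 1 1 z - h\<^sup>2 / 8 * (del ^^ 2) y 1 1 z) * v2 1 (snd z)
       - h\<^sup>2 / 4 * (6 * del y 3 0 z * v1 2 (fst z) + 2 * del y 1 2 z * v2 2 (snd z)) - h\<^sup>2 / 6 * (24 * ?A0 z * v1 3 (fst z) + 6 * ?D0 z * v2 3 (snd z))"
      using bracket[OF z, of 1 0] z n4 lo j10a[OF z] j10b[OF z] lead
      by (simp add: even_part_w[of _ 2 0] even_part_w[of _ 1 1] even_part_w[of _ 0 2] even_part_top o odd_part_0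
          fact_numeral numeral_2_eq_2[symmetric])
    have g2: "D2 (even_part h y 0 0) z - h\<^sup>2 / 4 * (D1 (D1 (del w 0 1)) z + D2 (D2 (del w 0 1)) z)
      = (w 1 1 z - h\<^sup>2 / 8 * (del ^^ 2) y 1 1 z) * v1 1 (fst z) + 2 * (w 0 2 z - h\<^sup>2 / 8 * (del ^^ 2) y 0 2 z) * v2 1 (snd z)
       - h\<^sup>2 / 4 * (2 * del y 2 1 z * v1 2 (fst z) + 6 * del y 0 3 z * v2 2 (snd z)) - h\<^sup>2 / 6 * (6 * ?B0 z * v1 3 (fst z) + 24 * ?E0 z * v2 3 (snd z))"
      using bracket[OF z, of 0 1] z n4 lo j01a[OF z] j01b[OF z] lead
      by (simp add: even_part_w[of _ 2 0] even_part_w[of _ 1 1] even_part_w[of _ 0 2] even_part_top o odd_part_0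
          fact_numeral numeral_2_eq_2[symmetric])
    have c1: "D1 (del (del w) 0 0) z = - 2 * (D1 (D1 (del w 1 0)) z + D2 (D2 (del w 1 0)) z)
        + 24 * ?A0 z * v1 3 (fst z) + 4 * (- 3 * ?A2 z * v1 1 (fst z) + 3 * ?B1 z * v1 2 (fst z) - 2 * ?B2 z * v2 1 (snd z) - 2 * ?B1 z * v2 2 (snd z))
        + 2 * (2 * ?C2 z * v1 1 (fst z) + 3 * ?D2 z * v2 1 (snd z) + 6 * ?D1 z * v2 2 (snd z) + 3 * ?D0 z * v2 3 (snd z))"
      using c(1) e30a[OF z] e21a[OF z] e12b[OF z] by (simp add: algebra_simps)
    have c2: "D2 (del (del w) 0 0) z = - 2 * (D1 (D1 (del w 0 1)) z + D2 (D2 (del w 0 1)) z)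
        + 6 * (?D2 z * v1 1 (fst z) + 4 * ?E0 z * v2 3 (snd z)) + 4 * (- 2 * ?B2 z * v1 1 (fst z) + 2 * ?C1 z * v1 2 (fst z) - 3 * ?C2 z * v2 1 (snd z) - 3 * ?C1 z * v2 2 (snd z))
        + 2 * (- 6 * ?A1 z * v1 2 (fst z) + 3 * ?B0 z * v1 3 (fst z) + 2 * ?A2 z * v2 1 (snd z))"
      using c(2) e03b[OF z] e12a[OF z] e21a[OF z] by (simp add: algebra_simps)
    have g1': "D1 (even_part h y 0 0) z = h\<^sup>2 / 4 * (D1 (D1 (del w 1 0)) z + D2 (D2 (del w 1 0)) z)
      + (2 * (w 2 0 z - h\<^sup>2 / 8 * (del ^^ 2) y 2 0 z) * v1 1 (fst z) + (w 1 1 z - h\<^sup>2 / 8 * (del ^^ 2) y 1 1 z) * v2 1 (snd z)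
       - h\<^sup>2 / 4 * (6 * del y 3 0 z * v1 2 (fst z) + 2 * del y 1 2 z * v2 2 (snd z)) - h\<^sup>2 / 6 * (24 * ?A0 z * v1 3 (fst z) + 6 * ?D0 z * v2 3 (snd z)))"
      using g1 by simp
    have g2': "D2 (even_part h y 0 0) z = h\<^sup>2 / 4 * (D1 (D1 (del w 0 1)) z + D2 (D2 (del w 0 1)) z)
      + ((w 1 1 z - h\<^sup>2 / 8 * (del ^^ 2) y 1 1 z) * v1 1 (fst z) + 2 * (w 0 2 z - h\<^sup>2 / 8 * (del ^^ 2) y 0 2 z) * v2 1 (snd z)
       - h\<^sup>2 / 4 * (2 * del y 2 1 z * v1 2 (fst z) + 6 * del y 0 3 z * v2 2 (snd z)) - h\<^sup>2 / 6 * (6 * ?B0 z * v1 3 (fst z) + 24 * ?E0 z * v2 3 (snd z)))"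
      using g2 by simp
    show "D1 W z = 2 * w 2 0 z * v1 1 (fst z) + w 1 1 z * v2 1 (snd z) - h\<^sup>2 * (?A0 z * v1 3 (fst z) + ?D0 z / 4 * v2 3 (snd z))"
      unfolding DW[OF z] g1' c1 m[OF z] k[OF z] by (simp add: field_simps)
    show "D2 W z = w 1 1 z * v1 1 (fst z) + 2 * w 0 2 z * v2 1 (snd z) - h\<^sup>2 * (?B0 z / 4 * v1 3 (fst z) + ?E0 z * v2 3 (snd z))"
      unfolding DW[OF z] g2' c2 m[OF z] k[OF z] by (simp add: field_simps)
  qed
  note wd = smooth_on_partials[OF smooth_w]
  show "D1 (w 2 0) q = 4 * ?A0 q * v1 1 (fst q) + ?B0 q * v2 1 (snd q)"
    "D2 (w 2 0) q + D1 (w 1 1) q = 3 * ?B0 q * v1 1 (fst q) + 2 * ?C0 q * v2 1 (snd q)"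
    "D2 (w 1 1) q + D1 (w 0 2) q = 2 * ?C0 q * v1 1 (fst q) + 3 * ?D0 q * v2 1 (snd q)"
    "D2 (w 0 2) q = ?D0 q * v1 1 (fst q) + 4 * ?E0 q * v2 1 (snd q)"
    using E[OF q] by (simp_all add: E_defs)
  \<comment> \<open>Both mixed second derivatives of W are computed from its gradient; their
    equality eliminates W.\<close>
  have x1: "D1 (D1 W) q = (2 * D1 (w 2 0) q * v1 1 (fst q) + 2 * w 2 0 q * v1 2 (fst q)) + D1 (w 1 1) q * v2 1 (snd q)
       - h\<^sup>2 * (?A0 q * v1 4 (fst q) - ?C1 q / 4 * v2 3 (snd q))
    \<and> D2 (D1 W) q = 2 * D2 (w 2 0) q * v1 1 (fst q) + D2 (w 1 1) q * v2 1 (snd q) + w 1 1 q * v2 2 (snd q)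
       - h\<^sup>2 * (?A1 q * v1 3 (fst q) + ?D1 q / 4 * v2 3 (snd q)
         + ?D0 q / 4 * v2 4 (snd q))"
    by (rule D_eqI[OF S q WD(1)], assumption)
      (auto intro!: derivative_eq_intros v_derivatives[OF q] wd[OF q] simp: fun_eq_iff field_simps)
  have x2: "D1 (D2 W) q = D1 (w 1 1) q * v1 1 (fst q) + w 1 1 q * v1 2 (fst q) + 2 * D1 (w 0 2) q * v2 1 (snd q)
       - h\<^sup>2 * (- ?A1 q / 4 * v1 3 (fst q) + ?B0 q / 4 * v1 4 (fst q)
         - ?D1 q * v2 3 (snd q))
    \<and> D2 (D2 W) q = D2 (w 1 1) q * v1 1 (fst q) + 2 * D2 (w 0 2) q * v2 1 (snd q) + 2 * w 0 2 q * v2 2 (snd q)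
       - h\<^sup>2 * (?B1 q / 4 * v1 3 (fst q) + ?E0 q * v2 4 (snd q))"
    by (rule D_eqI[OF S q WD(2)], assumption)
      (auto intro!: derivative_eq_intros v_derivatives[OF q] wd[OF q] simp: fun_eq_iff field_simps Z)
  show "2 * D2 (w 2 0) q * v1 1 (fst q) + D2 (w 1 1) q * v2 1 (snd q) + w 1 1 q * v2 2 (snd q)
       - h\<^sup>2 * (?A1 q * v1 3 (fst q) + ?D1 q / 4 * v2 3 (snd q)
         + ?D0 q / 4 * v2 4 (snd q))
     = D1 (w 1 1) q * v1 1 (fst q) + w 1 1 q * v1 2 (fst q) + 2 * D1 (w 0 2) q * v2 1 (snd q)
       - h\<^sup>2 * (- ?A1 q / 4 * v1 3 (fst q) + ?B0 q / 4 * v1 4 (fst q)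
         - ?D1 q * v2 3 (snd q))"
    using D1_D2_commute[OF S sW q] x1 x2 by simp
qed

text \<open>For n = 3 the lowest component of the bracket has degree zero. There is no further
  component to eliminate, and the last equation is algebraic in w.\<close>

lemma moyal_3:
  assumes n3: "n = 3"
    and lead: "\<And>q. q \<in> S \<Longrightarrow> y 3 0 q = PA a q" "\<And>q. q \<in> S \<Longrightarrow> y 2 1 q = PB a b q" "\<And>q. q \<in> S \<Longrightarrow> y 1 2 q = PC a b c q"
      "\<And>q. q \<in> S \<Longrightarrow> y 0 3 q = PD a b c d q"
    and deg: "pderiv (pderiv (pderiv (pderiv a))) = 0" "pderiv (pderiv (pderiv b)) = 0"
      "pderiv (pderiv c) = 0" "pderiv d = 0"
    and z: "z \<in> S"
  shows "D1 (w 1 0) z = 3 * PA a z * v1 1 (fst z) + PB a b z * v2 1 (snd z)"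
    "D2 (w 1 0) z + D1 (w 0 1) z = 2 * PB a b z * v1 1 (fst z) + 2 * PC a b c z * v2 1 (snd z)"
    "D2 (w 0 1) z = PC a b c z * v1 1 (fst z) + 3 * PD a b c d z * v2 1 (snd z)"
    "w 1 0 z * v1 1 (fst z) + w 0 1 z * v2 1 (snd z) - h\<^sup>2 / 4 * (PA a z * v1 3 (fst z) + PD a b c d z * v2 3 (snd z)) = 0"
proof -
  let ?A0 = "PA a"
    and ?A1 = "PA (pderiv a)"
    and ?A2 = "PA (pderiv (pderiv a))"
    and ?A3 = "PA (pderiv (pderiv (pderiv a)))"
    and ?B0 = "PB a b"
    and ?B1 = "PB (pderiv a) (pderiv b)"
    and ?B2 = "PB (pderiv (pderiv a)) (pderiv (pderiv b))"
    and ?B3 = "PB (pderiv (pderiv (pderiv a))) (pderiv (pderiv (pderiv b)))"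
    and ?C0 = "PC a b c"
    and ?C1 = "PC (pderiv a) (pderiv b) (pderiv c)"
    and ?C2 = "PC (pderiv (pderiv a)) (pderiv (pderiv b)) (pderiv (pderiv c))"
    and ?D0 = "PD a b c d"
    and ?D1 = "PD (pderiv a) (pderiv b) (pderiv c) (pderiv d)"
  have Z: "?D1 z = 0" "?C2 z = 0" "?B3 z = 0" for z
    by (simp_all add: PA_def PB_def PC_def PD_def kb_def kc_def kd_def deg)
  have l30: "D1 (y 3 0) z = 0 \<and> D2 (y 3 0) z = ?A1 z" if z: "z \<in> S" for z
    by (rule D_eqI[OF S z lead(1)], assumption)
      (auto intro!: derivative_eq_intros v_derivatives[OF z] simp: fun_eq_iff algebra_simps)
  have l21: "D1 (y 2 1) z = - ?A1 z \<and> D2 (y 2 1) z = ?B1 z" if z: "z \<in> S" for z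
    by (rule D_eqI[OF S z lead(2)], assumption)
      (auto intro!: derivative_eq_intros v_derivatives[OF z] simp: fun_eq_iff algebra_simps)
  have l12: "D1 (y 1 2) z = - ?B1 z \<and> D2 (y 1 2) z = ?C1 z" if z: "z \<in> S" for z
    by (rule D_eqI[OF S z lead(3)], assumption)
      (auto intro!: derivative_eq_intros v_derivatives[OF z] simp: fun_eq_iff algebra_simps)
  have l03: "D1 (y 0 3) z = - ?C1 z \<and> D2 (y 0 3) z = 0" if z: "z \<in> S" for z
    by (rule D_eqI[OF S z lead(4)], assumption)
      (auto intro!: derivative_eq_intros v_derivatives[OF z] simp: fun_eq_iff algebra_simps Z)
  have m: "del y 2 0 z = ?B1 z" "del y 1 1 z = - 2 * ?A1 z + 2 * ?C1 z" "del y 0 2 z = - ?B1 z" if "z \<in> S" for z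
    using l30[OF that] l21[OF that] l12[OF that] l03[OF that] by (simp_all add: del_def)
  have m20: "D1 (del y 2 0) z = - ?A2 z \<and> D2 (del y 2 0) z = ?B2 z" if z: "z \<in> S" for z
    by (rule D_eqI[OF S z m(1)], assumption)
      (auto intro!: derivative_eq_intros v_derivatives[OF z] simp: fun_eq_iff algebra_simps)
  have m11: "D1 (del y 1 1) z = - 2 * ?B2 z \<and> D2 (del y 1 1) z = - 2 * ?A2 z" if z: "z \<in> S" for z
    by (rule D_eqI[OF S z m(2)], assumption)
      (auto intro!: derivative_eq_intros v_derivatives[OF z] simp: fun_eq_iff algebra_simps Z)
  have m02: "D1 (del y 0 2) z = ?A2 z \<and> D2 (del y 0 2) z = - ?B2 z" if z: "z \<in> S" for z
    by (rule D_eqI[OF S z m(3)], assumption)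
      (auto intro!: derivative_eq_intros v_derivatives[OF z] simp: fun_eq_iff algebra_simps)
  have k: "(del ^^ 2) y 1 0 z = - 4 * ?A2 z" "(del ^^ 2) y 0 1 z = - 4 * ?B2 z" if "z \<in> S" for z
    unfolding funpow_2 del_def[of "del y"] using m20[OF that] m11[OF that] m02[OF that] by simp_all
  have k10: "D1 ((del ^^ 2) y 1 0) z = 0 \<and> D2 ((del ^^ 2) y 1 0) z = - 4 * ?A3 z" if z: "z \<in> S" for z
    by (rule D_eqI[OF S z k(1)], assumption)
      (auto intro!: derivative_eq_intros v_derivatives[OF z] simp: fun_eq_iff algebra_simps)
  have k01: "D1 ((del ^^ 2) y 0 1) z = 4 * ?A3 z \<and> D2 ((del ^^ 2) y 0 1) z = 0" if z: "z \<in> S" for z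
    by (rule D_eqI[OF S z k(2)], assumption)
      (auto intro!: derivative_eq_intros v_derivatives[OF z] simp: fun_eq_iff algebra_simps Z)
  have j: "(del ^^ 3) y 0 0 z = 0" if "z \<in> S" for z
    unfolding funpow_3 del_def[of "(del ^^ 2) y"] using k10[OF that] k01[OF that] by simp
  have j00: "D1 ((del ^^ 3) y 0 0) z = 0 \<and> D2 ((del ^^ 3) y 0 0) z = 0" if z: "z \<in> S" for z
    by (rule D_eqI[OF S z j], assumption)
      (auto intro!: derivative_eq_intros v_derivatives[OF z] simp: fun_eq_iff algebra_simps)
  have j00a: "D1 (D1 ((del ^^ 3) y 0 0)) z = 0 \<and> D2 (D1 ((del ^^ 3) y 0 0)) z = 0" if z: "z \<in> S" for z
    by (rule D_eqI[OF S z j00[THEN conjunct1]], assumption)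
      (auto intro!: derivative_eq_intros v_derivatives[OF z] simp: fun_eq_iff algebra_simps)
  have j00b: "D1 (D2 ((del ^^ 3) y 0 0)) z = 0 \<and> D2 (D2 ((del ^^ 3) y 0 0)) z = 0" if z: "z \<in> S" for z
    by (rule D_eqI[OF S z j00[THEN conjunct2]], assumption)
      (auto intro!: derivative_eq_intros v_derivatives[OF z] simp: fun_eq_iff algebra_simps)
  have o: "odd_part h y 2 0 z = del y 2 0 z" "odd_part h y 1 1 z = del y 1 1 z" "odd_part h y 0 2 z = del y 0 2 z" if "z \<in> S" for z
    using that n3 by (simp_all add: odd_part_top)
  have n20: "D1 (odd_part h y 2 0) z = - ?A2 z" "D2 (odd_part h y 2 0) z = ?B2 z" if z: "z \<in> S" for z
    using m20[OF z] D_cong[OF S z o(1)] by simp_all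
  have n11: "D1 (odd_part h y 1 1) z = - 2 * ?B2 z" "D2 (odd_part h y 1 1) z = - 2 * ?A2 z" if z: "z \<in> S" for z
    using m11[OF z] D_cong[OF S z o(2)] by simp_all
  have n02: "D1 (odd_part h y 0 2) z = ?A2 z" "D2 (odd_part h y 0 2) z = - ?B2 z" if z: "z \<in> S" for z
    using m02[OF z] D_cong[OF S z o(3)] by simp_all
  have n20a: "D1 (D1 (odd_part h y 2 0)) z = 0 \<and> D2 (D1 (odd_part h y 2 0)) z = - ?A3 z" if z: "z \<in> S" for z
    by (rule D_eqI[OF S z n20(1)], assumption)
      (auto intro!: derivative_eq_intros v_derivatives[OF z] simp: fun_eq_iff algebra_simps Z)
  have n20b: "D1 (D2 (odd_part h y 2 0)) z = - ?A3 z \<and> D2 (D2 (odd_part h y 2 0)) z = 0" if z: "z \<in> S" for z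
    by (rule D_eqI[OF S z n20(2)], assumption)
      (auto intro!: derivative_eq_intros v_derivatives[OF z] simp: fun_eq_iff algebra_simps Z)
  have n11a: "D1 (D1 (odd_part h y 1 1)) z = 2 * ?A3 z \<and> D2 (D1 (odd_part h y 1 1)) z = 0" if z: "z \<in> S" for z
    by (rule D_eqI[OF S z n11(1)], assumption)
      (auto intro!: derivative_eq_intros v_derivatives[OF z] simp: fun_eq_iff algebra_simps Z)
  have n11b: "D1 (D2 (odd_part h y 1 1)) z = 0 \<and> D2 (D2 (odd_part h y 1 1)) z = - 2 * ?A3 z" if z: "z \<in> S" for z
    by (rule D_eqI[OF S z n11(2)], assumption)
      (auto intro!: derivative_eq_intros v_derivatives[OF z] simp: fun_eq_iff algebra_simps Z)
  have n02a: "D1 (D1 (odd_part h y 0 2)) z = 0 \<and> D2 (D1 (odd_part h y 0 2)) z = ?A3 z" if z: "z \<in> S" for z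
    by (rule D_eqI[OF S z n02(1)], assumption)
      (auto intro!: derivative_eq_intros v_derivatives[OF z] simp: fun_eq_iff algebra_simps Z)
  have n02b: "D1 (D2 (odd_part h y 0 2)) z = ?A3 z \<and> D2 (D2 (odd_part h y 0 2)) z = 0" if z: "z \<in> S" for z
    by (rule D_eqI[OF S z n02(2)], assumption)
      (auto intro!: derivative_eq_intros v_derivatives[OF z] simp: fun_eq_iff algebra_simps Z)
  define E20 E11 E02 where "E20 z = 3 * ?A0 z * v1 1 (fst z) + ?B0 z * v2 1 (snd z)"
    and "E11 z = 2 * ?B0 z * v1 1 (fst z) + 2 * ?C0 z * v2 1 (snd z)"
    and "E02 z = ?C0 z * v1 1 (fst z) + 3 * ?D0 z * v2 1 (snd z)" for z
  note E_defs = E20_def E11_def E02_def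
  have E: "D1 (w 1 0) z = E20 z" "D2 (w 1 0) z + D1 (w 0 1) z = E11 z" "D2 (w 0 1) z = E02 z" if z: "z \<in> S" for z
    using bracket[OF z, of 2 0] bracket[OF z, of 1 1] bracket[OF z, of 0 2] z n3 lead
      k10[OF z] k01[OF z] n20a[OF z] n20b[OF z] n11a[OF z] n11b[OF z] n02a[OF z] n02b[OF z]
    by (simp_all add: D_even_part even_part_top odd_part_0 y0 fact_numeral E_defs algebra_simps One_nat_def[symmetric])
  have e20: "D1 (E20) z = 3 * ?A0 z * v1 2 (fst z) - ?A1 z * v2 1 (snd z) \<and> D2 (E20) z = 3 * ?A1 z * v1 1 (fst z) + ?B1 z * v2 1 (snd z) + ?B0 z * v2 2 (snd z)" if z: "z \<in> S" for z
    by (rule D_eqI[OF S z E20_def])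
      (auto intro!: derivative_eq_intros v_derivatives[OF z] simp: fun_eq_iff algebra_simps)
  have e20a: "D1 (D1 E20) z = 3 * ?A0 z * v1 3 (fst z) \<and> D2 (D1 E20) z = 3 * ?A1 z * v1 2 (fst z) - ?A2 z * v2 1 (snd z) - ?A1 z * v2 2 (snd z)" if z: "z \<in> S" for z
    by (rule D_eqI[OF S z e20[THEN conjunct1]], assumption)
      (auto intro!: derivative_eq_intros v_derivatives[OF z] simp: fun_eq_iff algebra_simps)
  have e11: "D1 (E11) z = - 2 * ?A1 z * v1 1 (fst z) + 2 * ?B0 z * v1 2 (fst z) - 2 * ?B1 z * v2 1 (snd z) \<and> D2 (E11) z = 2 * ?B1 z * v1 1 (fst z) + 2 * ?C1 z * v2 1 (snd z) + 2 * ?C0 z * v2 2 (snd z)" if z: "z \<in> S" for z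
    by (rule D_eqI[OF S z E11_def])
      (auto intro!: derivative_eq_intros v_derivatives[OF z] simp: fun_eq_iff algebra_simps)
  have e11a: "D1 (D1 E11) z = - 4 * ?A1 z * v1 2 (fst z) + 2 * ?B0 z * v1 3 (fst z) + 2 * ?A2 z * v2 1 (snd z) \<and> D2 (D1 E11) z = - 2 * ?A2 z * v1 1 (fst z) + 2 * ?B1 z * v1 2 (fst z) - 2 * ?B2 z * v2 1 (snd z) - 2 * ?B1 z * v2 2 (snd z)" if z: "z \<in> S" for z
    by (rule D_eqI[OF S z e11[THEN conjunct1]], assumption)
      (auto intro!: derivative_eq_intros v_derivatives[OF z] simp: fun_eq_iff algebra_simps)
  have e02: "D1 (E02) z = - ?B1 z * v1 1 (fst z) + ?C0 z * v1 2 (fst z) - 3 * ?C1 z * v2 1 (snd z) \<and> D2 (E02) z = ?C1 z * v1 1 (fst z) + 3 * ?D0 z * v2 2 (snd z)" if z: "z \<in> S" for z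
    by (rule D_eqI[OF S z E02_def])
      (auto intro!: derivative_eq_intros v_derivatives[OF z] simp: fun_eq_iff algebra_simps Z)
  have e02b: "D1 (D2 E02) z = - ?B2 z * v1 1 (fst z) + ?C1 z * v1 2 (fst z) - 3 * ?C1 z * v2 2 (snd z) \<and> D2 (D2 E02) z = 3 * ?D0 z * v2 3 (snd z)" if z: "z \<in> S" for z
    by (rule D_eqI[OF S z e02[THEN conjunct2]], assumption)
      (auto intro!: derivative_eq_intros v_derivatives[OF z] simp: fun_eq_iff algebra_simps Z)
  show "D1 (w 1 0) z = 3 * ?A0 z * v1 1 (fst z) + ?B0 z * v2 1 (snd z)" "D2 (w 1 0) z + D1 (w 0 1) z = 2 * ?B0 z * v1 1 (fst z) + 2 * ?C0 z * v2 1 (snd z)" "D2 (w 0 1) z = ?C0 z * v1 1 (fst z) + 3 * ?D0 z * v2 1 (snd z)"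
    using E[OF z] by (simp_all add: E_defs)
  have c: "D1 (D1 (del w 0 0)) z + D2 (D2 (del w 0 0)) z
      = 3 * ?A0 z * v1 3 (fst z) - 2 * ?A2 z * v1 1 (fst z) + 2 * ?B1 z * v1 2 (fst z) - 2 * ?B2 z * v2 1 (snd z) - 2 * ?B1 z * v2 2 (snd z)
        + 3 * ?D0 z * v2 3 (snd z)"
    using del_commutator_1[OF S smooth_w z E] e20a[OF z] e11a[OF z] e02b[OF z] by simp
  have g: "- (h\<^sup>2 / 4) * (D1 (D1 (del w 0 0)) z + D2 (D2 (del w 0 0)) z)
      = (w 1 0 z - h\<^sup>2 / 8 * (del ^^ 2) y 1 0 z) * v1 1 (fst z) + (w 0 1 z - h\<^sup>2 / 8 * (del ^^ 2) y 0 1 z) * v2 1 (snd z)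
       - h\<^sup>2 / 4 * (2 * del y 2 0 z * v1 2 (fst z) + 2 * del y 0 2 z * v2 2 (snd z)) - h\<^sup>2 / 6 * (6 * ?A0 z * v1 3 (fst z) + 6 * ?D0 z * v2 3 (snd z))"
    using bracket[OF z, of 0 0] z n3 laplace_odd_part[OF z, of 0 0] j00a[OF z] j00b[OF z] lead
    by (simp add: even_part_w[of _ 1 0] even_part_w[of _ 0 1] even_part_top o odd_part_0 fact_numeral numeral_2_eq_2[symmetric])
  show "w 1 0 z * v1 1 (fst z) + w 0 1 z * v2 1 (snd z) - h\<^sup>2 / 4 * (?A0 z * v1 3 (fst z) + ?D0 z * v2 3 (snd z)) = 0"
    using g[unfolded c m[OF z] k[OF z]] by (simp add: algebra_simps)
qed

lemma moyal_2:
  assumes n2: "n = 2"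
    and lead: "\<And>q. q \<in> S \<Longrightarrow> y 2 0 q = PA a q" "\<And>q. q \<in> S \<Longrightarrow> y 1 1 q = PB a b q" "\<And>q. q \<in> S \<Longrightarrow> y 0 2 q = PC a b c q"
    and deg: "pderiv (pderiv (pderiv a)) = 0" "pderiv (pderiv b) = 0" "pderiv c = 0"
    and q: "q \<in> S"
  shows "D1 (w 0 0) q = 2 * PA a q * v1 1 (fst q) + PB a b q * v2 1 (snd q)"
    "D2 (w 0 0) q = PB a b q * v1 1 (fst q) + 2 * PC a b c q * v2 1 (snd q)"
proof -
  have l1: "D1 (y 2 0) z = 0 \<and> D2 (y 2 0) z = PA (pderiv a) z" if z: "z \<in> S" for z
    by (rule D_eqI[OF S z lead(1)], assumption) (auto intro!: derivative_eq_intros)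
  have l2: "D1 (y 1 1) z = - PA (pderiv a) z \<and> D2 (y 1 1) z = PB (pderiv a) (pderiv b) z" if z: "z \<in> S" for z
    by (rule D_eqI[OF S z lead(2)], assumption) (auto intro!: derivative_eq_intros)
  have Z: "PC (pderiv a) (pderiv b) (pderiv c) z = 0" "PB (pderiv (pderiv a)) (pderiv (pderiv b)) z = 0" for z
    by (simp_all add: PC_def kc_def PB_def kb_def deg)
  have l3: "D1 (y 0 2) z = - PB (pderiv a) (pderiv b) z \<and> D2 (y 0 2) z = 0" if z: "z \<in> S" for z
    by (rule D_eqI[OF S z lead(3)], assumption)
      (auto intro!: derivative_eq_intros simp: Z)
  have m: "del y 1 0 z = PB (pderiv a) (pderiv b) z" "del y 0 1 z = - PA (pderiv a) z" if "z \<in> S" for z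
    using l1[OF that] l2[OF that] l3[OF that] by (simp_all add: del_def)
  have m1: "D1 (del y 1 0) z = - PA (pderiv (pderiv a)) z \<and> D2 (del y 1 0) z = 0" if z: "z \<in> S" for z
    by (rule D_eqI[OF S z m(1)], assumption)
      (auto intro!: derivative_eq_intros simp: Z)
  have m2: "D1 (del y 0 1) z = 0 \<and> D2 (del y 0 1) z = - PA (pderiv (pderiv a)) z" if z: "z \<in> S" for z
    by (rule D_eqI[OF S z m(2)], assumption) (auto intro!: derivative_eq_intros)
  have k: "(del ^^ 2) y 0 0 z = - 2 * PA (pderiv (pderiv a)) z" if z: "z \<in> S" for z
    using m1[OF z] m2[OF z] unfolding numeral_2_eq_2 funpow.simps o_apply id_apply del_def[of "del y"] by simp
  have k1: "D1 ((del ^^ 2) y 0 0) q = 0 \<and> D2 ((del ^^ 2) y 0 0) q = 0"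
    by (rule D_eqI[OF S q k], assumption) (auto intro!: derivative_eq_intros simp: fun_eq_iff PA_def deg)
  have o: "odd_part h y 1 0 z = del y 1 0 z" "odd_part h y 0 1 z = del y 0 1 z" if "z \<in> S" for z
    using that n2 by (simp_all add: odd_part_top)
  have m1': "D1 (odd_part h y 1 0) z = - PA (pderiv (pderiv a)) z" "D2 (odd_part h y 1 0) z = 0"
     "D1 (odd_part h y 0 1) z = 0" "D2 (odd_part h y 0 1) z = - PA (pderiv (pderiv a)) z" if z: "z \<in> S" for z
    using m1[OF z] m2[OF z] D_cong[OF S z o(1)] D_cong[OF S z o(2)] by simp_all
  have "D1 (D1 (odd_part h y 1 0)) q = 0 \<and> D2 (D1 (odd_part h y 1 0)) q = 0"
    by (rule D_eqI[OF S q m1'(1)], assumption) (auto intro!: derivative_eq_intros simp: fun_eq_iff PA_def deg)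
  moreover have "D1 (D2 (odd_part h y 1 0)) q = 0 \<and> D2 (D2 (odd_part h y 1 0)) q = 0"
    by (rule D_eqI[OF S q m1'(2)], assumption) (auto intro!: derivative_eq_intros simp: fun_eq_iff PA_def deg)
  moreover have "D1 (D1 (odd_part h y 0 1)) q = 0 \<and> D2 (D1 (odd_part h y 0 1)) q = 0"
    by (rule D_eqI[OF S q m1'(3)], assumption) (auto intro!: derivative_eq_intros simp: fun_eq_iff PA_def deg)
  moreover have "D1 (D2 (odd_part h y 0 1)) q = 0 \<and> D2 (D2 (odd_part h y 0 1)) q = 0"
    by (rule D_eqI[OF S q m1'(4)], assumption) (auto intro!: derivative_eq_intros simp: fun_eq_iff PA_def deg)
  ultimately show "D1 (w 0 0) q = 2 * PA a q * v1 1 (fst q) + PB a b q * v2 1 (snd q)"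
    "D2 (w 0 0) q = PB a b q * v1 1 (fst q) + 2 * PC a b c q * v2 1 (snd q)"
    using bracket[OF q, of 1 0] bracket[OF q, of 0 1] q n2 k1 lead
    by (simp_all add: D_even_part even_part_top odd_part_0 y0 fact_numeral)
qed

end

section \<open>Linear compatibility and the leading component\<close>

lemma pderiv_sum: "pderiv (sum f A) = (\<Sum>x\<in>A. pderiv (f x))"
  by (induction A rule: infinite_finite_induct) (simp_all add: pderiv_add)

lemma poly_antiderivative: "\<exists>R. pderiv R = (p :: real poly)"
proof
  have "pderiv (\<Sum>i\<le>degree p. monom (coeff p i / of_nat (i + 1)) (i + 1)) = (\<Sum>i\<le>degree p. monom (coeff p i) i)"
    by (simp add: pderiv_sum pderiv_monom del: of_nat_add of_nat_Suc)
  then show "pderiv (\<Sum>i\<le>degree p. monom (coeff p i / of_nat (i + 1)) (i + 1)) = p"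
    by (simp add: poly_as_sum_of_monoms)
qed

lemma xi_poly: "\<exists>p. \<forall>q. xi1 n \<alpha> k i q = poly p q" "\<exists>p. \<forall>q. xi2 n \<alpha> k i q = poly p q"
proof -
  show "\<exists>p. \<forall>q. xi1 n \<alpha> k i q = poly p q"
    by (rule exI[of _ "\<Sum>j = 0..n + 2*k - i. monom (\<alpha> i j (n + 2*k - i - j)) (n + 2*k - i - j)"])
      (simp add: xi1_def poly_sum poly_monom)
  show "\<exists>p. \<forall>q. xi2 n \<alpha> k i q = poly p q"
    by (rule exI[of _ "\<Sum>j = 0..n + 2*k - i. monom (\<alpha> j i (n + 2*k - i - j) * (- 1) ^ j) (n + 2*k - i - j)"])
      (simp add: xi2_def poly_sum poly_monom ac_simps)
qed

text \<open>The first equation says that \<xi>_00' Q is a polynomial; integrating the second says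
  the same of \<xi>_01 Q. Hence every constant combination of \<xi>_01 and \<xi>_00' clears the
  denominator of \<open>Q\<close>.\<close>

lemma linear_compatibility_poly:
  fixes p0 p1 :: "real poly"
  assumes I: "open I" "is_interval I" "I \<noteq> {}" and lin: "linear_compatibility I V \<xi>"
    and poly: "\<And>k i. \<exists>p. \<forall>q. \<xi> k i q = poly p q"
    and p0: "\<And>q. \<xi> 0 0 q = poly p0 q" and p1: "\<And>q. \<xi> 0 1 q = poly p1 q"
  obtains Q where "\<And>q. q \<in> I \<Longrightarrow> (Q has_real_derivative V q) (at q)"
    "\<And>r s. \<exists>S. \<forall>x\<in>I. poly (smult r p1 + smult s (pderiv p0)) x * Q x = poly S x"
proof -
  obtain Q where Q: "\<And>q. q \<in> I \<Longrightarrow> (Q has_real_derivative V q) (at q)"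
    "\<And>q. q \<in> I \<Longrightarrow> deriv (\<xi> 0 0) q * Q q + \<xi> 1 0 q = 0"
    "\<And>q. q \<in> I \<Longrightarrow> deriv (\<lambda>t. \<xi> 0 1 t * Q t) q + \<xi> 1 1 q = 0"
    using lin unfolding linear_compatibility_def by blast
  obtain r0 r1 where r: "\<And>q. \<xi> 1 0 q = poly r0 q" "\<And>q. \<xi> 1 1 q = poly r1 q" using poly by metis
  obtain R where R: "pderiv R = - r1" using poly_antiderivative by blast
  have "\<xi> 0 0 = poly p0" using p0 by blast
  then have d0: "deriv (\<xi> 0 0) q = poly (pderiv p0) q" for q by (simp add: DERIV_imp_deriv poly_DERIV)
  obtain x0 where x0: "x0 \<in> I" using I by blast
  have "poly p1 x * Q x = poly R x + (poly p1 x0 * Q x0 - poly R x0)" if x: "x \<in> I" for x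
  proof (rule eq_up_to_constant[OF I(1,2) x0 x])
    fix t assume t: "t \<in> I"
    have "((\<lambda>t. poly p1 t * Q t) has_real_derivative poly (pderiv p1) t * Q t + V t * poly p1 t) (at t)"
      by (rule DERIV_mult[OF poly_DERIV Q(1)[OF t]])
    moreover from this have "poly (pderiv p1) t * Q t + V t * poly p1 t = poly (pderiv R) t"
      using Q(3)[OF t] DERIV_imp_deriv by (fastforce simp: p1 r R)
    ultimately show "((\<lambda>t. poly p1 t * Q t) has_real_derivative poly (pderiv R) t) (at t)" by simp
  qed (rule poly_DERIV)
  moreover define c where "c = poly p1 x0 * Q x0 - poly R x0"
  ultimately have 1: "poly p1 x * Q x = poly R x + c" if "x \<in> I" for x using that by simp
  show thesis
  proof (rule that[OF Q(1)])
    fix r s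
    have "poly (smult r p1 + smult s (pderiv p0)) x * Q x = poly (smult r (R + [:c:]) - smult s r0) x" if "x \<in> I" for x
    proof -
      have "poly (pderiv p0) x * Q x = - poly r0 x" using Q(2)[OF that] d0 r by simp
      then have "r * (poly p1 x * Q x) + s * (poly (pderiv p0) x * Q x) = r * (poly R x + c) - s * poly r0 x"
        using 1[OF that] by simp
      then show ?thesis by (simp add: algebra_simps)
    qed
    then show "\<exists>S. \<forall>x\<in>I. poly (smult r p1 + smult s (pderiv p0)) x * Q x = poly S x" by blast
  qed
qed

lemma nontrivial_parameters_poly:
  fixes p0 p1 :: "real poly"
  assumes "nontrivial_parameters \<xi>" and p0: "\<And>q. \<xi> 0 0 q = poly p0 q" and p1: "\<And>q. \<xi> 0 1 q = poly p1 q"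
  shows "pderiv p0 \<noteq> 0 \<or> p1 \<noteq> 0"
proof -
  have "\<xi> 0 0 = poly p0" using p0 by blast
  then have "deriv (\<xi> 0 0) q = poly (pderiv p0) q" for q by (simp add: DERIV_imp_deriv poly_DERIV)
  then show ?thesis using assms by (auto simp: nontrivial_parameters_def)
qed

lemma nonzero_on_open:
  fixes p r :: "real poly"
  assumes "open I" "I \<noteq> {}" "p \<noteq> 0 \<or> r \<noteq> 0"
  shows "\<exists>y\<in>I. poly p y \<noteq> 0 \<or> poly r y \<noteq> 0"
  using poly_eq_on_open[OF assms(1,2), of p 0] poly_eq_on_open[OF assms(1,2), of r 0] assms(3) by auto

text \<open>A pencil that is affine in its parameter and vanishes at two different parameters is
  zero, and a non-empty open set contains two points.\<close>

lemma pencil_nonzero_on_open: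
  fixes p r :: "real poly"
  assumes I: "open I" "I \<noteq> {}" and "p \<noteq> 0 \<or> r \<noteq> 0" "s \<noteq> 0" "t \<noteq> 0"
    and f: "\<And>y. f y = smult s p + smult (t * y) r"
  shows "\<exists>y\<in>I. f y \<noteq> 0"
proof (rule ccontr)
  assume 0: "\<not> (\<exists>y\<in>I. f y \<noteq> 0)"
  obtain y where y: "y \<in> I" using I by blast
  have "I \<noteq> {y}" using I(1) not_open_singleton by metis
  then obtain z where yz: "y \<in> I" "z \<in> I" "y \<noteq> z" using y by blast
  have "f y = 0" "f z = 0" using 0 yz by auto
  then have "smult (t * (y - z)) r = 0" "smult s p + smult (t * y) r = 0"
    by (auto simp: f algebra_simps smult_diff_left)
  then show False using assms(3-5) yz(3) by auto
qed

text \<open>Needed because the constants are given separately for the two coordinates: families with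
  the same leading component must have the same polynomials a and b.\<close>

lemma kb_unique:
  assumes I: "open I1" "I1 \<noteq> {}" "open I2" "I2 \<noteq> {}"
    and a: "\<And>x y. x \<in> I1 \<Longrightarrow> y \<in> I2 \<Longrightarrow> poly a y = poly a' y"
    and b: "\<And>x y. x \<in> I1 \<Longrightarrow> y \<in> I2 \<Longrightarrow> kb a b x y = kb a' b' x y"
  shows "a = a' \<and> b = b'"
proof -
  obtain x0 where x0: "x0 \<in> I1" using I by blast
  have aa: "a = a'" by (rule poly_eq_on_open[OF I(3,4)]) (rule a[OF x0])
  have "b = b'" by (rule poly_eq_on_open[OF I(3,4)]) (use b[OF x0] aa in \<open>simp add: kb_def\<close>)
  with aa show ?thesis by simp
qed

section \<open>From the integral to its determining equations\<close>

lemma all_derivs_deriv: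
  assumes I: "open I" and V: "smooth_on I V"
  shows "all_derivs I (\<lambda>k. (deriv ^^ k) V)"
proof -
  have sm: "smooth_on I ((deriv ^^ k) V)" for k
  proof (induction k)
    case (Suc k)
    have "frechet_derivative ((deriv ^^ k) V) (at x) 1 = deriv ((deriv ^^ k) V) x" if "x \<in> I" for x
    proof -
      have "((deriv ^^ k) V has_real_derivative deriv ((deriv ^^ k) V) x) (at x)"
        using smooth_on_differentiable[OF Suc that] by (simp add: DERIV_deriv_iff_real_differentiable)
      then have "((deriv ^^ k) V has_derivative (\<lambda>t. deriv ((deriv ^^ k) V) x * t)) (at x)"
        by (simp add: has_field_derivative_def)
      from frechet_derivative_at[OF this, symmetric] show ?thesis by simp
    qed
    from smooth_on_cong[OF I this smooth_on_frechet[OF Suc]]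
    show ?case by simp
  qed (use V in simp)
  show ?thesis unfolding all_derivs_def
    using smooth_on_differentiable[OF sm] by (simp add: DERIV_deriv_iff_real_differentiable)
qed

lemma all_derivs_derivs_on: "all_derivs I v \<Longrightarrow> derivs_on m I v"
  by (simp add: all_derivs_def derivs_on_def)

lemma all_derivs_antiderivative:
  assumes "all_derivs I v" "\<And>q. q \<in> I \<Longrightarrow> (Q has_real_derivative v 0 q) (at q)"
  shows "derivs_on m I (\<lambda>k. case k of 0 \<Rightarrow> Q | Suc k \<Rightarrow> v k)"
  using assms by (auto simp: all_derivs_def derivs_on_def split: nat.splits)

lemma determining_equations_of_integral:
  assumes I1: "open I1" and I2: "open I2" and v1: "all_derivs I1 v1" and v2: "all_derivs I2 v2" and n: "n \<le> 4"
    and int: "eq_on (I1 \<times> I2) (bracket h X (H1 (v1 0) + H2 (v2 0))) 0" and std: "standard_form h (I1 \<times> I2) n X"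
  obtains y where "determining_equations h I1 I2 v1 v2 n y"
    "\<And>i j q. q \<in> I1 \<times> I2 \<Longrightarrow> i + j = n \<Longrightarrow> lk X i j q = of_real (y i j q)"
proof -
  have S: "open (I1 \<times> I2)" using I1 I2 by (rule open_Times)
  obtain y where y: "\<And>i j. smooth_on (I1 \<times> I2) (y i j)"
    "\<And>i j q. q \<in> I1 \<times> I2 \<Longrightarrow> n < i + j \<or> odd (n - (i + j)) \<Longrightarrow> y i j q = 0"
    "\<And>i j q. q \<in> I1 \<times> I2 \<Longrightarrow> lk X i j q = of_real (even_part h y i j q) + of_real h / \<i> / 2 * of_real (odd_part h y i j q)"
    using standard_form_real[OF S n std] by metis
  have z: "(del ^^ k) y i j q = 0" if "q \<in> I1 \<times> I2" "n < i + j + k" for i j k q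
    by (rule del_iter_eq_0[OF S, of n y]) (use y(2) that in auto)
  have e0: "even_part h y i j q = 0" "odd_part h y i j q = 0" if "4 < i + j" "q \<in> I1 \<times> I2" for i j q
    using z[OF that(2), of i j 1] z[OF that(2), of i j 0] that n
    by (simp_all add: even_part_def odd_part_def z One_nat_def)
  show thesis
  proof (rule that)
    show "determining_equations h I1 I2 v1 v2 n y"
      by (rule determining_equations.intro[OF I1 I2 v1 v2 y(1) n y(2)
            real_bracket[OF S v1 v2 y(3) smooth_on_parts(1)[OF S y(1)] smooth_on_parts(2)[OF S y(1)] e0 _ int]])
    fix i j q assume q: "q \<in> I1 \<times> I2" and ij: "i + j = n"
    \<comment> \<open>In the top degree n all positive powers of \<delta> vanish, so X and y agree
      there.\<close>
    show "lk X i j q = of_real (y i j q)"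
      using y(3)[OF q, of i j] z[OF q, of i j 1] z[OF q, of i j 2] z[OF q, of i j 3] z[OF q, of i j 4] ij
      by (simp add: even_part_def odd_part_def One_nat_def)
  qed
qed

section \<open>The leading component and the compatibility polynomials for each order\<close>

lemma atMost_small: "{..0 :: nat} = {0}" "{..1 :: nat} = {0, 1}" "{..2 :: nat} = {0, 1, 2}" "{..3 :: nat} = {0, 1, 2, 3}"
  "{..4 :: nat} = {0, 1, 2, 3, 4}"
  by auto

lemma binomials: "(2 :: nat) choose 1 = 2" "(3 :: nat) choose 1 = 3" "(4 :: nat) choose 1 = 4" "(3 :: nat) choose 2 = 3"
  "(4 :: nat) choose 2 = 6" "(4 :: nat) choose 3 = 4" "(1 :: nat) choose 1 = 1"
  by (simp_all add: numeral_eq_Suc One_nat_def)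

lemmas expand_sums = One_nat_def[symmetric] numeral_2_eq_2[symmetric] atMost_small atLeast0AtMost binomials power2_eq_square power3_eq_cube power4_eq_xxxx

lemma lead_4:
  fixes \<alpha> :: "nat \<Rightarrow> nat \<Rightarrow> nat \<Rightarrow> real"
  defines "a \<equiv> [:\<alpha> 4 0 0, - \<alpha> 3 0 1, \<alpha> 2 0 2, - \<alpha> 1 0 3, \<alpha> 0 0 4:]" and "b \<equiv> [:\<alpha> 3 1 0, - \<alpha> 2 1 1, \<alpha> 1 1 2, - \<alpha> 0 1 3:]"
    and "c \<equiv> [:\<alpha> 2 2 0, - \<alpha> 1 2 1, \<alpha> 0 2 2:]" and "d \<equiv> [:\<alpha> 1 3 0, - \<alpha> 0 3 1:]" and "e \<equiv> [:\<alpha> 0 4 0:]"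
  shows "lead_sum 4 \<alpha> 4 0 q = PA a q" "lead_sum 4 \<alpha> 3 1 q = PB a b q" "lead_sum 4 \<alpha> 2 2 q = PC a b c q"
    "lead_sum 4 \<alpha> 1 3 q = PD a b c d q" "lead_sum 4 \<alpha> 0 4 q = PE a b c d e q"
  unfolding lead_sum_def PA_def PB_def PC_def PD_def PE_def kb_def kc_def kd_def a_def b_def c_def d_def e_def
  by (simp_all add: expand_sums pderiv_pCons algebra_simps)

lemma lead_3:
  fixes \<alpha> :: "nat \<Rightarrow> nat \<Rightarrow> nat \<Rightarrow> real"
  defines "a \<equiv> [:\<alpha> 3 0 0, - \<alpha> 2 0 1, \<alpha> 1 0 2, - \<alpha> 0 0 3:]" and "b \<equiv> [:\<alpha> 2 1 0, - \<alpha> 1 1 1, \<alpha> 0 1 2:]"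
    and "c \<equiv> [:\<alpha> 1 2 0, - \<alpha> 0 2 1:]" and "d \<equiv> [:\<alpha> 0 3 0:]"
  shows "lead_sum 3 \<alpha> 3 0 q = PA a q" "lead_sum 3 \<alpha> 2 1 q = PB a b q" "lead_sum 3 \<alpha> 1 2 q = PC a b c q"
    "lead_sum 3 \<alpha> 0 3 q = PD a b c d q"
  unfolding lead_sum_def PA_def PB_def PC_def PD_def kb_def kc_def kd_def a_def b_def c_def d_def
  by (simp_all add: expand_sums pderiv_pCons algebra_simps)

lemma lead_2:
  fixes \<alpha> :: "nat \<Rightarrow> nat \<Rightarrow> nat \<Rightarrow> real"
  defines "a \<equiv> [:\<alpha> 2 0 0, - \<alpha> 1 0 1, \<alpha> 0 0 2:]" and "b \<equiv> [:\<alpha> 1 1 0, - \<alpha> 0 1 1:]" and "c \<equiv> [:\<alpha> 0 2 0:]"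
  shows "lead_sum 2 \<alpha> 2 0 q = PA a q" "lead_sum 2 \<alpha> 1 1 q = PB a b q" "lead_sum 2 \<alpha> 0 2 q = PC a b c q"
  unfolding lead_sum_def PA_def PB_def PC_def kb_def kc_def a_def b_def c_def
  by (simp_all add: expand_sums pderiv_pCons algebra_simps)

text \<open>For the second coordinate the compatibility polynomials are a and b of the Killing
  tensor, with one sign that depends on the parity of n; for the first coordinate they are a and b
  of the tensor with exchanged coordinates.\<close>

lemma xi1_4: "xi1 4 \<alpha> 0 0 q = poly [:\<alpha> 0 4 0, \<alpha> 0 3 1, \<alpha> 0 2 2, \<alpha> 0 1 3, \<alpha> 0 0 4:] q"
  "xi1 4 \<alpha> 0 1 q = poly [:\<alpha> 1 3 0, \<alpha> 1 2 1, \<alpha> 1 1 2, \<alpha> 1 0 3:] q"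
  and xi2_4: "xi2 4 \<alpha> 0 0 q = poly [:\<alpha> 4 0 0, - \<alpha> 3 0 1, \<alpha> 2 0 2, - \<alpha> 1 0 3, \<alpha> 0 0 4:] q"
  "xi2 4 \<alpha> 0 1 q = poly (- [:\<alpha> 3 1 0, - \<alpha> 2 1 1, \<alpha> 1 1 2, - \<alpha> 0 1 3:]) q"
  and xi1_3: "xi1 3 \<alpha> 0 0 q = poly [:\<alpha> 0 3 0, \<alpha> 0 2 1, \<alpha> 0 1 2, \<alpha> 0 0 3:] q"
  "xi1 3 \<alpha> 0 1 q = poly [:\<alpha> 1 2 0, \<alpha> 1 1 1, \<alpha> 1 0 2:] q"
  and xi2_3: "xi2 3 \<alpha> 0 0 q = poly (- [:\<alpha> 3 0 0, - \<alpha> 2 0 1, \<alpha> 1 0 2, - \<alpha> 0 0 3:]) q"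
  "xi2 3 \<alpha> 0 1 q = poly [:\<alpha> 2 1 0, - \<alpha> 1 1 1, \<alpha> 0 1 2:] q"
  and xi1_2: "xi1 2 \<alpha> 0 0 q = poly [:\<alpha> 0 2 0, \<alpha> 0 1 1, \<alpha> 0 0 2:] q"
  "xi1 2 \<alpha> 0 1 q = poly [:\<alpha> 1 1 0, \<alpha> 1 0 1:] q"
  and xi2_2: "xi2 2 \<alpha> 0 0 q = poly [:\<alpha> 2 0 0, - \<alpha> 1 0 1, \<alpha> 0 0 2:] q"
  "xi2 2 \<alpha> 0 1 q = poly (- [:\<alpha> 1 1 0, - \<alpha> 0 1 1:]) q"
  by (simp_all add: xi1_def xi2_def expand_sums algebra_simps)

text \<open>At order one \<xi>_00' and \<xi>_01 are constants. Whichever is non-zero, the linear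
  equations alone make the potential quadratic.\<close>

lemma listed_order_1:
  fixes a b c p0 p1 p2 p3 r0 r1 r2 :: real
  assumes I: "open I" "is_interval I" "I \<noteq> {}" and lin: "linear_compatibility I V \<xi>" and nt: "nontrivial_parameters \<xi>"
    and x: "\<And>q. \<xi> 0 0 q = a + b * q" "\<And>q. \<xi> 0 1 q = c"
      "\<And>q. \<xi> 1 0 q = p0 + p1 * q + p2 * q^2 + p3 * q^3" "\<And>q. \<xi> 1 1 q = r0 + r1 * q + r2 * q^2"
  shows "listed_potential h I V"
proof -
  obtain Q where Q: "\<And>q. q \<in> I \<Longrightarrow> (Q has_real_derivative V q) (at q)"
    "\<And>q. q \<in> I \<Longrightarrow> deriv (\<xi> 0 0) q * Q q + \<xi> 1 0 q = 0"
    "\<And>q. q \<in> I \<Longrightarrow> deriv (\<lambda>t. \<xi> 0 1 t * Q t) q + \<xi> 1 1 q = 0"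
    using lin unfolding linear_compatibility_def by blast
  have "\<xi> 0 0 = (\<lambda>q. a + b * q)" using x(1) by blast
  moreover have "((\<lambda>q. a + b * q) has_real_derivative b) (at q)" for q by (auto intro!: derivative_eq_intros)
  ultimately have d: "deriv (\<xi> 0 0) q = b" for q by (simp add: DERIV_imp_deriv)
  then consider "b \<noteq> 0" | "c \<noteq> 0" using nt x(2) by (auto simp: nontrivial_parameters_def)
  then show ?thesis
  proof cases
    case 1
    have "V q = - (p1 / b) + - (2 * p2 / b) * q + - (3 * p3 / b) * q\<^sup>2" if "q \<in> I" for q
    proof (rule deriv_eq_on_open[OF I(1) that _ Q(1)[OF that]])
      show "Q t = - (p0 + p1 * t + p2 * t^2 + p3 * t^3) / b" if "t \<in> I" for t
        using Q(2)[OF that] 1 by (simp add: d x field_simps)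
      show "((\<lambda>t. - (p0 + p1 * t + p2 * t^2 + p3 * t^3) / b) has_real_derivative - (p1 / b) + - (2 * p2 / b) * q + - (3 * p3 / b) * q\<^sup>2) (at q)"
        using 1 by (auto intro!: derivative_eq_intros simp: field_simps power2_eq_square)
    qed
    then show ?thesis by (rule listed_quadratic)
  next
    case 2
    have "V q = - (r0 / c) + - (r1 / c) * q + - (r2 / c) * q\<^sup>2" if "q \<in> I" for q
    proof -
      have "((\<lambda>t. c * Q t) has_real_derivative c * V q) (at q)" by (rule DERIV_cmult[OF Q(1)[OF that]])
      then have "c * V q + (r0 + r1 * q + r2 * q^2) = 0" using Q(3)[OF that] by (simp add: x DERIV_imp_deriv)
      then have "V q = - (r0 + r1 * q + r2 * q^2) / c" using 2 by (simp add: nonzero_eq_divide_eq algebra_simps)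
      also have "\<dots> = - (r0 / c) + - (r1 / c) * q + - (r2 / c) * q\<^sup>2" using 2 by (simp add: field_simps)
      finally show ?thesis .
    qed
    then show ?thesis by (rule listed_quadratic)
  qed
qed

lemma xi_1:
  "xi1 1 \<alpha> 0 0 q = \<alpha> 0 1 0 + \<alpha> 0 0 1 * q" "xi1 1 \<alpha> 0 1 q = \<alpha> 1 0 0"
  "xi1 1 \<alpha> 1 0 q = \<alpha> 0 3 0 + \<alpha> 0 2 1 * q + \<alpha> 0 1 2 * q^2 + \<alpha> 0 0 3 * q^3"
  "xi1 1 \<alpha> 1 1 q = \<alpha> 1 2 0 + \<alpha> 1 1 1 * q + \<alpha> 1 0 2 * q^2"
  "xi2 1 \<alpha> 0 0 q = - \<alpha> 1 0 0 + \<alpha> 0 0 1 * q" "xi2 1 \<alpha> 0 1 q = \<alpha> 0 1 0"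
  "xi2 1 \<alpha> 1 0 q = - \<alpha> 3 0 0 + \<alpha> 2 0 1 * q + - \<alpha> 1 0 2 * q^2 + \<alpha> 0 0 3 * q^3"
  "xi2 1 \<alpha> 1 1 q = \<alpha> 2 1 0 + - \<alpha> 1 1 1 * q + \<alpha> 0 1 2 * q^2"
  by (simp_all add: xi1_def xi2_def expand_sums algebra_simps)

lemma slice_derivative:
  assumes "smooth_on (I1 \<times> I2) f" "x \<in> I1" "y \<in> I2"
  shows "((\<lambda>t. f (t, y)) has_real_derivative D1 f (x, y)) (at x)" "((\<lambda>t. f (x, t)) has_real_derivative D2 f (x, y)) (at y)"
  using has_derivative_D1 has_derivative_D2 smooth_on_differentiable[OF assms(1), of "(x, y)"] assms(2,3) by auto

text \<open>The numbers e0 and e1 are the signs by which the compatibility polynomials differ from a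
  and b; being their own inverses, they disappear in the pencil.\<close>

lemma compatible_pencil:
  fixes a b :: "real poly"
  assumes I: "open I" "is_interval I" "I \<noteq> {}" and lin: "linear_compatibility I V \<xi>" and nt: "nontrivial_parameters \<xi>"
    and poly: "\<And>k i. \<exists>p. \<forall>q. \<xi> k i q = poly p q"
    and p0: "\<And>q. \<xi> 0 0 q = poly (smult e0 a) q" and p1: "\<And>q. \<xi> 0 1 q = poly (smult e1 b) q"
    and e: "e0 * e0 = 1" "e1 * e1 = 1"
  obtains Q where "\<And>q. q \<in> I \<Longrightarrow> (Q has_real_derivative V q) (at q)"
    "\<And>s. \<exists>S. \<forall>x\<in>I. poly (smult 1 b + smult s (pderiv a)) x * Q x = poly S x" "pderiv a \<noteq> 0 \<or> b \<noteq> 0"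
proof -
  obtain Q where Q: "\<And>q. q \<in> I \<Longrightarrow> (Q has_real_derivative V q) (at q)"
    "\<And>r s. \<exists>S. \<forall>x\<in>I. poly (smult r (smult e1 b) + smult s (pderiv (smult e0 a))) x * Q x = poly S x"
    using linear_compatibility_poly[OF I lin poly p0 p1] by metis
  have "\<exists>S. \<forall>x\<in>I. poly (smult 1 b + smult s (pderiv a)) x * Q x = poly S x" for s
    using Q(2)[of e1 "s * e0"] e by (simp add: pderiv_smult mult.assoc)
  moreover have "pderiv a \<noteq> 0 \<or> b \<noteq> 0"
    using nontrivial_parameters_poly[OF nt p0 p1] by (auto simp: pderiv_smult)
  ultimately show thesis using that Q(1) by metis
qed

lemmas P_eval = PA_def PB_def PC_def PD_def PE_def fst_conv snd_conv

lemmas P_expand = kb_def kc_def kd_def power2_eq_square power3_eq_cube power4_eq_xxxx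

section \<open>Orders four, three and two, for both coordinates\<close>

context determining_equations
begin

text \<open>The index is shifted by one: 0 is the antiderivative supplied by linear compatibility,
  so \<open>potential_1 Q 2\<close> is the first derivative of the potential.\<close>

definition potential_1 :: "(real \<Rightarrow> real) \<Rightarrow> nat \<Rightarrow> real \<Rightarrow> real" where
  "potential_1 Q k = (case k of 0 \<Rightarrow> Q | Suc k \<Rightarrow> v1 k)"

definition potential_2 :: "(real \<Rightarrow> real) \<Rightarrow> nat \<Rightarrow> real \<Rightarrow> real" where
  "potential_2 Q k = (case k of 0 \<Rightarrow> Q | Suc k \<Rightarrow> v2 k)"

lemma potential_simps: "potential_1 Q 0 = Q" "potential_1 Q 1 = v1 0" "potential_1 Q 2 = v1 1" "potential_1 Q 3 = v1 2"
  "potential_1 Q 4 = v1 3" "potential_1 Q 5 = v1 4"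
  "potential_2 Q 0 = Q" "potential_2 Q 1 = v2 0" "potential_2 Q 2 = v2 1" "potential_2 Q 3 = v2 2"
  "potential_2 Q 4 = v2 3" "potential_2 Q 5 = v2 4"
  by (simp_all add: potential_1_def potential_2_def numeral_eq_Suc One_nat_def)

lemma derivs_on_potential:
  "(\<And>q. q \<in> I1 \<Longrightarrow> (Q has_real_derivative v1 0 q) (at q)) \<Longrightarrow> derivs_on m I1 (potential_1 Q)"
  "(\<And>q. q \<in> I2 \<Longrightarrow> (Q has_real_derivative v2 0 q) (at q)) \<Longrightarrow> derivs_on m I2 (potential_2 Q)"
  unfolding potential_1_def[abs_def] potential_2_def[abs_def]
  by (rule all_derivs_antiderivative[OF v1], assumption) (rule all_derivs_antiderivative[OF v2], assumption)

lemmas slices = slice_derivative[OF smooth_w] slice_derivative[OF smooth_on_frechet[OF smooth_w]]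
  slice_derivative[OF smooth_on_frechet[OF smooth_on_frechet[OF smooth_w]]]

text \<open>The one-variable analysis is applied twice. For the second coordinate a', b', c', d' are
  the polynomials of the same Killing tensor with q1 and q2 exchanged.\<close>

lemma listed_4:
  fixes \<alpha> :: "nat \<Rightarrow> nat \<Rightarrow> nat \<Rightarrow> real"
  defines "a \<equiv> [:\<alpha> 4 0 0, - \<alpha> 3 0 1, \<alpha> 2 0 2, - \<alpha> 1 0 3, \<alpha> 0 0 4:]" and "b \<equiv> [:\<alpha> 3 1 0, - \<alpha> 2 1 1, \<alpha> 1 1 2, - \<alpha> 0 1 3:]"
    and "a' \<equiv> [:\<alpha> 0 4 0, \<alpha> 0 3 1, \<alpha> 0 2 2, \<alpha> 0 1 3, \<alpha> 0 0 4:]" and "b' \<equiv> [:\<alpha> 1 3 0, \<alpha> 1 2 1, \<alpha> 1 1 2, \<alpha> 1 0 3:]"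
  assumes n4: "n = 4"
    and J1: "is_interval I1" "I1 \<noteq> {}" and J2: "is_interval I2" "I2 \<noteq> {}"
    and lead: "\<And>i j q. q \<in> S \<Longrightarrow> i + j = n \<Longrightarrow> y i j q = lead_sum n \<alpha> i j q"
    and Q1: "\<And>q. q \<in> I1 \<Longrightarrow> (Q1 has_real_derivative v1 0 q) (at q)"
    and lin1: "\<And>s. \<exists>T. \<forall>x\<in>I1. poly (smult 1 b' + smult s (pderiv a')) x * Q1 x = poly T x"
    and nt1: "pderiv a' \<noteq> 0 \<or> b' \<noteq> 0"
    and Q2: "\<And>q. q \<in> I2 \<Longrightarrow> (Q2 has_real_derivative v2 0 q) (at q)"
    and lin2: "\<And>s. \<exists>T. \<forall>x\<in>I2. poly (smult 1 b + smult s (pderiv a)) x * Q2 x = poly T x"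
    and nt2: "pderiv a \<noteq> 0 \<or> b \<noteq> 0"
  shows "listed_potential h I1 (v1 0)" "listed_potential h I2 (v2 0)"
proof -
  define c d e where "c = [:\<alpha> 2 2 0, - \<alpha> 1 2 1, \<alpha> 0 2 2:]" and "d = [:\<alpha> 1 3 0, - \<alpha> 0 3 1:]" and "e = [:\<alpha> 0 4 0:]"
  define c' d' where "c' = [:\<alpha> 2 2 0, \<alpha> 2 1 1, \<alpha> 2 0 2:]" and "d' = [:\<alpha> 3 1 0, \<alpha> 3 0 1:]"
  note p = a_def b_def c_def d_def e_def a'_def b'_def c'_def d'_def
  obtain x0 y0 where x0: "x0 \<in> I1" and y0: "y0 \<in> I2" using J1 J2 by blast
  note dQ1 = derivs_on_potential(1)[OF Q1] and dQ2 = derivs_on_potential(2)[OF Q2]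
  note dv1 = all_derivs_derivs_on[OF v1] and dv2 = all_derivs_derivs_on[OF v2]
  have L: "y 4 0 q = PA a q" "y 3 1 q = PB a b q" "y 2 2 q = PC a b c q" "y 1 3 q = PD a b c d q" "y 0 4 q = PE a b c d e q"
    if "q \<in> S" for q
    using lead[OF that] n4 lead_4[of \<alpha> q] by (simp_all add: p)
  have deg: "pderiv (pderiv (pderiv (pderiv (pderiv a)))) = 0" "pderiv (pderiv (pderiv (pderiv b))) = 0"
    "pderiv (pderiv (pderiv c)) = 0" "pderiv (pderiv d) = 0" "pderiv e = 0"
    by (simp_all add: p pderiv_pCons)
  note M = moyal_4[OF n4 L deg]
  \<comment> \<open>Exchanging the coordinates reverses the order of the tensor coefficients.
    Differentiated coefficients change sign in addition, by the Killing chain.\<close>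
  have sw: "poly a' x = PE a b c d e (x, y)" "kb a' b' y x = kd a b c d x y" "kc a' b' c' y x = kc a b c x y"
    "kd a' b' c' d' y x = kb a b x y" "poly (pderiv a') x = - kd (pderiv a) (pderiv b) (pderiv c) (pderiv d) x y"
    "kd (pderiv a') (pderiv b') (pderiv c') (pderiv d') y x = - poly (pderiv a) y" for x y
    by (simp_all add: P_eval P_expand p pderiv_pCons algebra_simps)
  have nt2': "\<exists>y\<in>I2. poly b y \<noteq> 0 \<or> poly (pderiv a) y \<noteq> 0"
    by (rule nonzero_on_open[OF I2 J2(2)]) (use nt2 in blast)
  have nt1': "\<exists>x\<in>I1. poly b' x \<noteq> 0 \<or> poly (pderiv a') x \<noteq> 0"
    by (rule nonzero_on_open[OF I1 J1(2)]) (use nt1 in blast)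
  \<comment> \<open>Here linear compatibility meets the determining equations: at fixed q2 = u the
    coefficient of p1 p2^3 is the pencil \<xi>_01 - u \<xi>_00', so it is a denominator of
    \<open>Q\<close> of degree at most three.\<close>
  have k1: "kdp a b c d u = smult 1 b' + smult (- u) (pderiv a')" for u
    by (simp add: kdp_def p pderiv_pCons)
  have k2: "kdp a' b' c' d' u = smult 1 b + smult (- u) (pderiv a)" for u
    by (simp add: kdp_def p pderiv_pCons)
  have lin1': "\<exists>T. \<forall>x\<in>I1. poly (kdp a b c d u) x * potential_1 Q1 0 x = poly T x" for u
    unfolding k1 potential_simps by (rule lin1)
  have lin2': "\<exists>T. \<forall>x\<in>I2. poly (kdp a' b' c' d' u) x * potential_2 Q2 0 x = poly T x" for u
    unfolding k2 potential_simps by (rule lin2)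
  have ntk1: "\<exists>u\<in>I2. kdp a b c d u \<noteq> 0"
    by (rule pencil_nonzero_on_open[OF I2 J2(2), of b' "pderiv a'" 1 "- 1"]) (use nt1 k1 in auto)
  have ntk2: "\<exists>u\<in>I1. kdp a' b' c' d' u \<noteq> 0"
    by (rule pencil_nonzero_on_open[OF I1 J1(2), of b "pderiv a" 1 "- 1"]) (use nt2 k2 in auto)
  have N: "D1 (w 2 0) (x, y) = 4 * poly a y * v1 1 x + kb a b x y * v2 1 y"
    "D1 (w 1 1) (x, y) = 3 * kb a b x y * v1 1 x + 2 * kc a b c x y * v2 1 y - D2 (w 2 0) (x, y)"
    "D2 (w 1 1) (x, y) = 2 * kc a b c x y * v1 1 x + 3 * kd a b c d x y * v2 1 y - D1 (w 0 2) (x, y)"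
    "D2 (w 0 2) (x, y) = kd a b c d x y * v1 1 x + 4 * PE a b c d e (x, y) * v2 1 y"
    "2 * D2 (w 2 0) (x, y) * v1 1 x + D2 (w 1 1) (x, y) * v2 1 y + w 1 1 (x, y) * v2 2 y
       - h\<^sup>2 * (poly (pderiv a) y * v1 3 x + kd (pderiv a) (pderiv b) (pderiv c) (pderiv d) x y / 4 * v2 3 y
         + kd a b c d x y / 4 * v2 4 y)
     = D1 (w 1 1) (x, y) * v1 1 x + w 1 1 (x, y) * v1 2 x + 2 * D1 (w 0 2) (x, y) * v2 1 y
       - h\<^sup>2 * (- poly (pderiv a) y / 4 * v1 3 x + kb a b x y / 4 * v1 4 x
         - kd (pderiv a) (pderiv b) (pderiv c) (pderiv d) x y * v2 3 y)"
    "D1 (w 0 2) (x, y) = 2 * kc a b c x y * v1 1 x + 3 * kd a b c d x y * v2 1 y - D2 (w 1 1) (x, y)"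
    "D2 (w 2 0) (x, y) = 3 * kb a b x y * v1 1 x + 2 * kc a b c x y * v2 1 y - D1 (w 1 1) (x, y)" if "x \<in> I1" "y \<in> I2" for x y
    using M[of "(x, y)"] that by (simp_all add: P_eval)
  show "listed_potential h I1 (v1 0)"
  proof -
    have hyps: "((\<lambda>t. w 2 0 (t, y)) has_real_derivative 4 * poly a y * potential_1 Q1 2 x + kb a b x y * v2 1 y) (at x)"
      "((\<lambda>t. w 2 0 (x, t)) has_real_derivative D2 (w 2 0) (x, y)) (at y)"
      "((\<lambda>t. D2 (w 2 0) (x, t)) has_real_derivative D2 (\<lambda>q. D2 (w 2 0) q) (x, y)) (at y)"
      "((\<lambda>t. w 1 1 (t, y)) has_real_derivative 3 * kb a b x y * potential_1 Q1 2 x + 2 * kc a b c x y * v2 1 y - D2 (w 2 0) (x, y)) (at x)"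
      "((\<lambda>t. w 1 1 (x, t)) has_real_derivative D2 (w 1 1) (x, y)) (at y)"
      "2 * D2 (w 2 0) (x, y) * potential_1 Q1 2 x + D2 (w 1 1) (x, y) * v2 1 y + w 1 1 (x, y) * v2 2 y
          - h\<^sup>2 * (poly (pderiv a) y * potential_1 Q1 4 x + kd (pderiv a) (pderiv b) (pderiv c) (pderiv d) x y / 4 * v2 3 y
                + kd a b c d x y / 4 * v2 4 y)
        = (3 * kb a b x y * potential_1 Q1 2 x + 2 * kc a b c x y * v2 1 y - D2 (w 2 0) (x, y)) * potential_1 Q1 2 x
          + w 1 1 (x, y) * potential_1 Q1 3 x
          + 2 * (2 * kc a b c x y * potential_1 Q1 2 x + 3 * kd a b c d x y * v2 1 y - D2 (w 1 1) (x, y)) * v2 1 y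
          - h\<^sup>2 * (- poly (pderiv a) y / 4 * potential_1 Q1 4 x + kb a b x y / 4 * potential_1 Q1 5 x
                - kd (pderiv a) (pderiv b) (pderiv c) (pderiv d) x y * v2 3 y)" if "x \<in> I1" "y \<in> I2" for x y
      by (rule DERIV_cong[OF slices(1)[OF that]], simp add: N(1)[OF that] potential_simps, rule slices(2)[OF that],
          rule slices(4)[OF that], rule DERIV_cong[OF slices(1)[OF that]], simp add: N(2)[OF that] potential_simps,
          rule slices(2)[OF that], use N(5)[OF that] in \<open>simp add: N(2,6)[OF that] potential_simps algebra_simps\<close>)
    obtain B B' where B: "\<And>y. y \<in> I2 \<Longrightarrow> degree (B y) \<le> 3"
      "\<And>x y. y \<in> I2 \<Longrightarrow> ((\<lambda>t. poly (B t) x) has_real_derivative poly (B' y) x) (at y)"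
      "\<And>y. y \<in> I2 \<Longrightarrow> coeff (B y) 3 = v2 1 y * poly (pderiv (pderiv a)) y / 2 + v2 2 y * poly (pderiv a) y / 6"
      "\<And>y. y \<in> I2 \<Longrightarrow> coeff (B' y) 3 = v2 1 y * poly (pderiv (pderiv (pderiv a))) y / 2
         + 2 * v2 2 y * poly (pderiv (pderiv a)) y / 3 + v2 3 y * poly (pderiv a) y / 6" "\<And>y. degree (B' y) \<le> 3"
      "\<And>y. y \<in> I2 \<Longrightarrow> coeff (B y) 2 = - 3 / 2 * v2 1 y * poly (pderiv b) y - v2 2 y * poly b y / 2"
      "\<And>y. y \<in> I2 \<Longrightarrow> ode4_on I1 (h\<^sup>2) (poly b y) (- poly (pderiv a) y) (B y)
       (smult (3 * v2 1 y) (B' y) - smult (6 * (v2 1 y)\<^sup>2) (kdp a b c d y) + smult (v2 2 y) (B y)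
         - smult (h\<^sup>2) (smult (5 / 4 * v2 3 y) (kdp (pderiv a) (pderiv b) (pderiv c) (pderiv d) y)
              + smult (v2 4 y / 4) (kdp a b c d y))) (potential_1 Q1)"
      by (rule ode4_of_pde[where ?w20.0 = "\<lambda>x y. w 2 0 (x, y)" and ?w11.0 = "\<lambda>x y. w 1 1 (x, y)" and p = "\<lambda>x y. D2 (w 2 0) (x, y)"
            and ?p2.0 = "\<lambda>x y. D2 (\<lambda>q. D2 (w 2 0) q) (x, y)" and r = "\<lambda>x y. D2 (w 1 1) (x, y)" and \<kappa> = "h\<^sup>2",
            OF I1 J1(1) x0 I2 dQ1 dv2 hyps]) blast+
    have "listed_potential h I1 (potential_1 Q1 1)"
      by (rule listed_order_4[OF I1 J1(2) I2 J2(2) dQ1 lin1' ntk1 nt2' B(1,2,5,3,4,6,7)])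
    then show ?thesis by (simp add: potential_simps)
  qed
  show "listed_potential h I2 (v2 0)"
  proof -
    have hyps: "((\<lambda>t. w 0 2 (y, t)) has_real_derivative 4 * poly a' y * potential_2 Q2 2 x + kb a' b' x y * v1 1 y) (at x)"
      "((\<lambda>t. w 0 2 (t, x)) has_real_derivative D1 (w 0 2) (y, x)) (at y)"
      "((\<lambda>t. D1 (w 0 2) (t, x)) has_real_derivative D1 (\<lambda>q. D1 (w 0 2) q) (y, x)) (at y)"
      "((\<lambda>t. w 1 1 (y, t)) has_real_derivative 3 * kb a' b' x y * potential_2 Q2 2 x + 2 * kc a' b' c' x y * v1 1 y - D1 (w 0 2) (y, x)) (at x)"
      "((\<lambda>t. w 1 1 (t, x)) has_real_derivative D1 (w 1 1) (y, x)) (at y)"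
      "2 * D1 (w 0 2) (y, x) * potential_2 Q2 2 x + D1 (w 1 1) (y, x) * v1 1 y + w 1 1 (y, x) * v1 2 y
          - h\<^sup>2 * (poly (pderiv a') y * potential_2 Q2 4 x + kd (pderiv a') (pderiv b') (pderiv c') (pderiv d') x y / 4 * v1 3 y
                + kd a' b' c' d' x y / 4 * v1 4 y)
        = (3 * kb a' b' x y * potential_2 Q2 2 x + 2 * kc a' b' c' x y * v1 1 y - D1 (w 0 2) (y, x)) * potential_2 Q2 2 x
          + w 1 1 (y, x) * potential_2 Q2 3 x
          + 2 * (2 * kc a' b' c' x y * potential_2 Q2 2 x + 3 * kd a' b' c' d' x y * v1 1 y - D1 (w 1 1) (y, x)) * v1 1 y
          - h\<^sup>2 * (- poly (pderiv a') y / 4 * potential_2 Q2 4 x + kb a' b' x y / 4 * potential_2 Q2 5 x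
                - kd (pderiv a') (pderiv b') (pderiv c') (pderiv d') x y * v1 3 y)" if "x \<in> I2" "y \<in> I1" for x y
      unfolding sw(1)[of y x] sw(2-4) sw(5)[of y x] sw(6)
      by (rule DERIV_cong[OF slices(2)[OF that(2,1)]], simp add: N(4)[OF that(2,1)] potential_simps,
          rule slices(1)[OF that(2,1)], rule slices(3)[OF that(2,1)],
          rule DERIV_cong[OF slices(2)[OF that(2,1)]], simp add: N(3)[OF that(2,1)] potential_simps,
          rule slices(1)[OF that(2,1)],
          use N(5)[OF that(2,1)] in \<open>simp add: N(3,7)[OF that(2,1)] potential_simps algebra_simps\<close>)
    obtain B B' where B: "\<And>y. y \<in> I1 \<Longrightarrow> degree (B y) \<le> 3"
      "\<And>x y. y \<in> I1 \<Longrightarrow> ((\<lambda>t. poly (B t) x) has_real_derivative poly (B' y) x) (at y)"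
      "\<And>y. y \<in> I1 \<Longrightarrow> coeff (B y) 3 = v1 1 y * poly (pderiv (pderiv a')) y / 2 + v1 2 y * poly (pderiv a') y / 6"
      "\<And>y. y \<in> I1 \<Longrightarrow> coeff (B' y) 3 = v1 1 y * poly (pderiv (pderiv (pderiv a'))) y / 2
         + 2 * v1 2 y * poly (pderiv (pderiv a')) y / 3 + v1 3 y * poly (pderiv a') y / 6" "\<And>y. degree (B' y) \<le> 3"
      "\<And>y. y \<in> I1 \<Longrightarrow> coeff (B y) 2 = - 3 / 2 * v1 1 y * poly (pderiv b') y - v1 2 y * poly b' y / 2"
      "\<And>y. y \<in> I1 \<Longrightarrow> ode4_on I2 (h\<^sup>2) (poly b' y) (- poly (pderiv a') y) (B y)
       (smult (3 * v1 1 y) (B' y) - smult (6 * (v1 1 y)\<^sup>2) (kdp a' b' c' d' y) + smult (v1 2 y) (B y)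
         - smult (h\<^sup>2) (smult (5 / 4 * v1 3 y) (kdp (pderiv a') (pderiv b') (pderiv c') (pderiv d') y)
              + smult (v1 4 y / 4) (kdp a' b' c' d' y))) (potential_2 Q2)"
      by (rule ode4_of_pde[where ?w20.0 = "\<lambda>x y. w 0 2 (y, x)" and ?w11.0 = "\<lambda>x y. w 1 1 (y, x)" and p = "\<lambda>x y. D1 (w 0 2) (y, x)"
            and ?p2.0 = "\<lambda>x y. D1 (\<lambda>q. D1 (w 0 2) q) (y, x)" and r = "\<lambda>x y. D1 (w 1 1) (y, x)" and \<kappa> = "h\<^sup>2",
            OF I2 J2(1) y0 I1 dQ2 dv1 hyps]) blast+
    have "listed_potential h I2 (potential_2 Q2 1)"
      by (rule listed_order_4[OF I2 J2(2) I1 J1(2) dQ2 lin2' ntk2 nt1' B(1,2,5,3,4,6,7)])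
    then show ?thesis by (simp add: potential_simps)
  qed
qed

lemma listed_3:
  fixes \<alpha> :: "nat \<Rightarrow> nat \<Rightarrow> nat \<Rightarrow> real"
  defines "a \<equiv> [:\<alpha> 3 0 0, - \<alpha> 2 0 1, \<alpha> 1 0 2, - \<alpha> 0 0 3:]" and "b \<equiv> [:\<alpha> 2 1 0, - \<alpha> 1 1 1, \<alpha> 0 1 2:]"
    and "a' \<equiv> [:\<alpha> 0 3 0, \<alpha> 0 2 1, \<alpha> 0 1 2, \<alpha> 0 0 3:]" and "b' \<equiv> [:\<alpha> 1 2 0, \<alpha> 1 1 1, \<alpha> 1 0 2:]"
  assumes n3: "n = 3"
    and J1: "is_interval I1" "I1 \<noteq> {}" and J2: "is_interval I2" "I2 \<noteq> {}"
    and lead: "\<And>i j q. q \<in> S \<Longrightarrow> i + j = n \<Longrightarrow> y i j q = lead_sum n \<alpha> i j q"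
    and Q1: "\<And>q. q \<in> I1 \<Longrightarrow> (Q1 has_real_derivative v1 0 q) (at q)"
    and lin1: "\<And>s. \<exists>T. \<forall>x\<in>I1. poly (smult 1 b' + smult s (pderiv a')) x * Q1 x = poly T x"
    and nt1: "pderiv a' \<noteq> 0 \<or> b' \<noteq> 0"
    and Q2: "\<And>q. q \<in> I2 \<Longrightarrow> (Q2 has_real_derivative v2 0 q) (at q)"
    and lin2: "\<And>s. \<exists>T. \<forall>x\<in>I2. poly (smult 1 b + smult s (pderiv a)) x * Q2 x = poly T x"
    and nt2: "pderiv a \<noteq> 0 \<or> b \<noteq> 0"
  shows "listed_potential h I1 (v1 0)" "listed_potential h I2 (v2 0)"
proof -
  define c d where "c = [:\<alpha> 1 2 0, - \<alpha> 0 2 1:]" and "d = [:\<alpha> 0 3 0:]"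
  define c' d' where "c' = [:\<alpha> 2 1 0, \<alpha> 2 0 1:]" and "d' = [:\<alpha> 3 0 0:]"
  note p = a_def b_def c_def d_def a'_def b'_def c'_def d'_def
  obtain x0 y0 where x0: "x0 \<in> I1" and y0: "y0 \<in> I2" using J1 J2 by blast
  note dQ1 = derivs_on_potential(1)[OF Q1] and dQ2 = derivs_on_potential(2)[OF Q2]
  note dv1 = all_derivs_derivs_on[OF v1] and dv2 = all_derivs_derivs_on[OF v2]
  have L: "y 3 0 q = PA a q" "y 2 1 q = PB a b q" "y 1 2 q = PC a b c q" "y 0 3 q = PD a b c d q"
    if "q \<in> S" for q
    using lead[OF that] n3 lead_3[of \<alpha> q] by (simp_all add: p)
  have deg: "pderiv (pderiv (pderiv (pderiv a))) = 0" "pderiv (pderiv (pderiv b)) = 0" "pderiv (pderiv c) = 0" "pderiv d = 0"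
    by (simp_all add: p pderiv_pCons)
  note M = moyal_3[OF n3 L deg]
  have sw: "poly a' x = kd a b c d x y" "kb a' b' y x = kc a b c x y" "kc a' b' c' y x = kb a b x y"
    "kd a' b' c' d' y x = poly a y" for x y
    by (simp_all add: P_expand p pderiv_pCons algebra_simps)
  have nt2': "\<exists>y\<in>I2. poly b y \<noteq> 0 \<or> poly (pderiv a) y \<noteq> 0"
    by (rule nonzero_on_open[OF I2 J2(2)]) (use nt2 in blast)
  have nt1': "\<exists>x\<in>I1. poly b' x \<noteq> 0 \<or> poly (pderiv a') x \<noteq> 0"
    by (rule nonzero_on_open[OF I1 J1(2)]) (use nt1 in blast)
  \<comment> \<open>At order three the pencil is the coefficient of p1 p2^2, a polynomial of degree
    at most two in q1.\<close>
  have k1: "kcp a b c u = smult 1 b' + smult (- u) (pderiv a')" for u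
    by (simp add: kcp_def p pderiv_pCons)
  have k2: "kcp a' b' c' u = smult 1 b + smult (- u) (pderiv a)" for u
    by (simp add: kcp_def p pderiv_pCons)
  have lin1': "\<exists>T. \<forall>x\<in>I1. poly (kcp a b c u) x * potential_1 Q1 0 x = poly T x" for u
    unfolding k1 potential_simps by (rule lin1)
  have lin2': "\<exists>T. \<forall>x\<in>I2. poly (kcp a' b' c' u) x * potential_2 Q2 0 x = poly T x" for u
    unfolding k2 potential_simps by (rule lin2)
  have ntk1: "\<exists>u\<in>I2. kcp a b c u \<noteq> 0"
    by (rule pencil_nonzero_on_open[OF I2 J2(2), of b' "pderiv a'" 1 "- 1"]) (use nt1 k1 in auto)
  have ntk2: "\<exists>u\<in>I1. kcp a' b' c' u \<noteq> 0"
    by (rule pencil_nonzero_on_open[OF I1 J1(2), of b "pderiv a" 1 "- 1"]) (use nt2 k2 in auto)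
  have N: "D1 (w 1 0) (x, y) = 3 * poly a y * v1 1 x + kb a b x y * v2 1 y"
    "D1 (w 0 1) (x, y) = 2 * kb a b x y * v1 1 x + 2 * kc a b c x y * v2 1 y - D2 (w 1 0) (x, y)"
    "D2 (w 1 0) (x, y) = 2 * kb a b x y * v1 1 x + 2 * kc a b c x y * v2 1 y - D1 (w 0 1) (x, y)"
    "D2 (w 0 1) (x, y) = kc a b c x y * v1 1 x + 3 * kd a b c d x y * v2 1 y"
    "w 1 0 (x, y) * v1 1 x + w 0 1 (x, y) * v2 1 y - h\<^sup>2 / 4 * (poly a y * v1 3 x + kd a b c d x y * v2 3 y) = 0"
    if "x \<in> I1" "y \<in> I2" for x y
    using M[of "(x, y)"] that by (simp_all add: P_eval)
  show "listed_potential h I1 (v1 0)"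
  proof -
    have hyps: "((\<lambda>t. w 1 0 (t, y)) has_real_derivative 3 * poly a y * potential_1 Q1 2 x + kb a b x y * v2 1 y) (at x)"
      "((\<lambda>t. w 1 0 (x, t)) has_real_derivative D2 (w 1 0) (x, y)) (at y)"
      "((\<lambda>t. D2 (w 1 0) (x, t)) has_real_derivative D2 (\<lambda>q. D2 (w 1 0) q) (x, y)) (at y)"
      "((\<lambda>t. w 0 1 (t, y)) has_real_derivative 2 * kb a b x y * potential_1 Q1 2 x + 2 * kc a b c x y * v2 1 y - D2 (w 1 0) (x, y)) (at x)"
      "((\<lambda>t. w 0 1 (x, t)) has_real_derivative kc a b c x y * potential_1 Q1 2 x + 3 * kd a b c d x y * v2 1 y) (at y)"
      "potential_1 Q1 2 x * w 1 0 (x, y) + v2 1 y * w 0 1 (x, y)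
        - h\<^sup>2 / 4 * (poly a y * potential_1 Q1 4 x + kd a b c d x y * v2 3 y) = 0" if "x \<in> I1" "y \<in> I2" for x y
      by (rule DERIV_cong[OF slices(1)[OF that]], simp add: N(1)[OF that] potential_simps, rule slices(2)[OF that],
          rule slices(4)[OF that], rule DERIV_cong[OF slices(1)[OF that]], simp add: N(2)[OF that] potential_simps,
          rule DERIV_cong[OF slices(2)[OF that]], simp add: N(4)[OF that] potential_simps,
          use N(5)[OF that] in \<open>simp add: potential_simps mult.commute\<close>)
    have "listed_potential h I1 (potential_1 Q1 1)"
      by (rule listed_order_3[where ?w10.0 = "\<lambda>x y. w 1 0 (x, y)" and ?w01.0 = "\<lambda>x y. w 0 1 (x, y)" and p = "\<lambda>x y. D2 (w 1 0) (x, y)"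
            and ?p2.0 = "\<lambda>x y. D2 (\<lambda>q. D2 (w 1 0) q) (x, y)",
            OF I1 J1(1) x0 I2 J2(2) dQ1 dv2 hyps lin1' ntk1 nt2'])
    then show ?thesis by (simp add: potential_simps)
  qed
  show "listed_potential h I2 (v2 0)"
  proof -
    have hyps: "((\<lambda>t. w 0 1 (y, t)) has_real_derivative 3 * poly a' y * potential_2 Q2 2 x + kb a' b' x y * v1 1 y) (at x)"
      "((\<lambda>t. w 0 1 (t, x)) has_real_derivative D1 (w 0 1) (y, x)) (at y)"
      "((\<lambda>t. D1 (w 0 1) (t, x)) has_real_derivative D1 (\<lambda>q. D1 (w 0 1) q) (y, x)) (at y)"
      "((\<lambda>t. w 1 0 (y, t)) has_real_derivative 2 * kb a' b' x y * potential_2 Q2 2 x + 2 * kc a' b' c' x y * v1 1 y - D1 (w 0 1) (y, x)) (at x)"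
      "((\<lambda>t. w 1 0 (t, x)) has_real_derivative kc a' b' c' x y * potential_2 Q2 2 x + 3 * kd a' b' c' d' x y * v1 1 y) (at y)"
      "potential_2 Q2 2 x * w 0 1 (y, x) + v1 1 y * w 1 0 (y, x)
        - h\<^sup>2 / 4 * (poly a' y * potential_2 Q2 4 x + kd a' b' c' d' x y * v1 3 y) = 0" if "x \<in> I2" "y \<in> I1" for x y
      unfolding sw(1)[of y x] sw(2-4)
      by (rule DERIV_cong[OF slices(2)[OF that(2,1)]], simp add: N(4)[OF that(2,1)] potential_simps, rule slices(1)[OF that(2,1)],
          rule slices(3)[OF that(2,1)], rule DERIV_cong[OF slices(2)[OF that(2,1)]], simp add: N(3)[OF that(2,1)] potential_simps,
          rule DERIV_cong[OF slices(1)[OF that(2,1)]], simp add: N(1)[OF that(2,1)] potential_simps,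
          use N(5)[OF that(2,1)] in \<open>simp add: potential_simps algebra_simps\<close>)
    have "listed_potential h I2 (potential_2 Q2 1)"
      by (rule listed_order_3[where ?w10.0 = "\<lambda>x y. w 0 1 (y, x)" and ?w01.0 = "\<lambda>x y. w 1 0 (y, x)" and p = "\<lambda>x y. D1 (w 0 1) (y, x)"
            and ?p2.0 = "\<lambda>x y. D1 (\<lambda>q. D1 (w 0 1) q) (y, x)",
            OF I2 J2(1) y0 I1 J1(2) dQ2 dv1 hyps lin2' ntk2 nt1'])
    then show ?thesis by (simp add: potential_simps)
  qed
qed

lemma listed_2:
  fixes \<alpha> :: "nat \<Rightarrow> nat \<Rightarrow> nat \<Rightarrow> real"
  defines "a \<equiv> [:\<alpha> 2 0 0, - \<alpha> 1 0 1, \<alpha> 0 0 2:]" and "b \<equiv> [:\<alpha> 1 1 0, - \<alpha> 0 1 1:]"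
    and "a' \<equiv> [:\<alpha> 0 2 0, \<alpha> 0 1 1, \<alpha> 0 0 2:]" and "b' \<equiv> [:\<alpha> 1 1 0, \<alpha> 1 0 1:]"
  assumes n2: "n = 2"
    and J1: "is_interval I1" "I1 \<noteq> {}" and J2: "is_interval I2" "I2 \<noteq> {}"
    and lead: "\<And>i j q. q \<in> S \<Longrightarrow> i + j = n \<Longrightarrow> y i j q = lead_sum n \<alpha> i j q"
    and Q1: "\<And>q. q \<in> I1 \<Longrightarrow> (Q1 has_real_derivative v1 0 q) (at q)"
    and nt1: "pderiv a' \<noteq> 0 \<or> b' \<noteq> 0"
    and Q2: "\<And>q. q \<in> I2 \<Longrightarrow> (Q2 has_real_derivative v2 0 q) (at q)"
    and nt2: "pderiv a \<noteq> 0 \<or> b \<noteq> 0"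
  shows "listed_potential h I1 (v1 0)" "listed_potential h I2 (v2 0)"
proof -
  define c c' where "c = [:\<alpha> 0 2 0:]" and "c' = [:\<alpha> 2 0 0:]"
  note p = a_def b_def c_def a'_def b'_def c'_def
  obtain x0 y0 where x0: "x0 \<in> I1" and y0: "y0 \<in> I2" using J1 J2 by blast
  note dQ1 = derivs_on_potential(1)[OF Q1] and dQ2 = derivs_on_potential(2)[OF Q2]
  note dv1 = all_derivs_derivs_on[OF v1] and dv2 = all_derivs_derivs_on[OF v2]
  have L: "y 2 0 q = PA a q" "y 1 1 q = PB a b q" "y 0 2 q = PC a b c q" if "q \<in> S" for q
    using lead[OF that] n2 lead_2[of \<alpha> q] by (simp_all add: p)
  have deg: "pderiv (pderiv (pderiv a)) = 0" "pderiv (pderiv b) = 0" "pderiv c = 0"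
    by (simp_all add: p pderiv_pCons)
  note M = moyal_2[OF n2 L deg]
  have sw: "poly a' x = kc a b c x y" "kb a' b' y x = kb a b x y" "kc a' b' c' y x = poly a y" for x y
    by (simp_all add: P_expand p pderiv_pCons algebra_simps)
  have nt2': "\<exists>y\<in>I2. poly b y \<noteq> 0 \<or> poly (pderiv a) y \<noteq> 0"
    by (rule nonzero_on_open[OF I2 J2(2)]) (use nt2 in blast)
  have nt1': "\<exists>x\<in>I1. poly b' x \<noteq> 0 \<or> poly (pderiv a') x \<noteq> 0"
    by (rule nonzero_on_open[OF I1 J1(2)]) (use nt1 in blast)
  have N: "D1 (w 0 0) (x, y) = 2 * poly a y * v1 1 x + kb a b x y * v2 1 y"
    "D2 (w 0 0) (x, y) = kb a b x y * v1 1 x + 2 * kc a b c x y * v2 1 y" if "x \<in> I1" "y \<in> I2" for x y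
    using M[of "(x, y)"] that by (simp_all add: P_eval)
  show "listed_potential h I1 (v1 0)"
  proof -
    have hyps: "((\<lambda>t. w 0 0 (t, y)) has_real_derivative 2 * poly a y * potential_1 Q1 2 x + kb a b x y * v2 1 y) (at x)"
      "((\<lambda>t. w 0 0 (x, t)) has_real_derivative kb a b x y * potential_1 Q1 2 x + 2 * kc a b c x y * v2 1 y) (at y)"
      if "x \<in> I1" "y \<in> I2" for x y
      by (rule DERIV_cong[OF slices(1)[OF that]], simp add: N(1)[OF that] potential_simps,
          rule DERIV_cong[OF slices(2)[OF that]], simp add: N(2)[OF that] potential_simps)
    have "listed_potential h I1 (potential_1 Q1 1)"
      by (rule listed_order_2[where w = "\<lambda>x y. w 0 0 (x, y)", OF I1 J1(1) x0 I2 J2(2) dQ1 dv2 hyps nt2'])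
    then show ?thesis by (simp add: potential_simps)
  qed
  show "listed_potential h I2 (v2 0)"
  proof -
    have hyps: "((\<lambda>t. w 0 0 (y, t)) has_real_derivative 2 * poly a' y * potential_2 Q2 2 x + kb a' b' x y * v1 1 y) (at x)"
      "((\<lambda>t. w 0 0 (t, x)) has_real_derivative kb a' b' x y * potential_2 Q2 2 x + 2 * kc a' b' c' x y * v1 1 y) (at y)"
      if "x \<in> I2" "y \<in> I1" for x y
      unfolding sw(1)[of y x] sw(2-3)
      by (rule DERIV_cong[OF slices(2)[OF that(2,1)]], simp add: N(2)[OF that(2,1)] potential_simps,
          rule DERIV_cong[OF slices(1)[OF that(2,1)]], simp add: N(1)[OF that(2,1)] potential_simps)
    have "listed_potential h I2 (potential_2 Q2 1)"
      by (rule listed_order_2[where w = "\<lambda>x y. w 0 0 (y, x)", OF I2 J2(1) y0 I1 J1(2) dQ2 dv1 hyps nt1'])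
    then show ?thesis by (simp add: potential_simps)
  qed
qed

end

theorem theorem5:
  fixes h :: real and I1 I2 :: "real set" and V1 V2 :: "real \<Rightarrow> real"
    and n :: nat and X :: observable
  assumes "h \<ge> 0"
    and "open I1" "is_interval I1" "I1 \<noteq> {}" "smooth_on I1 V1"
    and "open I2" "is_interval I2" "I2 \<noteq> {}" "smooth_on I2 V2"
    and "1 \<le> n" "n \<le> 4"
    and "integral_of_order h (I1 \<times> I2) n (H1 V1 + H2 V2) X"
    and "standard_form h (I1 \<times> I2) n X"
    and "\<not> polynomial_in h (I1 \<times> I2) (H1 V1) (H2 V2) X"
    and "\<exists>\<alpha>. leading_coeffs (I1 \<times> I2) n X \<alpha> \<and>
             linear_compatibility I1 V1 (xi1 n \<alpha>) \<and> nontrivial_parameters (xi1 n \<alpha>)"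
    and "\<exists>\<alpha>. leading_coeffs (I1 \<times> I2) n X \<alpha> \<and>
             linear_compatibility I2 V2 (xi2 n \<alpha>) \<and> nontrivial_parameters (xi2 n \<alpha>)"
  shows "listed_potential h I1 V1 \<and> listed_potential h I2 V2"
proof -
  note I1 = assms(2-4) and I2 = assms(6-8)
  define v1 v2 where "v1 k = (deriv ^^ k) V1" and "v2 k = (deriv ^^ k) V2" for k
  have v: "v1 0 = V1" "v2 0 = V2" by (simp_all add: v1_def v2_def)
  have d: "all_derivs I1 v1" "all_derivs I2 v2"
    unfolding v1_def[abs_def] v2_def[abs_def] using assms by (auto intro: all_derivs_deriv)
  have int: "eq_on (I1 \<times> I2) (bracket h X (H1 (v1 0) + H2 (v2 0))) 0"
    using assms(12) by (simp add: integral_of_order_def v)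
  obtain y where de: "determining_equations h I1 I2 v1 v2 n y"
    and y: "\<And>i j q. q \<in> I1 \<times> I2 \<Longrightarrow> i + j = n \<Longrightarrow> lk X i j q = of_real (y i j q)"
    using determining_equations_of_integral[OF I1(1) I2(1) d assms(11) int assms(13)] by metis
  obtain \<alpha> \<beta> where \<alpha>: "leading_coeffs (I1 \<times> I2) n X \<alpha>" "linear_compatibility I1 (v1 0) (xi1 n \<alpha>)" "nontrivial_parameters (xi1 n \<alpha>)"
    and \<beta>: "leading_coeffs (I1 \<times> I2) n X \<beta>" "linear_compatibility I2 (v2 0) (xi2 n \<beta>)" "nontrivial_parameters (xi2 n \<beta>)"
    using assms(15,16) v by auto
  have lead: "y i j q = lead_sum n \<gamma> i j q" if "leading_coeffs (I1 \<times> I2) n X \<gamma>" "q \<in> I1 \<times> I2" "i + j = n" for \<gamma> i j q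
    using lookup_leading[OF that] y[OF that(2,3)] by (metis of_real_eq_iff)
  \<comment> \<open>The constants with index sum n + 2 may be chosen differently for the two
    coordinates. Those with index sum n belong to the same leading component, which is all that the
    two families have to share.\<close>
  have same: "lead_sum n \<alpha> i j (x, z) = lead_sum n \<beta> i j (x, z)" if "x \<in> I1" "z \<in> I2" "i + j = n" for i j x z
    using lead[OF \<alpha>(1), of "(x, z)" i j] lead[OF \<beta>(1), of "(x, z)" i j] that by simp
  consider "n = 1" | "n = 2" | "n = 3" | "n = 4" using assms(10,11) by linarith
  then show ?thesis
  proof cases
    case 1
    have "listed_potential h I1 (v1 0)"
      by (rule listed_order_1[OF I1 \<alpha>(2,3)]) (unfold 1 xi_1, (rule refl)+)
    moreover have "listed_potential h I2 (v2 0)"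
      by (rule listed_order_1[OF I2 \<beta>(2,3)]) (unfold 1 xi_1, (rule refl)+)
    ultimately show ?thesis by (simp add: v)
  next
    case 2
    have ab: "[:\<alpha> 2 0 0, - \<alpha> 1 0 1, \<alpha> 0 0 2:] = [:\<beta> 2 0 0, - \<beta> 1 0 1, \<beta> 0 0 2:] \<and> [:\<alpha> 1 1 0, - \<alpha> 0 1 1:] = [:\<beta> 1 1 0, - \<beta> 0 1 1:]"
      by (rule kb_unique[OF I1(1,3) I2(1,3)], rule same[of _ _ 2 0, unfolded 2 lead_2 P_eval], assumption, assumption, simp,
          rule same[of _ _ 1 1, unfolded 2 lead_2 P_eval], assumption, assumption, simp)
    obtain Q1 where Q1: "\<And>q. q \<in> I1 \<Longrightarrow> (Q1 has_real_derivative v1 0 q) (at q)"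
      "\<And>s. \<exists>S. \<forall>x\<in>I1. poly (smult 1 [:\<alpha> 1 1 0, \<alpha> 1 0 1:] + smult s (pderiv [:\<alpha> 0 2 0, \<alpha> 0 1 1, \<alpha> 0 0 2:])) x * Q1 x = poly S x"
      "pderiv [:\<alpha> 0 2 0, \<alpha> 0 1 1, \<alpha> 0 0 2:] \<noteq> 0 \<or> [:\<alpha> 1 1 0, \<alpha> 1 0 1:] \<noteq> 0"
      by (rule compatible_pencil[OF I1 \<alpha>(2,3) xi_poly(1), where ?e0.0 = 1 and ?e1.0 = 1
            and a = "[:\<alpha> 0 2 0, \<alpha> 0 1 1, \<alpha> 0 0 2:]" and b = "[:\<alpha> 1 1 0, \<alpha> 1 0 1:]"], simp add: 2 xi1_2, simp add: 2 xi1_2, simp, simp, blast)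
    obtain Q2 where Q2: "\<And>q. q \<in> I2 \<Longrightarrow> (Q2 has_real_derivative v2 0 q) (at q)"
      "\<And>s. \<exists>S. \<forall>x\<in>I2. poly (smult 1 [:\<beta> 1 1 0, - \<beta> 0 1 1:] + smult s (pderiv [:\<beta> 2 0 0, - \<beta> 1 0 1, \<beta> 0 0 2:])) x * Q2 x = poly S x"
      "pderiv [:\<beta> 2 0 0, - \<beta> 1 0 1, \<beta> 0 0 2:] \<noteq> 0 \<or> [:\<beta> 1 1 0, - \<beta> 0 1 1:] \<noteq> 0"
      by (rule compatible_pencil[OF I2 \<beta>(2,3) xi_poly(2), where ?e0.0 = 1 and ?e1.0 = "- 1"
            and a = "[:\<beta> 2 0 0, - \<beta> 1 0 1, \<beta> 0 0 2:]" and b = "[:\<beta> 1 1 0, - \<beta> 0 1 1:]"], simp add: 2 xi2_2, simp add: 2 xi2_2, simp, simp, blast)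
    note r = determining_equations.listed_2[OF de 2 I1(2,3) I2(2,3) lead[OF \<alpha>(1)] Q1(1,3) Q2(1) Q2(3)[folded ab[THEN conjunct1] ab[THEN conjunct2]]]
    from r[unfolded v] show ?thesis by blast
  next
    case 3
    have ab: "[:\<alpha> 3 0 0, - \<alpha> 2 0 1, \<alpha> 1 0 2, - \<alpha> 0 0 3:] = [:\<beta> 3 0 0, - \<beta> 2 0 1, \<beta> 1 0 2, - \<beta> 0 0 3:]
        \<and> [:\<alpha> 2 1 0, - \<alpha> 1 1 1, \<alpha> 0 1 2:] = [:\<beta> 2 1 0, - \<beta> 1 1 1, \<beta> 0 1 2:]"
      by (rule kb_unique[OF I1(1,3) I2(1,3)], rule same[of _ _ 3 0, unfolded 3 lead_3 P_eval], assumption, assumption, simp,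
          rule same[of _ _ 2 1, unfolded 3 lead_3 P_eval], assumption, assumption, simp)
    obtain Q1 where Q1: "\<And>q. q \<in> I1 \<Longrightarrow> (Q1 has_real_derivative v1 0 q) (at q)"
      "\<And>s. \<exists>S. \<forall>x\<in>I1. poly (smult 1 [:\<alpha> 1 2 0, \<alpha> 1 1 1, \<alpha> 1 0 2:] + smult s (pderiv [:\<alpha> 0 3 0, \<alpha> 0 2 1, \<alpha> 0 1 2, \<alpha> 0 0 3:])) x * Q1 x = poly S x"
      "pderiv [:\<alpha> 0 3 0, \<alpha> 0 2 1, \<alpha> 0 1 2, \<alpha> 0 0 3:] \<noteq> 0 \<or> [:\<alpha> 1 2 0, \<alpha> 1 1 1, \<alpha> 1 0 2:] \<noteq> 0"
      by (rule compatible_pencil[OF I1 \<alpha>(2,3) xi_poly(1), where ?e0.0 = 1 and ?e1.0 = 1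
            and a = "[:\<alpha> 0 3 0, \<alpha> 0 2 1, \<alpha> 0 1 2, \<alpha> 0 0 3:]" and b = "[:\<alpha> 1 2 0, \<alpha> 1 1 1, \<alpha> 1 0 2:]"], simp add: 3 xi1_3, simp add: 3 xi1_3, simp, simp, blast)
    obtain Q2 where Q2: "\<And>q. q \<in> I2 \<Longrightarrow> (Q2 has_real_derivative v2 0 q) (at q)"
      "\<And>s. \<exists>S. \<forall>x\<in>I2. poly (smult 1 [:\<beta> 2 1 0, - \<beta> 1 1 1, \<beta> 0 1 2:] + smult s (pderiv [:\<beta> 3 0 0, - \<beta> 2 0 1, \<beta> 1 0 2, - \<beta> 0 0 3:])) x * Q2 x = poly S x"
      "pderiv [:\<beta> 3 0 0, - \<beta> 2 0 1, \<beta> 1 0 2, - \<beta> 0 0 3:] \<noteq> 0 \<or> [:\<beta> 2 1 0, - \<beta> 1 1 1, \<beta> 0 1 2:] \<noteq> 0"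
      by (rule compatible_pencil[OF I2 \<beta>(2,3) xi_poly(2), where ?e0.0 = "- 1" and ?e1.0 = 1
            and a = "[:\<beta> 3 0 0, - \<beta> 2 0 1, \<beta> 1 0 2, - \<beta> 0 0 3:]" and b = "[:\<beta> 2 1 0, - \<beta> 1 1 1, \<beta> 0 1 2:]"], simp add: 3 xi2_3, simp add: 3 xi2_3, simp, simp, blast)
    note r = determining_equations.listed_3[OF de 3 I1(2,3) I2(2,3) lead[OF \<alpha>(1)] Q1 Q2(1) Q2(2,3)[folded ab[THEN conjunct1] ab[THEN conjunct2]]]
    from r[unfolded v] show ?thesis by blast
  next
    case 4
    have ab: "[:\<alpha> 4 0 0, - \<alpha> 3 0 1, \<alpha> 2 0 2, - \<alpha> 1 0 3, \<alpha> 0 0 4:] = [:\<beta> 4 0 0, - \<beta> 3 0 1, \<beta> 2 0 2, - \<beta> 1 0 3, \<beta> 0 0 4:]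
        \<and> [:\<alpha> 3 1 0, - \<alpha> 2 1 1, \<alpha> 1 1 2, - \<alpha> 0 1 3:] = [:\<beta> 3 1 0, - \<beta> 2 1 1, \<beta> 1 1 2, - \<beta> 0 1 3:]"
      by (rule kb_unique[OF I1(1,3) I2(1,3)], rule same[of _ _ 4 0, unfolded 4 lead_4 P_eval], assumption, assumption, simp,
          rule same[of _ _ 3 1, unfolded 4 lead_4 P_eval], assumption, assumption, simp)
    obtain Q1 where Q1: "\<And>q. q \<in> I1 \<Longrightarrow> (Q1 has_real_derivative v1 0 q) (at q)"
      "\<And>s. \<exists>S. \<forall>x\<in>I1. poly (smult 1 [:\<alpha> 1 3 0, \<alpha> 1 2 1, \<alpha> 1 1 2, \<alpha> 1 0 3:] + smult s (pderiv [:\<alpha> 0 4 0, \<alpha> 0 3 1, \<alpha> 0 2 2, \<alpha> 0 1 3, \<alpha> 0 0 4:])) x * Q1 x = poly S x"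
      "pderiv [:\<alpha> 0 4 0, \<alpha> 0 3 1, \<alpha> 0 2 2, \<alpha> 0 1 3, \<alpha> 0 0 4:] \<noteq> 0 \<or> [:\<alpha> 1 3 0, \<alpha> 1 2 1, \<alpha> 1 1 2, \<alpha> 1 0 3:] \<noteq> 0"
      by (rule compatible_pencil[OF I1 \<alpha>(2,3) xi_poly(1), where ?e0.0 = 1 and ?e1.0 = 1
            and a = "[:\<alpha> 0 4 0, \<alpha> 0 3 1, \<alpha> 0 2 2, \<alpha> 0 1 3, \<alpha> 0 0 4:]" and b = "[:\<alpha> 1 3 0, \<alpha> 1 2 1, \<alpha> 1 1 2, \<alpha> 1 0 3:]"], simp add: 4 xi1_4, simp add: 4 xi1_4, simp, simp, blast)
    obtain Q2 where Q2: "\<And>q. q \<in> I2 \<Longrightarrow> (Q2 has_real_derivative v2 0 q) (at q)"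
      "\<And>s. \<exists>S. \<forall>x\<in>I2. poly (smult 1 [:\<beta> 3 1 0, - \<beta> 2 1 1, \<beta> 1 1 2, - \<beta> 0 1 3:] + smult s (pderiv [:\<beta> 4 0 0, - \<beta> 3 0 1, \<beta> 2 0 2, - \<beta> 1 0 3, \<beta> 0 0 4:])) x * Q2 x = poly S x"
      "pderiv [:\<beta> 4 0 0, - \<beta> 3 0 1, \<beta> 2 0 2, - \<beta> 1 0 3, \<beta> 0 0 4:] \<noteq> 0 \<or> [:\<beta> 3 1 0, - \<beta> 2 1 1, \<beta> 1 1 2, - \<beta> 0 1 3:] \<noteq> 0"
      by (rule compatible_pencil[OF I2 \<beta>(2,3) xi_poly(2), where ?e0.0 = 1 and ?e1.0 = "- 1"
            and a = "[:\<beta> 4 0 0, - \<beta> 3 0 1, \<beta> 2 0 2, - \<beta> 1 0 3, \<beta> 0 0 4:]" and b = "[:\<beta> 3 1 0, - \<beta> 2 1 1, \<beta> 1 1 2, - \<beta> 0 1 3:]"], simp add: 4 xi2_4, simp add: 4 xi2_4, simp, simp, blast)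
    note r = determining_equations.listed_4[OF de 4 I1(2,3) I2(2,3) lead[OF \<alpha>(1)] Q1 Q2(1) Q2(2,3)[folded ab[THEN conjunct1] ab[THEN conjunct2]]]
    from r[unfolded v] show ?thesis by blast
  qed
qed

end
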